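(* Let $T>0$ and let $(u,P)$ be a (Leray-Hopf) solution of the Navier-Stokes equations with initial datum $u_0$ which is smooth on $[0,T)\times\mathbb{R}^3$. Suppose that $u\in L^{2,\infty}([0,T);BMO(\mathbb{R}^3))$ (or $\limsup_{t\to T^-}\sqrt{T-t}\,\|u(t)\|_{BMO(\mathbb{R}^3)}<\infty$). Then the energy equality holds on $[0,T]$: $$\int_{\mathbb{R}^3}|u(t,\cdot)|^2dx+2\int_0^t\int_{\mathbb{R}^3}|\nabla u|^2dxd\tau=\int_{\mathbb{R}^3}|u_0|^2dx\quad\text{for all }t\in[0,T].$$
   Context: Navier-Stokes equations on $\mathbb{R}^3$: $\partial_tu-\Delta u+u\cdot\nabla u+\nabla P=0$, $\nabla\cdot u=0$, $u(0,x)=u_0(x)$. A Leray-Hopf weak solution on $[0,T]\times\mathbb{R}^3$ is $u\in L^\infty(0,T;L^2)\cap L^2(0,T;H^1)$ such that for some distribution $P$ the pair $(u,P)$ satisfies the equations in the sense of distributions and, for a.e. $t_0\in[0,t]$ including $t_0=0$, $\int|u(t,x)|^2dx+2\int_{t_0}^t\int|\nabla u|^2dxd\tau\le\int|u(t_0,x)|^2dx$. Such solutions are taken weakly continuous in time with values in $L^2$, which gives meaning to $u(T)$. $\|f\|_{BMO(\mathbb{R}^3)}$ is the supremum over all balls $B\subset\mathbb{R}^3$ of $\frac1{|B|}\int_B|f-[f]_B|dx$, $[f]_B$ being the average of $f$ over $B$. $u\in L^{2,\infty}([0,T);BMO(\mathbb{R}^3))$ means $\sup_{\sigma>0}\sigma|\{t\in[0,T):\|u(t,\cdot)\|_{BMO(\mathbb{R}^3)}>\sigma\}|^{1/2}<\infty$.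 *)

theory Defs
  imports "HOL-Analysis.Analysis"
begin

section \<open>Smooth functions, test functions, distributions\<close>

text \<open>
  Derivatives are taken within \<open>S\<close>, so for a half-open time slab the derivatives at the initial
  time are one-sided in time.  The sets used below are convex with nonempty interior, where a
  derivative within \<open>S\<close> is unique; hence the existential quantifiers involve no choice.
\<close>

primrec C_k_on ::
  "nat \<Rightarrow> 'a::euclidean_space set \<Rightarrow> ('a \<Rightarrow> 'b::real_normed_vector) \<Rightarrow> bool" where
  "C_k_on 0 S f \<longleftrightarrow> continuous_on S f"
| "C_k_on (Suc k) S f \<longleftrightarrow>
     (\<exists>f'. (\<forall>x\<in>S. (f has_derivative f' x) (at x within S)) \<and> (\<forall>v. C_k_on k S (\<lambda>x. f' x v)))"

definition smooth_on ::
  "'a::euclidean_space set \<Rightarrow> ('a \<Rightarrow> 'b::real_normed_vector) \<Rightarrow> bool" where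
  "smooth_on S f \<longleftrightarrow> (\<forall>k. C_k_on k S f)"

definition supp :: "('a::euclidean_space \<Rightarrow> real) \<Rightarrow> 'a set" where
  "supp \<phi> = closure {x. \<phi> x \<noteq> 0}"

definition test_function :: "'a::euclidean_space set \<Rightarrow> ('a \<Rightarrow> real) \<Rightarrow> bool" where
  "test_function \<Omega> \<phi> \<longleftrightarrow> smooth_on UNIV \<phi> \<and> compact (supp \<phi>) \<and> supp \<phi> \<subseteq> \<Omega>"

definition dir_deriv ::
  "'a::euclidean_space \<Rightarrow> ('a \<Rightarrow> real) \<Rightarrow> 'a \<Rightarrow> real" where
  "dir_deriv v \<phi> x = frechet_derivative \<phi> (at x) v"

text \<open>
  Continuity of a distribution is the usual estimate by finitely many seminorms on each compact
  set: \<open>\<bar>P \<phi>\<bar> \<le> C * M\<close> whenever \<open>M\<close> bounds all partial derivatives of \<open>\<phi>\<close> of order at most \<open>N\<close>,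
  a partial derivative being given by the list of the coordinate directions in which one
  differentiates.  The values of \<open>P\<close> outside the test functions are irrelevant.
\<close>

definition distribution :: "'a::euclidean_space set \<Rightarrow> (('a \<Rightarrow> real) \<Rightarrow> real) \<Rightarrow> bool" where
  "distribution \<Omega> P \<longleftrightarrow>
     (\<forall>\<phi> \<psi>. test_function \<Omega> \<phi> \<longrightarrow> test_function \<Omega> \<psi> \<longrightarrow> P (\<lambda>x. \<phi> x + \<psi> x) = P \<phi> + P \<psi>) \<and>
     (\<forall>c \<phi>. test_function \<Omega> \<phi> \<longrightarrow> P (\<lambda>x. c * \<phi> x) = c * P \<phi>) \<and>
     (\<forall>K. compact K \<longrightarrow> K \<subseteq> \<Omega> \<longrightarrow>
        (\<exists>C N. \<forall>\<phi> M. test_function \<Omega> \<phi> \<longrightarrow> supp \<phi> \<subseteq> K \<longrightarrow>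
           (\<forall>vs x. set vs \<subseteq> Basis \<longrightarrow> length vs \<le> N \<longrightarrow> \<bar>foldr dir_deriv vs \<phi> x\<bar> \<le> M) \<longrightarrow>
           \<bar>P \<phi>\<bar> \<le> C * M))"

section \<open>Function spaces\<close>

definition L2 :: "(real^3 \<Rightarrow> 'b::euclidean_space) \<Rightarrow> bool" where
  "L2 f \<longleftrightarrow> f \<in> borel_measurable lebesgue \<and> integrable lebesgue (\<lambda>x. (norm (f x))\<^sup>2)"

definition is_weak_gradient :: "(real^3 \<Rightarrow> real^3) \<Rightarrow> (real^3 \<Rightarrow> real^3^3) \<Rightarrow> bool" where
  "is_weak_gradient f G \<longleftrightarrow>
     (\<forall>K. compact K \<longrightarrow> set_integrable lebesgue K f \<and> set_integrable lebesgue K G) \<and>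
     (\<forall>\<phi> i j. test_function UNIV \<phi> \<longrightarrow>
        (LINT x|lebesgue. f x $ i * dir_deriv (axis j 1) \<phi> x) =
        - (LINT x|lebesgue. G x $ i $ j * \<phi> x))"

text \<open>Determined up to null sets, hence \<open>dirichlet\<close> below does not depend on the choice.\<close>

definition weak_gradient :: "(real^3 \<Rightarrow> real^3) \<Rightarrow> real^3 \<Rightarrow> real^3^3" where
  "weak_gradient f = (SOME G. is_weak_gradient f G)"

definition H1 :: "(real^3 \<Rightarrow> real^3) \<Rightarrow> bool" where
  "H1 f \<longleftrightarrow> L2 f \<and> (\<exists>G. is_weak_gradient f G \<and> L2 G)"

text \<open>The norm on \<open>real^3^3\<close> is the Frobenius norm.\<close>

definition dirichlet :: "(real^3 \<Rightarrow> real^3) \<Rightarrow> real" where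
  "dirichlet f = (LINT x|lebesgue. (norm (weak_gradient f x))\<^sup>2)"

definition kinetic :: "(real^3 \<Rightarrow> real^3) \<Rightarrow> real" where
  "kinetic f = (LINT x|lebesgue. (norm (f x))\<^sup>2)"

definition average :: "(real^3) set \<Rightarrow> (real^3 \<Rightarrow> real^3) \<Rightarrow> real^3" where
  "average B f = (1 / measure lebesgue B) *\<^sub>R (LINT x:B|lebesgue. f x)"

text \<open>
  For measurable \<open>f\<close> that is not locally integrable the value is \<open>\<infinity>\<close>: if \<open>f\<close> is not integrable
  on \<open>B\<close>, then its formal average is \<open>0\<close> and the integral of \<open>norm (f x)\<close> over \<open>B\<close> is infinite.
\<close>

definition bmo_norm :: "(real^3 \<Rightarrow> real^3) \<Rightarrow> ennreal" where
  "bmo_norm f =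
     (SUP B \<in> {ball c r | c r. r > 0}.
        (\<integral>\<^sup>+x\<in>B. ennreal (norm (f x - average B f)) \<partial>lebesgue) / emeasure lebesgue B)"

definition weak_L2_BMO :: "real \<Rightarrow> (real \<Rightarrow> real^3 \<Rightarrow> real^3) \<Rightarrow> bool" where
  "weak_L2_BMO T u \<longleftrightarrow>
     (SUP \<sigma> \<in> {0<..}.
        ennreal (\<sigma> * sqrt (measure lebesgue {t \<in> {0..<T}. bmo_norm (u t) > ennreal \<sigma>}))) < \<infinity>"

section \<open>The Navier-Stokes equations\<close>

text \<open>
  For divergence-free \<open>u\<close> the convection term is \<open>div (u \<otimes> u)\<close>; the \<open>i\<close>-th momentum equation is
  tested with a scalar \<open>\<phi>\<close> and multiplied by \<open>-1\<close>.
\<close>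

abbreviation dt :: "(real \<times> (real^3) \<Rightarrow> real) \<Rightarrow> real \<times> (real^3) \<Rightarrow> real" where
  "dt \<equiv> dir_deriv (1, 0)"

abbreviation dx :: "3 \<Rightarrow> (real \<times> (real^3) \<Rightarrow> real) \<Rightarrow> real \<times> (real^3) \<Rightarrow> real" where
  "dx j \<equiv> dir_deriv (0, axis j 1)"

definition navier_stokes ::
  "real \<Rightarrow> (real \<Rightarrow> real^3 \<Rightarrow> real^3) \<Rightarrow> ((real \<times> (real^3) \<Rightarrow> real) \<Rightarrow> real) \<Rightarrow> bool" where
  "navier_stokes T u P \<longleftrightarrow>
     (\<forall>\<phi>. test_function ({0<..<T} \<times> UNIV) \<phi> \<longrightarrow>
        (\<forall>i. (LINT (t, x):{0<..<T} \<times> UNIV|lebesgue.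
                u t x $ i * dt \<phi> (t, x)
              + u t x $ i * (\<Sum>j\<in>UNIV. dx j (dx j \<phi>) (t, x))
              + (\<Sum>j\<in>UNIV. u t x $ i * u t x $ j * dx j \<phi> (t, x))) + P (dx i \<phi>) = 0) \<and>
        (LINT (t, x):{0<..<T} \<times> UNIV|lebesgue. (\<Sum>j\<in>UNIV. u t x $ j * dx j \<phi> (t, x))) = 0)"

definition weakly_continuous_L2 :: "real set \<Rightarrow> (real \<Rightarrow> real^3 \<Rightarrow> real^3) \<Rightarrow> bool" where
  "weakly_continuous_L2 I u \<longleftrightarrow>
     (\<forall>t\<in>I. L2 (u t)) \<and>
     (\<forall>g. L2 g \<longrightarrow> continuous_on I (\<lambda>t. LINT x|lebesgue. u t x \<bullet> g x))"

definition energy_inequality :: "(real \<Rightarrow> real^3 \<Rightarrow> real^3) \<Rightarrow> real \<Rightarrow> real \<Rightarrow> bool" where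
  "energy_inequality u t0 t \<longleftrightarrow>
     kinetic (u t) + 2 * (LINT \<tau>:{t0..t}|lebesgue. dirichlet (u \<tau>)) \<le> kinetic (u t0)"

definition leray_hopf ::
  "real \<Rightarrow> (real \<Rightarrow> real^3 \<Rightarrow> real^3) \<Rightarrow> ((real \<times> (real^3) \<Rightarrow> real) \<Rightarrow> real)
     \<Rightarrow> (real^3 \<Rightarrow> real^3) \<Rightarrow> bool" where
  "leray_hopf T u P u\<^sub>0 \<longleftrightarrow>
     (\<lambda>(t, x). u t x) \<in> borel_measurable (lebesgue_on ({0<..<T} \<times> UNIV)) \<and>
     (\<exists>C. AE t in lebesgue. t \<in> {0<..<T} \<longrightarrow> L2 (u t) \<and> kinetic (u t) \<le> C) \<and>
     (AE t in lebesgue. t \<in> {0<..<T} \<longrightarrow> H1 (u t)) \<and>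
     set_integrable lebesgue {0<..<T} (\<lambda>t. dirichlet (u t)) \<and>
     weakly_continuous_L2 {0..T} u \<and>
     (AE x in lebesgue. u 0 x = u\<^sub>0 x) \<and>
     distribution ({0<..<T} \<times> UNIV) P \<and>
     navier_stokes T u P \<and>
     (\<forall>t\<in>{0..T}. energy_inequality u 0 t \<and>
        (AE t0 in lebesgue. t0 \<in> {0..t} \<longrightarrow> energy_inequality u t0 t))"

end

theory Submission
 imports Defs "HOL-Real_Asymp.Real_Asymp"
begin

text \<open>
 Write \<open>E t\<close> for the kinetic energy and \<open>D\<close> for the Dirichlet integral.  The energy inequality is one half of the
 claim; to be shown is that no energy is lost.  Three difficulties shape the proof.

 The pressure is only a distribution and \<open>u\<close> has no decay beyond square integrability, so the equation can be tested only
 with compactly supported divergence-free fields.  The field \<open>leray \<phi> m u\<close> is such a field, close to \<open>u\<close>: up to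
 sign it is \<open>div (\<phi> (m * (\<phi> curl u)))\<close> with a cutoff \<open>\<phi>\<close> at radius \<open>R\<close> and a truncation \<open>m\<close> of the
 Newtonian potential at the scales \<open>\<epsilon>\<close> and \<open>R\<close>.  It is divergence-free because the bracket is antisymmetric
 (\<open>div_leray\<close>), and \<open>leray\<close> is a symmetric operator (\<open>leray_symmetric\<close>).  For divergence-free \<open>u\<close> it differs from
 \<open>\<phi> (mol \<epsilon> * (\<phi> u))\<close> by an error whose gradient is \<open>O(1 / R)\<close> in \<open>L\<^sup>2\<close>, uniformly in \<open>\<epsilon>\<close>
 (\<open>l2_pd_leray_err\<close>), and which tends weakly to zero (\<open>pairing_leray_err\<close>).

 On \<open>(0, T)\<close> the solution is smooth, but time derivatives are not known to decay in space.  Symmetry of \<open>leray\<close>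
 turns the equation, tested with fixed fields, into a differential equation for the quadratic form
 \<open>Q = <u, leray u>\<close> (\<open>Q_integral\<close>).  Its right-hand side is the work of the stress \<open>u \<otimes> u - \<nabla>u\<close> against
 \<open>\<nabla> leray u\<close>.  The stress is in \<open>L\<^sup>2\<close>, with a norm integrable in time, by the inequality of Ladyzhenskaya.  Letting
 \<open>\<epsilon>\<close> tend to zero and then \<open>R\<close> to infinity leaves \<open>-D\<close>; this is \<open>kinetic_lower_interior\<close>.  Weak continuity at
 time zero then gives \<open>E 0 \<le> E t + 2 \<integral> D\<close> for \<open>t < T\<close> (\<open>kinetic_lower\<close>).

 At the final time the bound on the \<open>BMO\<close> norm enters.  The interpolation inequality
 \<open>\<parallel>f\<parallel>\<^sub>4\<^sup>2 \<le> C \<parallel>f\<parallel>\<^sub>B\<^sub>M\<^sub>O \<parallel>f\<parallel>\<^sub>2\<close> (\<open>bmo_interpolation\<close>) bounds \<open>u \<otimes> u\<close> in \<open>L\<^sup>2\<close> by the \<open>BMO\<close> norm, which under either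
 hypothesis has an integral of order \<open>\<surd>\<delta>\<close> over the last time interval of length \<open>\<delta>\<close> (\<open>weak_bmo_tail\<close>,
 \<open>dyadic_majorant\<close>).  In that interval there is a time \<open>s\<close> with \<open>\<delta> D(s) \<le> \<eta>\<close> up to an error, where \<open>\<eta>\<close> is the
 dissipation over the interval (\<open>good_time\<close>).  Testing the equation on \<open>[s, T)\<close> with approximations of \<open>u s\<close> gives
 \<open>|<u T - u s, u s>| \<le> C \<surd>(D s) \<surd>\<delta> \<le> C \<surd>\<eta>\<close>, which tends to zero with \<open>\<delta>\<close>.  Hence \<open>E s \<le> E T + o(1)\<close>, and
 the energy at time \<open>T\<close> is the limit of the energies before.
\<close>

section \<open>Notation\<close>

abbreviation lborel_integral :: "('a::euclidean_space => 'b::{banach, second_countable_topology}) => 'b" (binder "\<L> " 60) where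
 "lborel_integral f == integral\<^sup>L lborel f"

abbreviation lborel_nn_integral :: "('a::euclidean_space => ennreal) => ennreal" (binder "\<N> " 60) where
 "lborel_nn_integral f == integral\<^sup>N lborel f"

abbreviation seq_tendsto :: "(nat => 'a::topological_space) => 'a => bool" ("((_)/ ----> (_))" [60, 60] 60) where
 "X ----> l == X \<longlonglongrightarrow> l"

abbreviation component_sum :: "('i::finite => 'a::comm_monoid_add) => 'a" (binder "\<S> " 10) where
 "component_sum f == sum f UNIV"

abbreviation meas :: "('a::topological_space => 'b::topological_space) => bool" where
 "meas f == f \<in> borel_measurable borel"

text \<open>The theorems of the same names on the Henstock-Kurzweil integral hide these.\<close>

lemmas B_integrable_add = Bochner_Integration.integrable_add
 and B_integrable_bound = Bochner_Integration.integrable_bound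
 and B_integrable_diff = Bochner_Integration.integrable_diff
 and B_integrable_sum = Bochner_Integration.integrable_sum
 and B_integral_cong = Bochner_Integration.integral_cong
 and B_integral_diff = Bochner_Integration.integral_diff
 and B_integral_minus = Bochner_Integration.integral_minus
 and B_integral_nonneg = Bochner_Integration.integral_nonneg
 and B_integral_sum = Bochner_Integration.integral_sum

section \<open>Calculus of smooth functions\<close>

lemma C_k_on_const [simp]: "C_k_on k S (%_. c)"
proof (induction k arbitrary: c)
 case (Suc k)
 then show ?case by (auto intro!: exI[of _ "%_ _. 0"])
qed simp

lemma C_k_on_Suc_imp: "C_k_on (Suc k) S f ==> C_k_on k S f"
proof (induction k arbitrary: f)
 case 0
 then show ?case by (auto simp: continuous_on_eq_continuous_within intro: has_derivative_continuous)
next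
 case (Suc k)
 from Suc.prems obtain f' where f': "\<forall>x\<in>S. (f has_derivative f' x) (at x within S)"
  "\<forall>v. C_k_on (Suc k) S (%x. f' x v)" unfolding C_k_on.simps(2)[of "Suc k"] by blast
 have "\<forall>v. C_k_on k S (%x. f' x v)" using f'(2) Suc.IH by blast
 with f'(1) show ?case unfolding C_k_on.simps(2)[of k] by blast
qed

lemma C_k_on_add: "C_k_on k S f ==> C_k_on k S g ==> C_k_on k S (%x. f x + g x)"
proof (induction k arbitrary: f g)
 case (Suc k)
 from Suc.prems obtain f' g' where "\<forall>x\<in>S. (f has_derivative f' x) (at x within S)"
  "\<forall>v. C_k_on k S (%x. f' x v)" "\<forall>x\<in>S. (g has_derivative g' x) (at x within S)"
  "\<forall>v. C_k_on k S (%x. g' x v)" by auto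
 then show ?case using Suc.IH
  by (auto intro!: exI[of _ "%x v. f' x v + g' x v"] has_derivative_add)
qed (auto intro: continuous_intros)

lemma C_k_on_mult:
 fixes f g :: "'a::euclidean_space => real"
 shows "C_k_on k S f ==> C_k_on k S g ==> C_k_on k S (%x. f x * g x)"
proof (induction k arbitrary: f g)
 case (Suc k)
 from Suc.prems obtain f' g' where "\<forall>x\<in>S. (f has_derivative f' x) (at x within S)"
  "\<forall>v. C_k_on k S (%x. f' x v)" "\<forall>x\<in>S. (g has_derivative g' x) (at x within S)"
  "\<forall>v. C_k_on k S (%x. g' x v)" by auto
 moreover have "C_k_on k S f" "C_k_on k S g" using Suc.prems C_k_on_Suc_imp by blast+
 ultimately show ?case using Suc.IH
  by (auto intro!: exI[of _ "%x v. f x * g' x v + f' x v * g x"] has_derivative_mult C_k_on_add)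
qed (auto intro: continuous_intros)

lemma C_k_on_bounded_linear:
 assumes "bounded_linear L"
 shows "C_k_on k S f ==> C_k_on k S (%x. L (f x))"
proof (induction k arbitrary: f)
 case 0
 then show ?case by (auto intro: bounded_linear.continuous_on[OF assms])
next
 case (Suc k)
 from Suc.prems obtain f' where "\<forall>x\<in>S. (f has_derivative f' x) (at x within S)"
  "\<forall>v. C_k_on k S (%x. f' x v)" by auto
 then show ?case using Suc.IH
  by (auto intro!: exI[of _ "%x v. L (f' x v)"] bounded_linear.has_derivative[OF assms])
qed

lemma C_k_on_affine:
 assumes "bounded_linear L" "!!x. x \<in> S' ==> c + L x \<in> S"
 shows "C_k_on k S f ==> C_k_on k S' (%x. f (c + L x))"
proof (induction k arbitrary: f)
 case 0
 have "continuous_on S' (%x. c + L x)"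
  by (intro continuous_intros bounded_linear.continuous_on[OF assms(1)])
 with 0 show ?case using assms(2) by (auto intro: continuous_on_compose2)
next
 case (Suc k)
 from Suc.prems obtain f' where f': "!!x. x \<in> S ==> (f has_derivative f' x) (at x within S)"
  "\<forall>v. C_k_on k S (%x. f' x v)" by auto
 have "((%x. f (c + L x)) has_derivative (%v. f' (c + L x) (L v))) (at x within S')"
  if "x \<in> S'" for x
 proof (rule has_derivative_in_compose2[where t = S])
  show "((%x. c + L x) has_derivative L) (at x within S')"
   using bounded_linear.has_derivative[OF assms(1) has_derivative_ident]
   by (auto intro!: derivative_eq_intros)
 qed (use assms that f' in auto)
 then show ?case using Suc.IH f' by (auto intro!: exI[of _ "%x v. f' (c + L x) (L v)"])
qed

text \<open>The derivative of the composition is a product of functions of class \<open>C_k\<close>, since \<open>h' y\<close> is multiplication by \<open>h' y 1\<close>.\<close>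

lemma C_k_on_compose_real:
 fixes f :: "'a::euclidean_space => real" and h :: "real => real"
 shows "C_k_on k UNIV h ==> C_k_on k S f ==> C_k_on k S (%x. h (f x))"
proof (induction k arbitrary: h)
 case 0
 then show ?case by (auto intro: continuous_on_compose2)
next
 case (Suc k)
 from Suc.prems obtain f' h' where f': "\<forall>x\<in>S. (f has_derivative f' x) (at x within S)"
  "\<forall>v. C_k_on k S (%x. f' x v)" and h': "!!x. (h has_derivative h' x) (at x)"
  "\<forall>v. C_k_on k UNIV (%x. h' x v)" by auto
 have lin: "h' y v = v * h' y 1" for y v
 proof -
  have "linear (h' y)" using h'(1)[of y] has_derivative_linear by blast
  from linear_scale[OF this, of v 1] show ?thesis by simp
 qed
 have "((%x. h (f x)) has_derivative (%v. f' x v * h' (f x) 1)) (at x within S)"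
  if "x \<in> S" for x
 proof -
  have "(%v. h' (f x) (f' x v)) = (%v. f' x v * h' (f x) 1)" by (rule ext) (rule lin)
  with has_derivative_compose[OF f'(1)[rule_format, OF that] h'(1)] show ?thesis by metis
 qed
 moreover have "C_k_on k S (%x. f' x v * h' (f x) 1)" for v
  using Suc.IH[of "%x. h' x 1"] f'(2) h'(2) C_k_on_Suc_imp[OF Suc.prems(2)]
  by (intro C_k_on_mult) auto
 ultimately show ?case by (auto intro!: exI[of _ "%x v. f' x v * h' (f x) 1"])
qed

abbreviation smooth :: "('a::euclidean_space => real) => bool" where
 "smooth f \<equiv> smooth_on UNIV f"

lemma smooth_const [simp]: "smooth (%_. c)"
 by (simp add: smooth_on_def)

lemma smooth_add: "smooth f ==> smooth g ==> smooth (%x. f x + g x)"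
 by (simp add: smooth_on_def C_k_on_add)

lemma smooth_mult: "smooth f ==> smooth g ==> smooth (%x. f x * g x)"
 by (simp add: smooth_on_def C_k_on_mult)

lemma smooth_minus: "smooth f ==> smooth (%x. - f x)"
 using smooth_mult[of "%_. -1" f] by simp

lemma smooth_diff: "smooth f ==> smooth g ==> smooth (%x. f x - g x)"
 using smooth_add[of f "%x. - g x"] smooth_minus by fastforce

lemma smooth_sum: "(!!i. i \<in> I ==> smooth (f i)) ==> smooth (%x. \<Sum>i\<in>I. f i x)"
 by (induction I rule: infinite_finite_induct) (auto intro: smooth_add)

lemma smooth_affine:
 assumes "smooth f" "bounded_linear L" shows "smooth (%x. f (c + L x))"
 using assms by (auto simp: smooth_on_def intro!: C_k_on_affine[where S=UNIV])

lemma smooth_scale: "smooth f ==> smooth (%x. f (c *\<^sub>R x))"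
 using smooth_affine[of f "%x. c *\<^sub>R x" 0] by (simp add: bounded_linear_scaleR_right)

lemma smooth_reflect: "smooth f ==> smooth (%y. f (x - y))"
 using smooth_affine[of f "%y. - y" x] by (simp add: bounded_linear_minus bounded_linear_ident)

lemma smooth_linear:
 assumes "bounded_linear (L :: 'a::euclidean_space => real)" shows "smooth L"
proof -
 have "C_k_on k UNIV (%x::'a. x)" for k
  by (cases k) (auto intro!: exI[of _ "%_ v. v"])
 then show ?thesis using C_k_on_bounded_linear[OF assms] by (auto simp: smooth_on_def)
qed

lemma smooth_compose:
 fixes h :: "real => real"
 shows "smooth h ==> smooth f ==> smooth (%x. h (f x))"
 by (simp add: smooth_on_def C_k_on_compose_real)

lemma smooth_inner_self: "smooth (%x::'a::euclidean_space. x \<bullet> x)"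
proof -
 have "smooth (%x::'a. \<Sum>b\<in>Basis. (x \<bullet> b) * (x \<bullet> b))"
  by (intro smooth_sum smooth_mult smooth_linear bounded_linear_inner_left)
 then show ?thesis by (simp add: euclidean_inner[symmetric])
qed

lemma smooth_cont: "smooth f ==> continuous_on S f"
 using C_k_on.simps(1)[of UNIV f] continuous_on_subset smooth_on_def by blast

lemma smooth_has_derivative:
 assumes "smooth f" shows "(f has_derivative (%v. dir_deriv v f x)) (at x)"
proof -
 from assms obtain f' where "\<forall>x\<in>UNIV. (f has_derivative f' x) (at x within UNIV)"
  using C_k_on.simps(2)[of 0 UNIV f] by (auto simp: smooth_on_def simp del: C_k_on.simps)
 then have "f differentiable (at x)" by (auto simp: differentiable_def)
 then show ?thesis unfolding dir_deriv_def using frechet_derivative_works[of f "at x"] by simp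
qed

lemma dir_deriv_eq: "(f has_derivative f') (at x) ==> dir_deriv v f x = f' v"
 unfolding dir_deriv_def using frechet_derivative_at by metis

lemma smooth_iff_has_derivative:
 fixes f :: "'a::euclidean_space => real"
 assumes "!!x. (f has_derivative f' x) (at x)" "!!v. smooth (%x. f' x v)"
 shows "smooth f"
proof -
 have "C_k_on (Suc k) UNIV f" for k using assms by (auto simp: smooth_on_def)
 from C_k_on_Suc_imp[OF this] show ?thesis by (simp add: smooth_on_def)
qed

lemma smooth_dir_deriv [intro]:
 assumes "smooth f" shows "smooth (dir_deriv v f)"
proof -
 have "C_k_on k UNIV (dir_deriv v f)" for k
 proof -
  from assms obtain f' where f': "\<forall>x\<in>UNIV. (f has_derivative f' x) (at x within UNIV)"
   "\<forall>v. C_k_on k UNIV (%x. f' x v)"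
   using C_k_on.simps(2)[of k UNIV f] by (auto simp: smooth_on_def simp del: C_k_on.simps)
  then have "dir_deriv v f = (%x. f' x v)" using dir_deriv_eq by fastforce
  then show ?thesis using f' by simp
 qed
 then show ?thesis by (simp add: smooth_on_def)
qed

lemma dir_deriv_const [simp]: "dir_deriv v (%_. c) = (%_. 0)"
 by (rule ext, rule dir_deriv_eq) simp

lemma dir_deriv_add: "smooth f ==> smooth g ==>
  dir_deriv v (%x. f x + g x) = (%x. dir_deriv v f x + dir_deriv v g x)"
 by (rule ext, rule dir_deriv_eq) (intro has_derivative_add smooth_has_derivative)

lemma dir_deriv_diff: "smooth f ==> smooth g ==>
  dir_deriv v (%x. f x - g x) = (%x. dir_deriv v f x - dir_deriv v g x)"
 by (rule ext, rule dir_deriv_eq) (intro has_derivative_diff smooth_has_derivative)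

lemma dir_deriv_minus: "smooth f ==> dir_deriv v (%x. - f x) = (%x. - dir_deriv v f x)"
 by (rule ext, rule dir_deriv_eq) (intro has_derivative_minus smooth_has_derivative)

lemma dir_deriv_mult: "smooth f ==> smooth g ==>
  dir_deriv v (%x. f x * g x) = (%x. f x * dir_deriv v g x + dir_deriv v f x * g x)"
 by (rule ext, rule dir_deriv_eq) (intro has_derivative_mult smooth_has_derivative)

lemma dir_deriv_cmult: "smooth f ==> dir_deriv v (%x. c * f x) = (%x. c * dir_deriv v f x)"
 using dir_deriv_mult[of "%_. c" f v] by simp

lemma dir_deriv_sum: "(!!i. i \<in> I ==> smooth (f i)) ==>
  dir_deriv v (%x. \<Sum>i\<in>I. f i x) = (%x. \<Sum>i\<in>I. dir_deriv v (f i) x)"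
 by (rule ext, rule dir_deriv_eq) (intro has_derivative_sum smooth_has_derivative)

lemma dir_deriv_affine:
 assumes "smooth f" "bounded_linear L"
 shows "dir_deriv v (%x. f (c + L x)) = (%x. dir_deriv (L v) f (c + L x))"
proof (rule ext, rule dir_deriv_eq)
 fix x
 have "((%x. c + L x) has_derivative L) (at x)"
  using bounded_linear.has_derivative[OF assms(2) has_derivative_ident]
  by (auto intro!: derivative_eq_intros)
 from has_derivative_compose[OF this smooth_has_derivative[OF assms(1)]]
 show "((%x. f (c + L x)) has_derivative (%v. dir_deriv (L v) f (c + L x))) (at x)" .
qed

lemma dir_deriv_linear: "smooth f ==> linear (%v. dir_deriv v f x)"
 using smooth_has_derivative has_derivative_linear by blast

lemma dir_deriv_scale:
 assumes "smooth f" shows "dir_deriv v (%x. f (c *\<^sub>R x)) = (%x. c * dir_deriv v f (c *\<^sub>R x))"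
 using dir_deriv_affine[OF assms bounded_linear_scaleR_right, of v 0 c]
  linear_scale[OF dir_deriv_linear[OF assms]] by simp

lemma dir_deriv_compose:
 fixes h :: "real => real"
 assumes "smooth h" "smooth f"
 shows "dir_deriv v (%x. h (f x)) = (%x. dir_deriv 1 h (f x) * dir_deriv v f x)"
proof (rule ext, rule dir_deriv_eq)
 fix x
 have "dir_deriv (dir_deriv v f x) h (f x) = dir_deriv 1 h (f x) * dir_deriv v f x" for v
  using linear_scale[OF dir_deriv_linear[OF assms(1)], of "dir_deriv v f x" 1] by simp
 then show "((%x. h (f x)) has_derivative (%v. dir_deriv 1 h (f x) * dir_deriv v f x)) (at x)"
  using has_derivative_compose[OF smooth_has_derivative[OF assms(2)] smooth_has_derivative[OF assms(1)], of x]
  by (simp only:)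
qed

lemma dir_deriv_inner_self: "dir_deriv v (%x. x \<bullet> x) x = 2 * (x \<bullet> v)"
proof (rule dir_deriv_eq[where f' = "%v. 2 * (x \<bullet> v)"])
 show "((%x. x \<bullet> x) has_derivative (%v. 2 * (x \<bullet> v))) (at x)"
  by (auto intro!: derivative_eq_intros simp: inner_commute)
qed

text \<open>Along a line a smooth function is an ordinary differentiable function of one variable, so
 the mean value theorem applies.\<close>

lemma dir_deriv_along_line:
 assumes "smooth f"
 shows "((%t. f (x + t *\<^sub>R v)) has_real_derivative dir_deriv v f (x + t *\<^sub>R v)) (at t)"
proof -
 have "((%t. x + t *\<^sub>R v) has_derivative (%h. h *\<^sub>R v)) (at t)"
  by (auto intro!: derivative_eq_intros)
 from has_derivative_compose[OF this smooth_has_derivative[OF assms]]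
 show ?thesis
  using linear_scale[OF dir_deriv_linear[OF assms]]
  by (simp add: has_field_derivative_def mult_commute_abs)
qed

lemma dir_deriv_mvt:
 assumes "smooth f" "0 < h"
 obtains z where "0 < z" "z < h" "f (x + h *\<^sub>R v) - f x = h * dir_deriv v f (x + z *\<^sub>R v)"
 using MVT2[of 0 h "%t. f (x + t *\<^sub>R v)"] assms dir_deriv_along_line[OF assms(1), of x v]
 by force

lemma dir_deriv_commute:
 assumes f: "smooth f"
 shows "dir_deriv v (dir_deriv w f) x = dir_deriv w (dir_deriv v f) x"
proof -
 \<comment> \<open>Both sides are limits of the second difference
   \<open>f (x + h v + h w) - f (x + h v) - f (x + h w) + f x\<close> divided by \<open>h^2\<close>.\<close>
 have key: "\<exists>a b. 0 < a \<and> a < h \<and> 0 < b \<and> b < h \<and>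
   f (x + h *\<^sub>R v + h *\<^sub>R w) - f (x + h *\<^sub>R v) - f (x + h *\<^sub>R w) + f x
   = h * h * dir_deriv v (dir_deriv w f) (x + a *\<^sub>R v + b *\<^sub>R w)" if h: "0 < h" for h v w
 proof -
  define g where "g = (%y. f (y + h *\<^sub>R v) - f y)"
  have sm: "smooth (%y. f (h *\<^sub>R v + y))"
   using smooth_affine[OF f bounded_linear_ident] .
  have "smooth g" unfolding g_def using smooth_diff[OF sm f] by (simp add: add.commute)
  from dir_deriv_mvt[OF this h, of x w] obtain b where b: "0 < b" "b < h"
   "g (x + h *\<^sub>R w) - g x = h * dir_deriv w g (x + b *\<^sub>R w)" by blast
  have "dir_deriv w g = (%y. dir_deriv w f (y + h *\<^sub>R v) - dir_deriv w f y)"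
   unfolding g_def using dir_deriv_diff[OF sm f, of w]
    dir_deriv_affine[OF f bounded_linear_ident, of w "h *\<^sub>R v"] by (simp add: add.commute)
  moreover obtain a where "0 < a" "a < h" "dir_deriv w f (x + b *\<^sub>R w + h *\<^sub>R v) - dir_deriv w f (x + b *\<^sub>R w)
    = h * dir_deriv v (dir_deriv w f) (x + b *\<^sub>R w + a *\<^sub>R v)"
   using dir_deriv_mvt[OF smooth_dir_deriv[OF f] h] by metis
  ultimately show ?thesis using b unfolding g_def
   by (intro exI[of _ a] exI[of _ b]) (auto simp: algebra_simps)
 qed
 define F where "F = dir_deriv v (dir_deriv w f)"
 define G where "G = dir_deriv w (dir_deriv v f)"
 have cont: "isCont F x" "isCont G x" unfolding F_def G_def
  using smooth_cont[OF smooth_dir_deriv[OF smooth_dir_deriv[OF f]], of UNIV]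
  by (auto simp: continuous_on_eq_continuous_at)
 define A where "A n = 1 / real (Suc n)" for n
 have A: "A n > 0" for n by (simp add: A_def)
 have A0: "A ----> 0" unfolding A_def using LIMSEQ_inverse_real_of_nat by (simp add: inverse_eq_divide)
 have "\<forall>n. \<exists>a b. 0 < a \<and> a < A n \<and> 0 < b \<and> b < A n \<and>
  f (x + A n *\<^sub>R v + A n *\<^sub>R w) - f (x + A n *\<^sub>R v) - f (x + A n *\<^sub>R w) + f x = A n * A n * F (x + a *\<^sub>R v + b *\<^sub>R w)"
  using key[OF A] unfolding F_def by blast
 then obtain a b where ab: "!!n. 0 < a n" "!!n. a n < A n" "!!n. 0 < b n" "!!n. b n < A n"
  "!!n. f (x + A n *\<^sub>R v + A n *\<^sub>R w) - f (x + A n *\<^sub>R v) - f (x + A n *\<^sub>R w) + f x = A n * A n * F (x + a n *\<^sub>R v + b n *\<^sub>R w)"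
  by metis
 have "\<forall>n. \<exists>a b. 0 < a \<and> a < A n \<and> 0 < b \<and> b < A n \<and>
  f (x + A n *\<^sub>R w + A n *\<^sub>R v) - f (x + A n *\<^sub>R w) - f (x + A n *\<^sub>R v) + f x = A n * A n * G (x + a *\<^sub>R w + b *\<^sub>R v)"
  using key[OF A] unfolding G_def by blast
 then obtain c d where cd: "!!n. 0 < c n" "!!n. c n < A n" "!!n. 0 < d n" "!!n. d n < A n"
  "!!n. f (x + A n *\<^sub>R w + A n *\<^sub>R v) - f (x + A n *\<^sub>R w) - f (x + A n *\<^sub>R v) + f x = A n * A n * G (x + c n *\<^sub>R w + d n *\<^sub>R v)"
  by metis
 have eq: "F (x + a n *\<^sub>R v + b n *\<^sub>R w) = G (x + c n *\<^sub>R w + d n *\<^sub>R v)" for n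
 proof -
  have "A n * A n * F (x + a n *\<^sub>R v + b n *\<^sub>R w) = A n * A n * G (x + c n *\<^sub>R w + d n *\<^sub>R v)"
   unfolding ab(5)[symmetric] cd(5)[symmetric] by (simp add: algebra_simps)
  then show ?thesis using A[of n] by simp
 qed
 have lim0: "e ----> 0" if "!!n. 0 < e n" "!!n. e n < A n" for e
  by (rule tendsto_sandwich[OF _ _ tendsto_const A0])
    (auto intro!: always_eventually less_imp_le that)
 have "(%n. x + a n *\<^sub>R v + b n *\<^sub>R w) ----> x + 0 *\<^sub>R v + 0 *\<^sub>R w"
  by (intro tendsto_intros lim0 ab)
 then have 1: "(%n. F (x + a n *\<^sub>R v + b n *\<^sub>R w)) ----> F x"
  using isCont_tendsto_compose[OF cont(1)] by force
 have "(%n. x + c n *\<^sub>R w + d n *\<^sub>R v) ----> x + 0 *\<^sub>R w + 0 *\<^sub>R v"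
  by (intro tendsto_intros lim0 cd)
 then have "(%n. G (x + c n *\<^sub>R w + d n *\<^sub>R v)) ----> G x"
  using isCont_tendsto_compose[OF cont(2)] by force
 with 1 show ?thesis unfolding eq F_def[symmetric] G_def[symmetric] by (rule LIMSEQ_unique)
qed

subsection \<open>Test functions\<close>

abbreviation test :: "('a::euclidean_space => real) => bool" where
 "test f \<equiv> test_function UNIV f"

lemma test_iff: "test f \<longleftrightarrow> smooth f \<and> (\<exists>r. \<forall>x. f x \<noteq> 0 --> norm x <= r)"
proof -
 have "compact (supp f) \<longleftrightarrow> (\<exists>r. \<forall>x. f x \<noteq> 0 --> norm x <= r)"
  unfolding supp_def compact_closure by (auto simp: bounded_iff)
 then show ?thesis unfolding test_function_def by auto
qed

lemma testI: "smooth f ==> (!!x. f x \<noteq> 0 ==> norm x <= r) ==> test f"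
 unfolding test_iff by blast

lemma test_smooth: "test f ==> smooth f"
 by (simp add: test_iff)

lemma test_bounded_supp: assumes "test f" obtains r where "!!x. r < norm x ==> f x = 0" "r > 0"
proof -
 obtain r where "!!x. f x \<noteq> 0 ==> norm x <= r" using assms by (auto simp: test_iff)
 then show ?thesis using that[of "max r 1"] by force
qed

lemma test_mult_left: assumes "smooth f" "test g" shows "test (%x. f x * g x)"
 using assms by (auto simp: test_iff intro: smooth_mult)

lemma test_mult_right: assumes "test f" "smooth g" shows "test (%x. f x * g x)"
 using assms by (auto simp: test_iff intro: smooth_mult)

lemma test_zero [simp]: "test (%_. 0)" by (simp add: test_iff)

lemma test_add: assumes "test f" "test g" shows "test (%x. f x + g x)"
proof -
 obtain r s where "!!x. f x \<noteq> 0 ==> norm x <= r" "!!x. g x \<noteq> 0 ==> norm x <= s"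
  using assms by (auto simp: test_iff)
 then show ?thesis using assms
  by (intro testI[of _ "max r s"] smooth_add) (use test_smooth in \<open>force simp: le_max_iff_disj\<close>)+
qed

lemma test_minus: "test f ==> test (%x. - f x)"
 using test_mult_left[of "%_. -1" f] by simp

lemma test_diff: "test f ==> test g ==> test (%x. f x - g x)"
 using test_add[of f "%x. - g x"] test_minus by fastforce

lemma test_sum: "(!!i. i \<in> I ==> test (f i)) ==> test (%x. \<Sum>i\<in>I. f i x)"
 by (induction I rule: infinite_finite_induct) (auto intro: test_add)

lemma dir_deriv_outside_supp:
 assumes "!!x. r < norm x ==> f x = 0" "r < norm x"
 shows "dir_deriv v f x = 0"
proof -
 have "open {x::'a. r < norm x}" by (intro open_Collect_less continuous_intros)
 then have "(f has_derivative (%_. 0)) (at x)"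
  by (rule has_derivative_transform_within_open[OF has_derivative_const]) (use assms in auto)
 from dir_deriv_eq[OF this] show ?thesis .
qed

lemma test_dir_deriv: assumes "test f" shows "test (dir_deriv v f)"
proof -
 obtain r where "!!x. r < norm x ==> f x = 0" using test_bounded_supp[OF assms] by blast
 then have "dir_deriv v f x \<noteq> 0 ==> norm x <= r" for x using dir_deriv_outside_supp[of r f] by force
 then show ?thesis using assms by (auto simp: test_iff)
qed

lemma test_bounded: assumes "test f" obtains B where "!!x. \<bar>f x\<bar> <= B" "B > 0"
proof -
 obtain r where r: "!!x. r < norm x ==> f x = 0" "r > 0" using test_bounded_supp[OF assms] by blast
 have "compact (f ` cball 0 r)" using assms
  by (intro compact_continuous_image smooth_cont test_smooth) auto
 then obtain B where "\<forall>y\<in>f ` cball 0 r. norm y <= B" using compact_imp_bounded bounded_iff by metis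
 then have "\<bar>f x\<bar> <= max B 1" for x using r(1)[of x] by (cases "r < norm x") (force simp: le_max_iff_disj)+
 then show ?thesis using that[of "max B 1"] by simp
qed

lemma test_scale: assumes "test f" "c \<noteq> 0" shows "test (%x. f (c *\<^sub>R x))"
proof -
 obtain r where "!!x. f x \<noteq> 0 ==> norm x <= r" using assms by (auto simp: test_iff)
 from this[of "c *\<^sub>R x" for x] have "f (c *\<^sub>R x) \<noteq> 0 ==> norm x <= r / \<bar>c\<bar>" for x
  using assms by (force simp: field_simps)
 then show ?thesis using assms smooth_scale test_smooth testI by metis
qed

lemma test_reflect: assumes "test f" shows "test (%y. f (x - y))"
proof -
 obtain r where r: "!!x. f x \<noteq> 0 ==> norm x <= r" using assms by (auto simp: test_iff)
 have "norm y <= r + norm x" if "f (x - y) \<noteq> 0" for y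
  using r[OF that] norm_triangle_sub[of y x] by (simp add: norm_minus_commute)
 then show ?thesis using assms smooth_reflect test_smooth testI by metis
qed

subsection \<open>A bump function\<close>

definition bump_aux :: "nat => real => real" where
 "bump_aux n x = (if x > 0 then exp (- 1 / x) / x ^ n else 0)"

lemma bump_aux_at_0: "((%x. exp (- 1 / x) / x ^ n) \<longlongrightarrow> (0::real)) (at_right 0)"
proof -
 have "((%y::real. y ^ n / exp y) \<longlongrightarrow> 0) at_top" by (rule tendsto_power_div_exp_0)
 from filterlim_compose[OF this filterlim_inverse_at_top_right]
 show ?thesis by (simp add: exp_minus divide_simps mult.commute)
qed

lemma bump_aux_has_derivative:
 "(bump_aux n has_real_derivative bump_aux (n + 2) x - n * bump_aux (n + 1) x) (at x)"
proof -
 consider "x > 0" | "x < 0" | "x = 0" by linarith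
 then show ?thesis
 proof cases
  case 1
  have pw: "m \<noteq> 0 ==> x * x ^ (m - Suc 0) = x ^ m" for m by (cases m) auto
  have "((%x. exp (- 1 / x) / x ^ n) has_real_derivative bump_aux (n + 2) x - n * bump_aux (n + 1) x) (at x)"
   using 1 by (cases n) (auto intro!: derivative_eq_intros simp: bump_aux_def field_simps power2_eq_square, metis pw)
  then show ?thesis
   by (rule has_field_derivative_transform_within_open[of _ _ _ "{0<..}"]) (use 1 in \<open>auto simp: bump_aux_def\<close>)
 next
  case 2
  have "((%x. 0) has_real_derivative 0) (at x)" by simp
  then have "(bump_aux n has_real_derivative 0) (at x)"
   by (rule has_field_derivative_transform_within_open[of _ _ _ "{..<0}"]) (use 2 in \<open>auto simp: bump_aux_def\<close>)
  then show ?thesis using 2 by (simp add: bump_aux_def)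
 next
  case 3
  have "((%y. bump_aux n y / y) \<longlongrightarrow> 0) (at_right 0)"
  proof (rule Lim_transform_eventually[OF bump_aux_at_0[of "Suc n"]])
   show "\<forall>\<^sub>F y in at_right 0. exp (- 1 / y) / y ^ Suc n = bump_aux n y / y"
    by (auto simp: bump_aux_def eventually_at_filter)
  qed
  moreover have "((%y. bump_aux n y / y) \<longlongrightarrow> 0) (at_left 0)"
   by (rule Lim_transform_eventually[OF tendsto_const[of 0]])
     (auto simp: bump_aux_def eventually_at_filter)
  ultimately have "((%y. bump_aux n y / y) \<longlongrightarrow> 0) (at 0)" using filterlim_split_at by blast
  then show ?thesis using 3 by (simp add: bump_aux_def has_field_derivative_iff)
 qed
qed

lemma smooth_bump_aux: "smooth (bump_aux n)"
proof -
 have "C_k_on k UNIV (bump_aux n)" for k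
 proof (induction k arbitrary: n)
  case 0
  then show ?case using bump_aux_has_derivative
   by (auto simp: continuous_on_eq_continuous_at intro: DERIV_isCont)
 next
  case (Suc k)
  have "C_k_on k UNIV (%x. (bump_aux (n + 2) x + (- n) * bump_aux (n + 1) x) * v)" for v
   using Suc by (intro C_k_on_mult C_k_on_add C_k_on_const) auto
  then show ?case using bump_aux_has_derivative[of n]
   by (auto intro!: exI[of _ "%x v. (bump_aux (n + 2) x + (- n) * bump_aux (n + 1) x) * v"] simp: has_field_derivative_def)
 qed
 then show ?thesis by (simp add: smooth_on_def)
qed

text \<open>The profile \<open>bump\<close> vanishes on the negative axis and is positive and increasing on the
 positive one; \<open>bump (1 - \<bar>x\<bar>^2)\<close> is a radial bump supported in the unit ball.\<close>

definition bump :: "real => real" where "bump x = (if x > 0 then exp (- 1 / x) else 0)"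

definition bump' :: "real => real" where "bump' x = (if x > 0 then exp (- 1 / x) / x^2 else 0)"

lemma smooth_bump: "smooth bump"
proof -
 have "bump = bump_aux 0" by (auto simp: bump_def bump_aux_def)
 then show ?thesis by (metis smooth_bump_aux)
qed

lemma smooth_bump': "smooth bump'"
proof -
 have "bump' = bump_aux 2" by (auto simp: bump'_def bump_aux_def)
 then show ?thesis by (metis smooth_bump_aux)
qed

lemma dir_deriv_bump: "dir_deriv 1 bump = bump'"
proof
 fix x
 have "bump = bump_aux 0" by (auto simp: bump_def bump_aux_def)
 moreover have "bump' = bump_aux 2" by (auto simp: bump'_def bump_aux_def)
 ultimately have "(bump has_derivative (%h. bump' x * h)) (at x)"
  using bump_aux_has_derivative[of 0 x] by (simp add: has_field_derivative_def numeral_2_eq_2)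
 from dir_deriv_eq[OF this] show "dir_deriv 1 bump x = bump' x" by simp
qed

section \<open>Integration of continuous and square integrable functions\<close>

lemma continuous_compact_integrable:
 fixes f :: "'a::euclidean_space => real"
 assumes "continuous_on UNIV f" "!!x. r < norm x ==> f x = 0"
 shows "integrable lborel f"
proof -
 have "integrable lborel (%x. indicator (cball 0 r) x *\<^sub>R f x)"
  using assms(1) continuous_on_subset by (intro borel_integrable_compact) auto
 also have "(%x. indicator (cball 0 r) x *\<^sub>R f x) = f"
  using assms(2) by (auto simp: fun_eq_iff indicator_def not_le)
 finally show ?thesis .
qed

lemma integrable_continuous_test:
 assumes "continuous_on UNIV f" "test g" shows "integrable lborel (%x. f x * g x)"
proof -
 obtain r where "!!x. r < norm x ==> g x = 0" using test_bounded_supp[OF assms(2)] by blast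
 moreover have "continuous_on UNIV g" using assms(2) by (simp add: smooth_cont test_smooth)
 ultimately show ?thesis using assms(1)
  by (intro continuous_compact_integrable[of _ r] continuous_intros) auto
qed

lemma test_integrable: "test g ==> integrable lborel g"
 using integrable_continuous_test[of "%_. 1" g] by simp

lemma smooth_borel [measurable (raw)]: "smooth f ==> f \<in> borel_measurable borel"
 by (intro borel_measurable_continuous_onI smooth_cont)

lemma test_borel: "test f ==> f \<in> borel_measurable borel"
 by (simp add: smooth_borel test_smooth)

lemma lborel_shift:
 fixes f :: "'a::euclidean_space => real"
 assumes "meas f" shows "(\<L> x. f (v + x)) = (\<L> x. f x)"
proof -
 have "(\<L> x. f x) = (LINT x|distr lborel borel ((+) v). f x)"
  by (simp add: lborel_distr_plus)
 also have "... = (\<L> x. f (v + x))" by (subst integral_distr) (use assms in auto)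
 finally show ?thesis ..
qed

lemma lborel_scale:
 fixes f :: "'a::euclidean_space => real"
 assumes f: "meas f" and c: "c \<noteq> 0"
 shows "(\<L> x. f (t + c *\<^sub>R x)) = (\<L> x. f x) / \<bar>c\<bar> ^ DIM('a)"
proof -
 have "(\<L> x. f x) = (LINT x|density (distr lborel borel (%x. t + c *\<^sub>R x)) (%_. ennreal (\<bar>c\<bar> ^ DIM('a))). f x)"
  using lborel_affine[OF c, of t] by (simp add: ennreal_power)
 also have "... = (LINT x|distr lborel borel (%x. t + c *\<^sub>R x). \<bar>c\<bar> ^ DIM('a) * f x)"
  by (subst integral_density) (use f in auto)
 also have "... = \<bar>c\<bar> ^ DIM('a) * (\<L> x. f (t + c *\<^sub>R x))"
  by (subst integral_distr) (use f in auto)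
 finally show ?thesis using c by (simp add: field_simps)
qed

lemma lborel_reflect:
 fixes f :: "'a::euclidean_space => real"
 assumes "meas f" shows "(\<L> y. f (x - y)) = (\<L> y. f y)"
 using lborel_scale[OF assms, of "-1" x] by simp

text \<open>The integral is translation invariant, so the integral of a difference quotient vanishes.\<close>

lemma integral_dir_deriv:
 assumes f: "test f" shows "(\<L> x. dir_deriv v f x) = 0"
proof -
 obtain r where r: "!!x. r < norm x ==> f x = 0" using test_bounded_supp[OF f] by blast
 obtain B where B: "!!x. \<bar>dir_deriv v f x\<bar> <= B" using test_bounded[OF test_dir_deriv[OF f]] by blast
 define h where "h n = 1 / real (Suc n)" for n
 have h: "0 < h n" "h n <= 1" for n by (auto simp: h_def)
 define q where "q n x = (f (h n *\<^sub>R v + x) - f x) / h n" for n x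
 have [measurable]: "meas f" "meas (dir_deriv v f)"
  using f test_dir_deriv test_borel by blast+
 have q0: "(\<L> x. q n x) = 0" for n
 proof -
  have i: "integrable lborel (%x. f (h n *\<^sub>R v + x))"
  proof (rule continuous_compact_integrable[of _ "r + norm (h n *\<^sub>R v)"])
   show "continuous_on UNIV (%x. f (h n *\<^sub>R v + x))"
    using smooth_affine[OF test_smooth[OF f] bounded_linear_ident] by (rule smooth_cont)
   show "f (h n *\<^sub>R v + x) = 0" if "r + norm (h n *\<^sub>R v) < norm x" for x
    using that norm_triangle_sub[of x "- h n *\<^sub>R v"] by (intro r) (simp add: add.commute)
  qed
  show ?thesis unfolding q_def using i test_integrable[OF f] by (simp add: lborel_shift)
 qed
 have "(%n. \<L> x. q n x) ----> (\<L> x. dir_deriv v f x)"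
 proof (rule integral_dominated_convergence[where w = "%x. indicator (cball 0 (r + norm v)) x * B"])
  show "integrable lborel (%x. indicat_real (cball 0 (r + norm v)) x * B)"
   using borel_integrable_compact[of "cball 0 (r + norm v)" "%_. B"] by simp
  show "AE x in lborel. (%n. q n x) ----> dir_deriv v f x"
  proof (rule AE_I2)
   fix x
   have "((%t. f (x + t *\<^sub>R v)) has_real_derivative dir_deriv v f x) (at 0)"
    using dir_deriv_along_line[OF test_smooth[OF f], of x v 0] by simp
   then have "((%t. (f (x + t *\<^sub>R v) - f x) / t) \<longlongrightarrow> dir_deriv v f x) (at 0)"
    by (simp add: has_field_derivative_iff)
   moreover have "filterlim h (at 0) sequentially"
   proof (rule filterlim_atI)
    show "h ----> 0" unfolding h_def using LIMSEQ_inverse_real_of_nat by (simp add: inverse_eq_divide)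
   qed (auto simp: h_def)
   ultimately show "(%n. q n x) ----> dir_deriv v f x"
    unfolding q_def using filterlim_compose by (fastforce simp: add.commute)
  qed
  show "AE x in lborel. norm (q n x) <= indicator (cball 0 (r + norm v)) x * B" for n
  proof (rule AE_I2)
   fix x
   show "norm (q n x) <= indicator (cball 0 (r + norm v)) x * B"
   proof (cases "norm x <= r + norm v")
    case True
    obtain z where "f (x + h n *\<^sub>R v) - f x = h n * dir_deriv v f (x + z *\<^sub>R v)"
     using dir_deriv_mvt[OF test_smooth[OF f] h(1)] by metis
    then have "q n x = dir_deriv v f (x + z *\<^sub>R v)" unfolding q_def using h[of n] by (simp add: add.commute)
    then show ?thesis using B True by simp
   next
    case False
    have "norm (h n *\<^sub>R v) <= norm v" using h[of n] by (simp add: mult_left_le_one_le)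
    then have "r < norm (h n *\<^sub>R v + x)" using False norm_triangle_sub[of x "- (h n *\<^sub>R v)"]
     by (simp add: add.commute)
    moreover have "r < norm x" using False norm_ge_zero[of v] by linarith
    ultimately have "q n x = 0" unfolding q_def using r by simp
    then show ?thesis using False by simp
   qed
  qed
 qed (auto simp: q_def)
 then show ?thesis by (simp add: q0 LIMSEQ_const_iff)
qed

lemma integral_by_parts:
 assumes "smooth f" "test g"
 shows "(\<L> x. dir_deriv v f x * g x) = - (\<L> x. f x * dir_deriv v g x)"
proof -
 have "test (%x. f x * g x)" using assms by (rule test_mult_left)
 from integral_dir_deriv[OF this, of v]
 have "(\<L> x. f x * dir_deriv v g x + dir_deriv v f x * g x) = 0"
  using assms by (simp add: dir_deriv_mult test_smooth)
 moreover have "integrable lborel (%x. f x * dir_deriv v g x)"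
  using assms by (intro integrable_continuous_test test_dir_deriv smooth_cont)
 moreover have "integrable lborel (%x. dir_deriv v f x * g x)"
  using assms by (intro integrable_continuous_test test_dir_deriv smooth_cont smooth_dir_deriv)
 ultimately show ?thesis by simp
qed

subsection \<open>The \<open>L\<^sup>2\<close> norm\<close>

definition sq_int :: "('a::euclidean_space => real) => bool" where
 "sq_int f \<longleftrightarrow> f \<in> borel_measurable borel \<and> integrable lborel (%x. (f x)^2)"

definition l2 :: "('a::euclidean_space => real) => real" where
 "l2 f = sqrt (\<L> x. (f x)^2)"

lemma sq_int_borel: "sq_int f ==> f \<in> borel_measurable borel"
 by (simp add: sq_int_def)

lemma l2_nonneg [simp]: "0 <= l2 f" by (simp add: l2_def)

lemma l2_power2: "(l2 f)^2 = (\<L> x. (f x)^2)" by (simp add: l2_def)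

lemma sq_int_mult_integrable:
 assumes "sq_int f" "sq_int g" shows "integrable lborel (%x. f x * g x)"
proof (rule B_integrable_bound[of _ "%x. (f x)^2 + (g x)^2"])
 have "\<bar>a * b\<bar> <= a^2 + b^2" for a b :: real
 proof -
  have "0 <= \<bar>a\<bar> * \<bar>b\<bar>" by simp
  then show ?thesis using sum_squares_bound[of "\<bar>a\<bar>" "\<bar>b\<bar>"] unfolding abs_mult power2_abs by linarith
 qed
 then show "AE x in lborel. norm (f x * g x) <= norm ((f x)^2 + (g x)^2)" by simp
qed (use assms in \<open>auto simp: sq_int_def\<close>)

lemma sq_int_add: assumes "sq_int f" "sq_int g" shows "sq_int (%x. f x + g x)"
proof -
 have "integrable lborel (%x. (f x)^2 + 2 * (f x * g x) + (g x)^2)"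
  using assms sq_int_mult_integrable[OF assms] by (auto simp: sq_int_def)
 then show ?thesis using assms by (simp add: sq_int_def power2_sum algebra_simps borel_measurable_add)
qed

lemma sq_int_cmult: "sq_int f ==> sq_int (%x. c * f x)"
 by (auto simp: sq_int_def power_mult_distrib)

lemma l2_cmult: "l2 (%x. c * f x) = \<bar>c\<bar> * l2 f"
 by (simp add: l2_def power_mult_distrib real_sqrt_mult)

lemma sq_int_minus: "sq_int f ==> sq_int (%x. - f x)"
 using sq_int_cmult[of f "-1"] by simp

lemma l2_minus [simp]: "l2 (%x. - f x) = l2 f" by (simp add: l2_def)

lemma sq_int_diff: "sq_int f ==> sq_int g ==> sq_int (%x. f x - g x)"
 using sq_int_add[of f "%x. - g x"] sq_int_minus by fastforce

lemma l2_Cauchy_Schwarz: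
 assumes "sq_int f" "sq_int g"
 shows "\<bar>\<L> x. f x * g x\<bar> <= l2 f * l2 g"
proof -
 define a b c where abc: "a = (\<L> x. (f x)^2)" "b = (\<L> x. f x * g x)"
  "c = (\<L> x. (g x)^2)"
 have i: "integrable lborel (%x. f x * g x)" "integrable lborel (%x. (f x)^2)" "integrable lborel (%x. (g x)^2)"
  using assms sq_int_mult_integrable[OF assms] by (auto simp: sq_int_def)
 have q: "0 <= a * t^2 + 2 * b * t + c" for t
 proof -
  have "0 <= (\<L> x. (t * f x + g x)^2)" by simp
  also have "... = (\<L> x. t^2 * (f x)^2 + 2 * t * (f x * g x) + (g x)^2)"
   by (rule B_integral_cong) (auto simp: power2_sum power_mult_distrib)
  also have "... = a * t^2 + 2 * b * t + c" using i by (simp add: abc)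
  finally show ?thesis .
 qed
 have "a \<ge> 0" "c \<ge> 0" by (auto simp: abc)
 have "b^2 <= a * c"
 proof (cases "a = 0")
  case True
  have "b = 0"
  proof (rule ccontr)
   assume "b \<noteq> 0"
   then show False using q[of "- (c + 1) / (2 * b)"] True by (simp add: field_simps)
  qed
  then show ?thesis using True by simp
 next
  case False
  then have "a > 0" using \<open>a \<ge> 0\<close> by simp
  then show ?thesis using q[of "- b / a"] by (simp add: field_simps power2_eq_square)
 qed
 then have "\<bar>b\<bar> <= sqrt (a * c)" using real_le_rsqrt by (simp add: real_le_rsqrt)
 then show ?thesis by (simp add: abc l2_def real_sqrt_mult)
qed

lemma l2_triangle:
 assumes "sq_int f" "sq_int g" shows "l2 (%x. f x + g x) <= l2 f + l2 g"
proof -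
 have i: "integrable lborel (%x. f x * g x)" "integrable lborel (%x. (f x)^2)" "integrable lborel (%x. (g x)^2)"
  using assms sq_int_mult_integrable[OF assms] by (auto simp: sq_int_def)
 have "(l2 (%x. f x + g x))^2 = (\<L> x. (f x)^2 + 2 * (f x * g x) + (g x)^2)"
  unfolding l2_power2 by (rule B_integral_cong) (auto simp: power2_sum)
 also have "... = (l2 f)^2 + 2 * (\<L> x. f x * g x) + (l2 g)^2" using i by (simp add: l2_power2)
 also have "... <= (l2 f + l2 g)^2"
  using l2_Cauchy_Schwarz[OF assms] by (simp add: power2_sum)
 finally show ?thesis by (rule power2_le_imp_le) simp
qed

lemma l2_triangle_diff:
 assumes "sq_int f" "sq_int g" shows "l2 (%x. f x - g x) <= l2 f + l2 g"
 using l2_triangle[OF assms(1) sq_int_minus[OF assms(2)]] by simp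

lemma sq_int_bound:
 assumes "sq_int g" "meas f" "!!x. \<bar>f x\<bar> <= c * \<bar>g x\<bar>" "0 <= c"
 shows "sq_int f" "l2 f <= c * l2 g"
proof -
 have b: "(f x)^2 <= c^2 * (g x)^2" for x
  using power_mono[OF assms(3)[of x], of 2] by (simp add: power_mult_distrib)
 have i: "integrable lborel (%x. c^2 * (g x)^2)" using assms(1) by (simp add: sq_int_def)
 show s: "sq_int f" unfolding sq_int_def
 proof
  show "integrable lborel (%x. (f x)^2)"
   by (rule B_integrable_bound[OF i]) (use b assms(2) in auto)
 qed fact
 have "(\<L> x. (f x)^2) <= (\<L> x. c^2 * (g x)^2)"
  using s b i by (intro integral_mono) (auto simp: sq_int_def)
 then have "(l2 f)^2 <= (c * l2 g)^2" by (simp add: l2_power2 power_mult_distrib)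
 then show "l2 f <= c * l2 g" by (rule power2_le_imp_le) (use assms in simp)
qed

lemma sq_int_mult_bounded:
 assumes "sq_int g" "meas f" "!!x. \<bar>f x\<bar> <= c"
 shows "sq_int (%x. f x * g x)" "l2 (%x. f x * g x) <= c * l2 g"
proof -
 have c: "0 <= c" using assms(3) abs_ge_zero order_trans by blast
 have "\<bar>f x * g x\<bar> <= c * \<bar>g x\<bar>" for x using assms(3) by (simp add: abs_mult mult_right_mono)
 from sq_int_bound[OF assms(1) _ this c] show "sq_int (%x. f x * g x)" "l2 (%x. f x * g x) <= c * l2 g"
  using assms by (auto simp: sq_int_def)
qed

lemma sq_int_sum: "(!!i. i \<in> I ==> sq_int (f i)) ==> sq_int (%x. \<Sum>i\<in>I. f i x)"
 by (induction I rule: infinite_finite_induct) (auto intro: sq_int_add simp: sq_int_def[of "%_. 0"])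

lemma l2_sum: "(!!i. i \<in> I ==> sq_int (f i)) ==> l2 (%x. \<Sum>i\<in>I. f i x) <= (\<Sum>i\<in>I. l2 (f i))"
proof (induction I rule: infinite_finite_induct)
 case (insert i I)
 have "l2 (%x. f i x + (\<Sum>i\<in>I. f i x)) <= l2 (f i) + l2 (%x. \<Sum>i\<in>I. f i x)"
  using insert by (intro l2_triangle sq_int_sum) auto
 then show ?case using insert by auto
qed (auto simp: l2_def)

lemma test_sq_int: "test f ==> sq_int f"
 using integrable_continuous_test[of f f]
 by (auto simp: sq_int_def power2_eq_square test_borel smooth_cont test_smooth)

subsection \<open>Integrals depending on a parameter\<close>

lemma compact_integral_eq:
 fixes f :: "'b::euclidean_space => real"
 assumes "continuous_on (cbox a b) f"
 shows "(LINT y:cbox a b|lborel. f y) = integral (cbox a b) f"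
 using borel_integrable_compact[OF compact_cbox assms]
 by (intro set_borel_integral_eq_integral) (simp add: set_integrable_def)

lemma has_derivative_parameter_integral:
 fixes f :: "'a::euclidean_space => 'b::euclidean_space => real"
 assumes d: "!!x y. y \<in> cbox a b ==> ((%x. f x y) has_derivative f' x y) (at x)"
  and c: "continuous_on (UNIV \<times> cbox a b) (%(x, y). f x y)"
  and c': "!!v. continuous_on (UNIV \<times> cbox a b) (%(x, y). f' x y v)"
 shows "((%x. LINT y:cbox a b|lborel. f x y) has_derivative (%v. LINT y:cbox a b|lborel. f' x y v)) (at x)"
proof -
 define F where "F x y = Blinfun (f' x y)" for x y
 have F: "blinfun_apply (F x y) = f' x y" if "y \<in> cbox a b" for x y
  unfolding F_def using d[OF that] has_derivative_bounded_linear bounded_linear_Blinfun_apply by blast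
 have cF: "continuous_on (UNIV \<times> cbox a b) (%(x, y). F x y)"
 proof -
  have "continuous_on (UNIV \<times> cbox a b) (%p. blinfun_apply (case p of (x, y) => F x y) i)" for i
   using c'[of i] by (rule continuous_on_eq) (auto simp: F)
  then show ?thesis unfolding continuous_on_eq_continuous_within
   by (auto intro!: continuous_blinfun_componentwiseI1)
 qed
 have sl: "continuous_on (cbox a b) (%y. g x y)" if "continuous_on (UNIV \<times> cbox a b) (%(x, y). g x y)"
  for g :: "'a => 'b => 'c::real_normed_vector" and x
  using continuous_on_compose2[OF that, of "cbox a b" "%y. (x, y)"] by (force intro: continuous_intros)
 have "((%x. integral (cbox a b) (f x)) has_derivative integral (cbox a b) (F x)) (at x within UNIV)"
 proof (rule leibniz_rule)
  show "f x integrable_on cbox a b" for x using sl[OF c] by (rule integrable_continuous)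
 qed (use d F cF in auto)
 moreover have "blinfun_apply (integral (cbox a b) (F x)) = (%v. LINT y:cbox a b|lborel. f' x y v)"
 proof
  fix v
  have "(F x) integrable_on cbox a b" using sl[OF cF] by (rule integrable_continuous)
  then have "blinfun_apply (integral (cbox a b) (F x)) v = integral (cbox a b) (%y. blinfun_apply (F x y) v)"
   using integral_linear[of "F x" "cbox a b" "%G. blinfun_apply G v"] blinfun.bounded_linear_left
   by (auto simp: o_def)
  also have "... = integral (cbox a b) (%y. f' x y v)" by (intro integral_cong) (simp add: F)
  also have "... = (LINT y:cbox a b|lborel. f' x y v)"
   using sl[OF c'[of v]] by (simp add: compact_integral_eq)
  finally show "blinfun_apply (integral (cbox a b) (F x)) v = (LINT y:cbox a b|lborel. f' x y v)" .
 qed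
 moreover have "(%x. LINT y:cbox a b|lborel. f x y) = (%x. integral (cbox a b) (f x))"
  using sl[OF c] by (simp add: compact_integral_eq)
 ultimately show ?thesis by simp
qed

section \<open>Convolution\<close>

definition conv :: "('a::euclidean_space => real) => ('a => real) => 'a => real" where
 "conv k g x = (\<L> y. k (x - y) * g y)"

lemma test_reflect_mult: "smooth k ==> test g ==> test (%y. k (x - y) * g y)"
 by (intro test_mult_left smooth_reflect)

lemma conv_has_derivative:
 assumes k: "smooth k" and g: "test g"
 shows "(conv k g has_derivative (%v. conv (dir_deriv v k) g x)) (at x)"
proof -
 obtain r where r: "!!x. r < norm x ==> g x = 0" using test_bounded_supp[OF g] by blast
 obtain a b where ab: "cball (0::'a) r \<subseteq> cbox a b"
  using bounded_subset_cbox_symmetric[OF bounded_cball] by metis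
 have eq: "conv k g x = (LINT y:cbox a b|lborel. k (x - y) * g y)" for k :: "'a => real" and x
  unfolding conv_def set_lebesgue_integral_def
 proof (rule B_integral_cong)
  fix y show "k (x - y) * g y = indicat_real (cbox a b) y *\<^sub>R (k (x - y) * g y)"
   using ab r[of y] by (cases "norm y <= r") (auto simp: subset_iff)
 qed simp
 have cont: "continuous_on (UNIV \<times> cbox a b) (%(x, y). k (x - y) * g y)" if "smooth k" for k
 proof -
  have "continuous_on (UNIV \<times> cbox a b) (%p. k (fst p - snd p))"
   by (rule continuous_on_compose2[OF smooth_cont[OF that, of UNIV]])
     (auto intro!: continuous_intros)
  moreover have "continuous_on (UNIV \<times> cbox a b) (%p::'a\<times>'a. g (snd p))"
   by (rule continuous_on_compose2[OF smooth_cont[OF test_smooth[OF g], of UNIV]])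
     (auto intro!: continuous_intros)
  ultimately show ?thesis unfolding split_beta by (rule continuous_on_mult)
 qed
 have "((%x. LINT y:cbox a b|lborel. k (x - y) * g y) has_derivative
   (%v. LINT y:cbox a b|lborel. dir_deriv v k (x - y) * g y)) (at x)"
 proof (rule has_derivative_parameter_integral[OF _ cont[OF k] cont[OF smooth_dir_deriv[OF k]]])
  fix x y :: 'a
  have "((%x. x - y) has_derivative (%v. v)) (at x)" by (auto intro!: derivative_eq_intros)
  from has_derivative_compose[OF this smooth_has_derivative[OF k]]
  show "((%x. k (x - y) * g y) has_derivative (%v. dir_deriv v k (x - y) * g y)) (at x)"
   by (rule has_derivative_mult_left)
 qed
 then show ?thesis unfolding eq[symmetric] by (simp add: eq[abs_def])
qed

lemma smooth_conv:
 assumes g: "test g" and k: "smooth k" shows "smooth (conv k g)"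
proof -
 have "C_k_on n UNIV (conv k g)" if "smooth k" for n k using that
 proof (induction n arbitrary: k)
  case 0
  then show ?case using conv_has_derivative[OF _ g] has_derivative_continuous
   by (fastforce simp: continuous_on_eq_continuous_at)
 next
  case (Suc n)
  then have "\<forall>x\<in>UNIV. (conv k g has_derivative (%v. conv (dir_deriv v k) g x)) (at x within UNIV)"
   using conv_has_derivative[OF _ g] by simp
  moreover have "\<forall>v. C_k_on n UNIV (%x. conv (dir_deriv v k) g x)"
   using Suc.IH[OF smooth_dir_deriv[OF Suc.prems]] by blast
  ultimately show ?case unfolding C_k_on.simps
   by (intro exI[of _ "%x v. conv (dir_deriv v k) g x"] conjI)
 qed
 then show ?thesis using k by (simp add: smooth_on_def)
qed

lemma dir_deriv_conv:
 assumes "smooth k" "test g" shows "dir_deriv v (conv k g) = conv (dir_deriv v k) g"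
 by (rule ext, rule dir_deriv_eq[OF conv_has_derivative[OF assms]])

lemma conv_commute: assumes "smooth k" "test g" shows "conv k g = conv g k"
proof
 fix x
 have "meas ((%y. k (x - y) * g y))"
  by (intro test_borel test_reflect_mult assms)
 from lborel_reflect[OF this, of x] show "conv k g x = conv g k x"
  by (simp add: conv_def mult.commute)
qed

lemma test_conv: assumes "test k" "test g" shows "test (conv k g)"
proof -
 obtain r where r: "!!x. r < norm x ==> k x = 0" using test_bounded_supp[OF assms(1)] by blast
 obtain s where s: "!!x. s < norm x ==> g x = 0" using test_bounded_supp[OF assms(2)] by blast
 show ?thesis
 proof (rule testI[of _ "r + s"])
  show "smooth (conv k g)" using smooth_conv assms test_smooth by blast
  fix x assume x: "conv k g x \<noteq> 0"
  show "norm x <= r + s"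
  proof (rule ccontr)
   assume n: "\<not> norm x <= r + s"
   have "k (x - y) * g y = 0" for y
   proof (cases "s < norm y")
    case False
    then have "r < norm (x - y)" using n norm_triangle_sub[of x y] by linarith
    then show ?thesis using r by simp
   qed (use s in simp)
   then have "(%y. k (x - y) * g y) = (%_. 0)" by blast
   then show False using x by (simp add: conv_def)
  qed
 qed
qed

lemma dir_deriv_conv_right:
 assumes "test k" "test g" shows "dir_deriv v (conv k g) = conv k (dir_deriv v g)"
 using dir_deriv_conv[of g k v] assms conv_commute[of k g] conv_commute[of k "dir_deriv v g"]
 by (simp add: test_smooth test_dir_deriv)

lemma conv_integrable: "smooth k ==> test g ==> integrable lborel (%y. k (x - y) * g y)"
 by (intro test_integrable test_reflect_mult)

lemma conv_add: assumes "smooth k" "test g" "test h"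
 shows "conv k (%x. g x + h x) = (%x. conv k g x + conv k h x)"
 using conv_integrable[OF assms(1,2)] conv_integrable[OF assms(1,3)]
 by (auto simp: conv_def algebra_simps)

lemma conv_diff: assumes "smooth k" "test g" "test h"
 shows "conv k (%x. g x - h x) = (%x. conv k g x - conv k h x)"
 using conv_integrable[OF assms(1,2)] conv_integrable[OF assms(1,3)]
 by (auto simp: conv_def algebra_simps)

lemma conv_minus: "conv k (%x. - g x) = (%x. - conv k g x)"
 by (auto simp: conv_def)

lemma conv_sum: assumes "smooth k" "!!i. i \<in> I ==> test (g i)"
 shows "conv k (%x. \<Sum>i\<in>I. g i x) = (%x. \<Sum>i\<in>I. conv k (g i) x)"
 using assms(2)
proof (induction I rule: infinite_finite_induct)
 case (insert i I)
 then show ?case using conv_add[OF assms(1), of "g i" "%x. \<Sum>i\<in>I. g i x"] by (simp add: test_sum)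
qed (auto simp: conv_def)

lemma conv_bound:
 assumes "test k" "test g" "!!x. \<bar>g x\<bar> <= B"
 shows "\<bar>conv k g x\<bar> <= (\<L> y. \<bar>k y\<bar>) * B"
proof -
 have i: "integrable lborel (%y. \<bar>k (x - y)\<bar>)"
  using test_integrable[OF test_reflect[OF assms(1)]] by (rule integrable_abs)
 have "\<bar>conv k g x\<bar> <= (\<L> y. \<bar>k (x - y) * g y\<bar>)" unfolding conv_def
  by (rule integral_abs_bound)
 also have "... <= (\<L> y. \<bar>k (x - y)\<bar> * B)"
  using i integrable_abs[OF conv_integrable[OF test_smooth[OF assms(1)] assms(2), of x]]
  by (intro integral_mono) (auto simp: abs_mult intro!: mult_left_mono assms(3))
 also have "... = (\<L> y. \<bar>k y\<bar>) * B"
  using lborel_reflect[of "%y. \<bar>k y\<bar>" x] test_borel[OF assms(1)] by simp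
 finally show ?thesis .
qed

lemma Fubini_test_product:
 fixes k :: "'a::euclidean_space => real"
 assumes "continuous_on UNIV k" "continuous_on UNIV f" "continuous_on UNIV g"
  "!!x. r < norm x ==> f x = 0" "!!x. r < norm x ==> g x = 0"
 shows "(\<L> x. \<L> y. k (x - y) * f x * g y) = (\<L> y. \<L> x. k (x - y) * f x * g y)"
  and "integrable lborel (%x. \<L> y. k (x - y) * f x * g y)"
proof -
 define F where "F = (%p::'a\<times>'a. k (fst p - snd p) * f (fst p) * g (snd p))"
 have "continuous_on UNIV F" unfolding F_def
  by (intro continuous_on_mult continuous_on_compose2[OF assms(1)] continuous_on_compose2[OF assms(2)]
    continuous_on_compose2[OF assms(3)]) (auto intro!: continuous_intros)
 moreover have "F p = 0" if "r + r < norm p" for p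
 proof -
  have "norm p <= norm (fst p) + norm (snd p)" using norm_Pair_le[of "fst p" "snd p"] by simp
  then have "r < norm (fst p) \<or> r < norm (snd p)" using that by linarith
  then show ?thesis unfolding F_def using assms(4,5) by auto
 qed
 ultimately have "integrable lborel F" by (rule continuous_compact_integrable)
 then have i: "integrable (lborel \<Otimes>\<^sub>M lborel) (%(x, y). k (x - y) * f x * g y)"
  unfolding F_def lborel_prod split_beta .
 from lborel_pair.Fubini_integral[OF this]
 show "(\<L> x. \<L> y. k (x - y) * f x * g y) = (\<L> y. \<L> x. k (x - y) * f x * g y)"
  by simp
 show "integrable lborel (%x. \<L> y. k (x - y) * f x * g y)"
  using lborel_pair.integrable_fst'[OF i] by simp
qed

text \<open>For an even kernel, convolution is a symmetric operator; this is Fubini.\<close>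

lemma conv_symmetric:
 assumes k: "smooth k" "!!x. k (- x) = k x" and g: "test g" and h: "test h"
 shows "(\<L> x. h x * conv k g x) = (\<L> x. g x * conv k h x)"
proof -
 obtain r where r: "!!x. r < norm x ==> h x = 0" using test_bounded_supp[OF h] by blast
 obtain s where s: "!!x. s < norm x ==> g x = 0" using test_bounded_supp[OF g] by blast
 have k': "k (x - y) = k (y - x)" for x y using k(2)[of "x - y"] by simp
 have "(\<L> x. h x * conv k g x) = (\<L> x. \<L> y. k (x - y) * h x * g y)"
  unfolding conv_def integral_mult_right_zero[symmetric] by (simp add: algebra_simps)
 also have "... = (\<L> y. \<L> x. k (x - y) * h x * g y)"
  by (rule Fubini_test_product[where r = "max r s"]) (use r s k g h in \<open>auto intro!: smooth_cont test_smooth\<close>)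
 also have "... = (\<L> y. g y * conv k h y)"
  unfolding conv_def integral_mult_right_zero[symmetric]
  by (subst k') (simp add: algebra_simps)
 finally show ?thesis .
qed

text \<open>Young's inequality: apply Cauchy-Schwarz with the weight \<open>\<bar>k\<bar>\<close> and integrate.\<close>

lemma l2_conv:
 assumes k: "test k" and g: "test g"
 shows "l2 (conv k g) <= (\<L> y. \<bar>k y\<bar>) * l2 g"
proof -
 define K where "K = (\<L> y. \<bar>k y\<bar>)"
 have K: "0 <= K" by (simp add: K_def)
 have ck: "continuous_on UNIV k" "continuous_on UNIV g"
  using k g smooth_cont test_smooth by blast+
 have [measurable]: "meas k" "meas g" using k g test_borel by blast+
 obtain r where r: "!!x. r < norm x ==> g x = 0" using test_bounded_supp[OF g] by blast
 obtain s where s: "!!x. s < norm x ==> k x = 0" using test_bounded_supp[OF k] by blast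
 have cg: "continuous_on UNIV (%y. (g y)^2)" "continuous_on UNIV (%y. \<bar>k y\<bar>)" using ck by (auto intro: continuous_intros)
 have pt: "(conv k g x)^2 <= K * (\<L> y. \<bar>k (x - y)\<bar> * (g y)^2)" for x
 proof -
  have i1: "integrable lborel (%y. \<bar>k (x - y)\<bar>)"
   using test_integrable[OF test_reflect[OF k]] by (rule integrable_abs)
  have "continuous_on UNIV (%y. \<bar>k (x - y)\<bar>)"
   by (rule continuous_on_compose2[OF cg(2) continuous_on_diff[OF continuous_on_const continuous_on_id]]) auto
  then have i2: "integrable lborel (%y. \<bar>k (x - y)\<bar> * (g y)^2)"
   using r cg by (intro continuous_compact_integrable[of _ r] continuous_on_mult) auto
  define f1 where "f1 y = sqrt \<bar>k (x - y)\<bar>" for y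
  define f2 where "f2 y = sqrt \<bar>k (x - y)\<bar> * \<bar>g y\<bar>" for y
  have s1: "sq_int f1" unfolding sq_int_def f1_def using i1 by simp
  have s2: "sq_int f2" unfolding sq_int_def f2_def using i2 by (simp add: power_mult_distrib)
  have "\<bar>conv k g x\<bar> <= (\<L> y. \<bar>k (x - y) * g y\<bar>)" unfolding conv_def by (rule integral_abs_bound)
  also have "... = (\<L> y. f1 y * f2 y)"
  proof (rule B_integral_cong)
   show "\<bar>k (x - y) * g y\<bar> = f1 y * f2 y" for y
    using real_sqrt_mult_self[of "k (x - y)"] unfolding f1_def f2_def abs_mult mult.assoc[symmetric]
    by (simp add: real_sqrt_abs2 flip: real_sqrt_mult)
  qed simp
  also have "... <= l2 f1 * l2 f2" using l2_Cauchy_Schwarz[OF s1 s2] by linarith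
  finally have "\<bar>conv k g x\<bar>^2 <= (l2 f1 * l2 f2)^2" by (rule power_mono) simp
  also have "... = (\<L> y. \<bar>k (x - y)\<bar>) * (\<L> y. \<bar>k (x - y)\<bar> * (g y)^2)"
   unfolding power_mult_distrib l2_power2 by (simp add: f1_def f2_def power_mult_distrib)
  also have "(\<L> y. \<bar>k (x - y)\<bar>) = K"
   unfolding K_def using lborel_reflect[of "%y. \<bar>k y\<bar>" x] by simp
  finally show ?thesis by simp
 qed
 define f where "f x = (indicator (cball 0 (r + s)) x :: real)" for x :: 'a
 \<comment> \<open>The cut-off \<open>w\<close> equals one wherever the double integrand lives, so Fubini applies to compactly supported data.\<close>
 define w where "w x = max 0 (min 1 (\<bar>r\<bar> + \<bar>s\<bar> + 1 - norm x))" for x :: 'a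
 have w: "continuous_on UNIV w" "!!x. \<bar>r\<bar> + \<bar>s\<bar> + 1 < norm x ==> w x = 0" "!!x. norm x <= \<bar>r\<bar> + \<bar>s\<bar> ==> w x = 1"
  unfolding w_def by (auto intro!: continuous_intros)
 have wk: "\<bar>k (x - y)\<bar> * w x * (g y)^2 = \<bar>k (x - y)\<bar> * (g y)^2" for x y
 proof (cases "norm y <= r \<and> norm (x - y) <= s")
  case True
  then have "norm x <= \<bar>r\<bar> + \<bar>s\<bar>" using norm_triangle_sub[of x y] by linarith
  then show ?thesis using w(3) by simp
 next
  case False
  then have "g y = 0 \<or> k (x - y) = 0" using r s by (auto simp: not_le)
  then show ?thesis by auto
 qed
 have fu: "(\<L> x. \<L> y. \<bar>k (x - y)\<bar> * (g y)^2) = (\<L> y. \<L> x. \<bar>k (x - y)\<bar> * (g y)^2)"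
  and fi: "integrable lborel (%x. \<L> y. \<bar>k (x - y)\<bar> * (g y)^2)"
 proof -
  have z: "(g x)^2 = 0" if "\<bar>r\<bar> + \<bar>s\<bar> + 1 < norm x" for x
   using that r[of x] by simp
  show "(\<L> x. \<L> y. \<bar>k (x - y)\<bar> * (g y)^2) = (\<L> y. \<L> x. \<bar>k (x - y)\<bar> * (g y)^2)"
   "integrable lborel (%x. \<L> y. \<bar>k (x - y)\<bar> * (g y)^2)"
   using Fubini_test_product[OF cg(2) w(1) cg(1) w(2) z] unfolding wk by auto
 qed
 have sh: "(\<L> x. \<bar>k (x - y)\<bar>) = K" for y
  unfolding K_def using lborel_shift[of "%x. \<bar>k x\<bar>" "- y"] by simp
 have "(l2 (conv k g))^2 <= (\<L> x. K * (\<L> y. \<bar>k (x - y)\<bar> * (g y)^2))"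
  unfolding l2_power2 using test_sq_int[OF test_conv[OF k g]] pt fi
  by (intro integral_mono) (auto simp: sq_int_def)
 also have "... = K * (\<L> y. \<L> x. \<bar>k (x - y)\<bar> * (g y)^2)" using fu by simp
 also have "... = (K * l2 g)^2" by (simp add: sh power_mult_distrib l2_power2 power2_eq_square[of K])
 finally show ?thesis unfolding K_def[symmetric] by (rule power2_le_imp_le) (simp add: K)
qed

text \<open>The other form of Young's inequality, for kernels of small \<open>L\<^sup>2\<close> norm such as very wide mollifiers.\<close>

lemma l2_conv': 
 assumes "test k" "test g" shows "l2 (conv k g) <= l2 k * (\<L> y. \<bar>g y\<bar>)"
 using l2_conv[OF assms(2,1)] conv_commute[OF test_smooth[OF assms(1)] assms(2)]
 by (simp add: mult.commute)

section \<open>Mollifiers and a truncated Newtonian potential\<close>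

abbreviation pd :: "3 => (real^3 => real) => real^3 => real" where
 "pd i \<equiv> dir_deriv (axis i 1)"

lemma dir_deriv_expand:
 assumes "smooth (f :: real^3 => real)" shows "dir_deriv v f x = (\<S> i. v $ i * pd i f x)"
proof -
 have lin: "linear (%v. dir_deriv v f x)" by (rule dir_deriv_linear[OF assms])
 have "v = (\<S> i. (v $ i) *\<^sub>R axis i 1)" by (simp add: vec_eq_iff axis_def if_distrib cong: if_cong)
 then have "dir_deriv v f x = dir_deriv (\<S> i. (v $ i) *\<^sub>R axis i 1) f x" by simp
 also have "... = (\<S> i. v $ i * pd i f x)"
  using linear_sum[OF lin, of "%i. (v $ i) *\<^sub>R axis i 1" UNIV] linear_scale[OF lin] by simp
 finally show ?thesis .
qed

lemma smooth_component: "smooth (%x::real^3. x $ i)"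
 by (rule smooth_linear) (rule bounded_linear_vec_nth)

lemma pd_component: "pd j (%x::real^3. x $ i) x = (if i = j then 1 else 0)"
proof (rule dir_deriv_eq[where f' = "%v. v $ i", THEN trans])
 show "((%x. x $ i) has_derivative (%v. v $ i)) (at x)"
  by (rule bounded_linear_imp_has_derivative) (rule bounded_linear_vec_nth)
qed (auto simp: axis_def)

definition bump_mass :: real where
 "bump_mass = (\<L> x::real^3. 2 * bump' (1 - x \<bullet> x))"

text \<open>\<open>rho\<close> is a probability density on the unit ball and \<open>tau\<close> its radial primitive: \<open>\<nabla>tau x = - rho x x\<close>.  Hence
 \<open>s^2 \<Delta>tau(s x)\<close> is the derivative of \<open>- s^3 rho(s x)\<close> in \<open>s\<close>, which makes \<open>laplacian_newton\<close> a case of the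
 fundamental theorem of calculus.\<close>

definition tau :: "real^3 => real" where "tau x = bump (1 - x \<bullet> x) / bump_mass"

definition rho :: "real^3 => real" where "rho x = 2 * bump' (1 - x \<bullet> x) / bump_mass"

lemma smooth_one_minus_sq: "smooth (%x::'a::euclidean_space. 1 - x \<bullet> x)"
 by (intro smooth_diff smooth_inner_self) simp

lemma sq_gt_1: "1 < norm x ==> 1 < x \<bullet> x"
 by (metis one_less_power power2_norm_eq_inner zero_less_numeral)

lemma test_unnormalised: "test (%x::'a::euclidean_space. 2 * bump' (1 - x \<bullet> x))"
proof (rule testI[of _ 1])
 show "smooth (%x::'a. 2 * bump' (1 - x \<bullet> x))"
  by (intro smooth_mult smooth_const smooth_compose[OF smooth_bump'] smooth_one_minus_sq)
 show "norm x <= 1" if "2 * bump' (1 - x \<bullet> x) \<noteq> 0" for x :: 'a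
  using that sq_gt_1[of x] by (force simp: bump'_def split: if_splits)
qed

lemma test_bump_ball: "test (%x::'a::euclidean_space. bump (1 - x \<bullet> x))"
proof (rule testI[of _ 1])
 show "smooth (%x::'a. bump (1 - x \<bullet> x))"
  by (intro smooth_compose[OF smooth_bump] smooth_one_minus_sq)
 show "norm x <= 1" if "bump (1 - x \<bullet> x) \<noteq> 0" for x :: 'a
  using that sq_gt_1[of x] by (force simp: bump_def split: if_splits)
qed

lemma bump'_nonneg: "0 <= bump' x" by (simp add: bump'_def)

lemma continuous_nonneg_integral_pos:
 fixes f :: "'a::euclidean_space => real"
 assumes "continuous_on UNIV f" "!!x. 0 <= f x" "integrable lborel f" "f a > 0"
 shows "(\<L> x. f x) > 0"
proof (rule ccontr)
 assume "\<not> ?thesis"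
 then have "(\<L> x. f x) = 0" using B_integral_nonneg[of lborel f] assms(2) by fastforce
 then have "AE x in lborel. f x = 0" using integral_nonneg_eq_0_iff_AE[OF assms(3)] assms(2) by simp
 then have n: "{x. f x \<noteq> 0} \<in> null_sets lborel"
  using assms(3) by (subst (asm) AE_iff_null) (auto simp: borel_measurable_integrable)
 have o: "open {x. f x \<noteq> 0}" by (intro open_Collect_neq assms(1) continuous_on_const)
 obtain e where "e > 0" "ball a e \<subseteq> {x. f x \<noteq> 0}" using openE[OF o, of a] assms(4) by auto
 then have "emeasure lborel (ball a e) = 0"
  using n null_sets_subset by (metis null_setsD1 sets_lborel borel_open open_ball)
 then show False using emeasure_ball[of e a] \<open>e > 0\<close> unit_ball_vol_pos[of "DIM('a)"]
  by (auto simp: ennreal_eq_0_iff mult_le_0_iff zero_less_power not_less[symmetric])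
qed

lemma bump_mass_pos: "bump_mass > 0"
 unfolding bump_mass_def
proof (rule continuous_nonneg_integral_pos[where a = 0])
 show "integrable lborel (%x::real^3. 2 * bump' (1 - x \<bullet> x))" by (rule test_integrable[OF test_unnormalised])
qed (auto intro: smooth_cont test_smooth test_unnormalised simp: bump'_nonneg, simp add: bump'_def)

lemma test_rho: "test rho"
 using test_mult_left[OF smooth_const test_unnormalised, of "1 / bump_mass"] by (simp add: rho_def[abs_def])

lemma test_tau: "test tau"
 using test_mult_left[OF smooth_const test_bump_ball, of "1 / bump_mass"] by (simp add: tau_def[abs_def])

lemma rho_nonneg: "0 <= rho x"
 using bump_mass_pos by (simp add: rho_def bump'_nonneg)

lemma integral_rho: "(\<L> x. rho x) = 1"
 using bump_mass_pos by (simp only: rho_def integral_divide_zero bump_mass_def[symmetric]) simp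

lemma rho_outside: "1 < norm x ==> rho x = 0"
 using sq_gt_1[of x] by (simp add: rho_def bump'_def)

lemma pd_tau: "pd i tau x = - (x $ i) * rho x"
proof -
 have 1: "smooth (%x::real^3. bump (1 - x \<bullet> x))" by (simp add: test_bump_ball test_smooth)
 have "pd i tau x = pd i (%x. (1 / bump_mass) * bump (1 - x \<bullet> x)) x" by (simp add: tau_def[abs_def])
 also have "... = (1 / bump_mass) * pd i (%x. bump (1 - x \<bullet> x)) x" by (simp only: dir_deriv_cmult[OF 1])
 also have "... = (1 / bump_mass) * (bump' (1 - x \<bullet> x) * - (2 * (x $ i)))"
  using smooth_one_minus_sq
  by (simp add: dir_deriv_compose[OF smooth_bump smooth_one_minus_sq] dir_deriv_bump
    dir_deriv_diff[OF smooth_const smooth_inner_self] dir_deriv_inner_self inner_axis)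
 finally show ?thesis by (simp add: rho_def)
qed

lemma laplacian_tau: "(\<S> i. pd i (pd i tau) y) = - (3 * rho y + (\<S> i. (y $ i) * pd i rho y))"
proof -
 have "pd i (pd i tau) y = - (rho y + y $ i * pd i rho y)" for i
 proof -
  have "pd i tau = (%x. - (x $ i * rho x))" by (auto simp: pd_tau)
  then show ?thesis
   using smooth_mult[OF smooth_component test_smooth[OF test_rho], of i]
   by (simp add: dir_deriv_minus dir_deriv_mult smooth_component test_smooth test_rho pd_component)
 qed
 then show ?thesis by (simp add: sum.distrib sum_negf sum_subtractf)
qed

definition mol :: "real => real^3 => real" where "mol r x = rho ((1 / r) *\<^sub>R x) / r ^ 3"

lemma lborel_scale3:
 fixes f :: "real^3 => real"
 assumes "meas f" "c > 0"
 shows "(\<L> x. f (c *\<^sub>R x)) = (\<L> x. f x) / c ^ 3"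
 using lborel_scale[OF assms(1), of c 0] assms(2) by simp

lemma test_mol: "r > 0 ==> test (mol r)"
 using test_mult_left[OF smooth_const test_scale[OF test_rho], of "1 / r" "1 / r ^ 3"]
 by (simp add: mol_def[abs_def])

lemma mol_nonneg: "r > 0 ==> 0 <= mol r x" by (simp add: mol_def rho_nonneg)

lemma mol_outside: "r > 0 ==> r < norm x ==> mol r x = 0"
 by (simp add: mol_def rho_outside)

lemma integral_mol: "r > 0 ==> (\<L> x. mol r x) = 1"
 using lborel_scale3[OF test_borel[OF test_rho], of "1 / r"]
 by (simp add: mol_def integral_rho power_divide)

lemma integral_abs_mol: "r > 0 ==> (\<L> x. \<bar>mol r x\<bar>) = 1"
 using integral_mol[of r] by (simp add: mol_nonneg)

lemma integral_abs_pd_mol: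
 assumes r: "r > 0" shows "(\<L> x. \<bar>pd i (mol r) x\<bar>) = (\<L> x. \<bar>pd i rho x\<bar>) / r"
proof -
 have "mol r = (%x. (1 / r ^ 3) * rho ((1 / r) *\<^sub>R x))" by (auto simp: mol_def)
 then have "pd i (mol r) = (%x. (1 / r ^ 3) * ((1 / r) * pd i rho ((1 / r) *\<^sub>R x)))"
  by (simp only: dir_deriv_cmult[OF smooth_scale[OF test_smooth[OF test_rho]]]
    dir_deriv_scale[OF test_smooth[OF test_rho]])
 moreover have "(\<L> x. \<bar>pd i rho ((1 / r) *\<^sub>R x)\<bar>) = (\<L> x. \<bar>pd i rho x\<bar>) / (1 / r) ^ 3"
  by (rule lborel_scale3) (use test_borel[OF test_dir_deriv[OF test_rho]] r in auto)
 ultimately show ?thesis using r by (simp add: abs_mult power_divide field_simps power2_eq_square)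
qed

lemma l2_mol: assumes r: "r > 0" shows "(l2 (mol r))^2 = (l2 rho)^2 / r ^ 3"
proof -
 have "(\<L> x. (rho ((1 / r) *\<^sub>R x))^2) = (\<L> x. (rho x)^2) / (1 / r) ^ 3"
  by (rule lborel_scale3[of "%x. (rho x)^2"]) (use test_borel[OF test_rho] r in auto)
 moreover have "(l2 (mol r))^2 = (\<L> x. (rho ((1 / r) *\<^sub>R x))^2) / (r ^ 3)^2"
  unfolding l2_power2 mol_def power_divide integral_divide_zero ..
 moreover have "(r ^ 3)^2 = r ^ 3 * r ^ 3" by (rule power2_eq_square)
 ultimately show ?thesis using r unfolding l2_power2 by (simp only: power_divide) (simp add: field_simps)
qed

text \<open>\<open>superpose a b k g\<close> is a superposition of dilates of \<open>g\<close>.  For \<open>g = tau\<close> and \<open>k = 0\<close> it is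
 the kernel of an approximate inverse of minus the Laplacian, see below.\<close>

definition superpose :: "real => real => nat => (real^3 => real) => real^3 => real" where
 "superpose a b k g x = (LINT s:{a..b}|lborel. s ^ k * g (s *\<^sub>R x))"

lemma continuous_superpose:
 assumes "continuous_on UNIV g"
 shows "continuous_on S (%(x::real^3, s). s ^ k * g (s *\<^sub>R x))"
 unfolding split_beta
 by (intro continuous_on_mult continuous_on_compose2[OF assms] continuous_intros) auto

lemma superpose_has_derivative:
 assumes g: "smooth g"
 shows "(superpose a b k g has_derivative (%v. superpose a b (Suc k) (dir_deriv v g) x)) (at x)"
proof -
 have "((%x. LINT s:cbox a b|lborel. s ^ k * g (s *\<^sub>R x)) has_derivative
   (%v. LINT s:cbox a b|lborel. s ^ Suc k * dir_deriv v g (s *\<^sub>R x))) (at x)"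
 proof (rule has_derivative_parameter_integral)
  fix x s
  have "((%x. g (s *\<^sub>R x)) has_derivative (%v. s * dir_deriv v g (s *\<^sub>R x))) (at x)"
   using smooth_has_derivative[OF smooth_scale[OF g], of s x] by (simp add: dir_deriv_scale[OF g])
  from has_derivative_mult_right[OF this, of "s ^ k"]
  show "((%x. s ^ k * g (s *\<^sub>R x)) has_derivative (%v. s ^ Suc k * dir_deriv v g (s *\<^sub>R x))) (at x)"
   by (simp add: algebra_simps)
 qed (intro continuous_superpose smooth_cont smooth_dir_deriv g)+
 then show ?thesis by (simp add: superpose_def[abs_def])
qed

lemma dir_deriv_superpose: "smooth g ==> dir_deriv v (superpose a b k g) = superpose a b (Suc k) (dir_deriv v g)"
 by (rule ext, rule dir_deriv_eq[OF superpose_has_derivative])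

lemma smooth_superpose:
 assumes "smooth g" shows "smooth (superpose a b k g)"
proof -
 have "C_k_on n UNIV (superpose a b k g)" if "smooth g" for n k g using that
 proof (induction n arbitrary: k g)
  case 0
  then show ?case using superpose_has_derivative has_derivative_continuous
   by (fastforce simp: continuous_on_eq_continuous_at)
 next
  case (Suc n)
  then have "\<forall>x\<in>UNIV. (superpose a b k g has_derivative (%v. superpose a b (Suc k) (dir_deriv v g) x)) (at x within UNIV)"
   using superpose_has_derivative by simp
  moreover have "\<forall>v. C_k_on n UNIV (%x. superpose a b (Suc k) (dir_deriv v g) x)"
   using Suc.IH[OF smooth_dir_deriv[OF Suc.prems]] by blast
  ultimately show ?case unfolding C_k_on.simps
   by (intro exI[of _ "%x v. superpose a b (Suc k) (dir_deriv v g) x"] conjI)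
 qed
 then show ?thesis using assms by (simp add: smooth_on_def)
qed

lemma superpose_outside:
 assumes "!!x. r < norm x ==> g x = 0" "0 < a" "r / a < norm x"
 shows "superpose a b k g x = 0"
proof -
 have "indicat_real {a..b} s *\<^sub>R (s ^ k * g (s *\<^sub>R x)) = 0" for s
 proof (cases "s \<in> {a..b}")
  case True
  then have "a * norm x <= norm (s *\<^sub>R x)" using assms(2) by (simp add: mult_right_mono)
  moreover have "r < a * norm x" using assms(2,3) by (simp add: field_simps)
  ultimately show ?thesis using assms(1) by simp
 qed simp
 then have "(%s. indicat_real {a..b} s *\<^sub>R (s ^ k * g (s *\<^sub>R x))) = (%_. 0)" by blast
 then show ?thesis unfolding superpose_def set_lebesgue_integral_def by (simp only: integral_zero)
qed

lemma test_superpose: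
 assumes "test g" "0 < a" shows "test (superpose a b k g)"
proof -
 obtain r where "!!x. r < norm x ==> g x = 0" using test_bounded_supp[OF assms(1)] by blast
 then have "superpose a b k g x \<noteq> 0 ==> norm x <= r / a" for x
  using superpose_outside[of r g a x] assms(2) by force
 then show ?thesis using assms testI smooth_superpose test_smooth by metis
qed

lemma superpose_L1:
 assumes g: "test g" and a: "0 < a"
 shows "(\<L> x. \<bar>superpose a b k g x\<bar>) <= (LINT s:{a..b}|lborel. s ^ k / s ^ 3) * (\<L> x. \<bar>g x\<bar>)"
proof -
 obtain r where r: "!!x. r < norm x ==> g x = 0" using test_bounded_supp[OF g] by blast
 define H where "H = (%p::(real^3)\<times>real. indicat_real (cball 0 (r / a) \<times> {a..b}) p *\<^sub>R (snd p ^ k * \<bar>g (snd p *\<^sub>R fst p)\<bar>))"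
 have H: "H (x, s) = indicat_real {a..b} s * (s ^ k * \<bar>g (s *\<^sub>R x)\<bar>)" for x s
 proof (cases "s \<in> {a..b} \<and> r / a < norm x")
  case True
  then have "a * norm x <= norm (s *\<^sub>R x)" using a by (simp add: mult_right_mono)
  moreover have "r < a * norm x" using True a by (simp add: field_simps)
  ultimately show ?thesis using r unfolding H_def by simp
 next
  case False
  then show ?thesis unfolding H_def by (auto simp: indicator_def)
 qed
 have "continuous_on UNIV (%y. \<bar>g y\<bar>)"
  by (intro continuous_intros smooth_cont test_smooth g)
 from continuous_superpose[OF this] have "integrable lborel H" unfolding H_def
  by (intro borel_integrable_compact compact_Times) (auto simp: split_beta)
 then have i: "integrable (lborel \<Otimes>\<^sub>M lborel) (%(x, s). H (x, s))" by (simp add: lborel_prod)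
 have "(\<L> x. \<bar>superpose a b k g x\<bar>) <= (\<L> x. \<L> s. H (x, s))"
 proof (rule integral_mono)
  show "integrable lborel (%x. \<bar>superpose a b k g x\<bar>)"
   using test_integrable[OF test_superpose[OF g a]] by (rule integrable_abs)
  show "integrable lborel (%x. \<L> s. H (x, s))" using lborel_pair.integrable_fst'[OF i] by simp
  show "\<bar>superpose a b k g x\<bar> <= (\<L> s. H (x, s))" for x
  proof -
   have "\<bar>superpose a b k g x\<bar> <= (\<L> s. \<bar>indicat_real {a..b} s *\<^sub>R (s ^ k * g (s *\<^sub>R x))\<bar>)"
    unfolding superpose_def set_lebesgue_integral_def by (rule integral_abs_bound)
   also have "... = (\<L> s. H (x, s))"
    by (rule B_integral_cong) (use a in \<open>auto simp: H indicator_def abs_mult\<close>)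
   finally show ?thesis .
  qed
 qed
 also have "... = (\<L> s. \<L> x. H (x, s))"
  using lborel_pair.Fubini_integral[of "%x s. H (x, s)"] i by simp
 also have "... = (\<L> s. indicat_real {a..b} s *\<^sub>R (s ^ k / s ^ 3) * (\<L> x. \<bar>g x\<bar>))"
 proof (rule B_integral_cong)
  fix s
  show "(\<L> x. H (x, s)) = indicat_real {a..b} s *\<^sub>R (s ^ k / s ^ 3) * (\<L> x. \<bar>g x\<bar>)"
  proof (cases "s \<in> {a..b}")
   case True
   then show ?thesis using a lborel_scale3[of "%x. \<bar>g x\<bar>" s] test_borel[OF g] by (simp add: H)
  qed (simp add: H)
 qed simp
 also have "... = (LINT s:{a..b}|lborel. s ^ k / s ^ 3) * (\<L> x. \<bar>g x\<bar>)"
  unfolding set_lebesgue_integral_def by (rule integral_mult_left_zero)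
 finally show ?thesis .
qed

lemma FTC_lborel:
 fixes F f :: "real => real"
 assumes "a <= b" "!!s. a <= s ==> s <= b ==> (F has_real_derivative f s) (at s)" "continuous_on {a..b} f"
 shows "(LINT s:{a..b}|lborel. f s) = F b - F a"
 unfolding set_lebesgue_integral_def using assms
 by (intro integral_FTC_Icc) (auto intro: has_field_derivative_at_within simp: has_real_derivative_iff_has_vector_derivative[symmetric])

text \<open>Integrating the dilates of \<open>tau\<close> over all scales would give a multiple of \<open>1 / norm x\<close>.  Restricted to
 scales between \<open>\<epsilon>\<close> and \<open>R\<close> it is a test function whose Laplacian is a difference of two mollifiers.\<close>

definition newton :: "real => real => real^3 => real" where
 "newton \<epsilon> R = superpose (1 / R) (1 / \<epsilon>) 0 tau"

definition newton_const :: real where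
 "newton_const = (\<L> x. \<bar>tau x\<bar>) + (\<S> i. \<L> x. \<bar>pd i tau x\<bar>)"

lemma newton_const_nonneg: "0 <= newton_const"
 unfolding newton_const_def by (intro add_nonneg_nonneg sum_nonneg integral_nonneg_AE) auto

lemma test_newton: "R > 0 ==> test (newton \<epsilon> R)"
 unfolding newton_def by (intro test_superpose test_tau) auto

lemma newton_even: "newton \<epsilon> R (- x) = newton \<epsilon> R x"
 by (simp add: newton_def superpose_def tau_def)

lemma newton_L1:
 assumes "0 < \<epsilon>" "\<epsilon> < R" shows "(\<L> x. \<bar>newton \<epsilon> R x\<bar>) <= newton_const * R^2"
proof -
 have ab: "1 / R <= 1 / \<epsilon>" "0 < 1 / R" using assms by (auto simp: field_simps)
 have "(LINT s:{1/R..1/\<epsilon>}|lborel. s ^ 0 / s ^ 3) = - 1 / (2 * (1/\<epsilon>)^2) - - 1 / (2 * (1/R)^2)"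
 proof (rule FTC_lborel[where F = "%s. - 1 / (2 * s^2)"])
  fix s assume "1 / R <= s"
  then have "s > 0" using ab by linarith
  then show "((%s. - 1 / (2 * s^2)) has_real_derivative s ^ 0 / s ^ 3) (at s)"
   by (auto intro!: derivative_eq_intros simp: field_simps power2_eq_square power3_eq_cube)
 next
  show "continuous_on {1/R..1/\<epsilon>} (%s. s ^ 0 / s ^ 3)"
   using ab by (intro continuous_intros) auto
 qed fact
 also have "... = R^2 / 2 - \<epsilon>^2 / 2" using assms by (simp add: power_divide)
 also have "... <= R^2" using zero_le_power2[of R] zero_le_power2[of \<epsilon>] by linarith
 finally have "(LINT s:{1/R..1/\<epsilon>}|lborel. s ^ 0 / s ^ 3) <= R^2" .
 moreover have "(\<L> x. \<bar>newton \<epsilon> R x\<bar>) <= (LINT s:{1/R..1/\<epsilon>}|lborel. s ^ 0 / s ^ 3) * (\<L> x. \<bar>tau x\<bar>)"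
  unfolding newton_def using ab by (intro superpose_L1 test_tau)
 ultimately have "(\<L> x. \<bar>newton \<epsilon> R x\<bar>) <= R^2 * (\<L> x. \<bar>tau x\<bar>)"
  using mult_right_mono[of _ "R^2" "\<L> x. \<bar>tau x\<bar>"] by fastforce
 also have "... <= R^2 * newton_const" unfolding newton_const_def
  by (intro mult_left_mono) (auto intro!: sum_nonneg)
 finally show ?thesis by (simp add: mult.commute)
qed

lemma pd_newton_L1:
 assumes "0 < \<epsilon>" "\<epsilon> < R" shows "(\<L> x. \<bar>pd i (newton \<epsilon> R) x\<bar>) <= newton_const * R"
proof -
 have ab: "1 / R <= 1 / \<epsilon>" "0 < 1 / R" using assms by (auto simp: field_simps)
 have "(LINT s:{1/R..1/\<epsilon>}|lborel. s ^ Suc 0 / s ^ 3) = - 1 / (1/\<epsilon>) - - 1 / (1/R)"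
 proof (rule FTC_lborel[where F = "%s. - 1 / s"])
  fix s assume "1 / R <= s"
  then have "s > 0" using ab by linarith
  then show "((%s. - 1 / s) has_real_derivative s ^ Suc 0 / s ^ 3) (at s)"
   by (auto intro!: derivative_eq_intros simp: field_simps power2_eq_square power3_eq_cube)
 next
  show "continuous_on {1/R..1/\<epsilon>} (%s. s ^ Suc 0 / s ^ 3)"
   using ab by (intro continuous_intros) auto
 qed fact
 also have "... <= R" using assms by simp
 finally have "(LINT s:{1/R..1/\<epsilon>}|lborel. s ^ Suc 0 / s ^ 3) <= R" .
 moreover have "(\<L> x. \<bar>pd i (newton \<epsilon> R) x\<bar>) <= (LINT s:{1/R..1/\<epsilon>}|lborel. s ^ Suc 0 / s ^ 3) * (\<L> x. \<bar>pd i tau x\<bar>)"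
  unfolding newton_def dir_deriv_superpose[OF test_smooth[OF test_tau]]
  using ab by (intro superpose_L1 test_dir_deriv test_tau)
 ultimately have "(\<L> x. \<bar>pd i (newton \<epsilon> R) x\<bar>) <= R * (\<L> x. \<bar>pd i tau x\<bar>)"
  using mult_right_mono[of _ R "\<L> x. \<bar>pd i tau x\<bar>"] by fastforce
 also have "... <= R * newton_const"
 proof (rule mult_left_mono)
  have "(\<L> x. \<bar>pd i tau x\<bar>) <= (\<S> i. \<L> x. \<bar>pd i tau x\<bar>)"
   by (rule member_le_sum) auto
  moreover have "0 <= (\<L> x. \<bar>tau x\<bar>)" by simp
  ultimately show "(\<L> x. \<bar>pd i tau x\<bar>) <= newton_const"
   unfolding newton_const_def by linarith
 qed (use assms in simp)
 finally show ?thesis by (simp add: mult.commute)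
qed

lemma laplacian_newton:
 assumes "0 < \<epsilon>" "\<epsilon> < R"
 shows "(\<S> i. pd i (pd i (newton \<epsilon> R)) x) = mol R x - mol \<epsilon> x"
proof -
 have ab: "1 / R <= 1 / \<epsilon>" "0 < 1 / R" using assms by (auto simp: field_simps)
 have st: "smooth tau" "smooth rho" using test_tau test_rho test_smooth by blast+
 have "pd i (pd i (newton \<epsilon> R)) x = (LINT s:{1/R..1/\<epsilon>}|lborel. s^2 * pd i (pd i tau) (s *\<^sub>R x))" for i
  unfolding newton_def dir_deriv_superpose[OF st(1)] dir_deriv_superpose[OF smooth_dir_deriv[OF st(1)]]
  by (simp add: superpose_def numeral_2_eq_2)
 moreover have "set_integrable lborel {1/R..1/\<epsilon>} (%s. s^2 * pd i (pd i tau) (s *\<^sub>R x))" for i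
  unfolding set_integrable_def
  by (intro borel_integrable_compact continuous_intros
    continuous_on_compose2[OF smooth_cont[OF smooth_dir_deriv[OF smooth_dir_deriv[OF st(1)]], of UNIV]]) auto
 then have "(LINT s:{1/R..1/\<epsilon>}|lborel. (\<S> i. s^2 * pd i (pd i tau) (s *\<^sub>R x)))
   = (\<S> i. LINT s:{1/R..1/\<epsilon>}|lborel. s^2 * pd i (pd i tau) (s *\<^sub>R x))"
  unfolding set_integrable_def set_lebesgue_integral_def scaleR_sum_right
  by (intro B_integral_sum) auto
 ultimately have "(\<S> i. pd i (pd i (newton \<epsilon> R)) x) = (LINT s:{1/R..1/\<epsilon>}|lborel. (\<S> i. s^2 * pd i (pd i tau) (s *\<^sub>R x)))"
  by simp
 also have "... = (LINT s:{1/R..1/\<epsilon>}|lborel. - (3 * s^2 * rho (s *\<^sub>R x) + s ^ 3 * dir_deriv x rho (s *\<^sub>R x)))"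
 proof -
  have "(\<S> i. s^2 * pd i (pd i tau) (s *\<^sub>R x)) = - (3 * s^2 * rho (s *\<^sub>R x) + s ^ 3 * dir_deriv x rho (s *\<^sub>R x))" for s
  proof -
   have D: "(\<S> i. (s *\<^sub>R x) $ i * pd i rho (s *\<^sub>R x)) = s * dir_deriv x rho (s *\<^sub>R x)"
    by (simp add: dir_deriv_expand[OF st(2), of x] sum_distrib_left mult.assoc)
   have "(\<S> i. s^2 * pd i (pd i tau) (s *\<^sub>R x)) = s^2 * - (3 * rho (s *\<^sub>R x) + s * dir_deriv x rho (s *\<^sub>R x))"
    unfolding D[symmetric] laplacian_tau[symmetric] by (rule sum_distrib_left[symmetric])
   then show ?thesis by (simp add: algebra_simps power2_eq_square power3_eq_cube)
  qed
  then show ?thesis by (simp only:)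
 qed
 also have "... = - ((1/\<epsilon>) ^ 3 * rho ((1/\<epsilon>) *\<^sub>R x)) - - ((1/R) ^ 3 * rho ((1/R) *\<^sub>R x))"
 proof (rule FTC_lborel[where F = "%s. - (s ^ 3 * rho (s *\<^sub>R x))"])
  fix s :: real
  have "((%s. rho (s *\<^sub>R x)) has_real_derivative dir_deriv x rho (s *\<^sub>R x)) (at s)"
   using dir_deriv_along_line[OF st(2), of 0 x s] by simp
  then show "((%s. - (s ^ 3 * rho (s *\<^sub>R x))) has_real_derivative - (3 * s^2 * rho (s *\<^sub>R x) + s ^ 3 * dir_deriv x rho (s *\<^sub>R x))) (at s)"
   by (auto intro!: derivative_eq_intros)
  show "continuous_on {1/R..1/\<epsilon>} (%s. - (3 * s^2 * rho (s *\<^sub>R x) + s ^ 3 * dir_deriv x rho (s *\<^sub>R x)))"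
   by (intro continuous_intros continuous_on_compose2[OF smooth_cont[OF st(2), of UNIV]]
    continuous_on_compose2[OF smooth_cont[OF smooth_dir_deriv[OF st(2)], of UNIV]]) auto
 qed (use ab in simp)
 also have "... = mol R x - mol \<epsilon> x" by (simp add: mol_def power_divide)
 finally show ?thesis .
qed

text \<open>Integrating by parts twice, the sum of the squares of all second derivatives has the integral of the squared Laplacian.\<close>

lemma l2_second_derivatives:
 assumes f: "test f"
 shows "l2 (pd i (pd j f)) <= l2 (%x. \<S> k. pd k (pd k f) x)"
proof -
 have s: "smooth f" using f by (rule test_smooth)
 have t: "test (pd a f)" "test (pd a (pd b f))" for a b using f test_dir_deriv by blast+
 have ibp: "(\<L> x. pd a (pd b f) x * pd a (pd b f) x) = (\<L> x. pd a (pd a f) x * pd b (pd b f) x)" for a b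
 proof -
  have "(\<L> x. pd a (pd b f) x * pd a (pd b f) x) = - (\<L> x. pd b f x * pd a (pd a (pd b f)) x)"
   using t by (intro integral_by_parts test_smooth)
  also have "pd a (pd a (pd b f)) = pd b (pd a (pd a f))"
  proof
   fix x
   have "pd a (pd b f) = pd b (pd a f)" using dir_deriv_commute[OF s] by blast
   then show "pd a (pd a (pd b f)) x = pd b (pd a (pd a f)) x"
    using dir_deriv_commute[OF smooth_dir_deriv[OF s]] by metis
  qed
  also have "- (\<L> x. pd b f x * pd b (pd a (pd a f)) x) = (\<L> x. pd b (pd b f) x * pd a (pd a f) x)"
   using integral_by_parts[OF test_smooth[OF t(1)] t(2)] by simp
  finally show ?thesis by (simp add: mult.commute)
 qed
 have i: "integrable lborel (%x. pd a (pd b f) x * pd c (pd d f) x)" for a b c d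
  using t by (intro integrable_continuous_test smooth_cont test_smooth)
 have "(l2 (pd i (pd j f)))^2 = (\<L> x. pd i (pd j f) x * pd i (pd j f) x)"
  unfolding l2_power2 by (simp add: power2_eq_square)
 also have "... <= (\<S> b. \<L> x. pd i (pd b f) x * pd i (pd b f) x)"
  by (rule member_le_sum) auto
 also have "... <= (\<S> a. \<S> b. \<L> x. pd a (pd b f) x * pd a (pd b f) x)"
  by (rule member_le_sum[where f = "%a. \<S> b. \<L> x. pd a (pd b f) x * pd a (pd b f) x"]) (auto intro!: sum_nonneg)
 also have "... = (\<L> x. (\<S> a. \<S> b. pd a (pd a f) x * pd b (pd b f) x))"
  unfolding ibp using i by (subst B_integral_sum; simp)+
 also have "... = (l2 (%x. \<S> k. pd k (pd k f) x))^2"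
  unfolding l2_power2 by (simp add: power2_eq_square sum_product)
 finally show ?thesis by (rule power2_le_imp_le) simp
qed

section \<open>A symmetric approximation of the Leray projection\<close>

definition cutoff :: "real => real^3 => real" where
 "cutoff R x = bump (1 - ((1 / R) *\<^sub>R x) \<bullet> ((1 / R) *\<^sub>R x)) / bump 1"

lemma test_cutoff: "R > 0 ==> test (cutoff R)"
 using test_mult_left[OF smooth_const test_scale[OF test_bump_ball, of "1 / R"], of "1 / bump 1"]
 by (simp add: cutoff_def[abs_def])

lemma cutoff_eq: "cutoff R x = cutoff 1 ((1 / R) *\<^sub>R x)"
 by (simp add: cutoff_def)

lemma cutoff_bounds: "0 <= cutoff R x" "cutoff R x <= 1" "\<bar>cutoff R x\<bar> <= 1"
proof -
 have "bump s <= bump 1" if "s <= 1" for s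
  using that by (auto simp: bump_def field_simps)
 then show "0 <= cutoff R x" "cutoff R x <= 1" by (auto simp: cutoff_def bump_def)
 then show "\<bar>cutoff R x\<bar> <= 1" by simp
qed

lemma cutoff_1_0: "cutoff 1 0 = 1" by (simp add: cutoff_def bump_def)

lemma pd_cutoff: "R > 0 ==> pd i (cutoff R) = (%x. (1 / R) * pd i (cutoff 1) ((1 / R) *\<^sub>R x))"
 using dir_deriv_scale[OF test_smooth[OF test_cutoff[of 1]], of "axis i 1" "1 / R"]
 unfolding cutoff_eq[of R, abs_def] by simp

lemma pd_pd_cutoff:
 assumes "R > 0" shows "pd j (pd i (cutoff R)) = (%x. (1 / R^2) * pd j (pd i (cutoff 1)) ((1 / R) *\<^sub>R x))"
proof -
 have "smooth (pd i (cutoff 1))" by (intro smooth_dir_deriv test_smooth test_cutoff) simp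
 then show ?thesis
  by (simp only: pd_cutoff[OF assms] dir_deriv_cmult smooth_scale dir_deriv_scale) (simp add: power2_eq_square)
qed

lemma pd_cutoff_1_0: "pd i (cutoff 1) 0 = 0"
proof -
 have e: "cutoff 1 = (%x. (1 / bump 1) * bump (1 - x \<bullet> x))" by (auto simp: cutoff_def)
 show ?thesis unfolding e
  by (simp only: dir_deriv_cmult[OF test_smooth[OF test_bump_ball]])
   (simp add: dir_deriv_compose[OF smooth_bump smooth_one_minus_sq]
    dir_deriv_diff[OF smooth_const smooth_inner_self] dir_deriv_inner_self)
qed

lemma cutoff_const_exists:
 "\<exists>c>0. \<forall>R>0. \<forall>i j x. \<bar>pd i (cutoff R) x\<bar> <= c / R \<and> \<bar>pd j (pd i (cutoff R)) x\<bar> <= c / R^2"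
proof -
 have "\<exists>B>0. \<forall>x. \<bar>f x\<bar> <= B" if "test f" for f :: "real^3 => real" using test_bounded[OF that] by metis
 from this[OF test_dir_deriv[OF test_cutoff]] this[OF test_dir_deriv[OF test_dir_deriv[OF test_cutoff]]] have "\<forall>i. \<exists>B>0. \<forall>x. \<bar>pd i (cutoff 1) x\<bar> <= B" "\<forall>i j. \<exists>B>0. \<forall>x. \<bar>pd j (pd i (cutoff 1)) x\<bar> <= B"
  by auto
 then obtain B D where B: "!!i. B i > 0" "!!i x. \<bar>pd i (cutoff 1) x\<bar> <= B i"
  and D: "!!i j. D i j > 0" "!!i j x. \<bar>pd j (pd i (cutoff 1)) x\<bar> <= D i j" by metis
 define c where "c = (\<S> i. B i) + (\<S> i. \<S> j. D i j)"
 have b: "B i <= (\<S> i. B i)" for i by (rule member_le_sum) (auto intro: less_imp_le B)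
 have d: "D i j <= (\<S> j. D i j)" for i j by (rule member_le_sum) (auto intro: less_imp_le D)
 have d': "(\<S> j. D i j) <= (\<S> i. \<S> j. D i j)" for i
  by (rule member_le_sum[where f = "%i. \<S> j. D i j"]) (auto intro!: sum_nonneg less_imp_le[OF D(1)])
 have p: "(\<S> i. B i) > 0" "(\<S> i. \<S> j. D i j) > 0" by (auto intro!: sum_pos B D)
 have c: "B i <= c" "D i j <= c" for i j
  unfolding c_def using b[of i] d[of i j] d'[of i] p by linarith+
 have c0: "c > 0" unfolding c_def using p by linarith
 show ?thesis
 proof (intro exI[of _ c] conjI allI impI c0)
  fix R i j x assume R: "0 < (R::real)"
  show "\<bar>pd i (cutoff R) x\<bar> <= c / R"
   unfolding pd_cutoff[OF R] abs_mult using R order_trans[OF B(2) c(1)]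
   by (simp add: divide_right_mono)
  show "\<bar>pd j (pd i (cutoff R)) x\<bar> <= c / R^2"
   unfolding pd_pd_cutoff[OF R] abs_mult using R order_trans[OF D(2) c(2)]
   by (simp add: divide_right_mono)
 qed
qed

text \<open>Only the scaling matters: each derivative of the cutoff gains a factor \<open>1 / R\<close>.\<close>

definition cutoff_const :: real where
 "cutoff_const = (SOME c. c > 0 \<and> (\<forall>R>0. \<forall>i j x. \<bar>pd i (cutoff R) x\<bar> <= c / R \<and> \<bar>pd j (pd i (cutoff R)) x\<bar> <= c / R^2))"

lemma cutoff_const:
 "cutoff_const > 0" "R > 0 ==> \<bar>pd i (cutoff R) x\<bar> <= cutoff_const / R"
 "R > 0 ==> \<bar>pd j (pd i (cutoff R)) x\<bar> <= cutoff_const / R^2"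
 using someI_ex[OF cutoff_const_exists] unfolding cutoff_const_def by blast+

lemma cutoff_tendsto: "(%n. cutoff (real (Suc n)) x) ----> 1"
 and pd_cutoff_tendsto: "(%n. real (Suc n) * pd i (cutoff (real (Suc n))) x) ----> 0"
proof -
 have "(%n. (1 / real (Suc n)) *\<^sub>R x) ----> 0 *\<^sub>R x"
  using LIMSEQ_inverse_real_of_nat by (intro tendsto_intros) (simp add: inverse_eq_divide)
 then have l: "(%n. (1 / real (Suc n)) *\<^sub>R x) ----> 0" by simp
 have "isCont (cutoff 1) 0" "isCont (pd i (cutoff 1)) 0"
  using smooth_cont[OF test_smooth[OF test_cutoff[of 1]], of UNIV]
   smooth_cont[OF test_smooth[OF test_dir_deriv[OF test_cutoff[of 1]]], of UNIV]
  by (auto simp: continuous_on_eq_continuous_at)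
 from isCont_tendsto_compose[OF this(1) l] isCont_tendsto_compose[OF this(2) l]
 show "(%n. cutoff (real (Suc n)) x) ----> 1" "(%n. real (Suc n) * pd i (cutoff (real (Suc n))) x) ----> 0"
  unfolding cutoff_eq[of "real (Suc n)" for n] pd_cutoff[OF of_nat_0_less_iff[THEN iffD2, OF zero_less_Suc]]
  by (simp_all add: cutoff_1_0 pd_cutoff_1_0)
qed

type_synonym vfield = "3 => real^3 => real"

text \<open>The curl in the form of an antisymmetric matrix.\<close>

definition curl_cut :: "(real^3 => real) => vfield => 3 => vfield" where
 "curl_cut \<phi> u i j x = \<phi> x * (pd i (u j) x - pd j (u i) x)"

text \<open>For \<open>\<phi> = 1\<close> and \<open>m\<close> the kernel of the inverse of minus the Laplacian this is the Leray projection.\<close>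

definition leray :: "(real^3 => real) => (real^3 => real) => vfield => vfield" where
 "leray \<phi> m u i x = - (\<S> j. pd j (%y. \<phi> y * conv m (curl_cut \<phi> u j i) y) x)"

lemma test_curl_cut: "test \<phi> ==> (!!i. smooth (u i)) ==> test (curl_cut \<phi> u i j)"
 unfolding curl_cut_def[abs_def] by (intro test_mult_right smooth_diff smooth_dir_deriv) auto

lemma test_leray_aux:
 "test \<phi> ==> test m ==> (!!i. smooth (u i)) ==> test (%y. \<phi> y * conv m (curl_cut \<phi> u j i) y)"
 by (intro test_mult_right test_smooth[OF test_conv] test_curl_cut)

lemma test_leray: "test \<phi> ==> test m ==> (!!i. smooth (u i)) ==> test (leray \<phi> m u i)"
 unfolding leray_def[abs_def] by (intro test_minus test_sum test_dir_deriv test_leray_aux)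

lemma curl_cut_antisym: "curl_cut \<phi> u i j = (%x. - curl_cut \<phi> u j i x)"
 by (auto simp: curl_cut_def algebra_simps)

text \<open>The divergence is a double sum of symmetric second derivatives against an antisymmetric matrix.\<close>

lemma div_leray:
 assumes "test \<phi>" "test m" "!!i. smooth (u i)"
 shows "(\<S> i. pd i (leray \<phi> m u i) x) = 0"
proof -
 define A where "A i j = (%y. \<phi> y * conv m (curl_cut \<phi> u j i) y)" for i j
 have tA: "smooth (A i j)" for i j unfolding A_def using test_leray_aux[of \<phi> m u] assms test_smooth by blast
 have anti: "A i j = (%x. - A j i x)" for i j
  unfolding A_def by (subst curl_cut_antisym, subst conv_minus) simp
 have p: "leray \<phi> m u i = (%x. - (\<S> j. pd j (A i j) x))" for i by (simp add: leray_def[abs_def] A_def)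
 have e: "(\<S> i. pd i (leray \<phi> m u i) x) = - (\<S> i. \<S> j. pd i (pd j (A i j)) x)"
  unfolding p by (simp add: dir_deriv_minus smooth_sum smooth_dir_deriv[OF tA] dir_deriv_sum sum_negf)
 have "(\<S> i. \<S> j. pd i (pd j (A i j)) x) = (\<S> j. \<S> i. pd i (pd j (A i j)) x)"
  by (rule sum.swap)
 also have "... = (\<S> j. \<S> i. - pd j (pd i (A j i)) x)"
 proof (intro sum.cong refl)
  fix i j
  have "pd i (pd j (A i j)) x = pd j (pd i (A i j)) x" by (rule dir_deriv_commute[OF tA])
  also have "... = - pd j (pd i (A j i)) x"
   by (subst anti) (simp add: dir_deriv_minus tA smooth_dir_deriv[OF tA])
  finally show "pd i (pd j (A i j)) x = - pd j (pd i (A j i)) x" .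
 qed
 finally show ?thesis unfolding e by (simp add: sum_negf)
qed

lemma sum_antisym_pair:
 fixes X :: "3 => 3 => real"
 assumes "!!i j. X i j = - X j i"
 shows "(\<S> i. \<S> j. d j i * X j i) = (\<S> i. \<S> j. (d j i - d i j) * X j i) / 2"
proof -
 have "(\<S> i. \<S> j. d j i * X j i) = (\<S> j. \<S> i. d j i * X j i)" by (rule sum.swap)
 also have "... = - (\<S> j. \<S> i. d j i * X i j)"
  unfolding sum_negf[symmetric] by (intro sum.cong refl) (subst assms, simp)
 finally show ?thesis by (simp add: left_diff_distrib sum_subtractf)
qed

text \<open>After integration by parts the pairing is a symmetric bilinear form in the truncated curls.\<close>

lemma integral_leray:
 assumes "test \<phi>" "test m" "!!i. smooth (u i)" "!!i. smooth (w i)"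
 shows "(\<S> i. \<L> x. w i x * leray \<phi> m u i x)
  = (\<S> i. \<S> j. \<L> x. curl_cut \<phi> w j i x * conv m (curl_cut \<phi> u j i) x) / 2"
proof -
 define X where "X j i = conv m (curl_cut \<phi> u j i)" for i j
 have tX: "test (%x. \<phi> x * X j i x)" for i j unfolding X_def using test_leray_aux[of \<phi> m u] assms by blast
 have anti: "X i j x = - X j i x" for i j x
  unfolding X_def by (subst curl_cut_antisym, subst conv_minus) simp
 have i1: "integrable lborel (%x. f x * (\<phi> x * X j i x))" if "smooth f" for f i j
  using that tX by (intro integrable_continuous_test smooth_cont)
 have "(\<L> x. w i x * leray \<phi> m u i x) = (\<S> j. \<L> x. pd j (w i) x * (\<phi> x * X j i x))" for i
 proof -
  have "(\<L> x. w i x * leray \<phi> m u i x) = (\<L> x. (\<S> j. - (w i x * pd j (%y. \<phi> y * X j i y) x)))"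
   by (simp add: leray_def X_def sum_negf sum_distrib_left)
  also have "... = (\<S> j. \<L> x. - (w i x * pd j (%y. \<phi> y * X j i y) x))"
   using assms tX by (intro B_integral_sum)
    (auto intro!: integrable_continuous_test smooth_cont test_dir_deriv)
  also have "... = (\<S> j. \<L> x. pd j (w i) x * (\<phi> x * X j i x))"
   using integral_by_parts[OF assms(4) tX] by simp
  finally show ?thesis .
 qed
 then have "(\<S> i. \<L> x. w i x * leray \<phi> m u i x)
   = (\<L> x. (\<S> i. \<S> j. pd j (w i) x * (\<phi> x * X j i x)))"
  using i1[OF smooth_dir_deriv[OF assms(4)]] by (subst B_integral_sum; simp)+
 also have "... = (\<L> x. (\<S> i. \<S> j. curl_cut \<phi> w j i x * X j i x) / 2)"
 proof (rule B_integral_cong)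
  fix x
  have "(\<S> i. \<S> j. pd j (w i) x * (\<phi> x * X j i x))
   = (\<S> i. \<S> j. (pd j (w i) x - pd i (w j) x) * (\<phi> x * X j i x)) / 2"
   by (rule sum_antisym_pair[of "%i j. \<phi> x * X i j x" "%j i. pd j (w i) x"]) (subst anti, simp)
  then show "(\<S> i. \<S> j. pd j (w i) x * (\<phi> x * X j i x)) = (\<S> i. \<S> j. curl_cut \<phi> w j i x * X j i x) / 2"
   by (simp add: curl_cut_def algebra_simps)
 qed simp
 also have "... = (\<S> i. \<S> j. \<L> x. curl_cut \<phi> w j i x * X j i x) / 2"
 proof -
  have "integrable lborel (%x. curl_cut \<phi> w j i x * X j i x)" for i j
   unfolding X_def using assms
   by (intro integrable_continuous_test smooth_cont test_conv test_curl_cut test_smooth[OF test_curl_cut])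
  then show ?thesis by (subst integral_divide_zero, (subst B_integral_sum; simp)+)
 qed
 finally show ?thesis by (simp add: X_def)
qed

lemma leray_symmetric:
 assumes "test \<phi>" "test m" "!!x. m (- x) = m x" "!!i. smooth (u i)" "!!i. smooth (w i)"
 shows "(\<S> i. \<L> x. w i x * leray \<phi> m u i x) = (\<S> i. \<L> x. u i x * leray \<phi> m w i x)"
 unfolding integral_leray[OF assms(1,2,4,5)] integral_leray[OF assms(1,2,5,4)]
 using conv_symmetric[OF test_smooth[OF assms(2)] assms(3) test_curl_cut test_curl_cut] assms
 by simp

lemma curl_cut_diff: "(!!i. smooth (u i)) ==> (!!i. smooth (w i)) ==>
  curl_cut \<phi> (%i x. u i x - w i x) i j = (%x. curl_cut \<phi> u i j x - curl_cut \<phi> w i j x)"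
 by (auto simp: curl_cut_def dir_deriv_diff algebra_simps)

lemma leray_diff:
 assumes "test \<phi>" "test m" "!!i. smooth (u i)" "!!i. smooth (w i)"
 shows "leray \<phi> m (%i x. u i x - w i x) i = (%x. leray \<phi> m u i x - leray \<phi> m w i x)"
proof
 fix x
 have "pd j (%y. \<phi> y * conv m (curl_cut \<phi> (%i x. u i x - w i x) j i) y) x
  = pd j (%y. \<phi> y * conv m (curl_cut \<phi> u j i) y) x - pd j (%y. \<phi> y * conv m (curl_cut \<phi> w j i) y) x" for j
 proof -
  have "(%y. \<phi> y * conv m (curl_cut \<phi> (%i x. u i x - w i x) j i) y)
   = (%y. \<phi> y * conv m (curl_cut \<phi> u j i) y - \<phi> y * conv m (curl_cut \<phi> w j i) y)"
   using assms by (simp add: curl_cut_diff conv_diff test_smooth test_curl_cut algebra_simps)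
  then show ?thesis
   using test_smooth[OF test_leray_aux[OF assms(1,2), of u]] test_smooth[OF test_leray_aux[OF assms(1,2), of w]] assms
   by (simp add: dir_deriv_diff)
 qed
 then show "leray \<phi> m (%i x. u i x - w i x) i x = leray \<phi> m u i x - leray \<phi> m w i x"
  by (simp add: leray_def sum_subtractf)
qed

section \<open>The error of the approximate projection\<close>

text \<open>The deviation of the approximate projection from a localised mollification.\<close>

definition leray_err :: "real => real => vfield => vfield" where
 "leray_err \<epsilon> R u i x = leray (cutoff R) (newton \<epsilon> R) u i x
   - cutoff R x * conv (mol \<epsilon>) (%y. cutoff R y * u i y) x"

text \<open>The terms of lower order that appear when the cutoff is commuted with curl and divergence.  They live
 where the gradient of the cutoff does.\<close>

definition cut_swirl :: "real => vfield => 3 => 3 => real^3 => real" where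
 "cut_swirl R u j i x = u i x * pd j (cutoff R) x - u j x * pd i (cutoff R) x"

definition cut_flux :: "real => vfield => real^3 => real" where
 "cut_flux R u x = (\<S> j. u j x * pd j (cutoff R) x)"

text \<open>Commuting \<open>\<phi>\<close> with the derivatives and using \<open>div u = 0\<close>, the main term is the Laplacian of the
 truncated potential of \<open>\<phi> u\<close>; all others carry a derivative of the cutoff or the wide mollifier.\<close>

lemma leray_err_expansion:
 fixes u :: vfield
 assumes R: "0 < \<epsilon>" "\<epsilon> < R" and u: "!!i. smooth (u i)" and div: "!!x. (\<S> i. pd i (u i) x) = 0"
 defines "\<phi> \<equiv> cutoff R" and "M \<equiv> conv (newton \<epsilon> R)"
 defines "a \<equiv> %i x. cutoff R x * u i x" and "b \<equiv> cut_swirl R u" and "c \<equiv> cut_flux R u"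
 shows "leray_err \<epsilon> R u i x = - (\<phi> x * conv (mol R) (a i) x) + \<phi> x * pd i (M c) x
   + (\<S> j. \<phi> x * pd j (M (b j i)) x)
   - (\<S> j. pd j \<phi> x * pd j (M (a i)) x) + (\<S> j. pd j \<phi> x * pd i (M (a j)) x)
   + (\<S> j. pd j \<phi> x * M (b j i) x)"
  and "test (a i)" "test (b j i)" "test c"
proof -
 have R0: "0 < R" using R by simp
 have t\<phi>: "test \<phi>" unfolding \<phi>_def by (rule test_cutoff[OF R0])
 have tm: "test (newton \<epsilon> R)" by (rule test_newton[OF R0])
 have s\<phi>: "smooth \<phi>" "!!j. smooth (pd j \<phi>)" using t\<phi> test_smooth by blast+
 show ta: "test (a i)" for i unfolding a_def \<phi>_def[symmetric] using t\<phi> u by (intro test_mult_right)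
 show tb: "test (b j i)" for j i unfolding b_def cut_swirl_def[abs_def] \<phi>_def[symmetric]
  using t\<phi> u by (intro test_diff test_mult_left test_dir_deriv)
 show tc: "test c" unfolding c_def cut_flux_def[abs_def] \<phi>_def[symmetric]
  using t\<phi> u by (intro test_sum test_mult_left test_dir_deriv)
 have pda: "pd j (a i) x = \<phi> x * pd j (u i) x + pd j \<phi> x * u i x" for i j x
  unfolding a_def \<phi>_def[symmetric] by (simp add: dir_deriv_mult s\<phi> u)
 have w: "curl_cut \<phi> u j i = (%x. (pd j (a i) x - pd i (a j) x) - b j i x)" for j i
  by (auto simp: curl_cut_def pda b_def cut_swirl_def \<phi>_def[symmetric] algebra_simps)
 have tM: "test (M g)" if "test g" for g unfolding M_def by (rule test_conv[OF tm that])
 have sM: "smooth (M g)" if "test g" for g using tM[OF that] by (rule test_smooth)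
 have Mw: "M (curl_cut \<phi> u j i) = (%x. (pd j (M (a i)) x - pd i (M (a j)) x) - M (b j i) x)" for j i
  unfolding w M_def
  by (simp add: conv_diff test_smooth[OF tm] test_diff test_dir_deriv ta tb dir_deriv_conv_right[OF tm ta])
 have pM: "pd j (%y. \<phi> y * M (curl_cut \<phi> u j i) y) x =
   \<phi> x * ((pd j (pd j (M (a i))) x - pd j (pd i (M (a j))) x) - pd j (M (b j i)) x)
   + pd j \<phi> x * ((pd j (M (a i)) x - pd i (M (a j)) x) - M (b j i) x)" for i j x
  unfolding Mw by (simp add: dir_deriv_mult dir_deriv_diff s\<phi> smooth_diff sM[OF ta] sM[OF tb] smooth_dir_deriv[OF sM[OF ta]])
 have lap: "(\<S> j. pd j (pd j (M (a i))) x) = conv (mol R) (a i) x - conv (mol \<epsilon>) (a i) x" for x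
 proof -
  have "pd j (pd j (M (a i))) = conv (pd j (pd j (newton \<epsilon> R))) (a i)" for j
   unfolding M_def using test_smooth[OF tm] ta by (simp add: dir_deriv_conv smooth_dir_deriv)
  then have "(\<S> j. pd j (pd j (M (a i))) x) = (\<L> y. (\<S> j. pd j (pd j (newton \<epsilon> R)) (x - y) * a i y))"
   unfolding conv_def using conv_integrable[OF test_smooth[OF test_dir_deriv[OF test_dir_deriv[OF tm]]] ta]
   by (subst B_integral_sum) auto
  also have "... = (\<L> y. mol R (x - y) * a i y - mol \<epsilon> (x - y) * a i y)"
   unfolding sum_distrib_right[symmetric] laplacian_newton[OF R] by (simp add: algebra_simps)
  also have "... = conv (mol R) (a i) x - conv (mol \<epsilon>) (a i) x" unfolding conv_def
   using R R0 by (intro B_integral_diff conv_integrable test_smooth[OF test_mol] ta)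
  finally show ?thesis .
 qed
 have dv: "(\<S> j. pd j (pd i (M (a j))) x) = pd i (M c) x" for x
 proof -
  have "(\<S> j. pd j (a j) y) = c y" for y
   using div[of y] by (simp add: pda sum.distrib sum_distrib_left[symmetric] c_def cut_flux_def \<phi>_def[symmetric] mult.commute)
  then have "c = (%y. \<S> j. pd j (a j) y)" by auto
  then have "M c = (%y. \<S> j. pd j (M (a j)) y)"
   unfolding M_def by (simp add: conv_sum test_smooth[OF tm] test_dir_deriv ta dir_deriv_conv_right[OF tm ta])
  then have "pd i (M c) x = (\<S> j. pd i (pd j (M (a j))) x)"
   by (simp add: dir_deriv_sum smooth_dir_deriv[OF sM[OF ta]])
  also have "... = (\<S> j. pd j (pd i (M (a j))) x)"
   by (intro sum.cong refl dir_deriv_commute sM ta)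
  finally show ?thesis ..
 qed
 have "leray \<phi> (newton \<epsilon> R) u i x = - (\<S> j. \<phi> x * pd j (pd j (M (a i))) x - \<phi> x * pd j (pd i (M (a j))) x
   - \<phi> x * pd j (M (b j i)) x + (pd j \<phi> x * pd j (M (a i)) x - pd j \<phi> x * pd i (M (a j)) x - pd j \<phi> x * M (b j i) x))"
  unfolding leray_def M_def[symmetric] pM by (simp add: algebra_simps)
 also have "... = - (\<phi> x * (conv (mol R) (a i) x - conv (mol \<epsilon>) (a i) x)) + \<phi> x * pd i (M c) x
   + (\<S> j. \<phi> x * pd j (M (b j i)) x)
   - (\<S> j. pd j \<phi> x * pd j (M (a i)) x) + (\<S> j. pd j \<phi> x * pd i (M (a j)) x)
   + (\<S> j. pd j \<phi> x * M (b j i) x)"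
  unfolding lap[symmetric] dv[symmetric] by (simp add: sum.distrib sum_subtractf sum_distrib_left)
 finally show "leray_err \<epsilon> R u i x = - (\<phi> x * conv (mol R) (a i) x) + \<phi> x * pd i (M c) x
   + (\<S> j. \<phi> x * pd j (M (b j i)) x)
   - (\<S> j. pd j \<phi> x * pd j (M (a i)) x) + (\<S> j. pd j \<phi> x * pd i (M (a j)) x)
   + (\<S> j. pd j \<phi> x * M (b j i) x)"
  by (simp add: leray_err_def \<phi>_def a_def algebra_simps)
qed

lemma l2_product_bounds:
 assumes t: "test \<psi>" "test F" and p: "!!x. \<bar>\<psi> x\<bar> <= p0" "!!x. \<bar>pd k \<psi> x\<bar> <= p1" and f: "l2 F <= f0" "l2 (pd k F) <= f1"
 shows "l2 (%x. \<psi> x * F x) <= p0 * f0" "l2 (pd k (%x. \<psi> x * F x)) <= p1 * f0 + p0 * f1"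
proof -
 have p0: "0 <= p0" "0 <= p1" using p abs_ge_zero order_trans by blast+
 show "l2 (%x. \<psi> x * F x) <= p0 * f0"
  using sq_int_mult_bounded(2)[OF test_sq_int[OF t(2)] test_borel[OF t(1)] p(1)] mult_left_mono[OF f(1) p0(1)] by linarith
 have "pd k (%x. \<psi> x * F x) = (%x. \<psi> x * pd k F x + pd k \<psi> x * F x)"
  using t by (intro dir_deriv_mult test_smooth)
 then have "l2 (pd k (%x. \<psi> x * F x)) <= l2 (%x. \<psi> x * pd k F x) + l2 (%x. pd k \<psi> x * F x)"
  using t by (auto intro!: l2_triangle test_sq_int test_mult_left test_smooth test_dir_deriv smooth_dir_deriv)
 also have "l2 (%x. \<psi> x * pd k F x) <= p0 * f1"
  using sq_int_mult_bounded(2)[OF test_sq_int[OF test_dir_deriv[OF t(2)]] test_borel[OF t(1)] p(1)] mult_left_mono[OF f(2) p0(1)]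
  by (meson order_trans)
 also have "l2 (%x. pd k \<psi> x * F x) <= p1 * f0"
  using sq_int_mult_bounded(2)[OF test_sq_int[OF t(2)] test_borel[OF test_dir_deriv[OF t(1)]] p(2)] mult_left_mono[OF f(1) p0(2)]
  by (meson order_trans)
 finally show "l2 (pd k (%x. \<psi> x * F x)) <= p1 * f0 + p0 * f1" by simp
qed

lemma newton_conv_bounds:
 assumes R: "0 < \<epsilon>" "\<epsilon> < R" and g: "test g"
 shows "l2 (conv (newton \<epsilon> R) g) <= newton_const * R^2 * l2 g"
  "l2 (pd i (conv (newton \<epsilon> R) g)) <= newton_const * R * l2 g"
  "l2 (pd k (pd i (conv (newton \<epsilon> R) g))) <= 2 * l2 g"
proof -
 have R0: "0 < R" using R by simp
 have tm: "test (newton \<epsilon> R)" by (rule test_newton[OF R0])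
 note s = test_smooth[OF tm]
 show "l2 (conv (newton \<epsilon> R) g) <= newton_const * R^2 * l2 g"
  using l2_conv[OF tm g] mult_right_mono[OF newton_L1[OF R], of "l2 g"] by simp
 show "l2 (pd i (conv (newton \<epsilon> R) g)) <= newton_const * R * l2 g"
  unfolding dir_deriv_conv[OF s g]
  using l2_conv[OF test_dir_deriv[OF tm] g, of "axis i 1"] mult_right_mono[OF pd_newton_L1[OF R, of i], of "l2 g"] by simp
 have lap: "(\<S> j. pd j (pd j (conv (newton \<epsilon> R) g)) x) = conv (mol R) g x - conv (mol \<epsilon>) g x" for x
 proof -
  have "pd j (pd j (conv (newton \<epsilon> R) g)) = conv (pd j (pd j (newton \<epsilon> R))) g" for j
   using s g by (simp add: dir_deriv_conv smooth_dir_deriv)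
  then have "(\<S> j. pd j (pd j (conv (newton \<epsilon> R) g)) x) = (\<L> y. (\<S> j. pd j (pd j (newton \<epsilon> R)) (x - y) * g y))"
   unfolding conv_def using conv_integrable[OF test_smooth[OF test_dir_deriv[OF test_dir_deriv[OF tm]]] g]
   by (subst B_integral_sum) auto
  also have "... = (\<L> y. mol R (x - y) * g y - mol \<epsilon> (x - y) * g y)"
   unfolding sum_distrib_right[symmetric] laplacian_newton[OF R] by (simp add: algebra_simps)
  also have "... = conv (mol R) g x - conv (mol \<epsilon>) g x" unfolding conv_def
   using R R0 by (intro B_integral_diff conv_integrable test_smooth[OF test_mol] g)
  finally show ?thesis .
 qed
 have "l2 (pd k (pd i (conv (newton \<epsilon> R) g))) <= l2 (%x. conv (mol R) g x - conv (mol \<epsilon>) g x)"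
  using l2_second_derivatives[OF test_conv[OF tm g], of k i] unfolding lap .
 also have "... <= l2 (conv (mol R) g) + l2 (conv (mol \<epsilon>) g)"
  using R R0 by (intro l2_triangle_diff test_sq_int test_conv test_mol g)
 also have "... <= l2 g + l2 g"
  using l2_conv[OF test_mol[OF R0] g] l2_conv[OF test_mol[OF R(1)] g] integral_abs_mol[OF R0] integral_abs_mol[OF R(1)] by simp
 finally show "l2 (pd k (pd i (conv (newton \<epsilon> R) g))) <= 2 * l2 g" by simp
qed

text \<open>The mass of \<open>f\<close> near the boundary of the cutoff.  The factor \<open>R\<close> makes the weight bounded, and it
 tends to zero pointwise, so the quantity vanishes in the limit for square integrable \<open>f\<close>.\<close>

definition edge :: "real => (real^3 => real) => real" where
 "edge R f = (\<S> j. l2 (%x. (R * pd j (cutoff R) x) * f x))"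

lemma edge_nonneg: "0 <= edge R f" by (simp add: edge_def sum_nonneg)

lemma edge_component: "0 < R ==> l2 (%x. pd j (cutoff R) x * f x) <= edge R f / R"
proof -
 assume R: "0 < R"
 have "l2 (%x. (R * pd j (cutoff R) x) * f x) <= edge R f"
  unfolding edge_def by (rule member_le_sum) auto
 moreover have "(%x. pd j (cutoff R) x * f x) = (%x. (1 / R) * ((R * pd j (cutoff R) x) * f x))" using R by auto
 ultimately show ?thesis using R l2_cmult[of "1 / R" "%x. (R * pd j (cutoff R) x) * f x"] by (simp add: divide_right_mono)
qed

lemma pd_cutoff_scaled: "0 < R ==> \<bar>R * pd j (cutoff R) x\<bar> <= cutoff_const"
 using cutoff_const(2)[of R j x] by (simp add: abs_mult field_simps)

lemma edge_bound: assumes "0 < R" "sq_int f" shows "edge R f <= 3 * cutoff_const * l2 f"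
proof -
 have "l2 (%x. (R * pd j (cutoff R) x) * f x) <= cutoff_const * l2 f" for j
 proof (rule sq_int_mult_bounded(2)[OF assms(2)])
  show "meas ((%x. R * pd j (cutoff R) x))"
   using test_borel[OF test_dir_deriv[OF test_cutoff[OF assms(1)]]] by simp
  show "\<bar>R * pd j (cutoff R) x\<bar> <= cutoff_const" for x
   by (rule pd_cutoff_scaled[OF assms(1)])
 qed
 then have "edge R f <= (\<Sum>j\<in>(UNIV::3 set). cutoff_const * l2 f)" unfolding edge_def by (intro sum_mono)
 then show ?thesis by simp
qed

lemma edge_tendsto:
 assumes f: "sq_int f" shows "(%n. edge (real (Suc n)) f) ----> 0"
proof -
 have "(%n. l2 (%x. (real (Suc n) * pd j (cutoff (real (Suc n))) x) * f x)) ----> 0" for j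
 proof -
  have [measurable]: "meas f" using f by (rule sq_int_borel)
  have mc[measurable]: "meas (pd j (cutoff (real (Suc n))))" for n
   by (intro test_borel test_dir_deriv test_cutoff) simp
  have "(%n. \<L> x. ((real (Suc n) * pd j (cutoff (real (Suc n))) x) * f x)^2) ----> (\<L> x::real^3. (0::real))"
  proof (rule integral_dominated_convergence[where f = "%_. 0" and w = "%x. cutoff_const^2 * (f x)^2"
    and s = "%n x. ((real (Suc n) * pd j (cutoff (real (Suc n))) x) * f x)^2"])
   show "integrable lborel (%x. cutoff_const^2 * (f x)^2)" using f by (simp add: sq_int_def)
   show "AE x in lborel. (%n. ((real (Suc n) * pd j (cutoff (real (Suc n))) x) * f x)^2) ----> 0"
   proof (rule AE_I2)
    fix x
    have "(%n. ((real (Suc n) * pd j (cutoff (real (Suc n))) x) * f x)^2) ----> (0 * f x)^2"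
     by (intro tendsto_intros pd_cutoff_tendsto)
    then show "(%n. ((real (Suc n) * pd j (cutoff (real (Suc n))) x) * f x)^2) ----> 0" by simp
   qed
   show "AE x in lborel. norm (((real (Suc n) * pd j (cutoff (real (Suc n))) x) * f x)^2) <= cutoff_const^2 * (f x)^2" for n
   proof (rule AE_I2)
    fix x
    have "\<bar>real (Suc n) * pd j (cutoff (real (Suc n))) x\<bar> <= cutoff_const"
     by (rule pd_cutoff_scaled) simp
    from power_mono[OF this, of 2]
    have "(real (Suc n) * pd j (cutoff (real (Suc n))) x)^2 <= cutoff_const^2" by simp
    from mult_right_mono[OF this, of "(f x)^2"] show "norm (((real (Suc n) * pd j (cutoff (real (Suc n))) x) * f x)^2) <= cutoff_const^2 * (f x)^2"
     by (simp only: power_mult_distrib[of _ "f x"] real_norm_def abs_mult abs_power2) simp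
   qed
  qed measurable
  then show ?thesis unfolding l2_def using tendsto_real_sqrt by fastforce
 qed
 from tendsto_sum[of UNIV, OF this] show ?thesis unfolding edge_def by simp
qed

lemma cut_flux_swirl_l2:
 assumes R: "0 < R" and u: "!!i. smooth (u i)" "!!i. sq_int (u i)"
 shows "l2 (cut_flux R u) <= (\<S> l. edge R (u l)) / R"
  and "l2 (cut_swirl R u j i) <= 2 * (\<S> l. edge R (u l)) / R"
proof -
 have s: "sq_int (%x. u i x * pd j (cutoff R) x)" for i j
  using u(1) by (intro test_sq_int test_mult_left test_dir_deriv test_cutoff R)
 have e: "l2 (%x. u i x * pd j (cutoff R) x) <= edge R (u i) / R" for i j
  using edge_component[OF R, of j "u i"] by (simp add: mult.commute)
 have "l2 (cut_flux R u) <= (\<S> j. l2 (%x. u j x * pd j (cutoff R) x))"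
  unfolding cut_flux_def[abs_def] by (intro l2_sum s)
 also have "... <= (\<S> j. edge R (u j) / R)" by (intro sum_mono e)
 finally show "l2 (cut_flux R u) <= (\<S> l. edge R (u l)) / R" by (simp add: sum_divide_distrib)
 have m: "edge R (u i) <= (\<S> l. edge R (u l))" for i
  by (rule member_le_sum) (auto simp: edge_nonneg)
 have m': "edge R (u i) / R <= (\<S> l. edge R (u l)) / R" for i
  using m R by (simp add: divide_right_mono)
 have "l2 (cut_swirl R u j i) <= l2 (%x. u i x * pd j (cutoff R) x) + l2 (%x. u j x * pd i (cutoff R) x)"
  unfolding cut_swirl_def[abs_def] by (intro l2_triangle_diff s)
 then show "l2 (cut_swirl R u j i) <= 2 * (\<S> l. edge R (u l)) / R"
  using e[of i j] e[of j i] m'[of i] m'[of j] by linarith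
qed

lemma cut_flux_swirl_l2_N:
 assumes R: "0 < R" and u: "!!i. smooth (u i)" "!!i. sq_int (u i)" "!!i. l2 (u i) <= N"
 shows "l2 (cut_flux R u) <= 18 * cutoff_const * N / R" and "l2 (cut_swirl R u j i) <= 18 * cutoff_const * N / R"
proof -
 have "edge R (u l) <= 3 * cutoff_const * N" for l
  using edge_bound[OF R u(2)] mult_left_mono[OF u(3), of "3 * cutoff_const"] cutoff_const(1) by (meson less_imp_le mult_nonneg_nonneg order_trans zero_le_numeral)
 then have "(\<S> l. edge R (u l)) <= (\<Sum>l\<in>(UNIV::3 set). 3 * cutoff_const * N)" by (intro sum_mono)
 then have "(\<S> l. edge R (u l)) <= 9 * cutoff_const * N" by simp
 moreover have "0 <= (\<S> l. edge R (u l))" by (simp add: edge_nonneg sum_nonneg)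
 ultimately have "2 * (\<S> l. edge R (u l)) <= 18 * cutoff_const * N" "(\<S> l. edge R (u l)) <= 18 * cutoff_const * N"
  by linarith+
 then have "2 * (\<S> l. edge R (u l)) / R <= 18 * cutoff_const * N / R" "(\<S> l. edge R (u l)) / R <= 18 * cutoff_const * N / R"
  using R by (intro divide_right_mono; simp)+
 then show "l2 (cut_flux R u) <= 18 * cutoff_const * N / R" "l2 (cut_swirl R u j i) <= 18 * cutoff_const * N / R"
  using order_trans[OF cut_flux_swirl_l2(1)[OF R u(1,2)]] order_trans[OF cut_flux_swirl_l2(2)[OF R u(1,2)]] by simp_all
qed

lemma l2_cut_u:
 assumes "0 < R" "sq_int f" shows "l2 (%x. cutoff R x * f x) <= l2 f"
 using sq_int_mult_bounded(2)[OF assms(2) test_borel[OF test_cutoff[OF assms(1)]] cutoff_bounds(3)] by simp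

definition rho_const :: real where "rho_const = (\<S> i. \<L> x. \<bar>pd i rho x\<bar>)"

lemma rho_const: "0 < r ==> (\<L> x. \<bar>pd i (mol r) x\<bar>) <= rho_const / r"
proof -
 assume r: "0 < r"
 have "(\<L> x. \<bar>pd i rho x\<bar>) <= rho_const" unfolding rho_const_def by (rule member_le_sum) auto
 then show ?thesis unfolding integral_abs_pd_mol[OF r] using r by (simp add: divide_right_mono)
qed

lemma rho_const_nonneg: "0 <= rho_const" unfolding rho_const_def by (intro sum_nonneg) auto

definition err_const :: real where
 "err_const = (cutoff_const + rho_const) + 4 * (18 * cutoff_const^2 * newton_const + 36 * cutoff_const)
   + 6 * (cutoff_const * newton_const + 2 * cutoff_const) + 3 * (36 * cutoff_const^2 * newton_const)"

text \<open>The error of the approximate projection gains a factor \<open>1 / R\<close> after one differentiation, with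
 no derivative of \<open>u\<close> on the right.  The second derivatives of potentials that occur are controlled
 by their Laplacian.\<close>

lemma l2_pd_leray_err:
 fixes u :: vfield
 assumes R: "0 < \<epsilon>" "\<epsilon> < R" and u: "!!i. smooth (u i)" "!!i. sq_int (u i)" "!!i. l2 (u i) <= N"
  and div: "!!x. (\<S> i. pd i (u i) x) = 0"
 shows "l2 (pd k (leray_err \<epsilon> R u i)) <= err_const * N / R"
proof -
 have R0: "0 < R" using R by simp
 define \<phi> where "\<phi> = cutoff R"
 define M where "M = conv (newton \<epsilon> R)"
 define a where "a = (%i x. cutoff R x * u i x)"
 define b where "b = cut_swirl R u"
 define c where "c = cut_flux R u"
 have ta: "test (a i)" for i unfolding a_def using test_cutoff[OF R0] u by (intro test_mult_right)
 have tb: "test (b j i)" for j i unfolding b_def by (rule leray_err_expansion(3)[OF R u(1) div])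
 have tc: "test c" unfolding c_def by (rule leray_err_expansion(4)[OF R u(1) div])
 have t\<phi>: "test \<phi>" unfolding \<phi>_def by (rule test_cutoff[OF R0])
 have tm: "test (newton \<epsilon> R)" by (rule test_newton[OF R0])
 have tM: "test (M g)" if "test g" for g unfolding M_def by (rule test_conv[OF tm that])
 let ?c = cutoff_const and ?n = newton_const
 have c0: "0 < ?c" "0 <= ?n" using cutoff_const(1) newton_const_nonneg by auto
 have N: "0 <= N" using u(3) l2_nonneg order_trans by blast
 have na: "l2 (a i) <= N" for i
  using l2_cut_u[OF R0 u(2)] u(3) unfolding a_def by (meson order_trans)
 have nb: "l2 (b j i) <= 18 * ?c * N / R" for j i unfolding b_def by (rule cut_flux_swirl_l2_N[OF R0 u])
 have nc: "l2 c <= 18 * ?c * N / R" unfolding c_def by (rule cut_flux_swirl_l2_N[OF R0 u])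
 have p0: "\<bar>\<phi> x\<bar> <= 1" "\<bar>pd k \<phi> x\<bar> <= ?c / R" for k x
  unfolding \<phi>_def using cutoff_bounds cutoff_const(2)[OF R0] by auto
 have p1: "\<bar>pd k (pd j \<phi>) x\<bar> <= ?c / R^2" for k j x
  unfolding \<phi>_def using cutoff_const(3)[OF R0] by auto
 have B2: "l2 (M g) <= ?n * R^2 * G" "l2 (pd i (M g)) <= ?n * R * G" "l2 (pd k (pd i (M g))) <= 2 * G"
  if "test g" "l2 g <= G" for g G i k
 proof -
  note nb = newton_conv_bounds[OF R that(1), folded M_def]
  show "l2 (M g) <= ?n * R^2 * G"
   by (rule order_trans[OF nb(1)]) (use c0 that in \<open>auto intro: mult_left_mono\<close>)
  show "l2 (pd i (M g)) <= ?n * R * G"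
   by (rule order_trans[OF nb(2)]) (use c0 that R0 in \<open>auto intro: mult_left_mono\<close>)
  show "l2 (pd k (pd i (M g))) <= 2 * G" using nb(3)[of k i] that by linarith
 qed
 have T1: "l2 (pd k (%x. \<phi> x * conv (mol R) (a i) x)) <= (?c + rho_const) * N / R"
 proof -
  have "l2 (conv (mol R) (a i)) <= N"
   using l2_conv[OF test_mol[OF R0] ta[of i]] na[of i] by (simp add: integral_abs_mol[OF R0])
  moreover have "l2 (pd k (conv (mol R) (a i))) <= rho_const / R * N"
   unfolding dir_deriv_conv[OF test_smooth[OF test_mol[OF R0]] ta[of i]]
   by (rule order_trans[OF l2_conv[OF test_dir_deriv[OF test_mol[OF R0]] ta[of i]]])
     (rule mult_mono[OF rho_const[OF R0] na], use rho_const_nonneg R0 in auto)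
  ultimately have "l2 (pd k (%x. \<phi> x * conv (mol R) (a i) x)) <= ?c / R * N + 1 * (rho_const / R * N)"
   by (intro l2_product_bounds(2) t\<phi> test_conv test_mol R0 ta p0)
  then show ?thesis by (simp add: add_divide_distrib algebra_simps)
 qed
 have T2: "l2 (pd k (%x. \<phi> x * pd j (M g) x)) <= (18 * ?c^2 * ?n + 36 * ?c) * N / R"
  if "test g" "l2 g <= 18 * ?c * N / R" for g j
 proof -
  have "l2 (pd k (%x. \<phi> x * pd j (M g) x)) <= ?c / R * (?n * R * (18 * ?c * N / R)) + 1 * (2 * (18 * ?c * N / R))"
   by (intro l2_product_bounds(2) t\<phi> test_dir_deriv tM that p0 B2)
  also have "... = (18 * ?c^2 * ?n + 36 * ?c) * N / R" using R0 by (simp add: field_simps power2_eq_square)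
  finally show ?thesis .
 qed
 have T4: "l2 (pd k (%x. pd j \<phi> x * pd l (M (a m)) x)) <= (?c * ?n + 2 * ?c) * N / R" for j l m
 proof -
  have "l2 (pd k (%x. pd j \<phi> x * pd l (M (a m)) x)) <= ?c / R^2 * (?n * R * N) + ?c / R * (2 * N)"
   by (intro l2_product_bounds(2) t\<phi> test_dir_deriv tM ta p0 p1 B2 na)
  also have "... = (?c * ?n + 2 * ?c) * N / R" using R0 by (simp add: field_simps power2_eq_square)
  finally show ?thesis .
 qed
 have T5: "l2 (pd k (%x. pd j \<phi> x * M (b j i) x)) <= (36 * ?c^2 * ?n) * N / R" for j
 proof -
  have "l2 (pd k (%x. pd j \<phi> x * M (b j i) x)) <= ?c / R^2 * (?n * R^2 * (18 * ?c * N / R)) + ?c / R * (?n * R * (18 * ?c * N / R))"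
   by (intro l2_product_bounds(2) t\<phi> test_dir_deriv tM tb p0 p1 B2 nb)
  also have "... = (36 * ?c^2 * ?n) * N / R" using R0 by (simp add: field_simps power2_eq_square)
  finally show ?thesis .
 qed
 define F1 where "F1 = (%x. \<phi> x * conv (mol R) (a i) x)"
 define F2 where "F2 = (%x. \<phi> x * pd i (M c) x)"
 define F3 where "F3 = (%j x. \<phi> x * pd j (M (b j i)) x)"
 define F4 where "F4 = (%j x. pd j \<phi> x * pd j (M (a i)) x)"
 define F5 where "F5 = (%j x. pd j \<phi> x * pd i (M (a j)) x)"
 define F6 where "F6 = (%j x. pd j \<phi> x * M (b j i) x)"
 have tF: "test F1" "test F2" "test (F3 j)" "test (F4 j)" "test (F5 j)" "test (F6 j)" for j
  unfolding F1_def F2_def F3_def F4_def F5_def F6_def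
  by (intro test_mult_left test_smooth[OF t\<phi>] test_dir_deriv test_conv test_mol R0 ta tM tb tc smooth_dir_deriv)+
 have E: "leray_err \<epsilon> R u i = (%x. - F1 x + F2 x + (\<S> j. F3 j x) - (\<S> j. F4 j x) + (\<S> j. F5 j x) + (\<S> j. F6 j x))"
  using leray_err_expansion(1)[OF R u(1) div, of i]
  unfolding F1_def F2_def F3_def F4_def F5_def F6_def \<phi>_def M_def b_def c_def a_def by blast
 have sF: "smooth F1" "smooth F2" "smooth (F3 j)" "smooth (F4 j)" "smooth (F5 j)" "smooth (F6 j)" for j
  using tF test_smooth by blast+
 have pE: "pd k (leray_err \<epsilon> R u i) = (%x. - pd k F1 x + pd k F2 x + (\<S> j. pd k (F3 j) x) - (\<S> j. pd k (F4 j) x)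
   + (\<S> j. pd k (F5 j) x) + (\<S> j. pd k (F6 j) x))"
  unfolding E by (simp add: dir_deriv_add dir_deriv_diff dir_deriv_minus dir_deriv_sum sF smooth_add smooth_diff smooth_minus smooth_sum)
 have q: "sq_int (pd k F1)" "sq_int (pd k F2)" "sq_int (pd k (F3 j))" "sq_int (pd k (F4 j))" "sq_int (pd k (F5 j))" "sq_int (pd k (F6 j))" for j
  using tF test_dir_deriv test_sq_int by blast+
 have "l2 (pd k (leray_err \<epsilon> R u i)) <= l2 (pd k F1) + l2 (pd k F2) + (\<S> j. l2 (pd k (F3 j))) + (\<S> j. l2 (pd k (F4 j)))
   + (\<S> j. l2 (pd k (F5 j))) + (\<S> j. l2 (pd k (F6 j)))"
  unfolding pE
  by (intro order_trans[OF l2_triangle] order_trans[OF l2_triangle_diff] add_mono l2_sum q sq_int_add sq_int_diff sq_int_minus sq_int_sum)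
   (simp_all add: q)
 also have "... <= (?c + rho_const) * N / R + (18 * ?c^2 * ?n + 36 * ?c) * N / R + (\<Sum>j\<in>(UNIV::3 set). (18 * ?c^2 * ?n + 36 * ?c) * N / R)
   + (\<Sum>j\<in>(UNIV::3 set). (?c * ?n + 2 * ?c) * N / R) + (\<Sum>j\<in>(UNIV::3 set). (?c * ?n + 2 * ?c) * N / R) + (\<Sum>j\<in>(UNIV::3 set). (36 * ?c^2 * ?n) * N / R)"
  unfolding F1_def F2_def F3_def F4_def F5_def F6_def
  by (intro add_mono sum_mono T1 T2 T4 T5 tb tc nb nc)
 also have "... = err_const * N / R"
  unfolding err_const_def by (simp add: add_divide_distrib algebra_simps)
 finally show ?thesis .
qed

definition pair_const :: real where
 "pair_const = 7 * newton_const + 6 * newton_const + 54 * cutoff_const * newton_const"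

text \<open>In contrast to its gradient the error itself is only bounded in norm, because of the terms with the
 potential of \<open>\<phi> u\<close>.  Their weight is a derivative of the cutoff, which can be moved to \<open>g\<close>.\<close>

lemma pairing_leray_err:
 fixes u :: vfield
 assumes R: "0 < \<epsilon>" "\<epsilon> < R" and u: "!!i. smooth (u i)" "!!i. sq_int (u i)" "!!i. l2 (u i) <= N"
  and div: "!!x. (\<S> i. pd i (u i) x) = 0" and g: "sq_int g"
 shows "\<bar>\<L> x. g x * leray_err \<epsilon> R u i x\<bar>
   <= l2 g * l2 (conv (mol R) (%x. cutoff R x * u i x)) + pair_const * (l2 g * (\<S> l. edge R (u l)) + N * edge R g)"
proof -
 have R0: "0 < R" using R by simp
 define \<phi> where "\<phi> = cutoff R"
 define M where "M = conv (newton \<epsilon> R)"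
 define a where "a = (%i x. cutoff R x * u i x)"
 define b where "b = cut_swirl R u"
 define c where "c = cut_flux R u"
 define d where "d = (\<S> l. edge R (u l))"
 have d0: "0 <= d" unfolding d_def by (simp add: edge_nonneg sum_nonneg)
 have ta: "test (a i)" for i unfolding a_def using test_cutoff[OF R0] u by (intro test_mult_right)
 have tb: "test (b j i)" for j i unfolding b_def by (rule leray_err_expansion(3)[OF R u(1) div])
 have tc: "test c" unfolding c_def by (rule leray_err_expansion(4)[OF R u(1) div])
 have t\<phi>: "test \<phi>" unfolding \<phi>_def by (rule test_cutoff[OF R0])
 have tm: "test (newton \<epsilon> R)" by (rule test_newton[OF R0])
 have tM: "test (M g)" if "test g" for g unfolding M_def by (rule test_conv[OF tm that])
 let ?c = cutoff_const and ?n = newton_const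
 have c0: "0 < ?c" "0 <= ?n" using cutoff_const(1) newton_const_nonneg by auto
 have N: "0 <= N" using u(3) l2_nonneg order_trans by blast
 have na: "l2 (a i) <= N" for i
  using l2_cut_u[OF R0 u(2)] u(3) unfolding a_def by (meson order_trans)
 have nb: "l2 (b j i) <= 2 * d / R" for j i unfolding b_def d_def by (rule cut_flux_swirl_l2[OF R0 u(1,2)])
 have nb': "l2 (b j i) <= 18 * ?c * N / R" for j i unfolding b_def by (rule cut_flux_swirl_l2_N[OF R0 u])
 have nc: "l2 c <= d / R" unfolding c_def d_def by (rule cut_flux_swirl_l2[OF R0 u(1,2)])
 have B2: "l2 (M g) <= ?n * R^2 * G" "l2 (pd i (M g)) <= ?n * R * G"
  if "test g" "l2 g <= G" for g G i
 proof -
  note nb = newton_conv_bounds[OF R that(1), folded M_def]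
  show "l2 (M g) <= ?n * R^2 * G"
   by (rule order_trans[OF nb(1)]) (use c0 that in \<open>auto intro: mult_left_mono\<close>)
  show "l2 (pd i (M g)) <= ?n * R * G"
   by (rule order_trans[OF nb(2)]) (use c0 that R0 in \<open>auto intro: mult_left_mono\<close>)
 qed
 have P: "\<bar>\<L> x. g x * (\<psi> x * F x)\<bar> <= A * B" if "test \<psi>" "test F" "l2 (%x. \<psi> x * g x) <= A" "l2 F <= B" for \<psi> F A B
 proof -
  note t = that
  obtain B0 where B0: "!!x. \<bar>\<psi> x\<bar> <= B0" using test_bounded[OF t(1)] by blast
  have "\<bar>\<L> x. (\<psi> x * g x) * F x\<bar> <= l2 (%x. \<psi> x * g x) * l2 F"
   by (intro l2_Cauchy_Schwarz test_sq_int t sq_int_mult_bounded(1)[OF g test_borel[OF t(1)] B0])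
  also have "... <= A * B" using t by (intro mult_mono) (auto intro: order_trans[OF l2_nonneg])
  finally show ?thesis by (simp add: algebra_simps)
 qed
 have gphi: "l2 (%x. \<phi> x * g x) <= l2 g" unfolding \<phi>_def by (rule l2_cut_u[OF R0 g])
 have gpd: "l2 (%x. pd j \<phi> x * g x) <= edge R g / R" for j unfolding \<phi>_def by (rule edge_component[OF R0])
 define F1 where "F1 = (%x. \<phi> x * conv (mol R) (a i) x)"
 define F2 where "F2 = (%x. \<phi> x * pd i (M c) x)"
 define F3 where "F3 = (%j x. \<phi> x * pd j (M (b j i)) x)"
 define F4 where "F4 = (%j x. pd j \<phi> x * pd j (M (a i)) x)"
 define F5 where "F5 = (%j x. pd j \<phi> x * pd i (M (a j)) x)"
 define F6 where "F6 = (%j x. pd j \<phi> x * M (b j i) x)"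
 have tF: "test F1" "test F2" "test (F3 j)" "test (F4 j)" "test (F5 j)" "test (F6 j)" for j
  unfolding F1_def F2_def F3_def F4_def F5_def F6_def
  by (intro test_mult_left test_smooth[OF t\<phi>] test_dir_deriv test_conv test_mol R0 ta tM tb tc smooth_dir_deriv)+
 have E: "leray_err \<epsilon> R u i = (%x. - F1 x + F2 x + (\<S> j. F3 j x) - (\<S> j. F4 j x) + (\<S> j. F5 j x) + (\<S> j. F6 j x))"
  using leray_err_expansion(1)[OF R u(1) div, of i]
  unfolding F1_def F2_def F3_def F4_def F5_def F6_def \<phi>_def M_def b_def c_def a_def by blast
 have I: "integrable lborel (%x. g x * F x)" if "test F" for F
  by (rule sq_int_mult_integrable[OF g test_sq_int[OF that]])
 have split: "(\<L> x. g x * leray_err \<epsilon> R u i x) = - (\<L> x. g x * F1 x) + (\<L> x. g x * F2 x)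
   + (\<S> j. \<L> x. g x * F3 j x) - (\<S> j. \<L> x. g x * F4 j x) + (\<S> j. \<L> x. g x * F5 j x)
   + (\<S> j. \<L> x. g x * F6 j x)"
 proof -
  have "(%x. g x * leray_err \<epsilon> R u i x) = (%x. - (g x * F1 x) + g x * F2 x + (\<S> j. g x * F3 j x) - (\<S> j. g x * F4 j x)
    + (\<S> j. g x * F5 j x) + (\<S> j. g x * F6 j x))"
   unfolding E by (simp add: algebra_simps sum_distrib_left)
  then show ?thesis by (simp add: I tF)
 qed
 have "\<bar>\<L> x. g x * leray_err \<epsilon> R u i x\<bar> <= \<bar>\<L> x. g x * F1 x\<bar> + \<bar>\<L> x. g x * F2 x\<bar>
   + (\<S> j. \<bar>\<L> x. g x * F3 j x\<bar>) + (\<S> j. \<bar>\<L> x. g x * F4 j x\<bar>) + (\<S> j. \<bar>\<L> x. g x * F5 j x\<bar>)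
   + (\<S> j. \<bar>\<L> x. g x * F6 j x\<bar>)"
  unfolding split using sum_abs[of "%j. \<L> x. g x * F3 j x" UNIV] sum_abs[of "%j. \<L> x. g x * F4 j x" UNIV]
   sum_abs[of "%j. \<L> x. g x * F5 j x" UNIV] sum_abs[of "%j. \<L> x. g x * F6 j x" UNIV] by linarith
 also have "... <= l2 g * l2 (conv (mol R) (a i)) + l2 g * (?n * R * (d / R)) + (\<Sum>j\<in>(UNIV::3 set). l2 g * (?n * R * (2 * d / R)))
   + (\<Sum>j\<in>(UNIV::3 set). edge R g / R * (?n * R * N)) + (\<Sum>j\<in>(UNIV::3 set). edge R g / R * (?n * R * N))
   + (\<Sum>j\<in>(UNIV::3 set). edge R g / R * (?n * R^2 * (18 * ?c * N / R)))"
  unfolding F1_def F2_def F3_def F4_def F5_def F6_def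
  by (intro add_mono sum_mono P t\<phi> test_dir_deriv test_conv test_mol R0 ta tM tb tc gphi gpd B2 na nb nb' nc order_refl)
 also have "... = l2 g * l2 (conv (mol R) (a i)) + (l2 g * d * (7 * ?n) + N * edge R g * (6 * ?n + 54 * ?c * ?n))"
  using R0 by (simp add: field_simps power2_eq_square)
 also have "... <= l2 g * l2 (conv (mol R) (a i)) + (l2 g * d * (7 * ?n + 6 * ?n + 54 * ?c * ?n) + N * edge R g * (7 * ?n + 6 * ?n + 54 * ?c * ?n))"
  using c0 d0 N edge_nonneg[of R g] by (intro add_left_mono add_mono mult_left_mono) auto
 finally show ?thesis unfolding a_def d_def pair_const_def by (simp add: algebra_simps)
qed

text \<open>Split off a fixed compactly supported part of \<open>f\<close>; on it the wide mollifier is small in \<open>L\<^sup>2\<close>, and the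
 remainder is small by itself.\<close>

lemma conv_mol_vanishes:
 assumes f: "sq_int f" "smooth f"
 shows "(%n. l2 (conv (mol (real (Suc n))) (%x. cutoff (real (Suc n)) x * f x))) ----> 0"
proof -
 define \<phi> where "\<phi> n = cutoff (real (Suc n))" for n
 define D where "D n = l2 (%x. (1 - \<phi> n x) * f x)" for n
 have t\<phi>: "test (\<phi> n)" for n unfolding \<phi>_def by (rule test_cutoff) simp
 have bd: "\<bar>1 - \<phi> n x\<bar> <= 1" for n x using cutoff_bounds[of "real (Suc n)" x] by (auto simp: \<phi>_def)
 have [measurable]: "meas f" "meas (\<phi> n)" for n
  using f t\<phi> test_borel by (auto simp: sq_int_borel)
 have qD: "sq_int (%x. (1 - \<phi> n x) * f x)" for n
  by (rule sq_int_mult_bounded(1)[OF f(1) _ bd]) measurable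
 have D: "D ----> 0"
 proof -
  have "(%n. \<L> x. ((1 - \<phi> n x) * f x)^2) ----> (\<L> x::real^3. (0::real))"
  proof (rule integral_dominated_convergence[where f = "%_. 0" and w = "%x. (f x)^2" and s = "%n x. ((1 - \<phi> n x) * f x)^2"])
   show "integrable lborel (%x. (f x)^2)" using f by (simp add: sq_int_def)
   show "AE x in lborel. (%n. ((1 - \<phi> n x) * f x)^2) ----> 0"
   proof (rule AE_I2)
    fix x
    have "(%n. ((1 - \<phi> n x) * f x)^2) ----> ((1 - 1) * f x)^2"
     unfolding \<phi>_def by (intro tendsto_intros cutoff_tendsto)
    then show "(%n. ((1 - \<phi> n x) * f x)^2) ----> 0" by simp
   qed
   show "AE x in lborel. norm (((1 - \<phi> n x) * f x)^2) <= (f x)^2" for n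
   proof (rule AE_I2)
    fix x
    have "\<bar>1 - \<phi> n x\<bar>^2 <= 1" using power_mono[OF bd[of n x], of 2] by simp
    then show "norm (((1 - \<phi> n x) * f x)^2) <= (f x)^2"
     using mult_right_mono[of "(1 - \<phi> n x)^2" 1 "(f x)^2"] by (simp add: power_mult_distrib)
   qed
  qed measurable
  then show ?thesis unfolding D_def l2_def using tendsto_real_sqrt by fastforce
 qed
 have main: "l2 (conv (mol (real (Suc n))) (%x. \<phi> n x * f x)) <= D k + D n + l2 rho / sqrt (real (Suc n) ^ 3) * (\<L> x. \<bar>\<phi> k x * f x\<bar>)" for n k
 proof -
  have tn: "test (%x. \<phi> n x * f x)" "test (%x. \<phi> k x * f x)" using t\<phi> f by (auto intro: test_mult_right)
  have tmol: "test (mol (real (Suc n)))" by (rule test_mol) simp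
  have "conv (mol (real (Suc n))) (%x. \<phi> n x * f x) =
   (%x. conv (mol (real (Suc n))) (%x. \<phi> n x * f x - \<phi> k x * f x) x + conv (mol (real (Suc n))) (%x. \<phi> k x * f x) x)"
   using tn tmol by (simp add: conv_diff test_smooth)
  then have "l2 (conv (mol (real (Suc n))) (%x. \<phi> n x * f x))
   <= l2 (conv (mol (real (Suc n))) (%x. \<phi> n x * f x - \<phi> k x * f x)) + l2 (conv (mol (real (Suc n))) (%x. \<phi> k x * f x))"
   using l2_triangle[OF test_sq_int[OF test_conv[OF tmol test_diff[OF tn]]] test_sq_int[OF test_conv[OF tmol tn(2)]]] by simp
  also have "l2 (conv (mol (real (Suc n))) (%x. \<phi> n x * f x - \<phi> k x * f x)) <= l2 (%x. \<phi> n x * f x - \<phi> k x * f x)"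
   using l2_conv[OF tmol test_diff[OF tn]] by (simp add: integral_abs_mol)
  also have "(%x. \<phi> n x * f x - \<phi> k x * f x) = (%x. (1 - \<phi> k x) * f x - (1 - \<phi> n x) * f x)" by (auto simp: algebra_simps)
  also have "l2 (%x. (1 - \<phi> k x) * f x - (1 - \<phi> n x) * f x) <= D k + D n"
   unfolding D_def by (intro l2_triangle_diff qD)
  also have "l2 (conv (mol (real (Suc n))) (%x. \<phi> k x * f x)) <= l2 (mol (real (Suc n))) * (\<L> x. \<bar>\<phi> k x * f x\<bar>)"
   by (rule l2_conv'[OF tmol tn(2)])
  also have "l2 (mol (real (Suc n))) = l2 rho / sqrt (real (Suc n) ^ 3)"
  proof -
   have "l2 (mol (real (Suc n))) = sqrt ((l2 rho)^2 / real (Suc n) ^ 3)"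
    using l2_mol[of "real (Suc n)"] by (metis l2_nonneg of_nat_0_less_iff real_sqrt_unique zero_less_Suc)
   then show ?thesis by (simp add: real_sqrt_divide)
  qed
  finally show ?thesis by simp
 qed
 show ?thesis unfolding \<phi>_def[symmetric]
 proof (rule LIMSEQ_I)
  fix e :: real assume e: "0 < e"
  obtain k where k: "D k < e / 3" using LIMSEQ_D[OF D, of "e / 3"] e by (auto simp: D_def)
  define L where "L = (\<L> x. \<bar>\<phi> k x * f x\<bar>)"
  have "(%n. 1 / sqrt (real (Suc n) ^ 3)) ----> 0" by real_asymp
  from tendsto_mult_right_zero[OF this, of "l2 rho * L"]
  have "(%n. l2 rho / sqrt (real (Suc n) ^ 3) * L) ----> 0" by simp
  then obtain n1 where n1: "!!n. n \<ge> n1 ==> \<bar>l2 rho / sqrt (real (Suc n) ^ 3) * L\<bar> < e / 3"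
   using LIMSEQ_D[of _ 0 "e / 3"] e by fastforce
  obtain n2 where n2: "!!n. n \<ge> n2 ==> D n < e / 3" using LIMSEQ_D[OF D, of "e / 3"] e by (auto simp: D_def)
  have "norm (l2 (conv (mol (real (Suc n))) (%x. \<phi> n x * f x)) - 0) < e" if "n \<ge> max n1 n2" for n
  proof -
   have "l2 rho / sqrt (real (Suc n) ^ 3) * L < e / 3"
    by (rule le_less_trans[OF abs_ge_self n1]) (use that in simp)
   moreover have "D n < e / 3" by (rule n2) (use that in simp)
   ultimately have "l2 (conv (mol (real (Suc n))) (%x. \<phi> n x * f x)) < e"
    using main[of n k] k unfolding L_def[symmetric] by linarith
   then show ?thesis by (simp del: of_nat_Suc)
  qed
  then show "\<exists>no. \<forall>n\<ge>no. norm (l2 (conv (mol (real (Suc n))) (%x. \<phi> n x * f x)) - 0) < e" by blast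
 qed
qed

section \<open>A Ladyzhenskaya inequality\<close>

definition coord3 :: "(real \<times> real) \<times> real => real^3" where
 "coord3 p = fst (fst p) *\<^sub>R axis 1 1 + snd (fst p) *\<^sub>R axis 2 1 + snd p *\<^sub>R axis 3 1"

lemma coord3_nth: "coord3 p $ 1 = fst (fst p)" "coord3 p $ 2 = snd (fst p)" "coord3 p $ 3 = snd p"
 by (simp_all add: coord3_def axis_def)

lemma continuous_coord3 [continuous_intros]: "continuous_on S coord3"
 unfolding coord3_def[abs_def] by (intro continuous_intros)

lemma measurable_coord3 [measurable]: "meas coord3"
 by (intro borel_measurable_continuous_onI continuous_coord3)

lemma prod_Basis_vec3: "(\<Prod>b\<in>(Basis :: (real^3) set). v \<bullet> b) = v $ 1 * v $ 2 * v $ 3"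
proof -
 have B: "(Basis :: (real^3) set) = (%i. axis i 1) ` UNIV" by (auto simp: Basis_vec_def)
 have inj: "inj (%i. axis i (1::real) :: real^3)" by (auto simp: inj_def axis_eq_axis)
 have "(\<Prod>b\<in>(Basis :: (real^3) set). v \<bullet> b) = (\<Prod>i\<in>UNIV. v \<bullet> axis i 1)"
  unfolding B prod.reindex[OF inj] o_def ..
 also have "... = (\<Prod>i\<in>UNIV. v $ i)" by (simp only: inner_axis) simp
 also have "... = v $ 1 * v $ 2 * v $ 3" unfolding UNIV_3 by (simp add: mult.assoc)
 finally show ?thesis .
qed

lemma distr_coord3: "distr lborel borel coord3 = lborel"
proof (rule lborel_eqI[symmetric])
 fix l u :: "real^3" assume lu: "!!b. b \<in> Basis ==> l \<bullet> b <= u \<bullet> b"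
 have le: "l $ i <= u $ i" for i using lu[of "axis i 1"] by (simp add: inner_axis)
 have pre: "coord3 -` box l u = ({l$1<..<u$1} \<times> {l$2<..<u$2}) \<times> {l$3<..<u$3}"
  by (auto simp: mem_box_cart forall_3 coord3_nth)
 have "emeasure (distr lborel borel coord3) (box l u) = emeasure lborel (coord3 -` box l u)"
  by (subst emeasure_distr) auto
 also have "... = emeasure (lborel \<Otimes>\<^sub>M lborel) (({l$1<..<u$1} \<times> {l$2<..<u$2}) \<times> {l$3<..<u$3})"
  unfolding pre lborel_prod ..
 also have "... = emeasure (lborel \<Otimes>\<^sub>M lborel) ({l$1<..<u$1} \<times> {l$2<..<u$2}) * emeasure lborel {l$3<..<u$3}"
  by (subst lborel.emeasure_pair_measure_Times) (auto simp: lborel_prod intro!: borel_open open_Times)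
 also have "... = ennreal (u$1 - l$1) * ennreal (u$2 - l$2) * ennreal (u$3 - l$3)"
  by (subst lborel.emeasure_pair_measure_Times) (use le in auto)
 also have "... = ennreal (\<Prod>b\<in>Basis. (u - l) \<bullet> b)"
  using le unfolding prod_Basis_vec3 by (simp add: ennreal_mult)
 finally show "emeasure (distr lborel borel coord3) (box l u) = ennreal (\<Prod>b\<in>Basis. (u - l) \<bullet> b)" .
qed simp

lemma nn_integral_coord3:
 assumes [measurable]: "meas f"
 shows "(\<N> x. f x) = (\<N> z. \<N> w. f (coord3 (w, z)))"
proof -
 have "(\<N> x. f x) = (\<N> p. f (coord3 p))"
  by (subst distr_coord3[symmetric], subst nn_integral_distr) auto
 also have "... = (\<integral>\<^sup>+p. f (coord3 p) \<partial>(lborel \<Otimes>\<^sub>M lborel))" by (simp add: lborel_prod)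
 also have "... = (\<N> z. \<N> w. f (coord3 (w, z)))"
  by (rule lborel_pair.nn_integral_snd[symmetric]) (simp add: lborel_prod)
 finally show ?thesis .
qed

text \<open>One-dimensional Sobolev embedding along a coordinate line.\<close>

lemma square_le_line_integral:
 fixes f :: "real^3 => real"
 assumes f: "test f"
 shows "ennreal ((f (p + s *\<^sub>R axis i 1))^2) <= (\<integral>\<^sup>+t. ennreal (2 * \<bar>f (p + t *\<^sub>R axis i 1) * pd i f (p + t *\<^sub>R axis i 1)\<bar>) \<partial>lborel)"
proof -
 define g where "g t = f (p + t *\<^sub>R axis i 1)" for t
 define g' where "g' t = pd i f (p + t *\<^sub>R axis i 1)" for t
 have d: "(g has_real_derivative g' t) (at t)" for t
  unfolding g_def g'_def by (rule dir_deriv_along_line[OF test_smooth[OF f]])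
 have c: "continuous_on S g" "continuous_on S g'" for S
 proof -
  have l: "continuous_on S (%t. p + t *\<^sub>R axis i 1)" by (intro continuous_intros)
  note sm = test_smooth[OF f]
  show "continuous_on S g" unfolding g_def
   by (rule continuous_on_compose2[OF smooth_cont[OF sm, of UNIV] l]) simp
  show "continuous_on S g'" unfolding g'_def
   by (rule continuous_on_compose2[OF smooth_cont[OF smooth_dir_deriv[OF sm], of UNIV] l]) simp
 qed
 have [measurable]: "meas g" "meas g'"
  using c by (auto intro: borel_measurable_continuous_onI)
 obtain r where r: "!!x. r < norm x ==> f x = 0" using test_bounded_supp[OF f] by blast
 define a where "a = - (\<bar>r\<bar> + norm p + \<bar>s\<bar> + 1)"
 have "g a = 0" unfolding g_def
 proof (rule r)
  have "\<bar>a\<bar> = norm (a *\<^sub>R (axis i 1 :: real^3))" by simp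
  also have "... <= norm (p + a *\<^sub>R axis i 1) + norm p" using norm_triangle_ineq4[of "p + a *\<^sub>R axis i 1" p] by (simp only: add_diff_cancel_left')
  finally have "\<bar>a\<bar> <= norm (p + a *\<^sub>R axis i 1) + norm p" .
  moreover have "\<bar>a\<bar> = \<bar>r\<bar> + norm p + \<bar>s\<bar> + 1"
   unfolding a_def abs_minus_cancel using norm_ge_zero[of p] by (intro abs_of_nonneg) linarith
  ultimately show "r < norm (p + a *\<^sub>R axis i 1)" by linarith
 qed
 have as: "a <= s" unfolding a_def using norm_ge_zero[of p] by linarith
 have "(LINT t:{a..s}|lborel. 2 * (g t * g' t)) = (g s)^2 - (g a)^2"
  by (rule FTC_lborel[OF as]) (auto intro!: derivative_eq_intros d continuous_intros c)
 then have "(g s)^2 = (LINT t:{a..s}|lborel. 2 * (g t * g' t))" using \<open>g a = 0\<close> by simp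
 also have "... <= (\<L> t. \<bar>indicator {a..s} t *\<^sub>R (2 * (g t * g' t))\<bar>)"
  unfolding set_lebesgue_integral_def using integral_abs_bound abs_le_D1 by blast
 finally have "ennreal ((g s)^2) <= ennreal (\<L> t. \<bar>indicator {a..s} t *\<^sub>R (2 * (g t * g' t))\<bar>)" by (rule ennreal_leI)
 also have "... = (\<integral>\<^sup>+t. ennreal \<bar>indicator {a..s} t *\<^sub>R (2 * (g t * g' t))\<bar> \<partial>lborel)"
 proof (rule nn_integral_eq_integral[symmetric])
  show "integrable lborel (%t. \<bar>indicator {a..s} t *\<^sub>R (2 * (g t * g' t))\<bar>)"
   by (intro integrable_abs borel_integrable_compact compact_Icc continuous_intros c)
 qed simp
 also have "... <= (\<N> t. ennreal (2 * \<bar>g t * g' t\<bar>))"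
  by (intro nn_integral_mono ennreal_leI) (auto simp: indicator_def abs_mult)
 finally show ?thesis unfolding g_def g'_def .
qed

lemma coord3_shift: "coord3 ((x, y), z) = coord3 ((0, y), z) + x *\<^sub>R axis 1 1"
 "coord3 ((x, y), z) = coord3 ((x, 0), z) + y *\<^sub>R axis 2 1"
 "coord3 (w, z) = coord3 (w, 0) + z *\<^sub>R axis 3 1"
 by (auto simp: coord3_def)

lemma nn_integral_sq: "sq_int f ==> (\<integral>\<^sup>+x. ennreal ((f x)^2) \<partial>lborel) = ennreal ((l2 f)^2)"
 unfolding l2_power2 sq_int_def by (intro nn_integral_eq_integral) auto

text \<open>In each horizontal plane the square of \<open>f\<close> is bounded by a function of one coordinate and by a function of the
 other one, and the fourth power by their product, whose integral factors.  The third coordinate is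
 controlled by the one-dimensional embedding.\<close>

lemma Ladyzhenskaya_test:
 fixes f :: "real^3 => real"
 assumes f: "test f"
 shows "(\<N> x. ennreal ((f x) ^ 4)) <= ennreal (2 * ((l2 f)^2 + (l2 (pd 3 f))^2) * ((l2 (pd 1 f))^2 + (l2 (pd 2 f))^2))"
proof -
 have [measurable]: "meas f" "meas (pd i f)" for i
  using f test_borel test_dir_deriv by blast+
 define F where "F w z = f (coord3 (w, z))" for w z
 define G where "G i w z = pd i f (coord3 (w, z))" for i w z
 have mF [measurable]: "meas ((%w. F w z))" "meas ((%w. G i w z))"
  "meas (F w)" "meas (G i w)"
  "(%(x, y). F (x, y) z) \<in> borel_measurable (borel \<Otimes>\<^sub>M borel)" "(%(x, y). G i (x, y) z) \<in> borel_measurable (borel \<Otimes>\<^sub>M borel)"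
  "(%(w, z). F w z) \<in> borel_measurable (borel \<Otimes>\<^sub>M borel)" "(%(w, z). G i w z) \<in> borel_measurable (borel \<Otimes>\<^sub>M borel)" for z i w
 proof -
  have c: "continuous_on S f" "continuous_on S (pd i f)" for S i
   using f by (auto intro!: smooth_cont test_smooth smooth_dir_deriv)
  have k: "continuous_on UNIV (%w. h (coord3 (w, z)))" "continuous_on UNIV (%z. h (coord3 (w, z)))" "continuous_on UNIV (%p. h (coord3 p))"
   if "!!S. continuous_on S h" for h :: "real^3 => real" and w z
   by (intro continuous_on_compose2[OF that[of UNIV]] continuous_on_compose2[OF continuous_coord3[of UNIV]] continuous_intros; auto)+
  show "meas ((%w. F w z))" "meas ((%w. G i w z))"
   "meas (F w)" "meas (G i w)" for z i w
   unfolding F_def G_def by (intro borel_measurable_continuous_onI k c)+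
  show "(%(x, y). F (x, y) z) \<in> borel_measurable (borel \<Otimes>\<^sub>M borel)" "(%(x, y). G i (x, y) z) \<in> borel_measurable (borel \<Otimes>\<^sub>M borel)"
   "(%(w, z). F w z) \<in> borel_measurable (borel \<Otimes>\<^sub>M borel)" "(%(w, z). G i w z) \<in> borel_measurable (borel \<Otimes>\<^sub>M borel)" for z i
   unfolding F_def G_def borel_prod split_beta prod.collapse by (intro borel_measurable_continuous_onI k c)+
 qed
 define P where "P i w z = ennreal (2 * \<bar>F w z * G i w z\<bar>)" for i w z
 have mP [measurable]: "meas ((%w. P i w z))" "(%(x, y). P i (x, y) z) \<in> borel_measurable (borel \<Otimes>\<^sub>M borel)" for i z
  unfolding P_def by measurable
 define FF where "FF z = (\<integral>\<^sup>+w. ennreal ((F w z)^2) \<partial>lborel)" for z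
 define XX where "XX i z = (\<integral>\<^sup>+w. ennreal ((G i w z)^2) \<partial>lborel)" for i z
 have [measurable]: "meas (XX i)" for i unfolding XX_def by measurable
 have slice: "(\<N> w. ennreal ((F w z) ^ 4)) <= (\<N> w. P 1 w z) * (\<N> w. P 2 w z)" for z
 proof -
  define A where "A y = (\<N> x. P 1 (x, y) z)" for y
  define B where "B x = (\<N> y. P 2 (x, y) z)" for x
  have [measurable]: "meas A" "meas B" unfolding A_def B_def by measurable
  have 1: "ennreal ((F (x, y) z)^2) <= A y" for x y
   using square_le_line_integral[OF f, of "coord3 ((0, y), z)" x 1]
   unfolding A_def P_def F_def G_def coord3_shift(1)[symmetric] .
  have 2: "ennreal ((F (x, y) z)^2) <= B x" for x y
   using square_le_line_integral[OF f, of "coord3 ((x, 0), z)" y 2]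
   unfolding B_def P_def F_def G_def coord3_shift(2)[symmetric] .
  have "(\<N> w. ennreal ((F w z) ^ 4)) = (\<N> x. \<N> y. ennreal ((F (x, y) z) ^ 4))"
   unfolding lborel_prod[symmetric] by (rule lborel.nn_integral_fst[symmetric], unfold lborel_prod) measurable
  also have "... <= (\<N> x. \<N> y. B x * A y)"
  proof (intro nn_integral_mono)
   fix x y
   have "ennreal ((F (x, y) z) ^ 4) = ennreal ((F (x, y) z)^2) * ennreal ((F (x, y) z)^2)"
    by (simp flip: ennreal_mult power_add)
   also have "... <= B x * A y" by (intro mult_mono 1 2) auto
   finally show "ennreal ((F (x, y) z) ^ 4) <= B x * A y" .
  qed
  also have "... = (\<N> x. B x) * (\<N> y. A y)"
   by (simp add: nn_integral_cmult nn_integral_multc)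
  also have "(\<N> x. B x) = (\<N> w. P 2 w z)" unfolding B_def lborel_prod[symmetric]
   by (rule lborel.nn_integral_fst, unfold lborel_prod) measurable
  also have "(\<N> y. A y) = (\<N> w. P 1 w z)" unfolding A_def lborel_prod[symmetric]
   by (rule lborel_pair.nn_integral_snd, unfold lborel_prod) measurable
  finally show ?thesis by (simp add: mult.commute)
 qed
 have PQ: "(\<N> w. P 1 w z) * (\<N> w. P 2 w z) <= 2 * FF z * (XX 1 z + XX 2 z)" for z
 proof -
  have "(\<N> w. P 1 w z) * (\<N> w. P 2 w z) = (\<N> w. \<N> w'. P 1 w z * P 2 w' z)"
   by (simp add: nn_integral_cmult nn_integral_multc)
  also have "... <= (\<integral>\<^sup>+w. \<integral>\<^sup>+w'. 2 * (ennreal ((G 1 w z)^2) * ennreal ((F w' z)^2) + ennreal ((F w z)^2) * ennreal ((G 2 w' z)^2)) \<partial>lborel \<partial>lborel)"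
  proof (intro nn_integral_mono)
   fix w w'
   have "(2 * \<bar>F w z * G 1 w z\<bar>) * (2 * \<bar>F w' z * G 2 w' z\<bar>) <= 2 * ((G 1 w z)^2 * (F w' z)^2 + (F w z)^2 * (G 2 w' z)^2)"
    using sum_squares_bound[of "\<bar>G 1 w z * F w' z\<bar>" "\<bar>F w z * G 2 w' z\<bar>"] by (simp add: abs_mult power_mult_distrib algebra_simps)
   note le = ennreal_leI[OF this]
   have "P 1 w z * P 2 w' z = ennreal ((2 * \<bar>F w z * G 1 w z\<bar>) * (2 * \<bar>F w' z * G 2 w' z\<bar>))"
    unfolding P_def by (rule ennreal_mult[symmetric]) auto
   moreover have "ennreal (2 * ((G 1 w z)^2 * (F w' z)^2 + (F w z)^2 * (G 2 w' z)^2))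
    = 2 * (ennreal ((G 1 w z)^2) * ennreal ((F w' z)^2) + ennreal ((F w z)^2) * ennreal ((G 2 w' z)^2))"
    by (simp add: ennreal_mult)
   ultimately show "P 1 w z * P 2 w' z <= 2 * (ennreal ((G 1 w z)^2) * ennreal ((F w' z)^2) + ennreal ((F w z)^2) * ennreal ((G 2 w' z)^2))"
    using le by simp
  qed
  also have "... = 2 * (XX 1 z * FF z + FF z * XX 2 z)"
   unfolding XX_def FF_def by (simp add: nn_integral_cmult nn_integral_multc nn_integral_add)
  finally show ?thesis by (simp add: algebra_simps)
 qed
 have sup: "FF z <= ennreal ((l2 f)^2 + (l2 (pd 3 f))^2)" for z
 proof -
  have "FF z <= (\<N> w. \<N> s. P 3 w s)" unfolding FF_def
  proof (rule nn_integral_mono)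
   fix w
   show "ennreal ((F w z)^2) <= (\<N> s. P 3 w s)"
    using square_le_line_integral[OF f, of "coord3 (w, 0)" z 3]
    unfolding P_def F_def G_def coord3_shift(3)[symmetric] .
  qed
  also have "... <= (\<integral>\<^sup>+w. \<integral>\<^sup>+s. ennreal ((F w s)^2 + (G 3 w s)^2) \<partial>lborel \<partial>lborel)"
  proof (intro nn_integral_mono)
   fix w s
   show "P 3 w s <= ennreal ((F w s)^2 + (G 3 w s)^2)" unfolding P_def
    using sum_squares_bound[of "\<bar>F w s\<bar>" "\<bar>G 3 w s\<bar>"] by (intro ennreal_leI) (simp add: abs_mult)
  qed
  also have "... = (\<integral>\<^sup>+s. \<integral>\<^sup>+w. ennreal ((F w s)^2 + (G 3 w s)^2) \<partial>lborel \<partial>lborel)"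
   by (rule lborel_pair.Fubini'[symmetric]) (simp add: split_beta' mF)
  also have "... = (\<integral>\<^sup>+x. ennreal ((f x)^2 + (pd 3 f x)^2) \<partial>lborel)"
   unfolding F_def G_def by (rule nn_integral_coord3[symmetric]) measurable
  also have "... = ennreal ((l2 f)^2 + (l2 (pd 3 f))^2)"
   using nn_integral_sq[OF test_sq_int[OF f]] nn_integral_sq[OF test_sq_int[OF test_dir_deriv[OF f]]]
   by (simp add: nn_integral_add)
  finally show ?thesis .
 qed
 have X: "(\<N> z. XX i z) = ennreal ((l2 (pd i f))^2)" for i
  unfolding XX_def G_def nn_integral_sq[OF test_sq_int[OF test_dir_deriv[OF f]], symmetric]
  by (rule nn_integral_coord3[symmetric]) measurable
 have "(\<N> x. ennreal ((f x) ^ 4)) = (\<N> z. \<N> w. ennreal ((F w z) ^ 4))"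
  unfolding F_def by (rule nn_integral_coord3) measurable
 also have "... <= (\<integral>\<^sup>+z. 2 * ennreal ((l2 f)^2 + (l2 (pd 3 f))^2) * (XX 1 z + XX 2 z) \<partial>lborel)"
 proof (rule nn_integral_mono)
  fix z
  have "2 * FF z * (XX 1 z + XX 2 z) <= 2 * ennreal ((l2 f)^2 + (l2 (pd 3 f))^2) * (XX 1 z + XX 2 z)"
   by (intro mult_right_mono mult_left_mono sup) auto
  then show "(\<N> w. ennreal ((F w z) ^ 4)) <= 2 * ennreal ((l2 f)^2 + (l2 (pd 3 f))^2) * (XX 1 z + XX 2 z)"
   using slice[of z] PQ[of z] order_trans by blast
 qed
 also have "... = 2 * ennreal ((l2 f)^2 + (l2 (pd 3 f))^2) * ((\<N> z. XX 1 z) + (\<N> z. XX 2 z))"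
  by (simp add: nn_integral_cmult nn_integral_add)
 also have "... = ennreal (2 * ((l2 f)^2 + (l2 (pd 3 f))^2) * ((l2 (pd 1 f))^2 + (l2 (pd 2 f))^2))"
  unfolding X by (simp add: ennreal_mult)
 finally show ?thesis .
qed

definition grad_sq :: "(real^3 => real) => real" where
 "grad_sq f = (\<S> i. (l2 (pd i f))^2)"

definition lady_const :: real where "lady_const = 2 * (1 + 2 + 6 * cutoff_const^2)"

lemma lady_const_nonneg: "0 <= lady_const" by (simp add: lady_const_def)

text \<open>The cutoffs of \<open>f\<close> are test functions with uniformly bounded norms; pass to the limit by Fatou's lemma.\<close>

lemma Ladyzhenskaya:
 fixes f :: "real^3 => real"
 assumes f: "smooth f" "sq_int f" "!!i. sq_int (pd i f)"
 shows "sq_int (%x. (f x)^2)" "l2 (%x. (f x)^2) <= lady_const * ((l2 f)^2 + grad_sq f)"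
proof -
 define K where "K = (l2 f)^2 + grad_sq f"
 have K: "0 <= K" "(l2 f)^2 <= K" unfolding K_def grad_sq_def by (auto intro!: add_nonneg_nonneg sum_nonneg)
 define h where "h n x = cutoff (real (Suc n)) x * f x" for n x
 have th: "test (h n)" for n unfolding h_def[abs_def] by (intro test_mult_right test_cutoff f) simp
 have b: "2 * ((l2 (h n))^2 + (l2 (pd 3 (h n)))^2) * ((l2 (pd 1 (h n)))^2 + (l2 (pd 2 (h n)))^2) <= (lady_const * K)^2" for n
 proof -
  have R: "0 < real (Suc n)" by simp
  have 1: "(l2 (h n))^2 <= (l2 f)^2" unfolding h_def[abs_def] by (intro power_mono l2_cut_u[OF R f(2)]) simp
  have 2: "(l2 (pd i (h n)))^2 <= 2 * (l2 (pd i f))^2 + 2 * cutoff_const^2 * (l2 f)^2" for i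
  proof -
   have e: "pd i (h n) = (%x. cutoff (real (Suc n)) x * pd i f x + pd i (cutoff (real (Suc n))) x * f x)"
    unfolding h_def[abs_def] by (intro dir_deriv_mult f test_smooth test_cutoff R)
   have q1: "sq_int (%x. cutoff (real (Suc n)) x * pd i f x)" "l2 (%x. cutoff (real (Suc n)) x * pd i f x) <= l2 (pd i f)"
    using sq_int_mult_bounded[OF f(3) test_borel[OF test_cutoff[OF R]] cutoff_bounds(3), of i] by auto
   have q2: "sq_int (%x. pd i (cutoff (real (Suc n))) x * f x)" "l2 (%x. pd i (cutoff (real (Suc n))) x * f x) <= cutoff_const * l2 f"
   proof -
    have "cutoff_const / real (Suc n) <= cutoff_const" using cutoff_const(1) by (simp add: field_simps)
    then have "\<bar>pd i (cutoff (real (Suc n))) x\<bar> <= cutoff_const" for x using cutoff_const(2)[OF R, of i x] by linarith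
    from sq_int_mult_bounded[OF f(2) test_borel[OF test_dir_deriv[OF test_cutoff[OF R]]] this]
    show "sq_int (%x. pd i (cutoff (real (Suc n))) x * f x)" "l2 (%x. pd i (cutoff (real (Suc n))) x * f x) <= cutoff_const * l2 f" by auto
   qed
   have "l2 (pd i (h n)) <= l2 (pd i f) + cutoff_const * l2 f"
    unfolding e using l2_triangle[OF q1(1) q2(1)] q1(2) q2(2) by linarith
   then have "(l2 (pd i (h n)))^2 <= (l2 (pd i f) + cutoff_const * l2 f)^2" by (intro power_mono) auto
   also have "... <= 2 * (l2 (pd i f))^2 + 2 * cutoff_const^2 * (l2 f)^2"
    using sum_squares_bound[of "l2 (pd i f)" "cutoff_const * l2 f"]
    unfolding power2_sum power_mult_distrib by linarith
   finally show ?thesis .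
  qed
  have "(l2 (pd 1 f))^2 + (l2 (pd 2 f))^2 + (l2 (pd 3 f))^2 = grad_sq f" unfolding grad_sq_def sum_3 ..
  then have g: "(l2 f)^2 + ((l2 (pd 1 f))^2 + (l2 (pd 2 f))^2 + (l2 (pd 3 f))^2) = K" unfolding K_def by simp
  define c where "c = cutoff_const^2 * (l2 f)^2"
  have c: "0 <= c" "c <= cutoff_const^2 * K" unfolding c_def using K by (auto intro: mult_left_mono)
  have s: "0 <= (l2 (pd i f))^2" for i by auto
  have s0: "0 <= (l2 f)^2" by auto
  have "(l2 (h n))^2 + (l2 (pd 3 (h n)))^2 <= 3 * K + 6 * c"
   using 1 2[of 3] g c s[of 1] s[of 2] s[of 3] s0 unfolding c_def by linarith
  moreover have "(l2 (pd 1 (h n)))^2 + (l2 (pd 2 (h n)))^2 <= 3 * K + 6 * c"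
   using 2[of 1] 2[of 2] g c s[of 1] s[of 2] s[of 3] s0 unfolding c_def by linarith
  ultimately have "2 * ((l2 (h n))^2 + (l2 (pd 3 (h n)))^2) * ((l2 (pd 1 (h n)))^2 + (l2 (pd 2 (h n)))^2) <= 2 * (3 * K + 6 * c) * (3 * K + 6 * c)"
   using K c by (intro mult_mono) auto
  also have "... <= (2 * (3 * K + 6 * c)) * (2 * (3 * K + 6 * c))" using K c by (intro mult_mono) auto
  also have "... <= (lady_const * K) * (lady_const * K)"
  proof -
   have q: "2 * (3 * K + 6 * c) <= lady_const * K" using c(2) by (simp add: lady_const_def algebra_simps)
   show ?thesis using K c by (intro mult_mono[OF q q]) (auto simp: lady_const_def)
  qed
  finally show ?thesis by (simp add: power2_eq_square)
 qed
 have lim: "(%n. h n x) ----> f x" for x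
  using tendsto_mult[OF cutoff_tendsto tendsto_const, of x "f x"] unfolding h_def by simp
 have [measurable]: "meas f" "meas (h n)" for n
  using f(2) th test_borel by (auto simp: sq_int_borel)
 have "(\<N> x. ennreal ((f x) ^ 4)) = (\<N> x. liminf (%n. ennreal ((h n x) ^ 4)))"
 proof (rule nn_integral_cong)
  fix x
  have "(%n. ennreal ((h n x) ^ 4)) ----> ennreal ((f x) ^ 4)" by (intro tendsto_intros tendsto_ennrealI lim)
  then show "ennreal ((f x) ^ 4) = liminf (%n. ennreal ((h n x) ^ 4))"
   using lim_imp_Liminf[OF sequentially_bot] by metis
 qed
 also have "... <= liminf (%n. \<integral>\<^sup>+x. ennreal ((h n x) ^ 4) \<partial>lborel)" by (rule nn_integral_liminf) measurable
 also have "... <= ennreal ((lady_const * K)^2)"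
  by (rule Liminf_le) (auto intro!: always_eventually order_trans[OF Ladyzhenskaya_test[OF th]] ennreal_leI b)
 finally have le: "(\<N> x. ennreal ((f x) ^ 4)) <= ennreal ((lady_const * K)^2)" .
 then have i: "integrable lborel (%x. (f x) ^ 4)"
  by (intro integrableI_nonneg) (auto intro: le_less_trans)
 have e: "((f x)^2)^2 = (f x) ^ 4" for x by (simp flip: power_mult)
 show "sq_int (%x. (f x)^2)" unfolding sq_int_def e using i by simp
 have "ennreal (\<L> x. (f x) ^ 4) <= ennreal ((lady_const * K)^2)"
  using le nn_integral_eq_integral[OF i] by simp
 then have "(l2 (%x. (f x)^2))^2 <= (lady_const * K)^2" unfolding l2_power2 e by (simp add: ennreal_le_iff)
 then have "l2 (%x. (f x)^2) <= lady_const * K" by (rule power2_le_imp_le) (use lady_const_nonneg K in simp)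
 then show "l2 (%x. (f x)^2) <= lady_const * ((l2 f)^2 + grad_sq f)" by (simp add: K_def)
qed

section \<open>Interpolation between \<open>L\<^sup>2\<close> and bounded mean oscillation\<close>

subsection \<open>Dyadic cubes and averages\<close>

definition cube :: "real => nat => real^3 => (real^3) set" where
 "cube L k x = {y. \<forall>i. \<lfloor>2 ^ k * y $ i / L\<rfloor> = \<lfloor>2 ^ k * x $ i / L\<rfloor>}"

definition side :: "real => nat => real" where "side L k = L / 2 ^ k"

lemma side_pos: "L > 0 ==> side L k > 0" by (simp add: side_def)

lemma side_Suc: "side L k = 2 * side L (Suc k)" by (simp add: side_def)

lemma cube_refl [simp]: "x \<in> cube L k x" by (simp add: cube_def)

lemma cube_eq: "y \<in> cube L k x ==> cube L k y = cube L k x" by (simp add: cube_def)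

lemma cube_sym: "y \<in> cube L k x \<longleftrightarrow> x \<in> cube L k y" by (auto simp: cube_def)

lemma cube_Suc_subset: "cube L (Suc k) x \<subseteq> cube L k x"
proof -
 have "\<lfloor>2 ^ k * a / L\<rfloor> = \<lfloor>2 ^ Suc k * a / L\<rfloor> div 2" for a :: real
  using floor_divide_real_eq_div[of 2 "2 ^ Suc k * a / L"] by simp
 then show ?thesis by (auto simp: cube_def simp del: power_Suc)
qed

lemma cube_subset: "j <= k ==> cube L k x \<subseteq> cube L j x"
 by (induction k rule: dec_induct) (blast dest: cube_Suc_subset[THEN subsetD])+

lemma cube_coarser_eq: "j <= k ==> y \<in> cube L k x ==> cube L j y = cube L j x"
 using cube_subset cube_eq by blast

lemma cube_corner:
 assumes "L > 0"
 obtains l where "cube L k x = {y. \<forall>i. l $ i <= y $ i \<and> y $ i < l $ i + side L k}"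
proof
 have s: "side L k > 0" using side_pos[OF assms] .
 have e: "2 ^ k * a / L = a / side L k" for a by (simp add: side_def)
 have A: "\<lfloor>2 ^ k * a / L\<rfloor> = n \<longleftrightarrow> side L k * real_of_int n <= a \<and> a < side L k * real_of_int n + side L k" for a n
  unfolding e floor_eq_iff using s by (simp add: field_simps)
 show "cube L k x = {y. \<forall>i. (\<chi> i. side L k * real_of_int \<lfloor>2 ^ k * x $ i / L\<rfloor>) $ i <= y $ i
    \<and> y $ i < (\<chi> i. side L k * real_of_int \<lfloor>2 ^ k * x $ i / L\<rfloor>) $ i + side L k}"
  unfolding cube_def A by simp
qed

lemma cube_in_ball: assumes "L > 0" shows "cube L k x \<subseteq> ball x (3 * side L k)"
proof
 fix y assume y: "y \<in> cube L k x"
 obtain l where l: "cube L k x = {y. \<forall>i. l $ i <= y $ i \<and> y $ i < l $ i + side L k}"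
  using cube_corner[OF assms] by blast
 have "\<bar>(x - y) $ i\<bar> < side L k" for i
 proof -
  have "l $ i <= y $ i \<and> y $ i < l $ i + side L k" "l $ i <= x $ i \<and> x $ i < l $ i + side L k"
   using y cube_refl[of x L k] unfolding l by blast+
  then show ?thesis by (simp add: abs_if)
 qed
 then have "(\<S> i. \<bar>(x - y) $ i\<bar>) < (\<Sum>i\<in>(UNIV::3 set). side L k)" by (intro sum_strict_mono) auto
 then show "y \<in> ball x (3 * side L k)" using norm_le_l1_cart[of "x - y"] by (simp add: dist_norm)
qed

lemma measurable_vec_component [measurable (raw)]:
 fixes f :: "'a => real^'n"
 assumes "f \<in> borel_measurable M" shows "(%x. f x $ i) \<in> borel_measurable M"
 by (rule measurable_compose[OF assms]) (intro borel_measurable_continuous_onI continuous_intros)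

lemma cube_measurable [measurable]: "cube L k x \<in> sets borel"
 unfolding cube_def by measurable

lemma cube_indicator_measurable:
 "(%(x, y). indicator (cube L k x) y :: ennreal) \<in> borel_measurable (borel \<Otimes>\<^sub>M borel)"
proof -
 have "(%(x, y). indicator (cube L k x) y :: ennreal) = (%(x, y). if (\<forall>i. \<lfloor>2 ^ k * y $ i / L\<rfloor> = \<lfloor>2 ^ k * x $ i / L\<rfloor>) then 1 else 0)"
  by (auto simp: cube_def indicator_def)
 also have "... \<in> borel_measurable (borel \<Otimes>\<^sub>M borel)" by measurable
 finally show ?thesis .
qed

lemma emeasure_cube: assumes "L > 0" shows "emeasure lborel (cube L k x) = ennreal (side L k ^ 3)"
proof -
 obtain l where c: "cube L k x = {y. \<forall>i. l $ i <= y $ i \<and> y $ i < l $ i + side L k}"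
  using cube_corner[OF assms] by blast
 have l: "box l (\<chi> i. l $ i + side L k) \<subseteq> cube L k x" "cube L k x \<subseteq> cbox l (\<chi> i. l $ i + side L k)"
  unfolding c by (auto simp: mem_box_cart less_imp_le)
 define u where "u = (\<chi> i. l $ i + side L k)"
 have le: "l \<bullet> b <= u \<bullet> b" if "b \<in> Basis" for b
  using that side_pos[OF assms, of k] by (auto simp: Basis_vec_def u_def inner_axis)
 have p: "(\<Prod>b\<in>Basis. (u - l) \<bullet> b) = side L k ^ 3" by (simp add: prod_Basis_vec3 u_def power3_eq_cube)
 have "emeasure lborel (box l u) = ennreal (side L k ^ 3)" "emeasure lborel (cbox l u) = ennreal (side L k ^ 3)"
  using le p by auto
 moreover have "emeasure lborel (box l u) <= emeasure lborel (cube L k x)" "emeasure lborel (cube L k x) <= emeasure lborel (cbox l u)"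
  using l unfolding u_def by (auto intro!: emeasure_mono)
 ultimately show ?thesis by simp
qed

lemma emeasure_ball_le:
 assumes "r > 0" shows "emeasure lborel (ball (x::real^3) r) <= ennreal ((2 * r) ^ 3)"
proof -
 define l u where "l = (\<chi> i. x $ i - r)" and "u = (\<chi> i. x $ i + r)"
 have le: "l \<bullet> b <= u \<bullet> b" if "b \<in> Basis" for b
  using that assms by (auto simp: Basis_vec_def l_def u_def inner_axis)
 have "ball x r \<subseteq> cbox l u"
 proof
  fix y assume "y \<in> ball x r"
  then have "\<bar>(x - y) $ i\<bar> < r" for i using component_le_norm_cart[of "x - y" i] by (simp add: dist_norm)
  then have "\<bar>x $ i - y $ i\<bar> < r" for i by simp
  from this[THEN abs_less_iff[THEN iffD1]] show "y \<in> cbox l u"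
   by (auto simp: mem_box_cart l_def u_def algebra_simps less_imp_le)
 qed
 then have "emeasure lborel (ball x r) <= emeasure lborel (cbox l u)" by (intro emeasure_mono) auto
 also have "... = ennreal (\<Prod>b\<in>Basis. (u - l) \<bullet> b)" using le by simp
 also have "(\<Prod>b\<in>Basis. (u - l) \<bullet> b) = (2 * r) ^ 3" by (simp add: prod_Basis_vec3 l_def u_def power3_eq_cube)
 finally show ?thesis .
qed

definition cube_avg :: "real => nat => (real^3 => ennreal) => real^3 => ennreal" where
 "cube_avg L k g x = ennreal (1 / side L k ^ 3) * (\<N> y. g y * indicator (cube L k x) y)"

definition at_level :: "real => nat => (real^3) set => bool" where
 "at_level L k W \<longleftrightarrow> W \<in> sets borel \<and> (\<forall>x y. y \<in> cube L k x --> (x \<in> W \<longleftrightarrow> y \<in> W))"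

lemma at_level_mono: "at_level L j W ==> j <= k ==> at_level L k W"
 unfolding at_level_def using cube_subset by blast

lemma at_level_Int: "at_level L k W ==> at_level L k V ==> at_level L k (W \<inter> V)"
 unfolding at_level_def by (auto dest: sets.Int)

lemma side_cancel: "L > 0 ==> ennreal (1 / side L k ^ 3) * ennreal (side L k ^ 3) = 1"
 using side_pos[of L k] by (simp flip: ennreal_mult)

lemma cube_avg_measurable [measurable]:
 assumes [measurable]: "meas g" shows "meas (cube_avg L k g)"
proof -
 note cube_indicator_measurable[measurable]
 have "meas ((%x. \<integral>\<^sup>+y. g y * (%(x, y). indicator (cube L k x) y) (x, y) \<partial>lborel))"
  by measurable
 then show ?thesis unfolding cube_avg_def[abs_def] by simp
qed

lemma cube_avg_const: "L > 0 ==> cube_avg L k (%_. c) x = c"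
 using side_cancel[of L k] by (simp add: cube_avg_def nn_integral_cmult_indicator emeasure_cube mult.left_commute)

lemma cube_avg_mono:
 "(!!y. y \<in> cube L k x ==> g y <= h y) ==> cube_avg L k g x <= cube_avg L k h x"
 unfolding cube_avg_def by (intro mult_left_mono nn_integral_mono) (auto simp: indicator_def)

lemma cube_avg_add:
 assumes [measurable]: "meas g" "meas h"
 shows "cube_avg L k (%y. g y + h y) x = cube_avg L k g x + cube_avg L k h x"
 unfolding cube_avg_def by (simp add: distrib_right nn_integral_add distrib_left)

lemma cube_avg_cmult:
 assumes [measurable]: "meas g"
 shows "cube_avg L k (%y. c * g y) x = c * cube_avg L k g x"
 unfolding cube_avg_def by (simp add: mult.assoc nn_integral_cmult mult.left_commute)

lemma cube_avg_cong: "y \<in> cube L k x ==> cube_avg L k g y = cube_avg L k g x"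
 by (simp add: cube_avg_def cube_eq)

lemma cube_avg_coarser: "j <= k ==> y \<in> cube L k x ==> cube_avg L j g y = cube_avg L j g x"
 using cube_subset cube_avg_cong by blast

lemma cube_avg_parent: assumes "L > 0" shows "cube_avg L (Suc k) g x <= 8 * cube_avg L k g x"
proof -
 have "ennreal (1 / side L (Suc k) ^ 3) = 8 * ennreal (1 / side L k ^ 3)"
  unfolding side_Suc[of L k] by (simp add: power_mult_distrib ennreal_mult'[symmetric] flip: ennreal_numeral)
 then show ?thesis unfolding cube_avg_def using cube_Suc_subset[of L k x]
  by (auto simp: mult.assoc indicator_def intro!: mult_left_mono nn_integral_mono)
qed

text \<open>Averaging over cubes is a conditional expectation: by Tonelli and the symmetry of the relation
 of lying in the same cube it preserves integrals over unions of cubes.\<close>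

lemma integral_cube_avg:
 assumes L: "L > 0" and W: "at_level L k W" and [measurable]: "meas g"
 shows "(\<N> x. cube_avg L k g x * indicator W x) = (\<N> x. g x * indicator W x)"
proof -
 note cube_indicator_measurable[measurable]
 have [measurable]: "W \<in> sets borel" using W by (simp add: at_level_def)
 define c where "c = ennreal (1 / side L k ^ 3)"
 define I where "I = (%(x, y). indicator (cube L k x) y :: ennreal)"
 have [measurable]: "I \<in> borel_measurable (borel \<Otimes>\<^sub>M borel)" unfolding I_def by measurable
 have sw: "I (x, y) * indicator W x = indicator (cube L k y) x * indicator W y" for x y
  using W cube_sym[of y L k x] unfolding I_def at_level_def by (auto simp: indicator_def)
 have "(\<N> x. cube_avg L k g x * indicator W x) = (\<N> x. \<N> y. c * g y * I (x, y) * indicator W x)"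
  by (simp add: cube_avg_def c_def[symmetric] I_def nn_integral_cmult[symmetric] nn_integral_multc[symmetric] mult.assoc)
 also have "... = (\<N> y. \<N> x. c * g y * I (x, y) * indicator W x)"
  by (rule lborel_pair.Fubini'[symmetric]) measurable
 also have "... = (\<N> y. g y * indicator W y)"
 proof (rule nn_integral_cong)
  fix y
  have "(\<N> x. c * g y * I (x, y) * indicator W x) = (\<N> x. (c * g y * indicator W y) * indicator (cube L k y) x)"
  proof (rule nn_integral_cong)
   fix x
   have "c * g y * I (x, y) * indicator W x = c * g y * (I (x, y) * indicator W x)" by (simp only: mult.assoc)
   then show "c * g y * I (x, y) * indicator W x = (c * g y * indicator W y) * indicator (cube L k y) x"
    unfolding sw by (simp only: ac_simps)
  qed
  also have "... = (c * g y * indicator W y) * ennreal (side L k ^ 3)"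
   by (simp add: nn_integral_cmult_indicator emeasure_cube[OF L])
  also have "... = g y * indicator W y * (c * ennreal (side L k ^ 3))" by (simp add: ac_simps)
  finally show "(\<N> x. c * g y * I (x, y) * indicator W x) = g y * indicator W y"
   unfolding c_def side_cancel[OF L] by simp
 qed
 finally show ?thesis .
qed

text \<open>The points whose averages exceed \<open>\<theta>\<close> for the first time at generation \<open>k\<close>: the union of the
 Calderon-Zygmund cubes of that generation.\<close>

definition stop_set :: "real => (real^3 => ennreal) => ennreal => nat => (real^3) set" where
 "stop_set L g \<theta> k = {x. cube_avg L k g x > \<theta> \<and> (\<forall>j<k. cube_avg L j g x <= \<theta>)}"

definition max_set :: "real => (real^3 => ennreal) => ennreal => (real^3) set" where
 "max_set L g \<theta> = {x. \<exists>k. cube_avg L k g x > \<theta>}"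

lemma max_set_UN: "max_set L g \<theta> = (\<Union>k. stop_set L g \<theta> k)"
proof -
 have "\<exists>k. cube_avg L k g x > \<theta> \<and> (\<forall>j<k. cube_avg L j g x <= \<theta>)" if "cube_avg L k g x > \<theta>" for x k
  using exists_least_iff[of "%k. cube_avg L k g x > \<theta>"] that by (auto simp: not_less)
 then show ?thesis by (auto simp: max_set_def stop_set_def)
qed

lemma stop_set_disjoint: "disjoint_family (stop_set L g \<theta>)"
 unfolding disjoint_family_on_def stop_set_def by (auto simp: neq_iff leD)

lemma stop_set_at_level:
 assumes [measurable]: "meas g" shows "at_level L k (stop_set L g \<theta> k)"
 unfolding at_level_def
proof (intro conjI allI impI)
 show "stop_set L g \<theta> k \<in> sets borel" unfolding stop_set_def by measurable
 fix x y assume "y \<in> cube L k x"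
 then have "cube_avg L j g y = cube_avg L j g x" if "j <= k" for j using cube_avg_coarser that by blast
 then show "x \<in> stop_set L g \<theta> k \<longleftrightarrow> y \<in> stop_set L g \<theta> k" unfolding stop_set_def by auto
qed

lemma stop_set_borel [measurable]: "g \<in> borel_measurable borel ==> stop_set L g \<theta> k \<in> sets borel"
 using stop_set_at_level unfolding at_level_def by blast

lemma max_set_borel [measurable]: "g \<in> borel_measurable borel ==> max_set L g \<theta> \<in> sets borel"
 unfolding max_set_UN by measurable

lemma sum_over_pieces:
 fixes S :: "nat => (real^3) set"
 assumes h: "meas h" and S: "!!j. S j \<in> sets borel" "disjoint_family S"
  and le: "!!j. c * emeasure lborel (S j) <= (\<N> x. h x * indicator (S j) x)"
 shows "c * emeasure lborel (\<Union>j. S j) <= (\<N> x. h x * indicator (\<Union>j. S j) x)"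
proof -
 define N where "N = density lborel h"
 have N: "emeasure N A = (\<N> x. h x * indicator A x)" if "A \<in> sets borel" for A
  unfolding N_def using h that by (simp add: emeasure_density)
 have "c * emeasure lborel (\<Union>j. S j) = (\<Sum>j. c * emeasure lborel (S j))"
 proof -
  have "range S \<subseteq> sets lborel" using S(1) by auto
  from suminf_emeasure[OF this S(2)] show ?thesis by simp
 qed
 also have "... <= (\<Sum>j. emeasure N (S j))" using le N S by (intro suminf_le) auto
 also have "... = emeasure N (\<Union>j. S j)" using S by (intro suminf_emeasure) (auto simp: N_def)
 finally show ?thesis using N S by (simp add: sets.countable_UN)
qed

lemma nn_integral_lebesgue: "integral\<^sup>N lebesgue f = integral\<^sup>N lborel f"
 by (rule nn_integral_completion)

text \<open>The seminorm enters only through this estimate; the constant \<open>a\<close> is the average over the ball.\<close>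

lemma bmo_ball:
 fixes u :: "real^3 => real^3"
 assumes "bmo_norm u <= ennreal b" "r > 0"
 shows "\<exists>a. (\<N> y. ennreal (norm (u y - a)) * indicator (ball x r) y) <= ennreal b * emeasure lborel (ball x r)"
proof (intro exI)
 define B where "B = ball x r"
 define I where "I = (\<integral>\<^sup>+y\<in>B. ennreal (norm (u y - average B u)) \<partial>lebesgue)"
 have m: "emeasure lebesgue B = emeasure lborel B" by (simp add: B_def)
 have "emeasure lborel B \<noteq> 0" "emeasure lborel B \<noteq> top"
  using assms(2) emeasure_ball_le[OF assms(2), of x] unit_ball_vol_pos[of 3] by (auto simp: B_def emeasure_ball ennreal_eq_0_iff not_le top_unique)
 moreover have "I / emeasure lborel B <= ennreal b"
 proof -
  have "I / emeasure lebesgue B <= bmo_norm u" unfolding bmo_norm_def I_def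
   by (rule SUP_upper) (use assms(2) in \<open>auto simp: B_def\<close>)
  then show ?thesis using assms(1) m by simp
 qed
 ultimately have "I <= ennreal b * emeasure lborel B"
  by (metis ennreal_divide_times ennreal_divide_self less_top mult.right_neutral mult_right_mono zero_le)
 then show "(\<N> y. ennreal (norm (u y - average B u)) * indicator (ball x r) y) <= ennreal b * emeasure lborel (ball x r)"
  unfolding I_def nn_integral_lebesgue B_def .
qed

definition cube_mean :: "real => nat => (real^3 => real^3) => real^3 => real^3" where
 "cube_mean L k u x = (1 / side L k ^ 3) *\<^sub>R (\<L> y. indicator (cube L k x) y *\<^sub>R u y)"

lemma cube_mean_cong: "j <= k ==> y \<in> cube L k x ==> cube_mean L j u y = cube_mean L j u x"
 by (simp add: cube_mean_def cube_coarser_eq)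

lemma cube_integrable:
 fixes u :: "real^3 => real^3"
 assumes "continuous_on UNIV u" "L > 0" shows "integrable lborel (%y. indicator (cube L k x) y *\<^sub>R u y)"
proof -
 obtain l where c: "cube L k x = {y. \<forall>i. l $ i <= y $ i \<and> y $ i < l $ i + side L k}"
  using cube_corner[OF assms(2)] by blast
 have "cube L k x \<subseteq> cbox l (\<chi> i. l $ i + side L k)"
  unfolding c by (auto simp: mem_box_cart less_imp_le)
 moreover have "set_integrable lborel (cbox l (\<chi> i. l $ i + side L k)) u"
  unfolding set_integrable_def using assms(1) continuous_on_subset by (intro borel_integrable_compact) auto
 ultimately show ?thesis using set_integrable_subset[of lborel _ u "cube L k x"] unfolding set_integrable_def by simp
qed

lemma cube_mean_diff_bound:
 fixes u :: "real^3 => real^3"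
 assumes c: "continuous_on UNIV u" and L: "L > 0"
 shows "ennreal (norm (cube_mean L k u x - a)) <= cube_avg L k (%y. ennreal (norm (u y - a))) x"
proof -
 define v where "v = side L k ^ 3"
 have v: "v > 0" using side_pos[OF L, of k] by (simp add: v_def)
 have i: "integrable lborel (%y. indicator (cube L k x) y *\<^sub>R (u y - a))"
  using c by (intro cube_integrable L continuous_intros)
 have ic: "integrable lborel (%y. indicator (cube L k x) y *\<^sub>R a)" by (intro cube_integrable L continuous_intros)
 have "measure lborel (cube L k x) = v" using emeasure_cube[OF L, of k x] v by (simp add: measure_def v_def)
 moreover have "integrable lborel (indicat_real (cube L k x))"
  using emeasure_cube[OF L, of k x] by (simp add: integrable_indicator_iff less_top[symmetric])
 ultimately have "(\<L> y. indicator (cube L k x) y *\<^sub>R a) = v *\<^sub>R a"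
  by simp
 moreover have "(\<L> y. indicator (cube L k x) y *\<^sub>R (u y - a)) =
   (\<L> y. indicator (cube L k x) y *\<^sub>R u y) - (\<L> y. indicator (cube L k x) y *\<^sub>R a)"
  unfolding scaleR_diff_right by (rule B_integral_diff[OF cube_integrable[OF c L] ic])
 ultimately have "cube_mean L k u x - a = (1 / v) *\<^sub>R (\<L> y. indicator (cube L k x) y *\<^sub>R (u y - a))"
  using v by (simp add: cube_mean_def v_def scaleR_diff_right)
 then have "norm (cube_mean L k u x - a) <= (1 / v) * (\<L> y. norm (indicator (cube L k x) y *\<^sub>R (u y - a)))"
  using v integral_norm_bound[of lborel "%y. indicator (cube L k x) y *\<^sub>R (u y - a)"] by (simp add: divide_right_mono)
 then have "ennreal (norm (cube_mean L k u x - a)) <= ennreal (1 / v) * ennreal (\<L> y. norm (indicator (cube L k x) y *\<^sub>R (u y - a)))"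
  using v by (simp flip: ennreal_mult add: ennreal_leI)
 also have "ennreal (\<L> y. norm (indicator (cube L k x) y *\<^sub>R (u y - a))) = (\<N> y. ennreal (norm (indicator (cube L k x) y *\<^sub>R (u y - a))))"
  by (rule nn_integral_eq_integral[symmetric, OF integrable_norm[OF i]]) auto
 also have "... = (\<N> y. ennreal (norm (u y - a)) * indicator (cube L k x) y)"
  by (intro nn_integral_cong) (simp add: indicator_def)
 finally show ?thesis unfolding cube_avg_def v_def .
qed

text \<open>A cube is contained in a ball of comparable volume; replacing the mean over the ball by the one over the cube
 costs a factor two.\<close>

lemma cube_oscillation:
 fixes u :: "real^3 => real^3"
 assumes c: "continuous_on UNIV u" and L: "L > 0" and b: "bmo_norm u <= ennreal b" "0 <= b"
 shows "cube_avg L k (%y. ennreal (norm (u y - cube_mean L k u x))) x <= ennreal (432 * b)"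
proof -
 have [measurable]: "meas u" using c by (rule borel_measurable_continuous_onI)
 define r where "r = 3 * side L k"
 have r: "r > 0" using side_pos[OF L] by (simp add: r_def)
 obtain a where a: "(\<N> y. ennreal (norm (u y - a)) * indicator (ball x r) y) <= ennreal b * emeasure lborel (ball x r)"
  using bmo_ball[OF b(1) r] by blast
 define D where "D = cube_avg L k (%y. ennreal (norm (u y - a))) x"
 have "D <= ennreal (1 / side L k ^ 3) * (\<N> y. ennreal (norm (u y - a)) * indicator (ball x r) y)"
  unfolding D_def cube_avg_def r_def using cube_in_ball[OF L, of k x]
  by (intro mult_left_mono nn_integral_mono) (auto simp: indicator_def)
 also have "... <= ennreal (1 / side L k ^ 3) * (ennreal b * ennreal ((2 * r) ^ 3))"
  by (intro mult_left_mono order_trans[OF a] mult_left_mono emeasure_ball_le[OF r]) auto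
 also have "... = ennreal (216 * b)"
  using side_pos[OF L, of k] b(2) by (simp flip: ennreal_mult add: r_def power_mult_distrib)
 finally have D: "D <= ennreal (216 * b)" .
 have "cube_avg L k (%y. ennreal (norm (u y - cube_mean L k u x))) x <= cube_avg L k (%y. ennreal (norm (u y - a)) + ennreal (norm (cube_mean L k u x - a))) x"
 proof (rule cube_avg_mono)
  fix y
  have "norm (u y - cube_mean L k u x) <= norm (u y - a) + norm (cube_mean L k u x - a)"
   using norm_triangle_ineq4[of "u y - a" "cube_mean L k u x - a"] by simp
  then show "ennreal (norm (u y - cube_mean L k u x)) <= ennreal (norm (u y - a)) + ennreal (norm (cube_mean L k u x - a))"
   by (simp flip: ennreal_plus add: ennreal_leI)
 qed
 also have "... = D + ennreal (norm (cube_mean L k u x - a))"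
  unfolding D_def by (subst cube_avg_add) (auto simp: cube_avg_const[OF L])
 also have "... <= D + D" unfolding D_def by (intro add_left_mono cube_mean_diff_bound[OF c L])
 also have "... <= ennreal (216 * b) + ennreal (216 * b)" by (intro add_mono D)
 also have "... = ennreal (432 * b)" using b by (simp flip: ennreal_plus)
 finally show ?thesis .
qed

text \<open>The good-lambda inequality.  On a cube where the averages of \<open>norm u\<close> first exceed \<open>l\<close>, the
 mean over the parent cube is at most \<open>l\<close>; the averages can exceed \<open>l + A\<close> inside it only through
 the oscillation around that mean.\<close>

lemma good_lambda:
 fixes u :: "real^3 => real^3"
 assumes c: "continuous_on UNIV u" and L: "L > 0" and b: "bmo_norm u <= ennreal b" "0 <= b"
  and A: "0 < A" and l: "0 <= l" and top: "!!x. cube_avg L 0 (%y. ennreal (norm (u y))) x <= ennreal l"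
 defines "g \<equiv> %y. ennreal (norm (u y))"
 shows "ennreal A * emeasure lborel (max_set L g (ennreal (l + A))) <= ennreal (3456 * b) * emeasure lborel (max_set L g (ennreal l))"
proof -
 have [measurable]: "meas u" using c by (rule borel_measurable_continuous_onI)
 have g[measurable]: "meas g" unfolding g_def by measurable
 define W where "W = stop_set L g (ennreal l)"
 define V where "V = stop_set L g (ennreal (l + A))"
 have mW[measurable]: "W k \<in> sets borel" "V k \<in> sets borel" for k unfolding W_def V_def by (auto intro: stop_set_borel g)
 have step: "ennreal A * emeasure lborel (W k \<inter> max_set L g (ennreal (l + A))) <= ennreal (3456 * b) * emeasure lborel (W k)" for k
 proof (cases k)
  case 0
  have "W 0 = {}" unfolding W_def stop_set_def g_def using top by (auto simp: not_less[symmetric])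
  then show ?thesis using 0 by simp
 next
  case (Suc p)
  define h where "h y = ennreal (norm (u y - cube_mean L p u y))" for y
  have mh[measurable]: "meas h"
  proof -
   have i: "(%(x, y). indicator (cube L p x) y *\<^sub>R u y) \<in> borel_measurable (borel \<Otimes>\<^sub>M borel)"
   proof -
    have "(%(x, y). indicator (cube L p x) y *\<^sub>R u y) = (%(x, y). if (\<forall>i. \<lfloor>2 ^ p * y $ i / L\<rfloor> = \<lfloor>2 ^ p * x $ i / L\<rfloor>) then u y else 0)"
     by (auto simp: cube_def indicator_def)
    also have "... \<in> borel_measurable (borel \<Otimes>\<^sub>M borel)" by measurable
    finally show ?thesis .
   qed
   have "meas ((%x. \<L> y. indicator (cube L p x) y *\<^sub>R u y))"
    using i by (intro lborel.borel_measurable_lebesgue_integral) (simp add: split_beta')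
   then have [measurable]: "meas (cube_mean L p u)" unfolding cube_mean_def[abs_def] by measurable
   show ?thesis unfolding h_def by measurable
  qed
  have piece: "ennreal A * emeasure lborel (W k \<inter> V j) <= (\<N> x. h x * indicator (W k \<inter> V j) x)" for j
  proof (cases "k <= j")
   case False
   have "W k \<inter> V j = {}"
   proof -
    have "ennreal l <= ennreal (l + A)" using A by (intro ennreal_leI) simp
    then show ?thesis using False unfolding W_def V_def stop_set_def by (auto simp: not_le dest: leD order_trans)
   qed
   then show ?thesis by simp
  next
   case True
   have lev: "at_level L j (W k \<inter> V j)"
    unfolding W_def V_def by (intro at_level_Int at_level_mono[OF stop_set_at_level True] stop_set_at_level g)
   have low: "ennreal A <= cube_avg L j h x" if x: "x \<in> W k \<inter> V j" for x
   proof -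
    have pj: "p <= j" using True Suc by simp
    have "cube_avg L p g x <= ennreal l" using x Suc unfolding W_def stop_set_def by auto
    moreover have "ennreal (norm (cube_mean L p u x)) <= cube_avg L p g x"
     using cube_mean_diff_bound[OF c L, of p x 0] by (simp add: g_def)
    ultimately have cm: "ennreal (norm (cube_mean L p u x)) <= ennreal l" by (rule order_trans[rotated])
    have "cube_avg L j g x <= cube_avg L j (%y. h y + ennreal l) x"
    proof (rule cube_avg_mono)
     fix y assume "y \<in> cube L j x"
     then have e: "cube_mean L p u y = cube_mean L p u x" using cube_mean_cong pj by blast
     have "norm (u y) <= norm (u y - cube_mean L p u y) + norm (cube_mean L p u x)"
      using norm_triangle_sub[of "u y" "cube_mean L p u y"] e by simp
     then have "g y <= h y + ennreal (norm (cube_mean L p u x))"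
      unfolding g_def h_def by (simp flip: ennreal_plus add: ennreal_leI)
     then show "g y <= h y + ennreal l" using cm by (meson add_left_mono order_trans)
    qed
    also have "... = cube_avg L j h x + ennreal l" by (subst cube_avg_add) (auto simp: cube_avg_const[OF L])
    finally have "ennreal A + ennreal l <= cube_avg L j h x + ennreal l"
     using x A l unfolding V_def stop_set_def by (auto simp: ennreal_plus[symmetric] add.commute simp del: ennreal_plus)
    then show ?thesis by (simp add: ennreal_add_left_cancel_le add.commute)
   qed
   have "ennreal A * emeasure lborel (W k \<inter> V j) = (\<N> x. ennreal A * indicator (W k \<inter> V j) x)"
    by (simp add: nn_integral_cmult_indicator)
   also have "... <= (\<N> x. cube_avg L j h x * indicator (W k \<inter> V j) x)"
    using low by (intro nn_integral_mono) (auto simp: indicator_def)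
   also have "... = (\<N> x. h x * indicator (W k \<inter> V j) x)" by (rule integral_cube_avg[OF L lev mh])
   finally show ?thesis .
  qed
  have "ennreal A * emeasure lborel (W k \<inter> max_set L g (ennreal (l + A))) = ennreal A * emeasure lborel (\<Union>j. W k \<inter> V j)"
   unfolding max_set_UN V_def by simp
  also have "... <= (\<N> x. h x * indicator (\<Union>j. W k \<inter> V j) x)"
   using stop_set_disjoint[of L g "ennreal (l + A)"]
   by (intro sum_over_pieces mh piece) (auto simp: disjoint_family_on_def V_def[symmetric])
  also have "... <= (\<N> x. h x * indicator (W k) x)" by (intro nn_integral_mono) (auto simp: indicator_def)
  also have "... = (\<N> x. cube_avg L k h x * indicator (W k) x)"
   unfolding W_def by (intro integral_cube_avg[symmetric] L stop_set_at_level g mh)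
  also have "... <= (\<N> x. ennreal (3456 * b) * indicator (W k) x)"
  proof (intro nn_integral_mono mult_right_mono)
   fix x
   have "cube_avg L k h x <= 8 * cube_avg L p h x" unfolding Suc by (rule cube_avg_parent[OF L])
   also have "cube_avg L p h x = cube_avg L p (%y. ennreal (norm (u y - cube_mean L p u x))) x"
    unfolding h_def by (intro antisym cube_avg_mono) (auto simp: cube_mean_cong[OF order_refl])
   also have "8 * ... <= 8 * ennreal (432 * b)" by (intro mult_left_mono cube_oscillation[OF c L b]) simp
   also have "... = ennreal (3456 * b)" using b by (simp flip: ennreal_mult' ennreal_numeral)
   finally show "cube_avg L k h x <= ennreal (3456 * b)" .
  qed simp
  finally show ?thesis by (simp add: nn_integral_cmult_indicator)
 qed
 have "ennreal l <= ennreal (l + A)" using A by (intro ennreal_leI) simp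
 then have "max_set L g (ennreal (l + A)) \<subseteq> max_set L g (ennreal l)"
  unfolding max_set_def by (blast intro: le_less_trans)
 then have "max_set L g (ennreal (l + A)) = (\<Union>k. W k \<inter> max_set L g (ennreal (l + A)))"
  unfolding W_def max_set_UN[of L g "ennreal l"] by blast
 then have "ennreal A * emeasure lborel (max_set L g (ennreal (l + A))) = ennreal A * (\<Sum>k. emeasure lborel (W k \<inter> max_set L g (ennreal (l + A))))"
  using stop_set_disjoint[of L g "ennreal l"]
  by (subst suminf_emeasure) (auto simp: disjoint_family_on_def W_def[symmetric] intro!: sets.Int max_set_borel g)
 also have "... = (\<Sum>k. ennreal A * emeasure lborel (W k \<inter> max_set L g (ennreal (l + A))))" by simp
 also have "... <= (\<Sum>k. ennreal (3456 * b) * emeasure lborel (W k))" by (intro suminf_le step) auto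
 also have "... = ennreal (3456 * b) * (\<Sum>k. emeasure lborel (W k))" by simp
 also have "(\<Sum>k. emeasure lborel (W k)) = emeasure lborel (max_set L g (ennreal l))"
  unfolding max_set_UN W_def[symmetric]
  using stop_set_disjoint[of L g "ennreal l"] by (intro suminf_emeasure) (auto simp: W_def[symmetric])
 finally show ?thesis .
qed

text \<open>By continuity the averages over small cubes detect the values of the function.\<close>

lemma norm_gt_imp_max_set:
 fixes u :: "real^3 => real^3"
 assumes c: "continuous_on UNIV u" and L: "L > 0" and t: "0 <= t" "t < norm (u x)"
 shows "x \<in> max_set L (%y. ennreal (norm (u y))) (ennreal t)"
proof -
 obtain s where s: "t < s" "s < norm (u x)" using dense[OF t(2)] by blast
 have "continuous_on UNIV (%y. norm (u y))" using c by (intro continuous_intros)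
 then have "open {y. s < norm (u y)}" by (intro open_Collect_less continuous_on_const)
 then obtain d where d: "d > 0" "ball x d \<subseteq> {y. s < norm (u y)}" using openE[of _ x] s(2) by blast
 obtain k where k: "3 * L / d < 2 ^ k" using real_arch_pow[of 2 "3 * L / d"] by auto
 then have "3 * side L k <= d" using d(1) by (simp add: side_def field_simps)
 then have sub: "cube L k x \<subseteq> {y. s < norm (u y)}" using cube_in_ball[OF L, of k x] d(2) subset_ball by blast
 have "ennreal t < ennreal s" using s t by (simp add: ennreal_lessI)
 also have "ennreal s = cube_avg L k (%_. ennreal s) x" by (simp add: cube_avg_const[OF L])
 also have "... <= cube_avg L k (%y. ennreal (norm (u y))) x"
  using sub by (intro cube_avg_mono ennreal_leI) (auto intro: less_imp_le)
 finally show ?thesis unfolding max_set_def by blast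
qed

definition bmo_const :: real where "bmo_const = 33 * 110592^2"

text \<open>Hence the distribution function of \<open>norm u\<close> decays exponentially beyond the height \<open>A\<close>, with the
 constant of \<open>u\<close> in \<open>L\<^sup>2\<close>, and fourth powers are integrable.\<close>

lemma bmo_interpolation:
 fixes u :: "real^3 => real^3"
 assumes c: "continuous_on UNIV u" and i: "integrable lborel (%x. (norm (u x))^2)" and b: "bmo_norm u <= ennreal b" "0 < b"
 shows "integrable lborel (%x. norm (u x) ^ 4)"
  "(\<L> x. norm (u x) ^ 4) <= bmo_const * b^2 * (\<L> x. (norm (u x))^2)"
proof -
 have [measurable]: "meas u" using c by (rule borel_measurable_continuous_onI)
 define g where "g y = ennreal (norm (u y))" for y
 define g2 where "g2 y = ennreal ((norm (u y))^2)" for y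
 have g[measurable]: "meas g" "meas g2" unfolding g_def g2_def by measurable
 define E where "E = (\<L> x. (norm (u x))^2)"
 have E0: "0 <= E" unfolding E_def by simp
 have gE: "(\<N> x. g2 x) = ennreal E"
  unfolding g2_def E_def using i by (intro nn_integral_eq_integral) auto
 \<comment> \<open>\<open>110592 = 32 * 3456\<close>: each step of height \<open>A\<close> gains a factor \<open>32\<close>, more than the \<open>16\<close> by which fourth powers grow.\<close>
 define A where "A = 110592 * b"
 have A: "0 < A" using b by (simp add: A_def)
 \<comment> \<open>Initial cubes so large that the average of \<open>norm u\<close> over each of them is at most \<open>A\<close>.\<close>
 define L where "L = max 1 (E / A^2)"
 have L: "0 < L" "1 <= L" "E / A^2 <= L" by (auto simp: L_def)
 have L3: "E / A^2 <= L ^ 3" using power_increasing[of 1 3 L] L by simp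
 have top: "cube_avg L 0 g x <= ennreal A" for x
 proof -
  have "cube_avg L 0 g x <= cube_avg L 0 (%y. ennreal (A / 2) + ennreal (1 / (2 * A)) * g2 y) x"
  proof (rule cube_avg_mono)
   fix y
   have "norm (u y) <= A / 2 + 1 / (2 * A) * (norm (u y))^2"
    using A sum_squares_bound[of "norm (u y)" A] by (simp add: field_simps power2_eq_square)
   then show "g y <= ennreal (A / 2) + ennreal (1 / (2 * A)) * g2 y"
    unfolding g_def g2_def using A by (simp flip: ennreal_mult ennreal_plus add: ennreal_leI)
  qed
  also have "... = ennreal (A / 2) + ennreal (1 / (2 * A)) * cube_avg L 0 g2 x"
   by (subst cube_avg_add) (auto simp: cube_avg_const[OF L(1)] cube_avg_cmult)
  also have "cube_avg L 0 g2 x <= ennreal (1 / L ^ 3) * ennreal E"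
   unfolding cube_avg_def side_def gE[symmetric]
   by (simp, intro mult_left_mono nn_integral_mono) (auto simp: indicator_def)
  also have "ennreal (A / 2) + ennreal (1 / (2 * A)) * (ennreal (1 / L ^ 3) * ennreal E) = ennreal (A / 2 + 1 / (2 * A) * (1 / L ^ 3 * E))"
   using A L E0 by (simp flip: ennreal_mult ennreal_plus)
  also have "... <= ennreal A"
  proof (rule ennreal_leI)
   have "E <= A^2 * L ^ 3" using L3 A by (simp add: field_simps)
   then have "1 / L ^ 3 * E <= A^2" using L by (simp add: field_simps)
   then have "1 / (2 * A) * (1 / L ^ 3 * E) <= 1 / (2 * A) * A^2" using A by (intro mult_left_mono) auto
   also have "... = A / 2" using A by (simp add: power2_eq_square)
   finally show "A / 2 + 1 / (2 * A) * (1 / L ^ 3 * E) <= A" by simp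
  qed
  finally show ?thesis by (simp add: add_left_mono mult_left_mono)
 qed
 define Om where "Om n = max_set L g (ennreal (real (Suc n) * A))" for n
 have [measurable]: "Om n \<in> sets borel" for n unfolding Om_def by (rule max_set_borel[OF g(1)])
 have rec: "32 * emeasure lborel (Om (Suc n)) <= emeasure lborel (Om n)" for n
 proof -
  have "A <= real (Suc n) * A" using A by simp
  then have "cube_avg L 0 g x <= ennreal (real (Suc n) * A)" for x using top[of x] ennreal_leI order_trans by blast
  from good_lambda[OF c L(1) b(1) less_imp_le[OF b(2)] A _ this[unfolded g_def]] A
  have "ennreal A * emeasure lborel (Om (Suc n)) <= ennreal (3456 * b) * emeasure lborel (Om n)"
   unfolding Om_def g_def by (simp add: algebra_simps)
  moreover have "ennreal A = ennreal (3456 * b) * 32" using b by (simp add: A_def ennreal_mult'[symmetric] flip: ennreal_numeral)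
  ultimately have "ennreal (3456 * b) * (32 * emeasure lborel (Om (Suc n))) <= ennreal (3456 * b) * emeasure lborel (Om n)"
   by (simp add: mult.assoc)
  then show ?thesis using b by (subst (asm) ennreal_mult_le_mult_iff) auto
 qed
 have base: "ennreal (A^2) * emeasure lborel (Om 0) <= ennreal E"
 proof -
  have piece: "ennreal (A^2) * emeasure lborel (stop_set L g (ennreal A) k) <= (\<N> x. g2 x * indicator (stop_set L g (ennreal A) k) x)" for k
  proof -
   have low: "ennreal (A^2) <= cube_avg L k g2 x" if "x \<in> stop_set L g (ennreal A) k" for x
   proof -
    have "ennreal (A^2) + ennreal (A^2) = ennreal (2 * A) * ennreal A"
     using A by (simp flip: ennreal_mult ennreal_plus add: power2_eq_square)
    also have "... <= ennreal (2 * A) * cube_avg L k g x"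
     using that unfolding stop_set_def by (intro mult_left_mono) auto
    also have "... = cube_avg L k (%y. ennreal (2 * A) * g y) x" by (simp add: cube_avg_cmult)
    also have "... <= cube_avg L k (%y. g2 y + ennreal (A^2)) x"
    proof (rule cube_avg_mono)
     fix y
     have "2 * A * norm (u y) <= (norm (u y))^2 + A^2" using sum_squares_bound[of "norm (u y)" A] by (simp add: algebra_simps)
     then show "ennreal (2 * A) * g y <= g2 y + ennreal (A^2)"
      unfolding g_def g2_def using A by (simp flip: ennreal_mult ennreal_plus add: ennreal_leI)
    qed
    also have "... = cube_avg L k g2 x + ennreal (A^2)" by (subst cube_avg_add) (auto simp: cube_avg_const[OF L(1)])
    finally show ?thesis by (simp add: ennreal_add_left_cancel_le add.commute)
   qed
   have "ennreal (A^2) * emeasure lborel (stop_set L g (ennreal A) k) = (\<N> x. ennreal (A^2) * indicator (stop_set L g (ennreal A) k) x)"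
    by (simp add: nn_integral_cmult_indicator)
   also have "... <= (\<N> x. cube_avg L k g2 x * indicator (stop_set L g (ennreal A) k) x)"
    using low by (intro nn_integral_mono) (auto simp: indicator_def)
   also have "... = (\<N> x. g2 x * indicator (stop_set L g (ennreal A) k) x)"
    by (rule integral_cube_avg[OF L(1) stop_set_at_level]) measurable
   finally show ?thesis .
  qed
  have "ennreal (A^2) * emeasure lborel (Om 0) = ennreal (A^2) * emeasure lborel (\<Union>k. stop_set L g (ennreal A) k)"
   unfolding Om_def max_set_UN by simp
  also have "... <= (\<N> x. g2 x * indicator (\<Union>k. stop_set L g (ennreal A) k) x)"
   by (intro sum_over_pieces piece stop_set_disjoint stop_set_borel g)
  also have "... <= (\<N> x. g2 x)" by (intro nn_integral_mono) (auto simp: indicator_def)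
  finally show ?thesis by (simp add: gE)
 qed
 have Om: "ennreal (A^2 * 32 ^ n) * emeasure lborel (Om n) <= ennreal E" for n
 proof (induction n)
  case (Suc n)
  have "ennreal (A^2 * 32 ^ Suc n) * emeasure lborel (Om (Suc n)) = ennreal (A^2 * 32 ^ n) * (32 * emeasure lborel (Om (Suc n)))"
   by (simp add: ennreal_mult' mult_ac)
  also have "... <= ennreal (A^2 * 32 ^ n) * emeasure lborel (Om n)" by (intro mult_left_mono rec) simp
  finally show ?case using Suc order_trans by blast
 qed (use base in simp)
 define w where "w n = 16 * 16 ^ n * A ^ 4" for n :: nat
 have pt: "ennreal (norm (u x) ^ 4) <= ennreal (A^2) * g2 x + (\<Sum>n. ennreal (w n) * indicator (Om n) x)" for x
 proof (cases "norm (u x) <= A")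
  case True
  have "norm (u x) ^ 4 = (norm (u x))^2 * (norm (u x))^2" by (simp flip: power_add)
  also have "... <= A^2 * (norm (u x))^2" using True by (intro mult_right_mono power_mono) auto
  finally have "ennreal (norm (u x) ^ 4) <= ennreal (A^2) * g2 x" unfolding g2_def by (simp flip: ennreal_mult add: ennreal_leI)
  then show ?thesis by (rule order_trans) simp
 next
  case False
  define n where "n = nat (\<lceil>norm (u x) / A\<rceil> - 2)"
  have "norm (u x) / A > 1" using False A by simp
  then have cl: "\<lceil>norm (u x) / A\<rceil> \<ge> 2" by (simp add: le_ceiling_iff)
  then have rn: "real n = real_of_int \<lceil>norm (u x) / A\<rceil> - 2" unfolding n_def by simp
  have "norm (u x) / A <= real n + 2" "real n + 1 < norm (u x) / A" unfolding rn
   using le_of_int_ceiling[of "norm (u x) / A"] of_int_ceiling_le_add_one[of "norm (u x) / A"] ceiling_correct[of "norm (u x) / A"] by linarith+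
  then have n: "norm (u x) <= (real n + 2) * A" "real (Suc n) * A < norm (u x)" using A by (auto simp: field_simps)
  have "x \<in> Om n" unfolding Om_def g_def using norm_gt_imp_max_set[OF c L(1) _ n(2)] A by simp
  have "norm (u x) ^ 4 <= ((real n + 2) * A) ^ 4" using n(1) by (intro power_mono) auto
  also have "... <= (2 * 2 ^ n * A) ^ 4"
  proof (intro power_mono mult_right_mono)
   have "n + 2 <= 2 * 2 ^ n" by (induction n) auto
   then have "real (n + 2) <= real (2 * 2 ^ n)" by (simp only: of_nat_le_iff)
   then show "real n + 2 <= 2 * 2 ^ n" by simp
  qed (use A in auto)
  also have "... = w n"
  proof -
   have "((2::real) ^ n) ^ 4 = (2 ^ 4) ^ n" by (simp only: power_mult[symmetric] mult.commute)
   then show ?thesis unfolding w_def by (simp add: power_mult_distrib)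
  qed
  finally have "ennreal (norm (u x) ^ 4) <= ennreal (w n) * indicator (Om n) x" using \<open>x \<in> Om n\<close> by (simp add: ennreal_leI)
  also have "... <= (\<Sum>n. ennreal (w n) * indicator (Om n) x)"
  proof -
   have "f n <= suminf f" for f :: "nat => ennreal" using sum_le_suminf[of f "{n}"] by simp
   then show ?thesis .
  qed
  finally show ?thesis by (rule order_trans) simp
 qed
 have "(\<N> x. ennreal (norm (u x) ^ 4)) <= (\<N> x. ennreal (A^2) * g2 x + (\<Sum>n. ennreal (w n) * indicator (Om n) x))"
  by (intro nn_integral_mono pt)
 also have "... = ennreal (A^2) * ennreal E + (\<Sum>n. ennreal (w n) * emeasure lborel (Om n))"
  by (simp add: nn_integral_add nn_integral_cmult gE nn_integral_suminf nn_integral_cmult_indicator)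
 also have "... <= ennreal (A^2) * ennreal E + (\<Sum>n. ennreal (16 * A^2 * E) * ennreal ((1/2) ^ n))"
 proof (intro add_left_mono suminf_le)
  fix n
  have "w n = (16 * A^2 * (1/2) ^ n) * (A^2 * 32 ^ n)"
  proof -
   have "(16 * A^2 * (1/2) ^ n) * (A^2 * 32 ^ n) = 16 * ((1/2) ^ n * 32 ^ n) * (A^2 * A^2)" by (simp only: mult_ac)
   also have "(1/2) ^ n * 32 ^ n = (16::real) ^ n" by (simp only: power_mult_distrib[symmetric]) simp
   also have "A^2 * A^2 = A ^ 4" by (simp flip: power_add)
   finally show ?thesis unfolding w_def ..
  qed
  then have "ennreal (w n) * emeasure lborel (Om n) = ennreal (16 * A^2 * (1/2) ^ n) * (ennreal (A^2 * 32 ^ n) * emeasure lborel (Om n))"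
   by (simp add: ennreal_mult mult.assoc)
  also have "... <= ennreal (16 * A^2 * (1/2) ^ n) * ennreal E" by (intro mult_left_mono Om) simp
  also have "... = ennreal (16 * A^2 * E) * ennreal ((1/2) ^ n)" using E0 by (simp flip: ennreal_mult add: mult_ac)
  finally show "ennreal (w n) * emeasure lborel (Om n) <= ennreal (16 * A^2 * E) * ennreal ((1/2) ^ n)" .
 qed auto
 also have "(\<Sum>n. ennreal (16 * A^2 * E) * ennreal ((1/2) ^ n)) = ennreal (16 * A^2 * E) * ennreal 2"
 proof -
  have "(\<Sum>n. ennreal ((1/2) ^ n)) = ennreal 2"
   using suminf_geometric[of "1/2::real"] by (subst suminf_ennreal2) (auto intro: summable_geometric)
  then show ?thesis by simp
 qed
 also have "ennreal (A^2) * ennreal E + ennreal (16 * A^2 * E) * ennreal 2 = ennreal (33 * A^2 * E)"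
  using E0 by (simp flip: ennreal_mult ennreal_plus del: ennreal_numeral add: algebra_simps)
 also have "33 * A^2 * E = bmo_const * b^2 * E" by (simp add: bmo_const_def A_def power_mult_distrib)
 finally have le: "(\<N> x. ennreal (norm (u x) ^ 4)) <= ennreal (bmo_const * b^2 * E)" .
 then show i4: "integrable lborel (%x. norm (u x) ^ 4)"
  by (intro integrableI_nonneg) (auto intro: le_less_trans)
 have "ennreal (\<L> x. norm (u x) ^ 4) <= ennreal (bmo_const * b^2 * E)"
  using le nn_integral_eq_integral[OF i4] by simp
 then show "(\<L> x. norm (u x) ^ 4) <= bmo_const * b^2 * (\<L> x. (norm (u x))^2)"
  using E0 by (simp add: E_def[symmetric] ennreal_le_iff bmo_const_def)
qed

section \<open>Testing functions against smooth bumps\<close>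

lemma integral_pos_on_ball:
 fixes f :: "'a::euclidean_space => real"
 assumes "integrable lborel f" "!!x. 0 <= f x" "e > 0" "!!x. x \<in> ball a e ==> 0 < f x"
 shows "(\<L> x. f x) > 0"
proof (rule ccontr)
 assume "\<not> ?thesis"
 then have "(\<L> x. f x) = 0" using B_integral_nonneg[of lborel f] assms(2) by fastforce
 then have "AE x in lborel. f x = 0" using integral_nonneg_eq_0_iff_AE[OF assms(1)] assms(2) by simp
 then have n: "{x. f x \<noteq> 0} \<in> null_sets lborel"
  using assms(1) by (subst (asm) AE_iff_null) (auto simp: borel_measurable_integrable)
 have "ball a e \<subseteq> {x. f x \<noteq> 0}" using assms(4) by force
 then have "emeasure lborel (ball a e) = 0"
  using n null_sets_subset by (metis null_setsD1 sets_lborel borel_open open_ball)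
 then show False using emeasure_ball[of e a] \<open>e > 0\<close> unit_ball_vol_pos[of "DIM('a)"]
  by (auto simp: ennreal_eq_0_iff mult_le_0_iff zero_less_power not_less[symmetric])
qed

lemma bump_ball:
 fixes a :: "'a::euclidean_space"
 assumes r: "r > 0"
 defines "\<phi> \<equiv> %x. bump (1 - ((1 / r) *\<^sub>R (x - a)) \<bullet> ((1 / r) *\<^sub>R (x - a)))"
 shows "smooth \<phi>" "!!x. 0 <= \<phi> x" "!!x. x \<in> ball a r ==> 0 < \<phi> x" "!!x. \<phi> x \<noteq> 0 ==> x \<in> cball a r" "test \<phi>"
proof -
 have n: "((1 / r) *\<^sub>R (x - a)) \<bullet> ((1 / r) *\<^sub>R (x - a)) = (dist a x / r)^2" for x
  unfolding power2_norm_eq_inner[symmetric] using r by (simp add: dist_norm norm_minus_commute power_divide)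
 have "smooth (%x. bump (1 - ((1 / r) *\<^sub>R x) \<bullet> ((1 / r) *\<^sub>R x)))"
  using smooth_scale[OF test_smooth[OF test_bump_ball], of "1 / r"] by simp
 from smooth_affine[OF this bounded_linear_ident, of "- a"] show s: "smooth \<phi>" unfolding \<phi>_def by simp
 show "0 <= \<phi> x" for x unfolding \<phi>_def by (simp add: bump_def)
 show "0 < \<phi> x" if "x \<in> ball a r" for x
 proof -
  have "(dist a x / r)^2 < 1^2" using that r by (intro power_strict_mono) auto
  then show ?thesis unfolding \<phi>_def n by (simp add: bump_def)
 qed
 show b: "x \<in> cball a r" if "\<phi> x \<noteq> 0" for x
 proof -
  have "(dist a x / r)^2 < 1^2" using that unfolding \<phi>_def n by (simp add: bump_def split: if_splits)
  then have "dist a x / r < 1" by (rule power_less_imp_less_base) simp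
  then show ?thesis using r by simp
 qed
 have "norm x <= norm a + r" if "\<phi> x \<noteq> 0" for x
  using b[OF that] norm_triangle_sub[of x a] by (simp add: dist_norm norm_minus_commute)
 with s show "test \<phi>" by (rule testI)
qed

lemma test_functionI:
 fixes \<phi> :: "'a::euclidean_space => real"
 assumes "smooth \<phi>" "compact K" "K \<subseteq> \<Omega>" "!!x. \<phi> x \<noteq> 0 ==> x \<in> K"
 shows "test_function \<Omega> \<phi>"
proof -
 have "supp \<phi> \<subseteq> K" unfolding supp_def using assms by (intro closure_minimal) (auto intro: compact_imp_closed)
 then show ?thesis unfolding test_function_def using assms
  by (metis closed_closure compact_Int_closed inf.absorb_iff2 order_trans supp_def)
qed

text \<open>If \<open>q\<close> were positive at a point, it would be so on a ball, and a bump on it would have positive pairing with \<open>q\<close>.\<close>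

lemma fundamental_lemma_continuous:
 fixes q :: "'a::euclidean_space => real"
 assumes q: "continuous_on \<Omega> q" and O: "open \<Omega>"
  and z: "!!\<phi>. test_function \<Omega> \<phi> ==> (LINT x:\<Omega>|lborel. q x * \<phi> x) = 0"
  and x: "x \<in> \<Omega>"
 shows "q x = 0"
proof -
 have main: "\<not> 0 < q x"
  if q: "continuous_on \<Omega> q" and z: "!!\<phi>. test_function \<Omega> \<phi> ==> (LINT x:\<Omega>|lborel. q x * \<phi> x) = 0" for q
 proof
  assume p: "0 < q x"
  have "open (\<Omega> \<inter> q -` {0<..})" using q O by (intro continuous_open_preimage) auto
  moreover have "x \<in> \<Omega> \<inter> q -` {0<..}" using x p by simp
  ultimately obtain e where e: "e > 0" "cball x e \<subseteq> \<Omega> \<inter> q -` {0<..}"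
   using open_contains_cball by blast
  define \<phi> where "\<phi> y = bump (1 - ((1 / e) *\<^sub>R (y - x)) \<bullet> ((1 / e) *\<^sub>R (y - x)))" for y
  note b = bump_ball[OF e(1), where a = x, folded \<phi>_def]
  have t: "test_function \<Omega> \<phi>" using b e by (intro test_functionI[where K = "cball x e"]) auto
  have eq: "indicator \<Omega> y *\<^sub>R (q y * \<phi> y) = indicator (cball x e) y *\<^sub>R (q y * \<phi> y)" for y
   using b(4)[of y] e(2) by (cases "\<phi> y = 0") (auto simp: indicator_def subset_iff)
  have "integrable lborel (%y. indicator (cball x e) y *\<^sub>R (q y * \<phi> y))"
   using e(2) q b(1) by (intro borel_integrable_compact continuous_intros)
    (auto intro: continuous_on_subset smooth_cont)
  then have "(\<L> y. indicator (cball x e) y *\<^sub>R (q y * \<phi> y)) > 0"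
  proof (rule integral_pos_on_ball[OF _ _ e(1), of _ x])
   show "0 <= indicator (cball x e) y *\<^sub>R (q y * \<phi> y)" for y
   proof (cases "y \<in> cball x e")
    case True
    then have "0 < q y" using e(2) by auto
    then show ?thesis using b(2)[of y] by simp
   qed simp
   show "0 < indicator (cball x e) y *\<^sub>R (q y * \<phi> y)" if "y \<in> ball x e" for y
    using e(2) b(3)[OF that] that by (auto simp: indicator_def subset_iff)
  qed
  then show False using z[OF t] unfolding set_lebesgue_integral_def eq by simp
 qed
 have "\<not> 0 < - q x"
 proof (rule main)
  show "(LINT x:\<Omega>|lborel. - q x * \<phi> x) = 0" if "test_function \<Omega> \<phi>" for \<phi>
   using z[OF that] by (simp add: set_lebesgue_integral_def)
 qed (intro continuous_intros q)
 then show ?thesis using main[OF q z] by simp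
qed

text \<open>Uniqueness of weak derivatives.  A product of bumps in the coordinates is a smooth function \<open>p\<close> with values
 in \<open>[0, 1]\<close> that is positive exactly on the box, and \<open>1 - (1 - p) ^ n\<close> tends to its indicator.\<close>

lemma box_approximation:
 fixes l u :: "'a::euclidean_space"
 defines "p \<equiv> %x. \<Prod>b\<in>Basis. bump (x \<bullet> b - l \<bullet> b) * bump (u \<bullet> b - x \<bullet> b)"
 defines "\<phi> \<equiv> %n x. 1 - (1 - p x) ^ n"
 shows "smooth (\<phi> n)" "x \<notin> box l u ==> \<phi> n x = 0" "0 <= \<phi> n x" "\<phi> n x <= 1" "(%n. \<phi> n x) ----> indicator (box l u) x"
proof -
 have lin: "smooth (%x. bump (c * (x \<bullet> b) + d))" for c d :: real and b :: 'a
  by (intro smooth_compose[OF smooth_bump] smooth_add smooth_mult smooth_const smooth_linear bounded_linear_inner_left)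
 have "smooth (%x. \<Prod>b\<in>B. bump (x \<bullet> b - l \<bullet> b) * bump (u \<bullet> b - x \<bullet> b))" if "finite B" for B
  using that
 proof induction
  case (insert b B)
  then show ?case using lin[of 1 b "- (l \<bullet> b)"] lin[of "-1" b "u \<bullet> b"] by (auto intro!: smooth_mult)
 qed simp
 then have sp: "smooth p" unfolding p_def by simp
 have "smooth (%x. (1 - p x) ^ n)" by (induction n) (auto intro!: smooth_mult smooth_diff sp)
 then show "smooth (\<phi> n)" unfolding \<phi>_def by (intro smooth_diff smooth_const)
 have b01: "0 <= bump s" "bump s <= 1" for s by (auto simp: bump_def)
 have p01: "0 <= p x" "p x <= 1" for x
  unfolding p_def by (auto intro!: prod_nonneg prod_le_1 mult_nonneg_nonneg mult_le_one b01)
 show z: "\<phi> n x = 0" if x: "x \<notin> box l u" for n x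
 proof -
  have "p x = 0" unfolding p_def using x by (intro prod_zero) (auto simp: mem_box bump_def)
  then show ?thesis by (simp add: \<phi>_def)
 qed
 show "0 <= \<phi> n x" "\<phi> n x <= 1" unfolding \<phi>_def using p01[of x] by (auto simp: power_le_one)
 show "(%n. \<phi> n x) ----> indicator (box l u) x"
 proof (cases "x \<in> box l u")
  case True
  then have "0 < p x" unfolding p_def by (intro prod_pos) (auto simp: mem_box bump_def)
  then have "(%n. (1 - p x) ^ n) ----> 0" using p01[of x] by (intro LIMSEQ_power_zero) auto
  then have "(%n. 1 - (1 - p x) ^ n) ----> 1 - 0" by (intro tendsto_diff tendsto_const)
  then show ?thesis using True by (simp add: \<phi>_def)
 qed (simp add: z)
qed

text \<open>The integrals of \<open>h\<close> over boxes vanish, so its positive and negative parts are densities of the same measure.\<close>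

lemma fundamental_lemma_L1_loc:
 fixes h :: "'a::euclidean_space => real"
 assumes h: "!!K. compact K ==> set_integrable lborel K h" and m[measurable]: "meas h"
  and z: "!!\<phi>. test \<phi> ==> (\<L> x. h x * \<phi> x) = 0"
 shows "AE x in lborel. h x = 0"
proof -
 have ib: "integrable lborel (%x. indicator (box l u) x * h x)" for l u
  using set_integrable_subset[OF h[OF compact_cbox[of l u]], of "box l u"] box_subset_cbox[of l u]
  unfolding set_integrable_def by simp
 have box0: "(\<L> x. indicator (box l u) x * h x) = 0" for l u
 proof -
  define \<phi> where "\<phi> n x = 1 - (1 - (\<Prod>b\<in>Basis. bump (x \<bullet> b - l \<bullet> b) * bump (u \<bullet> b - x \<bullet> b))) ^ n" for n x
  note \<phi> = box_approximation[where l = l and u = u, folded \<phi>_def]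
  have t: "test (\<phi> n)" for n
  proof -
   have "bounded (box l u)" by (rule bounded_box)
   then obtain r where r: "!!x. x \<in> box l u ==> norm x <= r" unfolding bounded_iff by blast
   show ?thesis using \<phi>(2) r by (intro testI[OF \<phi>(1)]) blast
  qed
  have [measurable]: "meas (\<phi> n)" for n using t test_borel by blast
  have "(%n. \<L> x. h x * \<phi> n x) ----> (\<L> x. indicator (box l u) x * h x)"
  proof (rule integral_dominated_convergence[where w = "%x. \<bar>indicator (box l u) x * h x\<bar>"])
   show "integrable lborel (%x. \<bar>indicator (box l u) x * h x\<bar>)" by (rule integrable_abs[OF ib])
   show "AE x in lborel. (%n. h x * \<phi> n x) ----> indicator (box l u) x * h x"
   proof (rule AE_I2)
    fix x
    have "(%n. h x * \<phi> n x) ----> h x * indicator (box l u) x" by (intro tendsto_intros \<phi>)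
    then show "(%n. h x * \<phi> n x) ----> indicator (box l u) x * h x" by (simp add: mult.commute)
   qed
   show "AE x in lborel. norm (h x * \<phi> n x) <= \<bar>indicator (box l u) x * h x\<bar>" for n
   proof (rule AE_I2)
    fix x
    show "norm (h x * \<phi> n x) <= \<bar>indicator (box l u) x * h x\<bar>"
     using \<phi>(2)[of x n] \<phi>(3,4)[of n x] by (cases "x \<in> box l u") (auto simp: abs_mult intro: mult_left_le)
   qed
  qed measurable
  then show ?thesis unfolding z[OF t] by (simp add: LIMSEQ_const_iff)
 qed
 define hp hn where "hp x = ennreal (max 0 (h x))" and "hn x = ennreal (max 0 (- h x))" for x
 have [measurable]: "meas hp" "meas hn" unfolding hp_def hn_def by measurable
 have em: "emeasure (density lborel hp) (box l u) = ennreal (\<L> x. max 0 (indicator (box l u) x * h x))"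
  "emeasure (density lborel hn) (box l u) = ennreal (\<L> x. max 0 (- (indicator (box l u) x * h x)))" for l u
 proof -
  have "emeasure (density lborel hp) (box l u) = (\<N> x. ennreal (max 0 (indicator (box l u) x * h x)))"
   by (subst emeasure_density) (auto simp: hp_def indicator_def intro!: nn_integral_cong)
  also have "... = ennreal (\<L> x. max 0 (indicator (box l u) x * h x))"
   using ib by (intro nn_integral_eq_integral integrable_max) auto
  finally show "emeasure (density lborel hp) (box l u) = ennreal (\<L> x. max 0 (indicator (box l u) x * h x))" .
  have "emeasure (density lborel hn) (box l u) = (\<N> x. ennreal (max 0 (- (indicator (box l u) x * h x))))"
   by (subst emeasure_density) (auto simp: hn_def indicator_def intro!: nn_integral_cong)
  also have "... = ennreal (\<L> x. max 0 (- (indicator (box l u) x * h x)))"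
   using ib by (intro nn_integral_eq_integral integrable_max integrable_minus) auto
  finally show "emeasure (density lborel hn) (box l u) = ennreal (\<L> x. max 0 (- (indicator (box l u) x * h x)))" .
 qed
 have "density lborel hp = density lborel hn"
 proof (rule measure_eqI_generator_eq[where E = "range (%(a, b). box a b :: 'a set)" and \<Omega> = UNIV and A = "%n::nat. box (- (real n *\<^sub>R One)) (real n *\<^sub>R One)"])
  show "Int_stable (range (%(a, b). box a b :: 'a set))" by (auto simp: Int_stable_def box_Int_box)
  show "sets (density lborel hp) = sigma_sets UNIV (range (%(a, b). box a b))"
   "sets (density lborel hn) = sigma_sets UNIV (range (%(a, b). box a b))" by (simp_all add: borel_eq_box)
  show "emeasure (density lborel hp) X = emeasure (density lborel hn) X" if "X \<in> range (%(a, b). box a b)" for X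
  proof -
   obtain l u where X: "X = box l u" using \<open>X \<in> _\<close> by auto
   have "(\<L> x. max 0 (indicator (box l u) x * h x)) - (\<L> x. max 0 (- (indicator (box l u) x * h x)))
     = (\<L> x. max 0 (indicator (box l u) x * h x) - max 0 (- (indicator (box l u) x * h x)))"
    using ib by (intro B_integral_diff[symmetric] integrable_max integrable_minus) auto
   also have "... = (\<L> x. indicator (box l u) x * h x)"
    by (intro B_integral_cong) (auto simp: max_def)
   finally show ?thesis unfolding X em box0 by simp
  qed
  show "(\<Union>n. box (- (real n *\<^sub>R One)) (real n *\<^sub>R One)) = (UNIV :: 'a set)" by (rule UN_box_eq_UNIV)
  show "emeasure (density lborel hp) (box (- (real n *\<^sub>R One)) (real n *\<^sub>R One)) \<noteq> \<infinity>" for n unfolding em by simp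
 qed auto
 then have "AE x in lborel. hp x = hn x" by (subst (asm) sigma_finite_measure.density_unique_iff[OF sigma_finite_lborel]) auto
 then show ?thesis by eventually_elim (auto simp: hp_def hn_def max_def split: if_splits)
qed

section \<open>Space-time integrals\<close>

abbreviation slab :: "real => (real \<times> (real^3)) set" where "slab T \<equiv> {0<..<T} \<times> UNIV"

lemma test_function_mono: "test_function \<Omega> \<phi> ==> test \<phi>"
 by (simp add: test_function_def)

lemma test_function_outside: "test_function \<Omega> \<phi> ==> x \<notin> \<Omega> ==> \<phi> x = 0"
 unfolding test_function_def supp_def using closure_subset[of "{x. \<phi> x \<noteq> 0}"] by (auto simp: subset_iff)

lemma test_function_compact:
 assumes "test_function \<Omega> \<phi>"
 obtains K where "compact K" "K \<subseteq> \<Omega>" "!!x. x \<notin> K ==> \<phi> x = 0"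
proof (rule that[of "supp \<phi>"])
 show "\<phi> x = 0" if "x \<notin> supp \<phi>" for x
  using that closure_subset[of "{x. \<phi> x \<noteq> 0}"] unfolding supp_def by (auto simp: subset_iff)
qed (use assms in \<open>auto simp: test_function_def\<close>)

lemma test_function_dir_deriv:
 assumes "test_function \<Omega> \<phi>" shows "test_function \<Omega> (dir_deriv v \<phi>)"
proof -
 obtain K where K: "compact K" "K \<subseteq> \<Omega>" "!!x. x \<notin> K ==> \<phi> x = 0" using test_function_compact[OF assms] by blast
 have "dir_deriv v \<phi> x = 0" if "x \<notin> K" for x
 proof -
  have "(\<phi> has_derivative (%_. 0)) (at x)"
   by (rule has_derivative_transform_within_open[OF has_derivative_const, of "- K"])
     (use K that compact_imp_closed in auto)
  from dir_deriv_eq[OF this] show ?thesis .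
 qed
 then show ?thesis using K assms
  by (intro test_functionI[where K = K]) (auto intro: test_smooth test_function_mono)
qed

text \<open>The time and space variables of the equation are separated by testing with products.\<close>

lemma tensor_test:
 fixes \<theta> :: "real => real" and \<psi> :: "real^3 => real"
 assumes "test_function {0<..<T} \<theta>" "test \<psi>"
 shows "test_function (slab T) (%(t, x). \<theta> t * \<psi> x)"
  and "dt (%(t, x). \<theta> t * \<psi> x) = (%(t, x). dir_deriv 1 \<theta> t * \<psi> x)"
  and "dx j (%(t, x). \<theta> t * \<psi> x) = (%(t, x). \<theta> t * pd j \<psi> x)"
proof -
 have s: "smooth \<theta>" "smooth \<psi>" using assms test_function_mono test_smooth by blast+
 have sf: "smooth (%p::real \<times> (real^3). \<theta> (fst p))" "smooth (%p::real \<times> (real^3). \<psi> (snd p))"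
  using smooth_affine[OF s(1) bounded_linear_fst, of 0] smooth_affine[OF s(2) bounded_linear_snd, of 0] by simp_all
 have d: "dir_deriv v (%p::real \<times> (real^3). \<theta> (fst p)) = (%p. dir_deriv (fst v) \<theta> (fst p))"
  "dir_deriv v (%p::real \<times> (real^3). \<psi> (snd p)) = (%p. dir_deriv (snd v) \<psi> (snd p))" for v
  using dir_deriv_affine[OF s(1) bounded_linear_fst, of v 0] dir_deriv_affine[OF s(2) bounded_linear_snd, of v 0] by simp_all
 have z: "dir_deriv 0 \<theta> t = 0" "dir_deriv 0 \<psi> x = 0" for t x
  using linear_0[OF dir_deriv_linear[OF s(1)]] linear_0[OF dir_deriv_linear[OF s(2)]] by auto
 obtain K where K: "compact K" "K \<subseteq> {0<..<T}" "!!x. x \<notin> K ==> \<theta> x = 0" using test_function_compact[OF assms(1)] by blast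
 obtain r where r: "!!x. r < norm x ==> \<psi> x = 0" using test_bounded_supp[OF assms(2)] by blast
 have e: "(%(t, x). \<theta> t * \<psi> x) = (%p. \<theta> (fst p) * \<psi> (snd p))" by auto
 show "test_function (slab T) (%(t, x). \<theta> t * \<psi> x)" unfolding e
 proof (rule test_functionI[where K = "K \<times> cball 0 r"])
  show "p \<in> K \<times> cball 0 r" if "\<theta> (fst p) * \<psi> (snd p) \<noteq> 0" for p
   using that K(3)[of "fst p"] r[of "snd p"] by (cases p) (force simp: not_less)
 qed (use K in \<open>auto intro!: compact_Times smooth_mult sf\<close>)
 show "dt (%(t, x). \<theta> t * \<psi> x) = (%(t, x). dir_deriv 1 \<theta> t * \<psi> x)"
  unfolding e dir_deriv_mult[OF sf] d by (auto simp: z)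
 show "dx j (%(t, x). \<theta> t * \<psi> x) = (%(t, x). \<theta> t * pd j \<psi> x)"
  unfolding e dir_deriv_mult[OF sf] d by (auto simp: z)
qed

lemma slab_integral:
 fixes q :: "real => real^3 => real"
 assumes \<theta>: "test_function {0<..<T} \<theta>" and \<psi>: "test \<psi>" and q: "continuous_on (slab T) (%(t, x). q t x)"
 shows "set_integrable lebesgue (slab T) (%(t, x). \<theta> t * (q t x * \<psi> x))"
  and "(LINT (t, x):slab T|lebesgue. \<theta> t * (q t x * \<psi> x)) = (LINT t:{0<..<T}|lborel. \<theta> t * (\<L> x. q t x * \<psi> x))"
proof -
 obtain K where K: "compact K" "K \<subseteq> {0<..<T}" "!!x. x \<notin> K ==> \<theta> x = 0" using test_function_compact[OF \<theta>] by blast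
 obtain r where r: "!!x. r < norm x ==> \<psi> x = 0" using test_bounded_supp[OF \<psi>] by blast
 define F where "F = (%p. indicator (slab T) p *\<^sub>R (\<theta> (fst p) * (q (fst p) (snd p) * \<psi> (snd p))))"
 have Fe: "F = (%p. indicator (K \<times> cball 0 r) p *\<^sub>R (\<theta> (fst p) * (q (fst p) (snd p) * \<psi> (snd p))))"
 proof
  fix p
  show "F p = indicator (K \<times> cball 0 r) p *\<^sub>R (\<theta> (fst p) * (q (fst p) (snd p) * \<psi> (snd p)))"
   unfolding F_def using K(2) K(3)[of "fst p"] r[of "snd p"]
   by (cases p; cases "fst p \<in> K"; cases "norm (snd p) <= r") (auto simp: indicator_def subset_iff)
 qed
 have c\<theta>: "continuous_on UNIV \<theta>" "continuous_on UNIV \<psi>"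
  using \<theta> \<psi> by (auto intro: smooth_cont test_smooth test_function_mono)
 have "integrable lborel F" unfolding Fe
 proof (intro borel_integrable_compact compact_Times K(1) compact_cball)
  have "continuous_on (K \<times> cball 0 r) (%p. q (fst p) (snd p))"
   using continuous_on_subset[OF q, of "K \<times> cball 0 r"] K(2) by (auto simp: split_beta)
  then show "continuous_on (K \<times> cball 0 r) (%p. \<theta> (fst p) * (q (fst p) (snd p) * \<psi> (snd p)))"
   by (intro continuous_intros continuous_on_compose2[OF c\<theta>(1)] continuous_on_compose2[OF c\<theta>(2)]) auto
 qed
 then have i: "integrable (lborel \<Otimes>\<^sub>M lborel) F" by (simp add: lborel_prod)
 have mF: "F \<in> borel_measurable lborel" using \<open>integrable lborel F\<close> by simp
 have eq: "(%p. indicator (slab T) p *\<^sub>R (case p of (t, x) => \<theta> t * (q t x * \<psi> x))) = F" by (auto simp: F_def)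
 show "set_integrable lebesgue (slab T) (%(t, x). \<theta> t * (q t x * \<psi> x))"
  unfolding set_integrable_def eq using \<open>integrable lborel F\<close> mF by (simp add: integrable_completion)
 have "(LINT (t, x):slab T|lebesgue. \<theta> t * (q t x * \<psi> x)) = (\<L> p. F p)"
  unfolding set_lebesgue_integral_def eq by (rule integral_completion[OF mF])
 also have "... = (LINT p|(lborel \<Otimes>\<^sub>M lborel). F p)" by (simp add: lborel_prod)
 also have "... = (\<L> t. \<L> x. F (t, x))" by (rule lborel_pair.integral_fst'[OF i, symmetric])
 also have "... = (LINT t:{0<..<T}|lborel. \<theta> t * (\<L> x. q t x * \<psi> x))"
  unfolding set_lebesgue_integral_def
 proof (rule B_integral_cong)
  fix t
  have "(\<L> x. F (t, x)) = (\<L> x. (indicator {0<..<T} t * \<theta> t) * (q t x * \<psi> x))"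
   by (rule B_integral_cong) (auto simp: F_def indicator_def)
  then show "(\<L> x. F (t, x)) = indicat_real {0<..<T} t *\<^sub>R (\<theta> t * (\<L> x. q t x * \<psi> x))"
   by (simp only: integral_mult_right_zero) simp
 qed simp
 finally show "(LINT (t, x):slab T|lebesgue. \<theta> t * (q t x * \<psi> x)) = (LINT t:{0<..<T}|lborel. \<theta> t * (\<L> x. q t x * \<psi> x))" .
qed

lemma continuous_slice_integral:
 fixes q :: "real => real^3 => real"
 assumes q: "continuous_on (I \<times> UNIV) (%(t, x). q t x)" and \<psi>: "!!x. r < norm x ==> \<psi> x = 0" "continuous_on UNIV \<psi>"
 shows "continuous_on I (%t. \<L> x. q t x * \<psi> x)"
proof -
 obtain a b where ab: "cball (0::real^3) r \<subseteq> cbox a b"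
  using bounded_subset_cbox_symmetric[OF bounded_cball] by metis
 have qs: "continuous_on (I \<times> cbox a b) (%p. q (fst p) (snd p))"
  using continuous_on_subset[OF q, of "I \<times> cbox a b"] by (auto simp: split_beta)
 have c: "continuous_on (I \<times> cbox a b) (%(t, x). q t x * \<psi> x)"
  unfolding split_beta by (intro continuous_on_mult qs continuous_on_compose2[OF \<psi>(2)] continuous_intros) auto
 have "(\<L> x. q t x * \<psi> x) = integral (cbox a b) (%x. q t x * \<psi> x)" if "t \<in> I" for t
 proof -
  have "continuous_on (cbox a b) (%x. q t x * \<psi> x)"
   using continuous_on_compose2[OF c, of "cbox a b" "%x. (t, x)"] that by (force intro: continuous_intros)
  then have "(LINT x:cbox a b|lborel. q t x * \<psi> x) = integral (cbox a b) (%x. q t x * \<psi> x)" by (rule compact_integral_eq)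
  moreover have "(%x. indicator (cbox a b) x *\<^sub>R (q t x * \<psi> x)) = (%x. q t x * \<psi> x)"
  proof
   fix x
   show "indicator (cbox a b) x *\<^sub>R (q t x * \<psi> x) = q t x * \<psi> x"
    using ab \<psi>(1)[of x] by (cases "norm x <= r") (auto simp: indicator_def subset_iff)
  qed
  ultimately show ?thesis unfolding set_lebesgue_integral_def by simp
 qed
 then show ?thesis using integral_continuous_on_param[OF c] by (simp cong: continuous_on_cong)
qed

lemma test_primitive:
 fixes \<phi> :: "real => real"
 assumes \<phi>: "test_function {a<..<b} \<phi>" and z: "(\<L> t. \<phi> t) = 0"
 obtains \<theta> where "test_function {a<..<b} \<theta>" "dir_deriv 1 \<theta> = \<phi>"
proof -
 obtain K where K: "compact K" "K \<subseteq> {a<..<b}" "!!x. x \<notin> K ==> \<phi> x = 0" using test_function_compact[OF \<phi>] by blast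
 obtain k l where kl: "a < k" "l < b" "K \<subseteq> {k..l}"
 proof (cases "K = {}")
  case False
  then obtain k l where "k \<in> K" "l \<in> K" "\<forall>x\<in>K. k <= x" "\<forall>x\<in>K. x <= l"
   using compact_attains_inf[OF K(1)] compact_attains_sup[OF K(1)] by metis
  then show ?thesis using K(2) that[of k l] by (auto simp: subset_iff)
 qed (use that[of "a + 1" "b - 1"] in auto)
 have c\<phi>: "continuous_on S \<phi>" for S using test_smooth[OF test_function_mono[OF \<phi>]] smooth_cont continuous_on_subset by blast
 define \<theta> where "\<theta> s = (LINT t:{..s}|lborel. \<phi> t)" for s
 have d: "(\<theta> has_derivative (%v. \<phi> s * v)) (at s)" for s
 proof -
  define c where "c = min k s - 1"
  have cs: "c < s" "s < s + 1" by (auto simp: c_def)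
  have "((%x. integral {c..x} \<phi>) has_real_derivative \<phi> s) (at s within {c..s+1})"
   by (rule integral_has_real_derivative[OF c\<phi>]) (auto simp: c_def)
  then have "((%x. integral {c..x} \<phi>) has_real_derivative \<phi> s) (at s)" unfolding at_within_Icc_at[OF cs] .
  then have "(\<theta> has_real_derivative \<phi> s) (at s)"
  proof (rule has_field_derivative_transform_within_open[of _ _ _ "{c<..}"])
   show "integral {c..x} \<phi> = \<theta> x" if "x \<in> {c<..}" for x
   proof -
    have "(%t. indicator {..x} t *\<^sub>R \<phi> t) = (%t. indicator {c..x} t *\<^sub>R \<phi> t)"
    proof
     fix t show "indicator {..x} t *\<^sub>R \<phi> t = indicator {c..x} t *\<^sub>R \<phi> t"
      using K(3)[of t] kl(3) by (cases "t \<in> K") (auto simp: indicator_def c_def subset_iff)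
    qed
    then show ?thesis using compact_integral_eq[of c x \<phi>] c\<phi> by (simp add: \<theta>_def set_lebesgue_integral_def)
   qed
  qed (use cs in auto)
  then show ?thesis by (simp add: has_field_derivative_def)
 qed
 have s: "smooth \<theta>" by (rule smooth_iff_has_derivative[OF d]) (intro smooth_mult smooth_const test_smooth test_function_mono[OF \<phi>])
 have "s \<in> {k..l}" if "\<theta> s \<noteq> 0" for s
 proof (rule ccontr)
  assume s: "s \<notin> {k..l}"
  have "\<theta> s = (\<L> t. indicator {..s} t *\<^sub>R \<phi> t)" by (simp add: \<theta>_def set_lebesgue_integral_def)
  also have "(%t. indicator {..s} t *\<^sub>R \<phi> t) = (if s < k then (%_. 0) else \<phi>)"
  proof
   fix t show "indicator {..s} t *\<^sub>R \<phi> t = (if s < k then (%_. 0) else \<phi>) t"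
    using K(3)[of t] kl(3) s by (cases "t \<in> K") (auto simp: indicator_def subset_iff)
  qed
  finally show False using that z by (simp split: if_splits)
 qed
 then have "test_function {a<..<b} \<theta>" by (intro test_functionI[OF s, of "{k..l}"]) (use kl in auto)
 then show ?thesis by (rule that) (use dir_deriv_eq[OF d] in \<open>simp add: fun_eq_iff\<close>)
qed

text \<open>A distributional derivative in time that is continuous is a derivative.  Subtracting a primitive
 of \<open>h\<close>, one is left with a function that is orthogonal to all derivatives of test functions, that is,
 to all test functions with integral zero; so it is constant.\<close>

lemma weak_time_derivative:
 fixes g h :: "real => real"
 assumes g: "continuous_on {0<..<T} g" and h: "continuous_on {0<..<T} h"
  and z: "!!\<theta>. test_function {0<..<T} \<theta> ==> (LINT \<tau>:{0<..<T}|lborel. dir_deriv 1 \<theta> \<tau> * g \<tau> + \<theta> \<tau> * h \<tau>) = 0"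
  and st: "0 < s" "s < t" "t < T"
 shows "g t - g s = (LINT \<tau>:{s..t}|lborel. h \<tau>)"
proof -
 define a b where "a = s / 2" and "b = (t + T) / 2"
 have ab: "0 < a" "a < s" "t < b" "b < T" "a < b" using st by (auto simp: a_def b_def)
 have sub: "{a..b} \<subseteq> {0<..<T}" using ab by auto
 note cg = continuous_on_subset[OF g sub] and ch = continuous_on_subset[OF h sub]
 obtain H where H: "!!x. x \<in> {a..b} ==> (H has_vector_derivative h x) (at x within {a..b})"
  using antiderivative_continuous[OF ch] by blast
 have cH: "continuous_on {a..b} H" by (rule continuous_on_vector_derivative[OF H])
 define F where "F \<tau> = g \<tau> - H \<tau>" for \<tau>
 have cF: "continuous_on {a..b} F" unfolding F_def by (intro continuous_intros cg cH)
 have move: "(LINT x:A|lborel. X x) = integral {a..b} X"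
  if "continuous_on {a..b} X" "{a<..<b} \<subseteq> A" "!!x. x \<notin> {a<..<b} ==> X x = 0" for X :: "real => real" and A
 proof -
  have "(%x. indicator A x *\<^sub>R X x) = (%x. indicator {a..b} x *\<^sub>R X x)"
  proof
   fix x show "indicator A x *\<^sub>R X x = indicator {a..b} x *\<^sub>R X x"
    using that(2) that(3)[of x] by (cases "x \<in> {a<..<b}") (auto simp: indicator_def subset_iff)
  qed
  then show ?thesis using compact_integral_eq[of a b X] that(1) by (simp add: set_lebesgue_integral_def)
 qed
 have ct: "continuous_on S \<phi>" "!!x. x \<notin> {a<..<b} ==> \<phi> x = 0" if t: "test_function {a<..<b} \<phi>" for S \<phi>
 proof -
  have "continuous_on UNIV \<phi>" by (rule smooth_cont[OF test_smooth[OF test_function_mono[OF t]]])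
  then show "continuous_on S \<phi>" by (rule continuous_on_subset) simp
  show "!!x. x \<notin> {a<..<b} ==> \<phi> x = 0" by (rule test_function_outside[OF t])
 qed
 have orth: "integral {a..b} (%\<tau>. dir_deriv 1 \<theta> \<tau> * F \<tau>) = 0" if \<theta>: "test_function {a<..<b} \<theta>" for \<theta>
 proof -
  note \<theta>' = test_function_dir_deriv[OF \<theta>, of 1]
  have d: "(\<theta> has_vector_derivative dir_deriv 1 \<theta> x) (at x within {a..b})" for x
  proof -
   note l = smooth_has_derivative[OF test_smooth[OF test_function_mono[OF \<theta>]], of x]
   have "(%v. dir_deriv v \<theta> x) = (%v. v *\<^sub>R dir_deriv 1 \<theta> x)"
   proof
    fix v
    show "dir_deriv v \<theta> x = v *\<^sub>R dir_deriv 1 \<theta> x"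
     using linear_scale[OF dir_deriv_linear[OF test_smooth[OF test_function_mono[OF \<theta>]]], of v 1 x] by simp
   qed
   from has_derivative_at_withinI[OF l[unfolded this]] show ?thesis unfolding has_vector_derivative_def .
  qed
  have "((%x. \<theta> x * h x + dir_deriv 1 \<theta> x * H x) has_integral \<theta> b * H b - \<theta> a * H a) {a..b}"
   using ab by (intro fundamental_theorem_of_calculus has_vector_derivative_mult d H) auto
  then have 1: "integral {a..b} (%x. \<theta> x * h x + dir_deriv 1 \<theta> x * H x) = 0"
   using ct(2)[OF \<theta>, of a] ct(2)[OF \<theta>, of b] by (simp add: integral_unique)
  have "test_function {0<..<T} \<theta>" using \<theta> ab by (auto simp: test_function_def subset_iff)
  note z[OF this]
  moreover have "continuous_on {a..b} (%x. dir_deriv 1 \<theta> x * g x + \<theta> x * h x)"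
   by (intro continuous_intros cg ch ct(1)[OF \<theta>] ct(1)[OF \<theta>'])
  ultimately have 2: "integral {a..b} (%x. dir_deriv 1 \<theta> x * g x + \<theta> x * h x) = 0"
   using ab ct(2)[OF \<theta>] ct(2)[OF \<theta>'] by (subst (asm) move) auto
  have "integral {a..b} (%x. (dir_deriv 1 \<theta> x * g x + \<theta> x * h x) - (\<theta> x * h x + dir_deriv 1 \<theta> x * H x)) = 0"
   using 1 2 by (subst Henstock_Kurzweil_Integration.integral_diff)
    (auto intro!: integrable_continuous_real continuous_intros cg ch cH ct(1)[OF \<theta>] ct(1)[OF \<theta>'])
  then show ?thesis by (simp add: F_def algebra_simps)
 qed
 define e where "e = (b - a) / 2"
 define \<beta> where "\<beta> x = bump (1 - ((1 / (e / 2)) *\<^sub>R (x - (a + e))) \<bullet> ((1 / (e / 2)) *\<^sub>R (x - (a + e))))" for x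
 have e: "0 < e" "0 < e / 2" "a + e + e = b" using ab by (auto simp: e_def field_simps)
 note \<beta> = bump_ball[OF e(2), where a = "a + e", folded \<beta>_def]
 have t\<beta>: "test_function {a<..<b} \<beta>"
 proof (rule test_functionI[OF \<beta>(1) compact_cball _ \<beta>(4)])
  show "cball (a + e) (e / 2) \<subseteq> {a<..<b}"
  proof
   fix x assume "x \<in> cball (a + e) (e / 2)"
   then have "\<bar>a + e - x\<bar> <= e / 2" by (simp add: dist_real_def)
   then show "x \<in> {a<..<b}" using e unfolding greaterThanLessThan_iff by linarith
  qed
 qed
 have m: "0 < (\<L> x. \<beta> x)" by (rule integral_pos_on_ball[OF test_integrable[OF \<beta>(5)] \<beta>(2) e(2) \<beta>(3)])
 define c where "c = integral {a..b} (%\<tau>. \<beta> \<tau> * F \<tau>) / (\<L> x. \<beta> x)"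
 have const: "F x - c = 0" if "x \<in> {a<..<b}" for x
 proof (rule fundamental_lemma_continuous[where \<Omega> = "{a<..<b}" and q = "%x. F x - c"])
  show "continuous_on {a<..<b} (%x. F x - c)" by (intro continuous_intros continuous_on_subset[OF cF]) auto
  fix \<phi> assume \<phi>: "test_function {a<..<b} \<phi>"
  define k where "k = (\<L> x. \<phi> x) / (\<L> x. \<beta> x)"
  define \<psi> where "\<psi> x = \<phi> x - k * \<beta> x" for x
  have "test_function {a<..<b} \<psi>"
  proof -
   obtain K where K: "compact K" "K \<subseteq> {a<..<b}" "!!x. x \<notin> K ==> \<phi> x = 0" using test_function_compact[OF \<phi>] by blast
   obtain L where L: "compact L" "L \<subseteq> {a<..<b}" "!!x. x \<notin> L ==> \<beta> x = 0" using test_function_compact[OF t\<beta>] by blast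
   have "smooth \<psi>" unfolding \<psi>_def[abs_def]
    by (intro smooth_diff smooth_mult smooth_const test_smooth test_function_mono[OF \<phi>] test_function_mono[OF t\<beta>])
   then show ?thesis
   proof (rule test_functionI[where K = "K \<union> L"])
    show "x \<in> K \<union> L" if "\<psi> x \<noteq> 0" for x using that K(3)[of x] L(3)[of x] by (cases "x \<in> K"; cases "x \<in> L") (auto simp: \<psi>_def)
   qed (use K L in auto)
  qed
  moreover have "(\<L> x. \<psi> x) = 0"
   unfolding \<psi>_def k_def using m test_integrable[OF test_function_mono[OF \<phi>]] test_integrable[OF test_function_mono[OF t\<beta>]] by simp
  ultimately obtain \<theta> where \<theta>: "test_function {a<..<b} \<theta>" "dir_deriv 1 \<theta> = \<psi>" by (rule test_primitive)
  have "integral {a..b} (%x. \<phi> x * F x - k * (\<beta> x * F x)) = 0"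
   using orth[OF \<theta>(1)] unfolding \<theta>(2) \<psi>_def by (simp add: algebra_simps)
  moreover have "integral {a..b} (%x. \<phi> x * F x - k * (\<beta> x * F x)) = integral {a..b} (%x. \<phi> x * F x) - integral {a..b} (%x. k * (\<beta> x * F x))"
   by (intro Henstock_Kurzweil_Integration.integral_diff integrable_continuous_real continuous_intros cF ct(1)[OF \<phi>] ct(1)[OF t\<beta>])
  ultimately have "integral {a..b} (%x. \<phi> x * F x) = k * integral {a..b} (%x. \<beta> x * F x)" by simp
  also have "... = c * (\<L> x. \<phi> x)" by (simp add: k_def c_def)
  also have "(\<L> x. \<phi> x) = integral {a..b} \<phi>"
   using move[of \<phi> UNIV] ct[OF \<phi>] by (simp add: set_lebesgue_integral_def)
  finally have "integral {a..b} (%x. \<phi> x * F x) = c * integral {a..b} \<phi>" .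
  moreover have "integral {a..b} (%x. \<phi> x * F x - c * \<phi> x) = integral {a..b} (%x. \<phi> x * F x) - integral {a..b} (%x. c * \<phi> x)"
   by (intro Henstock_Kurzweil_Integration.integral_diff integrable_continuous_real continuous_intros cF ct(1)[OF \<phi>])
  ultimately have "integral {a..b} (%x. \<phi> x * F x - c * \<phi> x) = 0" by simp
  then have "integral {a..b} (%x. (F x - c) * \<phi> x) = 0" by (simp add: algebra_simps)
  then show "(LINT x:{a<..<b}|lborel. (F x - c) * \<phi> x) = 0"
   using ct[OF \<phi>] by (subst move) (auto intro!: continuous_intros cF)
 qed (use that in auto)
 have "(h has_integral H t - H s) {s..t}"
  using ab st by (intro fundamental_theorem_of_calculus has_vector_derivative_within_subset[OF H]) auto
 moreover have "continuous_on {s..t} h" by (rule continuous_on_subset[OF ch]) (use ab in auto)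
 ultimately have "(LINT \<tau>:{s..t}|lborel. h \<tau>) = H t - H s" using compact_integral_eq[of s t h] by (simp add: integral_unique)
 then show ?thesis using const[of s] const[of t] ab st by (simp add: F_def)
qed

section \<open>Weak gradients of smooth fields\<close>

lemma test_function_time_integrable:
 assumes \<theta>: "test_function {0<..<T::real} \<theta>" and g: "continuous_on {0<..<T} g"
 shows "set_integrable lborel {0<..<T} (%t. \<theta> t * g t :: real)"
proof -
 obtain K where K: "compact K" "K \<subseteq> {0<..<T}" "!!x. x \<notin> K ==> \<theta> x = 0" using test_function_compact[OF \<theta>] by blast
 have "(%t. indicator {0<..<T} t *\<^sub>R (\<theta> t * g t)) = (%t. indicator K t *\<^sub>R (\<theta> t * g t))"
 proof
  fix t show "indicator {0<..<T} t *\<^sub>R (\<theta> t * g t) = indicator K t *\<^sub>R (\<theta> t * g t)"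
   using K(2) K(3)[of t] by (cases "t \<in> K") (auto simp: indicator_def)
 qed
 moreover have "continuous_on K (%t. \<theta> t * g t)"
  using smooth_cont[OF test_smooth[OF test_function_mono[OF \<theta>]]] continuous_on_subset[OF g K(2)]
  by (rule continuous_on_mult)
 ultimately show ?thesis unfolding set_integrable_def using borel_integrable_compact[OF K(1)] by metis
qed

lemma fundamental_lemma_lebesgue:
 fixes h :: "'a::euclidean_space => real"
 assumes h: "!!K. compact K ==> set_integrable lebesgue K h" and m: "h \<in> borel_measurable lebesgue"
  and z: "!!\<phi>. test \<phi> ==> (LINT x|lebesgue. h x * \<phi> x) = 0"
 shows "AE x in lebesgue. h x = 0"
proof -
 obtain h' where h': "h' \<in> borel_measurable lborel" "AE x in lborel. h x = h' x"
  using completion_ex_borel_measurable_real[OF m] by blast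
 have ae: "AE x in lebesgue. h x = h' x" using h'(2) by (rule AE_completion)
 have [measurable]: "meas h'" using h'(1) by simp
 then have m': "h' \<in> borel_measurable lebesgue" by (intro measurable_completion) simp
 have "AE x in lborel. h' x = 0"
 proof (rule fundamental_lemma_L1_loc)
  fix K :: "'a set" assume K: "compact K"
  then have [measurable]: "K \<in> sets borel" by (rule borel_compact)
  then have [measurable]: "K \<in> sets lebesgue" by simp
  have "integrable lebesgue (%x. indicator K x *\<^sub>R h' x)"
  proof (rule integrable_cong_AE_imp[OF h[OF K, unfolded set_integrable_def]])
   show "(%x. indicator K x *\<^sub>R h' x) \<in> borel_measurable lebesgue"
    using m' by (intro borel_measurable_scaleR borel_measurable_indicator) auto
   show "AE x in lebesgue. indicator K x *\<^sub>R h x = indicator K x *\<^sub>R h' x" using ae by eventually_elim simp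
  qed
  then show "set_integrable lborel K h'" unfolding set_integrable_def
   by (subst (asm) integrable_completion) measurable
 next
  fix \<phi> :: "'a => real" assume t: "test \<phi>"
  then have [measurable]: "meas \<phi>" by (rule test_borel)
  then have p: "\<phi> \<in> borel_measurable lebesgue" by (intro measurable_completion) simp
  have "(\<L> x. h' x * \<phi> x) = (LINT x|lebesgue. h' x * \<phi> x)"
   by (rule integral_completion[symmetric]) measurable
  also have "... = (LINT x|lebesgue. h x * \<phi> x)"
   by (rule integral_cong_AE) (use ae m m' p in \<open>auto elim: eventually_mono\<close>)
  finally show "(\<L> x. h' x * \<phi> x) = 0" using z[OF t] by simp
 qed measurable
 then have "AE x in lebesgue. h' x = 0" by (rule AE_completion)
 with ae show ?thesis by eventually_elim simp
qed

lemma integral_lebesgue_borel: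
 fixes f :: "'a::euclidean_space => real"
 shows "f \<in> borel_measurable borel ==> (LINT x|lebesgue. f x) = (\<L> x. f x)"
 by (rule integral_completion) simp

lemma integrable_lebesgue_borel:
 fixes f :: "'a::euclidean_space => real"
 shows "f \<in> borel_measurable borel ==> integrable lebesgue f \<longleftrightarrow> integrable lborel f"
 by (rule integrable_completion) simp

lemma is_weak_gradient_component:
 assumes G: "is_weak_gradient f G"
 shows "compact K ==> set_integrable lebesgue K (%x. G x $ i $ j)" "(%x. G x $ i $ j) \<in> borel_measurable lebesgue"
proof -
 have iK: "set_integrable lebesgue K (%x. G x $ i $ j)" if "compact K" for K i j
 proof -
  have "integrable lebesgue (%x. indicator K x *\<^sub>R G x)"
   using G that by (simp add: is_weak_gradient_def set_integrable_def)
  from integrable_bounded_linear[OF bounded_linear_compose[OF bounded_linear_vec_nth bounded_linear_vec_nth] this, of i j]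
  show ?thesis by (simp add: set_integrable_def)
 qed
 have mG: "(%x. G x $ i $ j) \<in> borel_measurable lebesgue" for i j
 proof (rule borel_measurable_LIMSEQ_real)
  show "(%x. indicator (cball 0 (real n)) x *\<^sub>R G x $ i $ j) \<in> borel_measurable lebesgue" for n :: nat
   using iK[OF compact_cball[of "0::real^3" "real n"], of i j] by (auto simp: set_integrable_def dest: borel_measurable_integrable)
  fix x :: "real^3"
  obtain N :: nat where "norm x <= real N" using real_arch_simple by blast
  then have "\<forall>\<^sub>F n in sequentially. indicator (cball 0 (real n)) x *\<^sub>R G x $ i $ j = G x $ i $ j"
   unfolding eventually_sequentially by (intro exI[of _ N]) (auto simp: indicator_def)
  then show "(%n. indicator (cball 0 (real n)) x *\<^sub>R G x $ i $ j) ----> G x $ i $ j" by (rule tendsto_eventually)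
 qed
 show "compact K ==> set_integrable lebesgue K (%x. G x $ i $ j)" by (rule iK)
 show "(%x. G x $ i $ j) \<in> borel_measurable lebesgue" by (rule mG)
qed

text \<open>A smooth function has its classical gradient as weak gradient, whichever one the choice operator selects.\<close>

lemma weak_gradient_smooth:
 fixes f :: "real^3 => real^3"
 assumes s: "!!i. smooth (%x. f x $ i)" and G: "is_weak_gradient f G"
 shows "AE x in lebesgue. \<forall>i j. G x $ i $ j = pd j (%x. f x $ i) x"
proof -
 note iK = is_weak_gradient_component(1)[OF G] and mG = is_weak_gradient_component(2)[OF G]
 have "AE x in lebesgue. G x $ i $ j - pd j (%x. f x $ i) x = 0" for i j
 proof (rule fundamental_lemma_lebesgue)
  have sp: "smooth (pd j (%x. f x $ i))" using s by blast
  have bp: "meas (pd j (%x. f x $ i))" using sp by (rule smooth_borel)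
  then have lp: "pd j (%x. f x $ i) \<in> borel_measurable lebesgue" by (intro measurable_completion) simp
  have ip: "set_integrable lebesgue K (pd j (%x. f x $ i))" if "compact K" for K
  proof -
   have "integrable lborel (%x. indicator K x *\<^sub>R pd j (%x. f x $ i) x)"
    using that sp by (intro borel_integrable_compact smooth_cont)
   then show ?thesis unfolding set_integrable_def by (subst integrable_completion) auto
  qed
  show "set_integrable lebesgue K (%x. G x $ i $ j - pd j (%x. f x $ i) x)" if "compact K" for K
   using iK[OF that] ip[OF that] by (rule set_integral_diff(1))
  show "(%x. G x $ i $ j - pd j (%x. f x $ i) x) \<in> borel_measurable lebesgue" using mG lp by (rule borel_measurable_diff)
  fix \<phi> :: "real^3 => real" assume t: "test \<phi>"
  obtain B where B: "!!x. \<bar>\<phi> x\<bar> <= B" using test_bounded[OF t] by blast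
  obtain r where r: "!!x. r < norm x ==> \<phi> x = 0" using test_bounded_supp[OF t] by blast
  have lphi: "\<phi> \<in> borel_measurable lebesgue" using test_borel[OF t] by (intro measurable_completion) simp
  have ig: "integrable lebesgue (%x. g x * \<phi> x)" if g: "set_integrable lebesgue (cball 0 r) g" "g \<in> borel_measurable lebesgue" for g
  proof (rule B_integrable_bound[of _ "%x. B * (indicator (cball 0 r) x *\<^sub>R g x)"])
   show "integrable lebesgue (%x. B * (indicator (cball 0 r) x *\<^sub>R g x))" using g(1) by (simp add: set_integrable_def)
   show "AE x in lebesgue. norm (g x * \<phi> x) <= norm (B * (indicator (cball 0 r) x *\<^sub>R g x))"
   proof (rule AE_I2)
    fix x
    have "\<bar>\<phi> x\<bar> * \<bar>g x\<bar> <= \<bar>B\<bar> * \<bar>g x\<bar>" using B[of x] by (intro mult_right_mono) auto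
    then show "norm (g x * \<phi> x) <= norm (B * (indicator (cball 0 r) x *\<^sub>R g x))"
     using r[of x] by (cases "norm x <= r") (auto simp: abs_mult indicator_def mult.commute)
   qed
  qed (use g lphi in auto)
  have "(LINT x|lebesgue. f x $ i * dir_deriv (axis j 1) \<phi> x) = - (LINT x|lebesgue. G x $ i $ j * \<phi> x)"
   using G t by (simp add: is_weak_gradient_def)
  moreover have "(LINT x|lebesgue. f x $ i * dir_deriv (axis j 1) \<phi> x) = (\<L> x. f x $ i * pd j \<phi> x)"
   using smooth_borel[OF s] test_borel[OF test_dir_deriv[OF t]] by (intro integral_lebesgue_borel borel_measurable_times)
  moreover have "(\<L> x. pd j (%x. f x $ i) x * \<phi> x) = - (\<L> x. f x $ i * pd j \<phi> x)"
   by (rule integral_by_parts[OF s t])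
  moreover have "(LINT x|lebesgue. pd j (%x. f x $ i) x * \<phi> x) = (\<L> x. pd j (%x. f x $ i) x * \<phi> x)"
   using bp test_borel[OF t] by (intro integral_lebesgue_borel borel_measurable_times)
  ultimately have "(LINT x|lebesgue. G x $ i $ j * \<phi> x) = (LINT x|lebesgue. pd j (%x. f x $ i) x * \<phi> x)" by simp
  then show "(LINT x|lebesgue. (G x $ i $ j - pd j (%x. f x $ i) x) * \<phi> x) = 0"
   using ig[OF iK mG, of i j] ig[OF ip lp] by (simp add: left_diff_distrib)
 qed
 then have "\<forall>i j. AE x in lebesgue. G x $ i $ j - pd j (%x. f x $ i) x = 0" by blast
 then have "AE x in lebesgue. \<forall>i\<in>UNIV. \<forall>j\<in>UNIV. G x $ i $ j - pd j (%x. f x $ i) x = 0"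
  by (intro AE_finite_allI) auto
 then show ?thesis by eventually_elim simp
qed

lemma norm_matrix_sq: "(norm (G :: real^3^3))^2 = (\<S> i. \<S> j. (G $ i $ j)^2)"
 unfolding power2_norm_eq_inner inner_vec_def by (simp add: power2_eq_square)

lemma norm_vec_sq: "(norm (v :: real^3))^2 = (\<S> i. (v $ i)^2)"
 unfolding power2_norm_eq_inner inner_vec_def by (simp add: power2_eq_square)

lemma dirichlet_smooth:
 fixes f :: "real^3 => real^3"
 assumes s: "!!i. smooth (%x. f x $ i)" and H: "H1 f"
 shows "sq_int (pd j (%x. f x $ i))" "dirichlet f = (\<S> i. grad_sq (%x. f x $ i))"
proof -
 obtain G where G: "is_weak_gradient f G" "L2 G" using H by (auto simp: H1_def)
 then have W: "is_weak_gradient f (weak_gradient f)" unfolding weak_gradient_def by (metis someI)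
 define p where "p i j = pd j (%x. f x $ i)" for i j
 have bp [measurable]: "meas (p i j)" for i j unfolding p_def using smooth_borel[OF smooth_dir_deriv[OF s]] .
 have bs: "meas ((%x. \<S> i. \<S> j. (p i j x)^2))" by measurable
 have ae: "AE x in lebesgue. (norm (G x))^2 = (\<S> i. \<S> j. (p i j x)^2)" if "is_weak_gradient f G" for G
  using weak_gradient_smooth[OF s that] by eventually_elim (simp add: norm_matrix_sq p_def)
 have lm: "g \<in> borel_measurable borel ==> g \<in> borel_measurable lebesgue" for g :: "real^3 => real"
  by (intro measurable_completion) simp
 have "integrable lebesgue (%x. \<S> i. \<S> j. (p i j x)^2)"
 proof (rule integrable_cong_AE_imp)
  show "integrable lebesgue (%x. (norm (G x))^2)" using G(2) by (simp add: L2_def)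
  show "AE x in lebesgue. (norm (G x))^2 = (\<S> i. \<S> j. (p i j x)^2)" by (rule ae[OF G(1)])
 qed (rule lm[OF bs])
 then have I: "integrable lborel (%x. \<S> i. \<S> j. (p i j x)^2)" using integrable_lebesgue_borel[OF bs] by simp
 have q: "sq_int (p i j)" for i j unfolding sq_int_def
 proof
  show "integrable lborel (%x. (p i j x)^2)"
  proof (rule B_integrable_bound[OF I])
   have "(p i j x)^2 <= (\<S> i. \<S> j. (p i j x)^2)" for x
    using member_le_sum[of j UNIV "%j. (p i j x)^2"] member_le_sum[of i UNIV "%i. \<S> j. (p i j x)^2"]
    by (simp add: sum_nonneg)
   then show "AE x in lborel. norm ((p i j x)^2) <= norm (\<S> i. \<S> j. (p i j x)^2)"
    by (auto intro: order_trans[OF _ abs_ge_self])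
  qed measurable
 qed measurable
 show "sq_int (pd j (%x. f x $ i))" using q by (simp add: p_def)
 have mW: "(%x. (norm (weak_gradient f x))^2) \<in> borel_measurable lebesgue"
  unfolding norm_matrix_sq by (intro borel_measurable_sum borel_measurable_power is_weak_gradient_component(2)[OF W])
 have "dirichlet f = (LINT x|lebesgue. (\<S> i. \<S> j. (p i j x)^2))"
  unfolding dirichlet_def by (rule integral_cong_AE[OF mW lm[OF bs] ae[OF W]])
 also have "... = (\<L> x. (\<S> i. \<S> j. (p i j x)^2))" by (rule integral_lebesgue_borel[OF bs])
 also have "... = (\<S> i. \<S> j. (l2 (p i j))^2)"
  unfolding l2_power2 using q by (subst B_integral_sum; simp add: sq_int_def)+
 finally show "dirichlet f = (\<S> i. grad_sq (%x. f x $ i))" by (simp add: grad_sq_def p_def)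
qed

section \<open>Smooth Leray-Hopf solutions\<close>

lemma set_LINT_sum:
 fixes f :: "'i => 'a => real"
 assumes "!!i. i \<in> I ==> set_integrable M A (f i)"
 shows "set_integrable M A (%x. \<Sum>i\<in>I. f i x)" "(LINT x:A|M. (\<Sum>i\<in>I. f i x)) = (\<Sum>i\<in>I. LINT x:A|M. f i x)"
proof -
 note i = assms[unfolded set_integrable_def]
 show "set_integrable M A (%x. \<Sum>i\<in>I. f i x)"
  unfolding set_integrable_def scaleR_sum_right by (intro B_integrable_sum i)
 show "(LINT x:A|M. (\<Sum>i\<in>I. f i x)) = (\<Sum>i\<in>I. LINT x:A|M. f i x)"
  unfolding set_lebesgue_integral_def scaleR_sum_right by (intro B_integral_sum i)
qed

locale smooth_leray =
 fixes T :: real and u :: "real => real^3 => real^3"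
  and P :: "(real \<times> (real^3) => real) => real" and u0 :: "real^3 => real^3"
 assumes T: "T > 0" and lh: "leray_hopf T u P u0"
  and sm: "smooth_on ({0..<T} \<times> UNIV) (%(t, x). u t x)"
begin

abbreviation dissip :: "real set => real" where
 "dissip A == (LINT \<tau>:A|lebesgue. dirichlet (u \<tau>))"

definition U :: "real => vfield" where "U t i x = u t x $ i"

lemma C_k_U: "C_k_on k ({0..<T} \<times> UNIV) (%p. u (fst p) (snd p) $ i)"
 using sm C_k_on_bounded_linear[OF bounded_linear_vec_nth, of k "{0..<T} \<times> UNIV" "%(t, x). u t x" i]
 by (simp add: smooth_on_def split_beta)

lemma smooth_U: assumes "t \<in> {0..<T}" shows "smooth (U t i)"
proof -
 have L: "bounded_linear (%x::real^3. (0::real, x))"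
  by (intro bounded_linear_Pair bounded_linear_zero bounded_linear_ident)
 show ?thesis unfolding smooth_on_def
 proof
  fix k
  show "C_k_on k UNIV (U t i)"
   using C_k_on_affine[OF L, of UNIV "(t, 0)" "{0..<T} \<times> UNIV", OF _ C_k_U[of k i]] assms by (simp add: U_def[abs_def])
 qed
qed

lemma continuous_U: "continuous_on ({0..<T} \<times> UNIV) (%(t, x). U t i x)"
 using C_k_U[of 0 i] by (simp add: U_def split_beta)

lemma continuous_pd_U: "continuous_on ({0..<T} \<times> UNIV) (%(t, x). pd j (U t i) x)"
proof -
 obtain f' where f': "!!p. p \<in> {0..<T} \<times> UNIV ==> ((%p. u (fst p) (snd p) $ i) has_derivative f' p) (at p within {0..<T} \<times> UNIV)"
  "!!v. continuous_on ({0..<T} \<times> UNIV) (%p. f' p v)" using C_k_U[of "Suc 0" i] by auto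
 have "pd j (U t i) x = f' (t, x) (0, axis j 1)" if "t \<in> {0..<T}" for t x
 proof -
  have "((%x. (t, x)) has_derivative (%v. (0, v))) (at x within UNIV)" by (auto intro!: derivative_eq_intros)
  moreover have subset_slab: "range (Pair t) \<subseteq> {0..<T} \<times> UNIV" using that by auto
  ultimately have "((%x. u (fst (t, x)) (snd (t, x)) $ i) has_derivative (%v. f' (t, x) (0, v))) (at x within UNIV)"
   using subset_slab has_derivative_in_compose2[where g = "%p. u (fst p) (snd p) $ i" and g' = f' and t = "{0..<T} \<times> UNIV" and s = UNIV, OF f'(1), of "%x. (t, x)" x "%v. (0, v)"]
    that by auto
  then have "(U t i has_derivative (%v. f' (t, x) (0, v))) (at x)" by (simp add: U_def[abs_def])
  from dir_deriv_eq[OF this] show ?thesis by simp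
 qed
 then show ?thesis by (intro continuous_on_eq[OF f'(2)[of "(0, axis j 1)"]]) auto
qed

lemma slab_subset: "slab T \<subseteq> {0..<T} \<times> UNIV" by auto

lemma lh_facts: "weakly_continuous_L2 {0..T} u" "navier_stokes T u P" "distribution (slab T) P"
 "AE x in lebesgue. u 0 x = u0 x" "!!t. t \<in> {0..T} ==> energy_inequality u 0 t"
 "AE t in lebesgue. t \<in> {0<..<T} --> H1 (u t)" "set_integrable lebesgue {0<..<T} (%t. dirichlet (u t))"
 using lh by (auto simp: leray_hopf_def)

text \<open>Testing with products \<open>\<theta> t * \<psi> x\<close> turns the equation into a family of ordinary distributional equations in time.\<close>

lemma tested_equation:
 assumes \<theta>: "test_function {0<..<T} \<theta>" and \<psi>: "test \<psi>"
 shows "(LINT t:{0<..<T}|lborel. dir_deriv 1 \<theta> t * (\<L> x. U t i x * \<psi> x))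
   + (\<S> j. LINT t:{0<..<T}|lborel. \<theta> t * (\<L> x. U t i x * pd j (pd j \<psi>) x))
   + (\<S> j. LINT t:{0<..<T}|lborel. \<theta> t * (\<L> x. (U t i x * U t j x) * pd j \<psi> x))
   + P (%(t, x). \<theta> t * pd i \<psi> x) = 0"
  and "(\<S> j. LINT t:{0<..<T}|lborel. \<theta> t * (\<L> x. U t j x * pd j \<psi> x)) = 0"
proof -
 define \<phi> where "\<phi> = (%(t, x). \<theta> t * \<psi> x)"
 have t\<phi>: "test_function (slab T) \<phi>" unfolding \<phi>_def by (rule tensor_test[OF \<theta> \<psi>])
 have d: "dt \<phi> (t, x) = dir_deriv 1 \<theta> t * \<psi> x" "dx j \<phi> = (%(t, x). \<theta> t * pd j \<psi> x)"
  "dx j (dx j \<phi>) (t, x) = \<theta> t * pd j (pd j \<psi>) x" for t x j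
  unfolding \<phi>_def by (simp_all add: tensor_test(2,3)[OF \<theta> \<psi>] tensor_test(3)[OF \<theta> test_dir_deriv[OF \<psi>]])
 have cU: "continuous_on (slab T) (%(t, x). U t i x)" for i
  by (rule continuous_on_subset[OF continuous_U slab_subset])
 have cUU: "continuous_on (slab T) (%(t, x). U t i x * U t j x)" for i j
  using continuous_on_mult[OF cU[of i] cU[of j]] by (simp add: split_beta)
 note s1 = slab_integral[OF test_function_dir_deriv[OF \<theta>] \<psi> cU]
 note s2 = slab_integral[OF \<theta> test_dir_deriv[OF test_dir_deriv[OF \<psi>]] cU]
 note s3 = slab_integral[OF \<theta> test_dir_deriv[OF \<psi>] cUU]
 note s4 = slab_integral[OF \<theta> test_dir_deriv[OF \<psi>] cU]
 define I where "I F = (LINT p:slab T|lebesgue. F p)" for F :: "real \<times> (real^3) => real"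
 have add: "I (%p. F p + G p) = I F + I G" "set_integrable lebesgue (slab T) (%p. F p + G p)"
  if "set_integrable lebesgue (slab T) F" "set_integrable lebesgue (slab T) G" for F G
  using that unfolding I_def by auto
 have sum: "I (%p. \<S> j. F j p) = (\<S> j. I (F j))" "set_integrable lebesgue (slab T) (%p. \<S> j. F j p)"
  if "!!j. set_integrable lebesgue (slab T) (F j)" for F :: "3 => real \<times> (real^3) => real"
  using set_LINT_sum[of UNIV lebesgue "slab T" F] that unfolding I_def by blast+
 define A where "A = (%(t, x). dir_deriv 1 \<theta> t * (U t i x * \<psi> x))"
 define B where "B = (%j (t, x). \<theta> t * (U t i x * pd j (pd j \<psi>) x))"
 define C where "C = (%j (t, x). \<theta> t * ((U t i x * U t j x) * pd j \<psi> x))"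
 have e: "(%(t, x). u t x $ i * dt \<phi> (t, x) + u t x $ i * (\<S> j. dx j (dx j \<phi>) (t, x)) + (\<S> j. u t x $ i * u t x $ j * dx j \<phi> (t, x)))
   = (%p. (A p + (\<S> j. B j p)) + (\<S> j. C j p))"
  unfolding d(3) unfolding d(1,2) by (auto simp: fun_eq_iff A_def B_def C_def U_def sum_distrib_left mult_ac)
 have "I (%(t, x). u t x $ i * dt \<phi> (t, x) + u t x $ i * (\<S> j. dx j (dx j \<phi>) (t, x)) + (\<S> j. u t x $ i * u t x $ j * dx j \<phi> (t, x)))
   + P (dx i \<phi>) = 0"
  using lh_facts(2) t\<phi> unfolding navier_stokes_def I_def by blast
 moreover have "set_integrable lebesgue (slab T) A" "set_integrable lebesgue (slab T) (B j)" "set_integrable lebesgue (slab T) (C j)" for j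
  unfolding A_def B_def C_def by (rule s1(1) s2(1) s3(1))+
 ultimately have "I A + (\<S> j. I (B j)) + (\<S> j. I (C j)) + P (dx i \<phi>) = 0"
  unfolding e by (simp add: add sum)
 then show "(LINT t:{0<..<T}|lborel. dir_deriv 1 \<theta> t * (\<L> x. U t i x * \<psi> x))
   + (\<S> j. LINT t:{0<..<T}|lborel. \<theta> t * (\<L> x. U t i x * pd j (pd j \<psi>) x))
   + (\<S> j. LINT t:{0<..<T}|lborel. \<theta> t * (\<L> x. (U t i x * U t j x) * pd j \<psi> x))
   + P (%(t, x). \<theta> t * pd i \<psi> x) = 0"
  unfolding I_def A_def B_def C_def s1(2) s2(2) s3(2) d .
 have "I (%(t, x). \<S> j. u t x $ j * dx j \<phi> (t, x)) = 0"
  using lh_facts(2) t\<phi> unfolding navier_stokes_def I_def by blast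
 moreover have "(%(t, x). \<S> j. u t x $ j * dx j \<phi> (t, x)) = (%p. \<S> j. (%(t, x). \<theta> t * (U t j x * pd j \<psi> x)) p)"
  unfolding d by (auto simp: fun_eq_iff U_def mult_ac)
 ultimately show "(\<S> j. LINT t:{0<..<T}|lborel. \<theta> t * (\<L> x. U t j x * pd j \<psi> x)) = 0"
  using sum(1)[of "%j (t, x). \<theta> t * (U t j x * pd j \<psi> x)"] s4 unfolding I_def by simp
qed

lemma continuous_time_integral:
 assumes "test \<psi>"
 shows "continuous_on {0<..<T} (%t. \<L> x. U t i x * \<psi> x)"
  "continuous_on {0<..<T} (%t. \<L> x. (U t i x * U t j x) * \<psi> x)"
  "continuous_on {0<..<T} (%t. \<L> x. pd j (U t i) x * \<psi> x)"
proof -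
 obtain r where r: "!!x. r < norm x ==> \<psi> x = 0" using test_bounded_supp[OF assms] by blast
 have c\<psi>: "continuous_on UNIV \<psi>" using assms by (intro smooth_cont test_smooth)
 have cU: "continuous_on (slab T) (%(t, x). U t i x)" "continuous_on (slab T) (%(t, x). pd j (U t i) x)" for i j
  by (rule continuous_on_subset[OF continuous_U slab_subset] continuous_on_subset[OF continuous_pd_U slab_subset])+
 have cUU: "continuous_on (slab T) (%(t, x). U t i x * U t j x)" for i j
  using continuous_on_mult[OF cU(1)[of i] cU(1)[of j]] by (simp add: split_beta)
 show "continuous_on {0<..<T} (%t. \<L> x. U t i x * \<psi> x)"
  "continuous_on {0<..<T} (%t. \<L> x. (U t i x * U t j x) * \<psi> x)"
  "continuous_on {0<..<T} (%t. \<L> x. pd j (U t i) x * \<psi> x)"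
  by (rule continuous_slice_integral[OF cU(1) r c\<psi>] continuous_slice_integral[OF cUU r c\<psi>] continuous_slice_integral[OF cU(2) r c\<psi>]; assumption)+
qed

text \<open>The divergence constraint holds in the sense of distributions and its left-hand side is continuous.\<close>

lemma divergence_free:
 assumes t: "t \<in> {0<..<T}" shows "(\<S> i. pd i (U t i) x) = 0"
proof -
 have sU: "smooth (U t i)" for i using t by (intro smooth_U) auto
 have weak: "(\<S> j. \<L> x. U t j x * pd j \<psi> x) = 0" if \<psi>: "test \<psi>" for \<psi>
 proof (rule fundamental_lemma_continuous[where \<Omega> = "{0<..<T}" and q = "%t. \<S> j. \<L> x. U t j x * pd j \<psi> x"])
  show c: "continuous_on {0<..<T} (%t. \<S> j. \<L> x. U t j x * pd j \<psi> x)"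
   by (intro continuous_on_sum continuous_time_integral(1) test_dir_deriv \<psi>)
  fix \<theta> assume \<theta>: "test_function {0<..<T} \<theta>"
  have i: "set_integrable lborel {0<..<T} (%t. \<theta> t * (\<L> x. U t j x * pd j \<psi> x))" for j
   by (intro test_function_time_integrable \<theta> continuous_time_integral(1) test_dir_deriv \<psi>)
  have "(LINT t:{0<..<T}|lborel. (\<S> j. \<L> x. U t j x * pd j \<psi> x) * \<theta> t)
   = (LINT t:{0<..<T}|lborel. (\<S> j. \<theta> t * (\<L> x. U t j x * pd j \<psi> x)))"
   by (simp add: sum_distrib_left mult.commute)
  also have "... = (\<S> j. LINT t:{0<..<T}|lborel. \<theta> t * (\<L> x. U t j x * pd j \<psi> x))"
   using i unfolding set_integrable_def set_lebesgue_integral_def scaleR_sum_right by (intro B_integral_sum) auto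
  finally show "(LINT t:{0<..<T}|lborel. (\<S> j. \<L> x. U t j x * pd j \<psi> x) * \<theta> t) = 0"
   using tested_equation(2)[OF \<theta> \<psi>] by simp
 qed (use t in auto)
 show ?thesis
 proof (rule fundamental_lemma_continuous[where \<Omega> = UNIV and q = "%x. \<S> i. pd i (U t i) x"])
  show "continuous_on UNIV (%x. \<S> i. pd i (U t i) x)"
   by (intro smooth_cont smooth_sum smooth_dir_deriv sU)
  fix \<psi> :: "real^3 => real" assume "test_function UNIV \<psi>"
  then have \<psi>: "test \<psi>" .
  have "(LINT x:UNIV|lborel. (\<S> i. pd i (U t i) x) * \<psi> x) = (\<L> x. (\<S> i. pd i (U t i) x * \<psi> x))"
   by (simp add: set_lebesgue_integral_def sum_distrib_right)
  also have "... = (\<S> i. \<L> x. pd i (U t i) x * \<psi> x)"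
   by (intro B_integral_sum integrable_continuous_test \<psi> smooth_cont smooth_dir_deriv sU)
  also have "... = - (\<S> i. \<L> x. U t i x * pd i \<psi> x)"
   by (simp add: integral_by_parts[OF sU \<psi>] sum_negf)
  finally show "(LINT x:UNIV|lborel. (\<S> i. pd i (U t i) x) * \<psi> x) = 0" using weak[OF \<psi>] by simp
 qed auto
qed

definition stress :: "real => 3 => 3 => real^3 => real" where
 "stress t i j x = - pd j (U t i) x + U t i x * U t j x"

text \<open>The rate of work of the total stress against a field \<open>w\<close>.\<close>

definition stress_power :: "real => vfield => real" where
 "stress_power t w = (\<S> i. \<S> j. \<L> x. stress t i j x * pd j (w i) x)"

lemma smooth_stress: "t \<in> {0..<T} ==> smooth (stress t i j)"
 unfolding stress_def[abs_def] by (intro smooth_add smooth_minus smooth_mult smooth_dir_deriv smooth_U)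

lemma continuous_stress_power:
 assumes w: "!!i. test (w i)" shows "continuous_on {0<..<T} (%t. stress_power t w)"
proof -
 have "continuous_on {0<..<T} (%t. \<L> x. stress t i j x * pd j (w i) x)" for i j
 proof (rule continuous_on_eq)
  show "continuous_on {0<..<T} (%t. - (\<L> x. pd j (U t i) x * pd j (w i) x) + (\<L> x. (U t i x * U t j x) * pd j (w i) x))"
   by (intro continuous_intros continuous_time_integral test_dir_deriv w)
  fix t assume t: "t \<in> {0<..<T}"
  have sU: "smooth (U t i)" for i using t by (intro smooth_U) auto
  have "integrable lborel (%x. pd j (U t i) x * pd j (w i) x)" "integrable lborel (%x. (U t i x * U t j x) * pd j (w i) x)"
   by (intro integrable_continuous_test test_dir_deriv w smooth_cont smooth_mult smooth_dir_deriv sU)+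
  then show "- (\<L> x. pd j (U t i) x * pd j (w i) x) + (\<L> x. (U t i x * U t j x) * pd j (w i) x)
    = (\<L> x. stress t i j x * pd j (w i) x)" unfolding stress_def by (simp add: algebra_simps)
 qed
 then show ?thesis unfolding stress_power_def by (intro continuous_on_sum)
qed

text \<open>The equation tested with a divergence-free field that does not depend on time.  The pressure
 drops out, since it only sees the divergence of the test field.\<close>

lemma momentum:
 assumes w: "!!i. test (w i)" and div: "!!x. (\<S> i. pd i (w i) x) = 0" and st: "0 < s" "s < t" "t < T"
 shows "(\<S> i. \<L> x. U t i x * w i x) - (\<S> i. \<L> x. U s i x * w i x) = (LINT \<tau>:{s..t}|lborel. stress_power \<tau> w)"
proof (rule weak_time_derivative[OF _ _ _ st])
 show "continuous_on {0<..<T} (%t. \<S> i. \<L> x. U t i x * w i x)"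
  by (intro continuous_on_sum continuous_time_integral w)
 show "continuous_on {0<..<T} (%t. stress_power t w)" by (rule continuous_stress_power[OF w])
 fix \<theta> assume \<theta>: "test_function {0<..<T} \<theta>"
 have P0: "(\<S> i. P (%(t, x). \<theta> t * pd i (w i) x)) = 0"
 proof -
  define f where "f i = (%(t, x). \<theta> t * pd i (w i) x)" for i
  have tf: "test_function (slab T) (f i)" for i unfolding f_def by (intro tensor_test(1) \<theta> test_dir_deriv w)
  have fsum: "f 1 p + f 2 p + f 3 p = 0" for p
  proof -
   have "f 1 p + f 2 p + f 3 p = \<theta> (fst p) * (pd 1 (w 1) (snd p) + pd 2 (w 2) (snd p) + pd 3 (w 3) (snd p))"
    unfolding f_def split_beta distrib_left ..
   then show ?thesis using div[of "snd p"] unfolding sum_3 by simp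
  qed
  have padd: "P (%p. F p + G p) = P F + P G" if "test_function (slab T) F" "test_function (slab T) G" for F G
   by (rule conjunct1[OF lh_facts(3)[unfolded distribution_def], rule_format, OF that])
  have pm: "P (%p. c * F p) = c * P F" if "test_function (slab T) F" for F c
   by (rule conjunct1[OF conjunct2[OF lh_facts(3)[unfolded distribution_def]], rule_format, OF that])
  have f12: "test_function (slab T) (%p. f 1 p + f 2 p)"
  proof -
   have "(%p. f 1 p + f 2 p) = (%p. - f 3 p)"
   proof
    fix p :: "real \<times> (real^3)"
    show "f 1 p + f 2 p = - f 3 p" using fsum[of p] by linarith
   qed
   moreover have "test_function (slab T) (%p. - f 3 p)"
    using tensor_test(1)[OF \<theta> test_minus[OF test_dir_deriv[OF w]], of "axis 3 1" 3]
    by (simp add: f_def split_beta')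
   ultimately show ?thesis by simp
  qed
  have "P (f 1) + P (f 2) + P (f 3) = P (%p. f 1 p + f 2 p + f 3 p)"
   using padd[OF f12 tf[of 3]] padd[OF tf[of 1] tf[of 2]] by simp
  also have "(%p. f 1 p + f 2 p + f 3 p) = (%p. 0 * f 1 p)"
  proof
   fix p :: "real \<times> (real^3)"
   show "f 1 p + f 2 p + f 3 p = 0 * f 1 p" using fsum[of p] by simp
  qed
  also have "P (%p. 0 * f 1 p) = 0" using pm[OF tf[of 1], of 0] by simp
  finally show ?thesis by (simp add: f_def sum_3)
 qed
 define a where "a i t = (\<L> x. U t i x * w i x)" for i t
 define b where "b i j t = (\<L> x. U t i x * pd j (pd j (w i)) x)" for i j t
 define c where "c i j t = (\<L> x. (U t i x * U t j x) * pd j (w i) x)" for i j t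
 have ia: "set_integrable lborel {0<..<T} (%t. dir_deriv 1 \<theta> t * a i t)" "set_integrable lborel {0<..<T} (%t. \<theta> t * b i j t)"
  "set_integrable lborel {0<..<T} (%t. \<theta> t * c i j t)" for i j
  unfolding a_def b_def c_def
  by (intro test_function_time_integrable test_function_dir_deriv \<theta> continuous_time_integral test_dir_deriv w)+
 have pw: "stress_power t w = (\<S> i. \<S> j. b i j t + c i j t)" if t: "t \<in> {0<..<T}" for t
 proof -
  have sU: "smooth (U t i)" for i using t by (intro smooth_U) auto
  have "(\<L> x. stress t i j x * pd j (w i) x) = b i j t + c i j t" for i j
  proof -
   have "integrable lborel (%x. pd j (U t i) x * pd j (w i) x)" "integrable lborel (%x. (U t i x * U t j x) * pd j (w i) x)"
    by (intro integrable_continuous_test test_dir_deriv w smooth_cont smooth_mult smooth_dir_deriv sU)+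
   then show ?thesis using integral_by_parts[OF sU[of i] test_dir_deriv[OF w[of i], of "axis j 1"], of "axis j 1"]
    unfolding stress_def b_def c_def by (simp add: algebra_simps)
  qed
  then show ?thesis unfolding stress_power_def by simp
 qed
 have "(LINT t:{0<..<T}|lborel. dir_deriv 1 \<theta> t * (\<S> i. a i t) + \<theta> t * stress_power t w)
   = (LINT t:{0<..<T}|lborel. (\<S> i. dir_deriv 1 \<theta> t * a i t + (\<S> j. \<theta> t * b i j t) + (\<S> j. \<theta> t * c i j t)))"
  by (rule set_lebesgue_integral_cong) (auto simp: pw sum_distrib_left sum.distrib distrib_left)
 also have "... = (\<S> i. (LINT t:{0<..<T}|lborel. dir_deriv 1 \<theta> t * a i t) + (\<S> j. LINT t:{0<..<T}|lborel. \<theta> t * b i j t)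
   + (\<S> j. LINT t:{0<..<T}|lborel. \<theta> t * c i j t))"
  using ia by (simp add: set_LINT_sum)
 also have "... = (\<S> i. - P (%(t, x). \<theta> t * pd i (w i) x))"
 proof (rule sum.cong[OF refl])
  fix i
  show "(LINT t:{0<..<T}|lborel. dir_deriv 1 \<theta> t * a i t) + (\<S> j. LINT t:{0<..<T}|lborel. \<theta> t * b i j t)
   + (\<S> j. LINT t:{0<..<T}|lborel. \<theta> t * c i j t) = - P (%(t, x). \<theta> t * pd i (w i) x)"
   using tested_equation(1)[OF \<theta> w[of i], of i] unfolding a_def b_def c_def by linarith
 qed
 also have "... = 0" using P0 by (simp add: sum_negf)
 finally show "(LINT t:{0<..<T}|lborel. dir_deriv 1 \<theta> t * (\<S> i. \<L> x. U t i x * w i x) + \<theta> t * stress_power t w) = 0"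
  unfolding a_def .
qed

lemma L2_U:
 assumes t: "t \<in> {0..<T}"
 shows "sq_int (U t i)" "kinetic (u t) = (\<S> i. (l2 (U t i))^2)"
proof -
 have sU: "smooth (U t i)" for i by (rule smooth_U[OF t])
 have b: "meas ((%x. (norm (u t x))^2))"
  unfolding norm_vec_sq U_def[symmetric] using smooth_borel[OF sU] by measurable
 have "L2 (u t)" using lh_facts(1) t by (auto simp: weakly_continuous_L2_def)
 then have I: "integrable lborel (%x. (norm (u t x))^2)" using integrable_lebesgue_borel[OF b] by (simp add: L2_def)
 have q: "sq_int (U t i)" for i unfolding sq_int_def
 proof
  show "meas (U t i)" by (rule smooth_borel[OF sU])
  then have "(%x. (U t i x)^2) \<in> borel_measurable lborel" by simp
  moreover have "(U t i x)^2 <= (norm (u t x))^2" for x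
   unfolding norm_vec_sq U_def by (rule member_le_sum) auto
  ultimately show "integrable lborel (%x. (U t i x)^2)"
   by (intro B_integrable_bound[OF I]) auto
 qed
 then show "sq_int (U t i)" .
 have "kinetic (u t) = (\<L> x. (\<S> i. (U t i x)^2))"
  unfolding kinetic_def integral_lebesgue_borel[OF b] unfolding norm_vec_sq U_def ..
 also have "... = (\<S> i. (l2 (U t i))^2)"
  unfolding l2_power2 using q by (intro B_integral_sum) (auto simp: sq_int_def)
 finally show "kinetic (u t) = (\<S> i. (l2 (U t i))^2)" .
qed

lemma dirichlet_nonneg: "0 <= dirichlet f" by (simp add: dirichlet_def)

lemma kinetic_nonneg: "0 <= kinetic f" by (simp add: kinetic_def)

lemma kinetic_le: assumes "t \<in> {0..T}" shows "kinetic (u t) <= kinetic (u 0)"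
proof -
 have "0 <= dissip {0..t}"
  unfolding set_lebesgue_integral_def by (intro B_integral_nonneg) (auto simp: dirichlet_nonneg)
 then show ?thesis using lh_facts(5)[OF assms] by (simp add: energy_inequality_def)
qed

definition ubound :: real where "ubound = sqrt (kinetic (u 0))"

lemma l2_U_le: assumes t: "t \<in> {0..<T}" shows "l2 (U t i) <= ubound"
proof -
 have "(l2 (U t i))^2 <= kinetic (u t)" unfolding L2_U(2)[OF t] by (rule member_le_sum) auto
 also have "... <= kinetic (u 0)" using t by (intro kinetic_le) auto
 finally show ?thesis unfolding ubound_def by (rule real_le_rsqrt)
qed

lemma ubound_nonneg: "0 <= ubound" by (simp add: ubound_def kinetic_nonneg)

lemma gradient_U:
 assumes t: "t \<in> {0..<T}" and H: "H1 (u t)"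
 shows "sq_int (pd j (U t i))" "dirichlet (u t) = (\<S> i. grad_sq (U t i))"
 using dirichlet_smooth[OF smooth_U[OF t, unfolded U_def[abs_def]] H] by (simp_all add: U_def[abs_def])

end

section \<open>The quadratic form of the approximate projection\<close>

text \<open>A crude bound, used only to compare the approximate projections at neighbouring times; its constant depends on
 the cutoff and the kernel.\<close>

lemma leray_sup_bound:
 assumes \<phi>: "test \<phi>" and m: "test m"
 shows "\<exists>C\<ge>0. \<forall>w M. (\<forall>i. smooth (w i)) --> (\<forall>i j x. \<bar>curl_cut \<phi> w i j x\<bar> <= M) --> (\<forall>i k x. \<bar>pd k (leray \<phi> m w i) x\<bar> <= C * M)"
proof -
 have "\<exists>B>0. \<forall>x. \<bar>f x\<bar> <= B" if "test f" for f :: "real^3 => real" using test_bounded[OF that] by metis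
 then have "\<exists>B>0. \<forall>x. \<bar>\<phi> x\<bar> <= B" "\<forall>j. \<exists>B>0. \<forall>x. \<bar>pd j \<phi> x\<bar> <= B" "\<forall>k j. \<exists>B>0. \<forall>x. \<bar>pd k (pd j \<phi>) x\<bar> <= B"
  using \<phi> test_dir_deriv by blast+
 then obtain b0 b1 b2 where b: "b0 > 0" "!!x. \<bar>\<phi> x\<bar> <= b0" "!!j. b1 j > 0" "!!j x. \<bar>pd j \<phi> x\<bar> <= b1 j"
  "!!k j. b2 k j > 0" "!!k j x. \<bar>pd k (pd j \<phi>) x\<bar> <= b2 k j" by metis
 define l0 where "l0 = (\<L> x. \<bar>m x\<bar>)"
 define l1 where "l1 j = (\<L> x. \<bar>pd j m x\<bar>)" for j
 define l2' where "l2' k j = (\<L> x. \<bar>pd k (pd j m) x\<bar>)" for k j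
 define c where "c k = (\<S> j. b0 * l2' k j + b1 k * l1 j + b1 j * l1 k + b2 k j * l0)" for k
 have nn: "0 <= l0" "0 <= l1 j" "0 <= l2' k j" for k j by (auto simp: l0_def l1_def l2'_def)
 have c0: "0 <= c k" for k unfolding c_def
  by (intro sum_nonneg add_nonneg_nonneg mult_nonneg_nonneg nn less_imp_le b)
 define C where "C = (\<S> k. c k)"
 have cC: "c k <= C" for k unfolding C_def by (rule member_le_sum) (auto simp: c0)
 have C0: "0 <= C" unfolding C_def by (intro sum_nonneg c0)
 have "\<bar>pd k (leray \<phi> m w i) x\<bar> <= C * M" if w: "\<forall>i. smooth (w i)" and M: "\<forall>i j x. \<bar>curl_cut \<phi> w i j x\<bar> <= M" for w M i k x
 proof -
  have M0: "0 <= M" using M abs_ge_zero order_trans by blast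
  define g where "g j = curl_cut \<phi> w j i" for j
  have tg: "test (g j)" for j unfolding g_def using \<phi> w by (intro test_curl_cut) auto
  have gM: "\<bar>g j x\<bar> <= M" for j x using M by (simp add: g_def)
  have tc: "test (conv m (g j))" for j by (rule test_conv[OF m tg])
  have s: "smooth \<phi>" "smooth (pd j \<phi>)" "smooth (conv m (g j))" "smooth (pd j (conv m (g j)))" for j
   using \<phi> tc test_smooth by blast+
  have d1: "pd j (conv m (g j')) = conv (pd j m) (g j')" for j j' by (rule dir_deriv_conv[OF test_smooth[OF m] tg])
  have d2: "pd k (pd j (conv m (g j'))) = conv (pd k (pd j m)) (g j')" for k j j'
   unfolding d1 by (rule dir_deriv_conv[OF smooth_dir_deriv[OF test_smooth[OF m]] tg])
  have e: "pd k (leray \<phi> m w i) x = - (\<S> j. pd k (pd j (%y. \<phi> y * conv m (g j) y)) x)"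
   unfolding leray_def[abs_def] g_def[symmetric]
   by (simp add: dir_deriv_minus smooth_sum dir_deriv_sum smooth_dir_deriv smooth_mult s)
  have "pd k (pd j (%y. \<phi> y * conv m (g j) y)) x = \<phi> x * conv (pd k (pd j m)) (g j) x + pd k \<phi> x * conv (pd j m) (g j) x
    + pd j \<phi> x * conv (pd k m) (g j) x + pd k (pd j \<phi>) x * conv m (g j) x" for j
   using s by (simp add: dir_deriv_mult dir_deriv_add smooth_mult d2[symmetric] d1[symmetric])
  moreover have "\<bar>\<phi> x * conv (pd k (pd j m)) (g j) x + pd k \<phi> x * conv (pd j m) (g j) x
    + pd j \<phi> x * conv (pd k m) (g j) x + pd k (pd j \<phi>) x * conv m (g j) x\<bar>
    <= b0 * (l2' k j * M) + b1 k * (l1 j * M) + b1 j * (l1 k * M) + b2 k j * (l0 * M)" for j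
  proof -
   have "\<bar>p * q\<bar> <= P * Q" if "\<bar>p\<bar> <= P" "\<bar>q\<bar> <= Q" for p q P Q :: real
    unfolding abs_mult using that by (intro mult_mono) auto
   then show ?thesis unfolding l0_def l1_def l2'_def
    by (intro order_trans[OF abs_triangle_ineq] add_mono) (simp_all add: b conv_bound[OF _ tg gM] m test_dir_deriv)
  qed
  ultimately have "\<bar>pd k (pd j (%y. \<phi> y * conv m (g j) y)) x\<bar> <= (b0 * l2' k j + b1 k * l1 j + b1 j * l1 k + b2 k j * l0) * M" for j
   by (simp add: algebra_simps)
  then have "\<bar>\<S> j. pd k (pd j (%y. \<phi> y * conv m (g j) y)) x\<bar> <= (\<S> j. (b0 * l2' k j + b1 k * l1 j + b1 j * l1 k + b2 k j * l0) * M)"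
   by (intro order_trans[OF sum_abs] sum_mono)
  also have "... = c k * M" by (simp add: c_def sum_distrib_right)
  also have "... <= C * M" by (intro mult_right_mono cC M0)
  finally show ?thesis unfolding e by simp
 qed
 then show ?thesis using C0 by blast
qed

lemma slab_uniformly_continuous:
 fixes f :: "real => real^3 => real"
 assumes "continuous_on ({a..b} \<times> UNIV) (%(t, x). f t x)" "0 < e"
 obtains d where "0 < d" "!!t t' x x'. t \<in> {a..b} ==> t' \<in> {a..b} ==> norm x <= r ==> norm x' <= r ==> \<bar>t - t'\<bar> < d ==> dist x x' < d ==> \<bar>f t x - f t' x'\<bar> < e"
proof -
 have "uniformly_continuous_on ({a..b} \<times> cball 0 r) (%p. f (fst p) (snd p))"
  using assms(1) by (intro compact_uniformly_continuous compact_Times) (auto simp: split_beta intro: continuous_on_subset)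
 then obtain d where d: "0 < d" "!!p p'. p \<in> {a..b} \<times> cball 0 r ==> p' \<in> {a..b} \<times> cball 0 r ==> dist p' p < d ==> dist (f (fst p') (snd p')) (f (fst p) (snd p)) < e"
  using assms(2) unfolding uniformly_continuous_on_def by metis
 show ?thesis
 proof (rule that[of "d / 2"])
  show "\<bar>f t x - f t' x'\<bar> < e" if "t \<in> {a..b}" "t' \<in> {a..b}" "norm x <= r" "norm x' <= r" "\<bar>t - t'\<bar> < d / 2" "dist x x' < d / 2" for t t' x x'
  proof -
   have "dist (t, x) (t', x') <= dist t t' + dist x x'" unfolding dist_Pair_Pair by (rule sqrt_sum_squares_le_sum) auto
   then have "dist (t, x) (t', x') < d" using that by (simp add: dist_real_def)
   then show ?thesis using d(2)[of "(t', x')" "(t, x)"] that by (simp add: dist_real_def)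
  qed
 qed (use d in simp)
qed

lemma slab_bounded:
 fixes f :: "real => real^3 => real"
 assumes "continuous_on ({a..b} \<times> UNIV) (%(t, x). f t x)"
 obtains B where "0 < B" "!!t x. t \<in> {a..b} ==> norm x <= r ==> \<bar>f t x\<bar> <= B"
proof -
 have "compact ((%p. f (fst p) (snd p)) ` ({a..b} \<times> cball 0 r))"
  by (intro compact_continuous_image continuous_on_subset[OF assms[unfolded split_beta']] compact_Times) auto
 then obtain B where B: "\<forall>y\<in>(%p. f (fst p) (snd p)) ` ({a..b} \<times> cball 0 r). norm y <= B" using compact_imp_bounded bounded_iff by metis
 show ?thesis
 proof (rule that[of "max B 1"])
  show "\<bar>f t x\<bar> <= max B 1" if "t \<in> {a..b}" "norm x <= r" for t x
  proof -
   have "(t, x) \<in> {a..b} \<times> cball 0 r" using that by simp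
   from bspec[OF B imageI[OF this]] show ?thesis by simp
  qed
 qed simp
qed

lemma integral_bound_ball:
 fixes f g :: "real^3 => real"
 assumes f: "continuous_on UNIV f" and g: "test g" and r: "0 < r" "!!x. r < norm x ==> g x = 0"
  and b: "!!x. norm x <= r ==> \<bar>f x\<bar> <= B" "!!x. \<bar>g x\<bar> <= M"
 shows "\<bar>\<L> x. f x * g x\<bar> <= measure lborel (cball (0::real^3) r) * (B * M)"
proof -
 have M0: "0 <= M" using b(2) abs_ge_zero order_trans by blast
 have B0: "0 <= B" using b(1)[of 0] r(1) by force
 have i: "integrable lborel (%x. \<bar>f x * g x\<bar>)" by (intro integrable_abs integrable_continuous_test f g)
 have ii: "integrable lborel (%x::real^3. indicator (cball 0 r) x * (B * M))"
  using borel_integrable_compact[of "cball (0::real^3) r" "%_. B * M"] by simp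
 have "\<bar>\<L> x. f x * g x\<bar> <= (\<L> x. \<bar>f x * g x\<bar>)" by (rule integral_abs_bound)
 also have "... <= (\<L> x::real^3. indicator (cball 0 r) x * (B * M))"
 proof (rule integral_mono[OF i ii])
  fix x :: "real^3"
  show "\<bar>f x * g x\<bar> <= indicator (cball 0 r) x * (B * M)"
   using b(1)[of x] b(2)[of x] r(2)[of x] B0 by (cases "norm x <= r") (auto simp: abs_mult intro!: mult_mono)
 qed
 also have "... = measure lborel (cball (0::real^3) r) * (B * M)" by simp
 finally show ?thesis .
qed

lemma cutoff_outside: assumes "0 < R" "R < norm y" shows "cutoff R y = 0"
proof -
 have "1 < norm ((1 / R) *\<^sub>R y)" using assms by (simp add: field_simps)
 from sq_gt_1[OF this] show ?thesis unfolding cutoff_def bump_def by simp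
qed

lemma leray_outside: assumes "test m" "!!i. smooth (u i)" "0 < R" "R < norm x" shows "leray (cutoff R) m u i x = 0"
proof -
 have "pd j (%y. cutoff R y * conv m (curl_cut (cutoff R) u j i) y) x = 0" for j
  by (rule dir_deriv_outside_supp[OF _ assms(4)]) (simp add: cutoff_outside[OF assms(3)])
 then show ?thesis by (simp add: leray_def)
qed

context smooth_leray
begin

definition S :: "real => real => real => vfield" where
 "S \<epsilon> R t = leray (cutoff R) (newton \<epsilon> R) (U t)"

lemma test_S: "0 < R ==> t \<in> {0..<T} ==> test (S \<epsilon> R t i)"
 unfolding S_def by (intro test_leray test_cutoff test_newton smooth_U)

lemma div_S: "0 < R ==> t \<in> {0..<T} ==> (\<S> i. pd i (S \<epsilon> R t i) x) = 0"
 unfolding S_def by (intro div_leray test_cutoff test_newton smooth_U)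

lemma slab_cont:
 assumes "0 < a" "b < T"
 shows "continuous_on ({a..b} \<times> UNIV) (%(t, x). U t i x)" "continuous_on ({a..b} \<times> UNIV) (%(t, x). pd j (U t i) x)"
  "continuous_on ({a..b} \<times> UNIV) (%(t, x). stress t i j x)"
proof -
 have sub: "{a..b} \<times> UNIV \<subseteq> {0..<T} \<times> UNIV" using assms by auto
 show c: "continuous_on ({a..b} \<times> UNIV) (%(t, x). U t i x)" "continuous_on ({a..b} \<times> UNIV) (%(t, x). pd j (U t i) x)" for i
  by (rule continuous_on_subset[OF continuous_U sub] continuous_on_subset[OF continuous_pd_U sub])+
 have "continuous_on ({a..b} \<times> UNIV) (%p. - (case p of (t, x) => pd j (U t i) x) + (case p of (t, x) => U t i x) * (case p of (t, x) => U t j x))"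
  by (intro continuous_intros c)
 then show "continuous_on ({a..b} \<times> UNIV) (%(t, x). stress t i j x)" by (simp add: stress_def split_beta)
qed

lemma stress_power_diff:
 assumes "t \<in> {0<..<T}" "!!i. test (v i)" "!!i. test (w i)"
 shows "stress_power t (%i x. v i x - w i x) = stress_power t v - stress_power t w"
proof -
 have sc: "continuous_on UNIV (stress t i j)" for i j using assms(1) by (intro smooth_cont smooth_stress) auto
 have "integrable lborel (%x. stress t i j x * pd j (v i) x)" "integrable lborel (%x. stress t i j x * pd j (w i) x)" for i j
  by (intro integrable_continuous_test sc test_dir_deriv assms)+
 then show ?thesis unfolding stress_power_def
  by (simp add: dir_deriv_diff test_smooth[OF assms(2)] test_smooth[OF assms(3)] right_diff_distrib sum_subtractf)
qed

lemma stress_power_S_modulus: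
 assumes ab: "0 < a" "b < T" and R: "0 < R" and e: "0 < e"
 obtains d where "0 < d" "!!t \<tau>. t \<in> {a..b} ==> \<tau> \<in> {a..b} ==> \<bar>t - \<tau>\<bar> < d ==> \<bar>stress_power \<tau> (S \<epsilon> R t) - stress_power \<tau> (S \<epsilon> R \<tau>)\<bar> <= e"
proof -
 have t\<phi>: "test (cutoff R)" and tm: "test (newton \<epsilon> R)" by (rule test_cutoff[OF R] test_newton[OF R])+
 obtain C where C: "0 <= C" "!!w M i k x. (!!i. smooth (w i)) ==> (!!i j x. \<bar>curl_cut (cutoff R) w i j x\<bar> <= M) ==> \<bar>pd k (leray (cutoff R) (newton \<epsilon> R) w i) x\<bar> <= C * M"
  using leray_sup_bound[OF t\<phi> tm] by metis
 have "\<forall>i j. \<exists>B>0. \<forall>t x. t \<in> {a..b} --> norm x <= R --> \<bar>stress t i j x\<bar> <= B"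
  using slab_bounded[OF slab_cont(3)[OF ab]] by metis
 then obtain Bs where Bs: "!!i j. 0 < Bs i j" "!!i j t x. t \<in> {a..b} ==> norm x <= R ==> \<bar>stress t i j x\<bar> <= Bs i j" by metis
 define V where "V = measure lborel (cball (0::real^3) R)"
 define H where "H = (\<S> i. \<S> j. V * (Bs i j * C))"
 have H: "0 <= H" unfolding H_def V_def using C Bs(1) by (intro sum_nonneg mult_nonneg_nonneg) (auto intro: less_imp_le)
 define M where "M = e / (H + 1)"
 have M: "0 < M" using e H by (simp add: M_def)
 have "\<forall>i j. \<exists>d>0. \<forall>t t' x. t \<in> {a..b} --> t' \<in> {a..b} --> norm x <= R --> \<bar>t - t'\<bar> < d --> \<bar>pd j (U t i) x - pd j (U t' i) x\<bar> < M / 2"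
 proof (intro allI)
  fix i j
  obtain d where d: "0 < d" "!!t t' x x'. t \<in> {a..b} ==> t' \<in> {a..b} ==> norm x <= R ==> norm x' <= R ==> \<bar>t - t'\<bar> < d ==> dist x x' < d ==> \<bar>pd j (U t i) x - pd j (U t' i) x'\<bar> < M / 2"
   using slab_uniformly_continuous[OF slab_cont(2)[OF ab], of "M / 2" R] M by auto
  then show "\<exists>d>0. \<forall>t t' x. t \<in> {a..b} --> t' \<in> {a..b} --> norm x <= R --> \<bar>t - t'\<bar> < d --> \<bar>pd j (U t i) x - pd j (U t' i) x\<bar> < M / 2"
   by (intro exI[of _ d]) auto
 qed
 then obtain dd where dd: "!!i j. 0 < dd i j" "!!i j t t' x. t \<in> {a..b} ==> t' \<in> {a..b} ==> norm x <= R ==> \<bar>t - t'\<bar> < dd i j ==> \<bar>pd j (U t i) x - pd j (U t' i) x\<bar> < M / 2"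
  by metis
 define d where "d = Min (range (%(i, j). dd i j))"
 have d0: "0 < d" unfolding d_def by (subst Min_gr_iff) (auto simp: dd(1))
 have dle: "d <= dd i j" for i j unfolding d_def by (rule Min_le) (auto intro: rev_image_eqI[of "(i, j)"])
 show ?thesis
 proof (rule that[OF d0])
  fix t \<tau> assume t: "t \<in> {a..b}" "\<tau> \<in> {a..b}" "\<bar>t - \<tau>\<bar> < d"
  have t0: "t \<in> {0..<T}" "\<tau> \<in> {0..<T}" "\<tau> \<in> {0<..<T}" using t ab by auto
  have sU: "smooth (U t i)" "smooth (U \<tau> i)" for i using smooth_U t0 by auto
  define w where "w = (%i x. U t i x - U \<tau> i x)"
  have sw: "smooth (w i)" for i unfolding w_def by (intro smooth_diff sU)
  have cM: "\<bar>curl_cut (cutoff R) w i j x\<bar> <= M" for i j x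
  proof (cases "norm x <= R")
   case True
   have "\<bar>pd i (U t j) x - pd i (U \<tau> j) x\<bar> < M / 2" "\<bar>pd j (U t i) x - pd j (U \<tau> i) x\<bar> < M / 2"
    using dd(2)[OF t(1,2) True] t(3) dle less_le_trans by blast+
   moreover have "pd i (w j) x - pd j (w i) x = (pd i (U t j) x - pd i (U \<tau> j) x) - (pd j (U t i) x - pd j (U \<tau> i) x)"
    unfolding w_def by (simp add: dir_deriv_diff sU)
   ultimately have "\<bar>pd i (w j) x - pd j (w i) x\<bar> <= M" by linarith
   then show ?thesis unfolding curl_cut_def abs_mult
    using mult_mono[OF cutoff_bounds(3)[of R x] _ , of "\<bar>pd i (w j) x - pd j (w i) x\<bar>" M] by simp
  next
   case False
   then show ?thesis using cutoff_outside[OF R] M by (simp add: curl_cut_def)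
  qed
  have wS: "(%x. S \<epsilon> R t i x - S \<epsilon> R \<tau> i x) = leray (cutoff R) (newton \<epsilon> R) w i" for i
   unfolding S_def w_def by (rule leray_diff[OF t\<phi> tm sU, symmetric])
  have tw: "test (leray (cutoff R) (newton \<epsilon> R) w i)" for i by (intro test_leray t\<phi> tm sw)
  have "\<bar>\<L> x. stress \<tau> i j x * pd j (leray (cutoff R) (newton \<epsilon> R) w i) x\<bar> <= V * (Bs i j * (C * M))" for i j
   unfolding V_def
  proof (rule integral_bound_ball[OF _ test_dir_deriv[OF tw] R])
   show "continuous_on UNIV (stress \<tau> i j)" using t0 by (intro smooth_cont smooth_stress)
   show "pd j (leray (cutoff R) (newton \<epsilon> R) w i) x = 0" if "R < norm x" for x
    by (rule dir_deriv_outside_supp[OF _ that]) (rule leray_outside[OF tm sw R])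
  qed (use Bs t C(2)[OF sw cM] in auto)
  then have "\<bar>stress_power \<tau> (%i x. S \<epsilon> R t i x - S \<epsilon> R \<tau> i x)\<bar> <= (\<S> i. \<S> j. V * (Bs i j * (C * M)))"
   unfolding stress_power_def wS by (intro order_trans[OF sum_abs] sum_mono)
  also have "... = H * M" unfolding H_def by (simp add: sum_distrib_right mult.assoc)
  also have "... <= e" unfolding M_def using H e by (simp add: field_simps)
  finally show "\<bar>stress_power \<tau> (S \<epsilon> R t) - stress_power \<tau> (S \<epsilon> R \<tau>)\<bar> <= e"
   using stress_power_diff[OF t0(3), of "S \<epsilon> R t" "S \<epsilon> R \<tau>"] test_S[OF R] t0 by simp
 qed
qed

definition Q :: "real => real => real => real" where
 "Q \<epsilon> R t = (\<S> i. \<L> x. U t i x * S \<epsilon> R t i x)"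

lemma continuous_K:
 assumes ab: "0 < a" "b < T" and R: "0 < R"
 shows "continuous_on {a..b} (%\<tau>. stress_power \<tau> (S \<epsilon> R \<tau>))"
 unfolding continuous_on_iff
proof (intro ballI allI impI)
 fix s e assume s: "s \<in> {a..b}" and e: "0 < (e::real)"
 obtain d where d: "0 < d" "!!t \<tau>. t \<in> {a..b} ==> \<tau> \<in> {a..b} ==> \<bar>t - \<tau>\<bar> < d ==> \<bar>stress_power \<tau> (S \<epsilon> R t) - stress_power \<tau> (S \<epsilon> R \<tau>)\<bar> <= e / 2"
  using stress_power_S_modulus[OF ab R, of "e / 2" \<epsilon>] e by auto
 have s0: "s \<in> {0..<T}" using s ab by auto
 have "continuous_on {a..b} (%\<tau>. stress_power \<tau> (S \<epsilon> R s))"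
  by (rule continuous_on_subset[OF continuous_stress_power[OF test_S[OF R s0]]]) (use ab in auto)
 then obtain d' where d': "0 < d'" "!!\<tau>. \<tau> \<in> {a..b} ==> dist \<tau> s < d' ==> dist (stress_power \<tau> (S \<epsilon> R s)) (stress_power s (S \<epsilon> R s)) < e / 2"
  unfolding continuous_on_iff using s e by (metis half_gt_zero)
 show "\<exists>d>0. \<forall>x'\<in>{a..b}. dist x' s < d --> dist (stress_power x' (S \<epsilon> R x')) (stress_power s (S \<epsilon> R s)) < e"
 proof (intro exI[of _ "min d d'"] conjI ballI impI)
  fix \<tau> assume t: "\<tau> \<in> {a..b}" "dist \<tau> s < min d d'"
  then have "\<bar>stress_power \<tau> (S \<epsilon> R s) - stress_power \<tau> (S \<epsilon> R \<tau>)\<bar> <= e / 2"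
   "\<bar>stress_power \<tau> (S \<epsilon> R s) - stress_power s (S \<epsilon> R s)\<bar> < e / 2"
   using d(2)[OF s t(1)] d'(2)[OF t(1)] by (auto simp: dist_real_def abs_minus_commute)
  then show "dist (stress_power \<tau> (S \<epsilon> R \<tau>)) (stress_power s (S \<epsilon> R s)) < e"
   unfolding dist_real_def by linarith
 qed (use d d' in simp)
qed

text \<open>Since the approximate projection is symmetric, pairing the increment of \<open>u\<close> with its value at
 both ends gives the increment of the quadratic form \<open>Q\<close>.  So \<open>Q\<close> is differentiable in time with
 derivative \<open>2 * stress_power \<tau> (S \<tau>)\<close>, without any differentiation of \<open>u\<close> in time.\<close>

lemma Q_increment:
 assumes R: "0 < R" and st: "0 < s" "s < t" "t < T"
 shows "Q \<epsilon> R t - Q \<epsilon> R s = (LINT \<tau>:{s..t}|lborel. stress_power \<tau> (S \<epsilon> R t)) + (LINT \<tau>:{s..t}|lborel. stress_power \<tau> (S \<epsilon> R s))"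
proof -
 have t0: "t \<in> {0..<T}" "s \<in> {0..<T}" using st by auto
 have sym: "(\<S> i. \<L> x. U t i x * S \<epsilon> R s i x) = (\<S> i. \<L> x. U s i x * S \<epsilon> R t i x)"
  unfolding S_def using t0 by (intro leray_symmetric test_cutoff test_newton R newton_even smooth_U)
 show ?thesis
  using momentum[OF test_S[OF R t0(1), of \<epsilon>] div_S[OF R t0(1)] st] momentum[OF test_S[OF R t0(2), of \<epsilon>] div_S[OF R t0(2)] st] sym
  unfolding Q_def by linarith
qed

text \<open>The increments of \<open>Q\<close> agree with those of the integral up to \<open>o(t - s)\<close>, so the difference has derivative zero.\<close>

lemma Q_integral:
 assumes ab: "0 < a" "a < b" "b < T" and R: "0 < R"
 shows "Q \<epsilon> R b - Q \<epsilon> R a = 2 * (LINT \<tau>:{a..b}|lborel. stress_power \<tau> (S \<epsilon> R \<tau>))"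
proof -
 define K where "K \<tau> = stress_power \<tau> (S \<epsilon> R \<tau>)" for \<tau>
 have cK: "continuous_on {a..b} K" unfolding K_def by (rule continuous_K[OF ab(1,3) R])
 have iK: "set_integrable lborel {s..t} K" if "a <= s" "t <= b" for s t
  unfolding set_integrable_def using cK that by (intro borel_integrable_compact) (auto intro: continuous_on_subset)
 define G where "G t = Q \<epsilon> R t - 2 * integral {a..t} K" for t
 have K_split: "integral {a..t} K - integral {a..s} K = (LINT \<tau>:{s..t}|lborel. K \<tau>)" if "a <= s" "s <= t" "t <= b" for s t
 proof -
  have ci: "continuous_on {s..t} K" "continuous_on {a..t} K" using cK that by (auto intro: continuous_on_subset)
  then have "integral {a..s} K + integral {s..t} K = integral {a..t} K"
   using that by (intro Henstock_Kurzweil_Integration.integral_combine integrable_continuous_real) auto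
  then show ?thesis using compact_integral_eq[of s t K] ci by simp
 qed
 have mod: "\<exists>d>0. \<forall>s\<in>{a..b}. \<forall>t\<in>{a..b}. s < t --> t - s < d --> \<bar>G t - G s\<bar> <= e * (t - s)" if e: "0 < e" for e
 proof -
  obtain d where d: "0 < d" "!!t \<tau>. t \<in> {a..b} ==> \<tau> \<in> {a..b} ==> \<bar>t - \<tau>\<bar> < d ==> \<bar>stress_power \<tau> (S \<epsilon> R t) - K \<tau>\<bar> <= e / 2"
   unfolding K_def using stress_power_S_modulus[OF ab(1,3) R, of "e / 2" \<epsilon>] e by auto
  have "\<bar>G t - G s\<bar> <= e * (t - s)" if st: "s \<in> {a..b}" "t \<in> {a..b}" "s < t" "t - s < d" for s t
  proof -
   have one: "\<bar>(LINT \<tau>:{s..t}|lborel. stress_power \<tau> (S \<epsilon> R r)) - (LINT \<tau>:{s..t}|lborel. K \<tau>)\<bar> <= e / 2 * (t - s)" if r: "r = s \<or> r = t" for r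
   proof -
    have rab: "r \<in> {a..b}" "r \<in> {0..<T}" using r st ab by auto
    have ir: "set_integrable lborel {s..t} (%\<tau>. stress_power \<tau> (S \<epsilon> R r))"
     unfolding set_integrable_def
     by (intro borel_integrable_compact compact_Icc continuous_on_subset[OF continuous_stress_power[OF test_S[OF R rab(2)]]]) (use st ab in auto)
    have iK': "set_integrable lborel {s..t} K" using iK st by auto
    have "(LINT \<tau>:{s..t}|lborel. stress_power \<tau> (S \<epsilon> R r)) - (LINT \<tau>:{s..t}|lborel. K \<tau>) = (LINT \<tau>:{s..t}|lborel. stress_power \<tau> (S \<epsilon> R r) - K \<tau>)"
     using set_integral_diff(2)[OF ir iK'] by simp
    also have "\<bar>...\<bar> <= (\<L> \<tau>. \<bar>indicator {s..t} \<tau> *\<^sub>R (stress_power \<tau> (S \<epsilon> R r) - K \<tau>)\<bar>)"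
     unfolding set_lebesgue_integral_def by (rule integral_abs_bound)
    also have "... <= (\<L> \<tau>. indicator {s..t} \<tau> *\<^sub>R (e / 2))"
    proof (rule integral_mono)
     show "integrable lborel (%\<tau>. \<bar>indicator {s..t} \<tau> *\<^sub>R (stress_power \<tau> (S \<epsilon> R r) - K \<tau>)\<bar>)"
      using set_integral_diff(1)[OF ir iK'] unfolding set_integrable_def by (rule integrable_abs)
     show "integrable lborel (%\<tau>. indicator {s..t} \<tau> *\<^sub>R (e / 2))" by (intro borel_integrable_compact) auto
     show "\<bar>indicator {s..t} \<tau> *\<^sub>R (stress_power \<tau> (S \<epsilon> R r) - K \<tau>)\<bar> <= indicator {s..t} \<tau> *\<^sub>R (e / 2)" for \<tau>
     proof (cases "\<tau> \<in> {s..t}")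
      case True
      then have "\<tau> \<in> {a..b}" "\<bar>r - \<tau>\<bar> < d" using r st by auto
      from d(2)[OF rab(1) this] True show ?thesis by simp
     qed simp
    qed
    also have "... = e / 2 * (t - s)" using st by simp
    finally show ?thesis .
   qed
   have "Q \<epsilon> R t - Q \<epsilon> R s = (LINT \<tau>:{s..t}|lborel. stress_power \<tau> (S \<epsilon> R t)) + (LINT \<tau>:{s..t}|lborel. stress_power \<tau> (S \<epsilon> R s))"
    using st ab by (intro Q_increment R) auto
   moreover have "integral {a..t} K - integral {a..s} K = (LINT \<tau>:{s..t}|lborel. K \<tau>)" using st by (intro K_split) auto
   moreover note one[of s] one[of t]
   moreover have "e / 2 * (t - s) = e * (t - s) / 2" by simp
   ultimately show ?thesis unfolding G_def abs_le_iff by linarith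
  qed
  then show ?thesis using d(1) by blast
 qed
 have "(G has_field_derivative 0) (at s within {a..b})" if s: "s \<in> {a..b}" for s
  unfolding has_field_derivative_iff Lim_within
 proof (intro allI impI)
  fix e :: real assume e: "0 < e"
  obtain d where d: "0 < d" "!!s t. s \<in> {a..b} ==> t \<in> {a..b} ==> s < t ==> t - s < d ==> \<bar>G t - G s\<bar> <= e / 2 * (t - s)"
   using mod[of "e / 2"] e by auto
  have "dist ((G y - G s) / (y - s)) 0 < e" if y: "y \<in> {a..b}" "0 < dist y s" "dist y s < d" for y
  proof -
   have "\<bar>G y - G s\<bar> <= e / 2 * \<bar>y - s\<bar>"
    using d(2)[OF s y(1)] d(2)[OF y(1) s] y(2,3) by (cases "s < y") (auto simp: dist_real_def abs_minus_commute)
   moreover have "0 < \<bar>y - s\<bar>" using y by (simp add: dist_real_def)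
   ultimately have "\<bar>G y - G s\<bar> / \<bar>y - s\<bar> <= e / 2" by (simp add: divide_le_eq)
   then have "\<bar>G y - G s\<bar> / \<bar>y - s\<bar> < e" using e by linarith
   then show ?thesis by (simp add: dist_real_def abs_divide)
  qed
  then show "\<exists>d>0. \<forall>y\<in>{a..b}. 0 < dist y s \<and> dist y s < d --> dist ((G y - G s) / (y - s)) 0 < e"
   using d(1) by blast
 qed
 from has_field_derivative_zero_constant[OF convex_closed_interval this]
 obtain c where "!!x. x \<in> {a..b} ==> G x = c" by auto
 then have "G b = G a" using ab by simp
 then show ?thesis unfolding G_def using K_split[of a b] ab K_def by simp
qed

end

section \<open>Energy balance inside the time interval\<close>

lemma conv_mol_close:
 assumes r: "0 < r" and f: "test f" and c: "!!y. dist x y <= r ==> \<bar>f y - f x\<bar> <= \<eta>"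
 shows "\<bar>conv (mol r) f x - f x\<bar> <= \<eta>"
proof -
 have cf: "continuous_on UNIV f" by (rule smooth_cont[OF test_smooth[OF f]])
 have tm: "test (mol r)" by (rule test_mol[OF r])
 have i1: "integrable lborel (%y. f (x - y) * mol r y)"
  by (intro integrable_continuous_test tm continuous_on_compose2[OF cf]) (auto intro!: continuous_intros)
 have i2: "integrable lborel (%y. c * mol r y)" for c using test_integrable[OF tm] by simp
 have "conv (mol r) f x - f x = (\<L> y. f (x - y) * mol r y) - (\<L> y. f x * mol r y)"
  unfolding conv_commute[OF test_smooth[OF tm] f] by (simp add: conv_def integral_mol r)
 also have "... = (\<L> y. f (x - y) * mol r y - f x * mol r y)" by (rule B_integral_diff[OF i1 i2, symmetric])
 also have "\<bar>...\<bar> <= (\<L> y. \<bar>f (x - y) * mol r y - f x * mol r y\<bar>)" by (rule integral_abs_bound)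
 also have "... <= (\<L> y. \<eta> * mol r y)"
 proof (rule integral_mono[OF integrable_abs[OF B_integrable_diff[OF i1 i2]] i2])
  fix y
  show "\<bar>f (x - y) * mol r y - f x * mol r y\<bar> <= \<eta> * mol r y"
  proof (cases "norm y <= r")
   case True
   then have "\<bar>f (x - y) - f x\<bar> <= \<eta>" by (intro c) (simp add: dist_norm)
   then have "\<bar>f (x - y) - f x\<bar> * \<bar>mol r y\<bar> <= \<eta> * mol r y" using mol_nonneg[OF r] by (simp add: mult_right_mono)
   then show ?thesis by (simp add: abs_mult[symmetric] left_diff_distrib)
  qed (simp add: mol_outside r)
 qed
 also have "... = \<eta>" by (simp add: integral_mol r)
 finally show ?thesis .
qed

lemma l2_cutoff_tendsto:
 assumes f: "sq_int f"
 shows "(%n. (l2 (%x. cutoff (real (Suc n)) x * f x))^2) ----> (l2 f)^2"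
 unfolding l2_power2
proof (rule integral_dominated_convergence[where w = "%x. (f x)^2"])
 have [measurable]: "meas (cutoff (real (Suc n)))" "meas f" for n
  using f by (auto intro: test_borel[OF test_cutoff] sq_int_borel)
 show "(%x. (cutoff (real (Suc n)) x * f x)^2) \<in> borel_measurable lborel" for n by measurable
 show "(%x. (f x)^2) \<in> borel_measurable lborel" by measurable
 show "integrable lborel (%x. (f x)^2)" using f by (simp add: sq_int_def)
 show "AE x in lborel. (%n. (cutoff (real (Suc n)) x * f x)^2) ----> (f x)^2"
  using tendsto_power[OF tendsto_mult[OF cutoff_tendsto tendsto_const]] by (auto intro!: AE_I2)
 show "AE x in lborel. norm ((cutoff (real (Suc n)) x * f x)^2) <= (f x)^2" for n
  using cutoff_bounds[of "real (Suc n)"]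
  by (auto intro!: AE_I2 simp: power_mult_distrib mult_left_le_one_le power_le_one)
qed

text \<open>The bound in \<open>pairing_leray_err\<close>; it tends to zero as \<open>R\<close> runs through the integers.\<close>

definition pair_err :: "real => vfield => (real^3 => real) => real => 3 => real" where
 "pair_err N u g R i = l2 g * l2 (conv (mol R) (%x. cutoff R x * u i x))
   + pair_const * (l2 g * (\<S> l. edge R (u l)) + N * edge R g)"

lemma pair_err_tendsto:
 assumes u: "!!i. smooth (u i)" "!!i. sq_int (u i)" and g: "sq_int g"
 shows "(%n. pair_err N u g (real (Suc n)) i) ----> 0"
proof -
 have "(%n. pair_err N u g (real (Suc n)) i) ----> l2 g * 0 + pair_const * (l2 g * (\<Sum>l\<in>(UNIV::3 set). 0) + N * 0)"
  unfolding pair_err_def by (intro tendsto_intros conv_mol_vanishes edge_tendsto u g)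
 then show ?thesis by simp
qed

context smooth_leray
begin

text \<open>As \<open>\<epsilon>\<close> tends to zero the localised mollification tends to \<open>main0\<close>, uniformly with first derivatives and
 locally uniformly in time.\<close>

definition main :: "real => real => real => vfield" where
 "main \<epsilon> R t i x = cutoff R x * conv (mol \<epsilon>) (%y. cutoff R y * U t i y) x"

definition main0 :: "real => real => vfield" where
 "main0 R t i x = cutoff R x * (cutoff R x * U t i x)"

lemma test_cut_U: "0 < R ==> t \<in> {0..<T} ==> test (%x. cutoff R x * U t i x)"
 by (intro test_mult_right test_cutoff smooth_U)

lemma test_main: "0 < R ==> 0 < \<epsilon> ==> t \<in> {0..<T} ==> test (main \<epsilon> R t i)"
 unfolding main_def[abs_def] by (intro test_mult_right test_smooth[OF test_conv] test_cutoff test_mol test_cut_U)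

lemma test_main0: "0 < R ==> t \<in> {0..<T} ==> test (main0 R t i)"
 unfolding main0_def[abs_def] by (intro test_mult_right test_cutoff test_smooth[OF test_cut_U])

lemma leray_err_eq: "leray_err \<epsilon> R (U t) i = (%x. S \<epsilon> R t i x - main \<epsilon> R t i x)"
 by (simp add: leray_err_def[abs_def] S_def main_def)

lemma main_modulus:
 assumes ab: "0 < a" "b < T" and R: "0 < R" and e: "0 < e"
 obtains d where "0 < d" "!!\<epsilon> t i x. 0 < \<epsilon> ==> \<epsilon> < d ==> t \<in> {a..b} ==> \<bar>main \<epsilon> R t i x - main0 R t i x\<bar> <= e"
  "!!\<epsilon> t i j x. 0 < \<epsilon> ==> \<epsilon> < d ==> t \<in> {a..b} ==> \<bar>pd j (%x. main \<epsilon> R t i x - main0 R t i x) x\<bar> <= e"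
proof -
 define h where "h = e / (1 + cutoff_const / R)"
 have cR: "0 < cutoff_const / R" using cutoff_const(1) R by simp
 have h: "0 < h" "h <= e" "cutoff_const / R * h + h <= e"
 proof -
  show "0 < h" unfolding h_def using cR e by simp
  have "cutoff_const / R * h + h = (1 + cutoff_const / R) * h" by (simp add: distrib_right)
  then show "cutoff_const / R * h + h <= e" unfolding h_def using cR by simp
  then show "h <= e" using cR \<open>0 < h\<close> by (smt (verit) mult_pos_pos)
 qed
 define f where "f i t x = cutoff R x * U t i x" for i t x
 define g where "g i j t x = pd j (f i t) x" for i j t x
 have tf: "test (f i t)" if "t \<in> {a..b}" for i t unfolding f_def[abs_def] using that ab by (intro test_cut_U R) auto
 have ge: "g i j t x = cutoff R x * pd j (U t i) x + pd j (cutoff R) x * U t i x" if "t \<in> {a..b}" for i j t x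
  unfolding g_def f_def[abs_def] using that ab by (subst dir_deriv_mult) (auto intro: test_smooth[OF test_cutoff[OF R]] smooth_U)
 have cc: "continuous_on ({a..b} \<times> UNIV) (%p::real \<times> (real^3). k (snd p))" if "test k" for k
  by (rule continuous_on_compose2[OF smooth_cont[OF test_smooth[OF that]]]) (auto intro!: continuous_intros)
 have cf: "continuous_on ({a..b} \<times> UNIV) (%(t, x). f i t x)" for i
  using continuous_on_mult[OF cc[OF test_cutoff[OF R]] slab_cont(1)[OF ab, of i]] by (simp add: f_def split_beta)
 have cg: "continuous_on ({a..b} \<times> UNIV) (%(t, x). g i j t x)" for i j
  using continuous_on_add[OF continuous_on_mult[OF cc[OF test_cutoff[OF R]] slab_cont(2)[OF ab, of j i]]
    continuous_on_mult[OF cc[OF test_dir_deriv[OF test_cutoff[OF R]]] slab_cont(1)[OF ab, of i]], of "axis j 1"]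
  by (rule continuous_on_eq) (auto simp: ge)
 have f0: "f i t x = 0" if "R < norm x" for i t x using cutoff_outside[OF R that] by (simp add: f_def)
 have g0: "g i j t x = 0" if "R < norm x" for i j t x unfolding g_def by (rule dir_deriv_outside_supp[OF f0 that])
 have uc: "\<exists>d>0. \<forall>t\<in>{a..b}. \<forall>x y. dist x y < d --> \<bar>F t y - F t x\<bar> <= h"
  if F: "continuous_on ({a..b} \<times> UNIV) (%(t, x). F t x)" "!!t x. R < norm x ==> F t x = 0" for F :: "real => real^3 => real"
 proof -
  obtain d where d: "0 < d" "!!t t' x x'. t \<in> {a..b} ==> t' \<in> {a..b} ==> norm x <= R + 1 ==> norm x' <= R + 1 ==> \<bar>t - t'\<bar> < d ==> dist x x' < d ==> \<bar>F t x - F t' x'\<bar> < h"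
   using slab_uniformly_continuous[OF F(1) h(1), of "R + 1"] by auto
  have "\<bar>F t y - F t x\<bar> <= h" if "t \<in> {a..b}" "dist x y < min d 1" for t x y
  proof (cases "norm x <= R + 1 \<and> norm y <= R + 1")
   case True
   then show ?thesis using d(1) d(2)[of t t y x] that by (auto simp: dist_commute intro: less_imp_le)
  next
   case False
   have "\<bar>norm x - norm y\<bar> < 1" using that norm_triangle_ineq3[of x y] by (simp add: dist_norm)
   then have "R < norm x" "R < norm y" using False by linarith+
   then show ?thesis using F(2) h by simp
  qed
  then show ?thesis using d(1) by (intro exI[of _ "min d 1"]) auto
 qed
 have "\<forall>i. \<exists>d>0. \<forall>t\<in>{a..b}. \<forall>x y. dist x y < d --> \<bar>f i t y - f i t x\<bar> <= h"
  "\<forall>i j. \<exists>d>0. \<forall>t\<in>{a..b}. \<forall>x y. dist x y < d --> \<bar>g i j t y - g i j t x\<bar> <= h"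
  using uc[OF cf f0] uc[OF cg g0] by blast+
 then obtain d1 d2 where d1: "!!i. 0 < d1 i" "!!i t x y. t \<in> {a..b} ==> dist x y < d1 i ==> \<bar>f i t y - f i t x\<bar> <= h"
  and d2: "!!i j. 0 < d2 i j" "!!i j t x y. t \<in> {a..b} ==> dist x y < d2 i j ==> \<bar>g i j t y - g i j t x\<bar> <= h" by metis
 define d where "d = Min (range d1 \<union> range (%(i, j). d2 i j))"
 have d0: "0 < d" unfolding d_def by (subst Min_gr_iff) (auto simp: d1(1) d2(1))
 have dle: "d <= d1 i" "d <= d2 i j" for i j unfolding d_def by (rule Min_le; auto intro: rev_image_eqI[of "(i, j)"])+
 have A: "\<bar>conv (mol \<epsilon>) (f i t) x - f i t x\<bar> <= h" "\<bar>conv (mol \<epsilon>) (g i j t) x - g i j t x\<bar> <= h"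
  if "0 < \<epsilon>" "\<epsilon> < d" "t \<in> {a..b}" for \<epsilon> t i j x
 proof -
  show "\<bar>conv (mol \<epsilon>) (f i t) x - f i t x\<bar> <= h"
   by (rule conv_mol_close[OF that(1) tf[OF that(3)]], rule d1(2)[OF that(3)]) (use that dle(1)[of i] in linarith)
  have "test (g i j t)" unfolding g_def[abs_def] by (intro test_dir_deriv tf that)
  then show "\<bar>conv (mol \<epsilon>) (g i j t) x - g i j t x\<bar> <= h"
   by (rule conv_mol_close[OF that(1)], intro d2(2)[OF that(3)]) (use that dle(2)[of i j] in linarith)
 qed
 show ?thesis
 proof (rule that[OF d0])
  fix \<epsilon> t i x assume p: "0 < \<epsilon>" "\<epsilon> < d" "t \<in> {a..b}"
  have e: "main \<epsilon> R t i x - main0 R t i x = cutoff R x * (conv (mol \<epsilon>) (f i t) x - f i t x)" for x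
   unfolding main_def main0_def f_def[abs_def] by (simp add: right_diff_distrib)
  have "\<bar>cutoff R x * (conv (mol \<epsilon>) (f i t) x - f i t x)\<bar> <= 1 * h"
   unfolding abs_mult by (intro mult_mono cutoff_bounds A(1)[OF p]) auto
  then show "\<bar>main \<epsilon> R t i x - main0 R t i x\<bar> <= e" unfolding e using h by linarith
  fix j
  have tc: "test (conv (mol \<epsilon>) (f i t))" by (intro test_conv test_mol tf p)
  have "pd j (%x. main \<epsilon> R t i x - main0 R t i x) x
    = cutoff R x * (conv (mol \<epsilon>) (g i j t) x - g i j t x) + pd j (cutoff R) x * (conv (mol \<epsilon>) (f i t) x - f i t x)"
   unfolding e g_def[abs_def] dir_deriv_conv_right[OF test_mol[OF p(1)] tf[OF p(3)], symmetric]
   by (subst dir_deriv_mult)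
     (auto simp: dir_deriv_diff smooth_diff test_smooth tc tf[OF p(3)] test_cutoff[OF R])
  also have "\<bar>...\<bar> <= 1 * h + cutoff_const / R * h"
   by (intro order_trans[OF abs_triangle_ineq] add_mono) (unfold abs_mult, (intro mult_mono cutoff_bounds cutoff_const(2) R A[OF p]; use cR in auto)+)
  finally show "\<bar>pd j (%x. main \<epsilon> R t i x - main0 R t i x) x\<bar> <= e" using h by linarith
 qed
qed

text \<open>A bound, integrable in time, for the \<open>L\<^sup>2\<close> norms of the stress and of the squared velocities at almost every time.\<close>

definition sbound :: "real => real" where "sbound t = (1 + lady_const) * (1 + ubound^2 + dirichlet (u t))"

lemma stress_bounds:
 assumes t: "t \<in> {0..<T}" and H: "H1 (u t)"
 shows "l2 (pd j (U t i)) <= sqrt (dirichlet (u t))" "sq_int (%x. (U t i x)^2)" "l2 (%x. (U t i x)^2) <= sbound t"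
  "sq_int (%x. U t i x * U t j x)" "sq_int (stress t i j)" "l2 (stress t i j) <= sbound t"
proof -
 have grad: "grad_sq (U t i) <= dirichlet (u t)" for i unfolding gradient_U(2)[OF t H]
  by (rule member_le_sum) (auto simp: grad_sq_def intro: sum_nonneg)
 have "(l2 (pd j (U t i)))^2 <= grad_sq (U t i)" for i j unfolding grad_sq_def by (rule member_le_sum) auto
 then have g2: "(l2 (pd j (U t i)))^2 <= dirichlet (u t)" for i j using grad order_trans by blast
 then show g: "l2 (pd j (U t i)) <= sqrt (dirichlet (u t))" for i j by (intro real_le_rsqrt)
 note sU = smooth_U[OF t] and qU = L2_U(1)[OF t] and qD = gradient_U(1)[OF t H]
 note L = Ladyzhenskaya[OF sU qU qD]
 show q4: "sq_int (%x. (U t i x)^2)" for i by (rule L)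
 have "(l2 (U t i))^2 <= ubound^2" for i by (intro power_mono l2_U_le t) auto
 then have "lady_const * ((l2 (U t i))^2 + grad_sq (U t i)) <= lady_const * (ubound^2 + dirichlet (u t))" for i
  using grad by (intro mult_left_mono lady_const_nonneg add_mono)
 then have l4: "l2 (%x. (U t i x)^2) <= lady_const * (ubound^2 + dirichlet (u t))" for i using L(2) order_trans by blast
 have "0 <= ubound^2 + dirichlet (u t)" by (simp add: dirichlet_nonneg)
 then have lb: "lady_const * (ubound^2 + dirichlet (u t)) + (1 + dirichlet (u t)) <= sbound t"
  unfolding sbound_def using lady_const_nonneg by (simp add: algebra_simps)
 then show "l2 (%x. (U t i x)^2) <= sbound t" using l4[of i] dirichlet_nonneg[of "u t"] by linarith
 have ab: "\<bar>a * b\<bar> <= 1 * \<bar>(1 / 2) * (a^2 + b^2)\<bar>" for a b :: real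
  using sum_squares_bound[of "\<bar>a\<bar>" "\<bar>b\<bar>"] by (simp add: abs_mult)
 have q2: "sq_int (%x. 1 / 2 * ((U t i x)^2 + (U t j x)^2))" for i j by (intro sq_int_cmult sq_int_add q4)
 have m2: "meas ((%x. U t i x * U t j x))" for i j by (intro smooth_borel smooth_mult sU)
 show qUU: "sq_int (%x. U t i x * U t j x)" for i j by (rule sq_int_bound[OF q2 m2 ab]) simp
 have "l2 (%x. U t i x * U t j x) <= 1 * l2 (%x. 1 / 2 * ((U t i x)^2 + (U t j x)^2))" by (rule sq_int_bound[OF q2 m2 ab]) simp
 also have "... <= 1 / 2 * (l2 (%x. (U t i x)^2) + l2 (%x. (U t j x)^2))" unfolding l2_cmult using l2_triangle[OF q4 q4, of i j] by simp
 also have "... <= lady_const * (ubound^2 + dirichlet (u t))" using l4[of i] l4[of j] by simp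
 finally have UU: "l2 (%x. U t i x * U t j x) <= lady_const * (ubound^2 + dirichlet (u t))" .
 show "sq_int (stress t i j)" unfolding stress_def[abs_def] by (intro sq_int_add sq_int_minus qD qUU)
 have "l2 (stress t i j) <= l2 (pd j (U t i)) + l2 (%x. U t i x * U t j x)"
  unfolding stress_def[abs_def] using l2_triangle[OF sq_int_minus[OF qD] qUU] by simp
 also have "l2 (pd j (U t i)) <= 1 + dirichlet (u t)"
 proof -
  have "2 * l2 (pd j (U t i)) <= 1 + (l2 (pd j (U t i)))^2" using sum_squares_bound[of 1 "l2 (pd j (U t i))"] by simp
  then show ?thesis using g2[of j i] l2_nonneg[of "pd j (U t i)"] by linarith
 qed
 finally show "l2 (stress t i j) <= sbound t" using UU lb by linarith
qed

lemma sbound_nonneg: "0 <= sbound t"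
 unfolding sbound_def using lady_const_nonneg dirichlet_nonneg[of "u t"] by simp

text \<open>The viscous stress gives minus the dissipation and the convective one a perfect derivative; both up to terms
 with a gradient of the cutoff.\<close>

lemma main0_power:
 assumes t: "t \<in> {0<..<T}" and H: "H1 (u t)" and R: "0 < R"
 shows "stress_power t (main0 R t) \<ge> - dirichlet (u t) - 27 * cutoff_const * ubound * sbound t / R"
proof -
 have t0: "t \<in> {0..<T}" using t by simp
 note sU = smooth_U[OF t0] and qU = L2_U(1)[OF t0] and qD = gradient_U(1)[OF t0 H]
 note sb = stress_bounds[OF t0 H]
 define \<phi> where "\<phi> = cutoff R"
 define c where "c = cutoff_const / R"
 have c0: "0 <= c" unfolding c_def using cutoff_const(1) R by simp
 have t\<phi>: "test \<phi>" unfolding \<phi>_def by (rule test_cutoff[OF R])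
 note s\<phi> = test_smooth[OF t\<phi>]
 have \<phi>b: "\<bar>\<phi> x\<bar> <= 1" "\<bar>pd j \<phi> x\<bar> <= c" for x j unfolding \<phi>_def c_def by (rule cutoff_bounds cutoff_const(2)[OF R])+
 define v where "v j i x = (2 * \<phi> x * pd j \<phi> x) * U t i x" for j i x
 have \<phi>\<phi>: "\<bar>2 * \<phi> x * pd j \<phi> x\<bar> <= 2 * c" for x j
  using mult_mono[OF \<phi>b(1)[of x] \<phi>b(2)[of j x]] by (simp add: abs_mult)
 have tv: "test (v j i)" for i j unfolding v_def[abs_def]
  by (intro test_mult_right test_mult_left test_dir_deriv t\<phi> sU smooth_mult s\<phi> smooth_const)
 have lv: "l2 (v j i) <= 2 * c * ubound" for i j
 proof -
  have "l2 (v j i) <= 2 * c * l2 (U t i)" unfolding v_def[abs_def]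
   by (rule sq_int_mult_bounded(2)[OF qU _ \<phi>\<phi>]) (intro smooth_borel smooth_mult smooth_const s\<phi> smooth_dir_deriv)
  also have "... <= 2 * c * ubound" using c0 by (intro mult_left_mono l2_U_le t0) auto
  finally show ?thesis .
 qed
 have pm: "pd j (main0 R t i) x = \<phi> x * (\<phi> x * pd j (U t i) x) + v j i x" for i j x
  unfolding main0_def[abs_def] v_def \<phi>_def[symmetric]
  by (simp add: dir_deriv_mult smooth_mult s\<phi> sU algebra_simps)
 define A where "A i j = (\<L> x. stress t i j x * v j i x)" for i j
 define B where "B i j = (\<L> x. (\<phi> x * pd j (U t i) x)^2)" for i j
 define D where "D i j = (\<L> x. (U t i x * pd j (U t i) x) * (\<phi> x * (\<phi> x * U t j x)))" for i j
 have sS: "smooth (stress t i j)" for i j by (rule smooth_stress[OF t0])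
 have q\<phi>D: "sq_int (%x. \<phi> x * pd j (U t i) x)" for i j by (rule sq_int_mult_bounded(1)[OF qD test_borel[OF t\<phi>] \<phi>b(1)])
 have split: "(\<L> x. stress t i j x * pd j (main0 R t i) x) = A i j - B i j + D i j" for i j
 proof -
  have i: "integrable lborel (%x. stress t i j x * v j i x)" "integrable lborel (%x. (\<phi> x * pd j (U t i) x)^2)"
   "integrable lborel (%x. (U t i x * pd j (U t i) x) * (\<phi> x * (\<phi> x * U t j x)))"
   using q\<phi>D by (auto simp: sq_int_def intro!: integrable_continuous_test tv smooth_cont sS smooth_mult sU smooth_dir_deriv test_mult_right t\<phi> s\<phi>)
  have e: "stress t i j x * pd j (main0 R t i) x = stress t i j x * v j i x - (\<phi> x * pd j (U t i) x)^2 + (U t i x * pd j (U t i) x) * (\<phi> x * (\<phi> x * U t j x))" for x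
   unfolding pm by (simp add: stress_def algebra_simps power2_eq_square)
  show ?thesis unfolding e A_def B_def D_def using i by simp
 qed
 have Ab: "\<bar>A i j\<bar> <= sbound t * (2 * c * ubound)" for i j
 proof -
  have "\<bar>A i j\<bar> <= l2 (stress t i j) * l2 (v j i)" unfolding A_def by (rule l2_Cauchy_Schwarz[OF sb(5) test_sq_int[OF tv]])
  also have "... <= sbound t * (2 * c * ubound)" by (intro mult_mono sb lv sbound_nonneg) auto
  finally show ?thesis .
 qed
 have Bb: "(\<S> i. \<S> j. B i j) <= dirichlet (u t)"
  unfolding gradient_U(2)[OF t0 H] grad_sq_def
 proof (intro sum_mono)
  fix i j
  have "l2 (%x. \<phi> x * pd j (U t i) x) <= 1 * l2 (pd j (U t i))" by (rule sq_int_mult_bounded(2)[OF qD test_borel[OF t\<phi>] \<phi>b(1)])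
  then show "B i j <= (l2 (pd j (U t i)))^2" unfolding B_def l2_power2[symmetric] by (intro power_mono) auto
 qed
 \<comment> \<open>The transport term: \<open>u \<cdot> \<nabla>u\<close> is orthogonal to \<open>u\<close> up to the gradient of the cutoff.\<close>
 have Db: "\<bar>\<S> j. D i j\<bar> <= 3 * (sbound t * (c * ubound))" for i
 proof -
  define g where "g j x = \<phi> x * (\<phi> x * U t j x)" for j x
  have tg: "test (g j)" for j unfolding g_def[abs_def] by (intro test_mult_right t\<phi> smooth_mult s\<phi> sU)
  have gp: "pd j (g j) x = (\<phi> x)^2 * pd j (U t j) x + v j j x" for j x
   using pm[of j j x] by (simp add: main0_def[abs_def] g_def[abs_def] \<phi>_def power2_eq_square)
  have s2: "smooth (%x. U t i x * U t i x)" by (intro smooth_mult sU)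
  have ig: "integrable lborel (%x. (U t i x * U t i x) * pd j (g j) x)" for j
   by (intro integrable_continuous_test test_dir_deriv tg smooth_cont s2)
  have iv: "integrable lborel (%x. (U t i x * U t i x) * v j j x)" for j
   by (intro integrable_continuous_test tv smooth_cont s2)
  have "2 * D i j = - (\<L> x. (U t i x * U t i x) * pd j (g j) x)" for j
  proof -
   have "2 * D i j = (\<L> x. 2 * ((U t i x * pd j (U t i) x) * g j x))" unfolding D_def g_def by simp
   also have "... = (\<L> x. pd j (%x. U t i x * U t i x) x * g j x)"
    by (simp add: dir_deriv_mult sU algebra_simps)
   finally show ?thesis unfolding integral_by_parts[OF s2 tg] .
  qed
  then have "2 * (\<S> j. D i j) = - (\<S> j. \<L> x. (U t i x * U t i x) * pd j (g j) x)"
   by (simp add: sum_distrib_left sum_negf)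
  also have "... = - (\<L> x. (\<S> j. (U t i x * U t i x) * pd j (g j) x))"
   using ig by simp
  also have "(%x. \<S> j. (U t i x * U t i x) * pd j (g j) x) = (%x. \<S> j. (U t i x * U t i x) * v j j x)"
   unfolding gp distrib_left sum.distrib
   by (simp add: sum_distrib_left[symmetric] divergence_free[OF t])
  also have "- (\<L> x. (\<S> j. (U t i x * U t i x) * v j j x)) = - (\<S> j. \<L> x. (U t i x * U t i x) * v j j x)"
   using iv by simp
  finally have "2 * \<bar>\<S> j. D i j\<bar> = \<bar>\<S> j. \<L> x. (U t i x * U t i x) * v j j x\<bar>" by linarith
  also have "... <= (\<Sum>j\<in>(UNIV::3 set). sbound t * (2 * c * ubound))"
  proof (intro order_trans[OF sum_abs] sum_mono)
   fix j
   have "\<bar>\<L> x. (U t i x)^2 * v j j x\<bar> <= l2 (%x. (U t i x)^2) * l2 (v j j)" by (rule l2_Cauchy_Schwarz[OF sb(2) test_sq_int[OF tv]])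
   also have "... <= sbound t * (2 * c * ubound)" by (intro mult_mono sb lv sbound_nonneg) auto
   finally show "\<bar>\<L> x. (U t i x * U t i x) * v j j x\<bar> <= sbound t * (2 * c * ubound)" by (simp add: power2_eq_square)
  qed
  finally show ?thesis by (simp add: mult_ac)
 qed
 have "stress_power t (main0 R t) = (\<S> i. \<S> j. A i j) - (\<S> i. \<S> j. B i j) + (\<S> i. \<S> j. D i j)"
  unfolding stress_power_def split by (simp add: sum.distrib sum_subtractf)
 moreover have "\<bar>\<S> i. \<S> j. A i j\<bar> <= (\<Sum>i\<in>(UNIV::3 set). \<Sum>j\<in>(UNIV::3 set). sbound t * (2 * c * ubound))"
  by (intro order_trans[OF sum_abs] sum_mono Ab)
 moreover have "\<bar>\<S> i. \<S> j. D i j\<bar> <= (\<Sum>i\<in>(UNIV::3 set). 3 * (sbound t * (c * ubound)))"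
  by (intro order_trans[OF sum_abs] sum_mono Db)
 moreover have "27 * cutoff_const * ubound * sbound t / R = 27 * (sbound t * (c * ubound))" by (simp add: c_def)
 ultimately show ?thesis using Bb by simp
qed

lemma stress_power_err:
 assumes t: "t \<in> {0<..<T}" and H: "H1 (u t)" and R: "0 < \<epsilon>" "\<epsilon> < R"
 shows "\<bar>stress_power t (leray_err \<epsilon> R (U t))\<bar> <= 9 * err_const * ubound * sbound t / R"
proof -
 have t0: "t \<in> {0..<T}" using t by simp
 have te: "test (leray_err \<epsilon> R (U t) i)" for i unfolding leray_err_eq using R by (intro test_diff test_S test_main t0) auto
 have "\<bar>\<L> x. stress t i j x * pd j (leray_err \<epsilon> R (U t) i) x\<bar> <= sbound t * (err_const * ubound / R)" for i j
 proof -
  have "\<bar>\<L> x. stress t i j x * pd j (leray_err \<epsilon> R (U t) i) x\<bar> <= l2 (stress t i j) * l2 (pd j (leray_err \<epsilon> R (U t) i))"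
   by (rule l2_Cauchy_Schwarz[OF stress_bounds(5)[OF t0 H] test_sq_int[OF test_dir_deriv[OF te]]])
  also have "... <= sbound t * (err_const * ubound / R)"
   by (intro mult_mono stress_bounds(6)[OF t0 H] l2_pd_leray_err R smooth_U L2_U t0 l2_U_le divergence_free t sbound_nonneg l2_nonneg)
  finally show ?thesis .
 qed
 then have "\<bar>stress_power t (leray_err \<epsilon> R (U t))\<bar> <= (\<Sum>i\<in>(UNIV::3 set). \<Sum>j\<in>(UNIV::3 set). sbound t * (err_const * ubound / R))"
  unfolding stress_power_def by (intro order_trans[OF sum_abs] sum_mono)
 then show ?thesis by (simp add: mult_ac)
qed

lemma set_integrable_lebesgue_continuous:
 fixes K :: "real => real"
 assumes "continuous_on {a..b} K"
 shows "set_integrable lebesgue {a..b} K" "(LINT \<tau>:{a..b}|lebesgue. K \<tau>) = (LINT \<tau>:{a..b}|lborel. K \<tau>)"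
proof -
 have i: "integrable lborel (%x. indicator {a..b} x *\<^sub>R K x)" using assms by (intro borel_integrable_compact) auto
 then have b: "meas ((%x. indicator {a..b} x *\<^sub>R K x))" using borel_measurable_integrable by fastforce
 show "set_integrable lebesgue {a..b} K" unfolding set_integrable_def integrable_lebesgue_borel[OF b] by (rule i)
 show "(LINT \<tau>:{a..b}|lebesgue. K \<tau>) = (LINT \<tau>:{a..b}|lborel. K \<tau>)"
  unfolding set_lebesgue_integral_def by (rule integral_lebesgue_borel[OF b])
qed

lemma set_integrable_dirichlet:
 assumes "A \<subseteq> {0..T}" "A \<in> sets lebesgue"
 shows "set_integrable lebesgue A (%\<tau>. dirichlet (u \<tau>))"
proof -
 have "set_integrable lebesgue ({0<..<T} \<union> {0, T}) (%\<tau>. dirichlet (u \<tau>))"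
 proof (rule set_integrable_Un[OF lh_facts(7)])
  have "(%x. indicator {0, T} x *\<^sub>R dirichlet (u x)) = (%x. indicator {0} x * dirichlet (u 0) + indicator {T} x * dirichlet (u T))"
   using T by (auto simp: indicator_def)
  then show "set_integrable lebesgue {0, T} (%\<tau>. dirichlet (u \<tau>))"
   unfolding set_integrable_def by (simp add: integrable_real_indicator)
 qed auto
 then show ?thesis by (rule set_integrable_subset) (use assms T in auto)
qed

lemma set_integral_mono_dirichlet:
 assumes "A \<subseteq> B" "B \<subseteq> {0..T}" "A \<in> sets lebesgue" "B \<in> sets lebesgue"
 shows "dissip A <= dissip B"
 unfolding set_lebesgue_integral_def
 using set_integrable_dirichlet[of A] set_integrable_dirichlet[of B] assms
 by (intro integral_mono) (auto simp: set_integrable_def indicator_def dirichlet_nonneg)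

lemma pairing_S_close:
 assumes t: "t \<in> {0<..<T}" and R: "0 < R" and e: "0 < e" and g: "sq_int g"
 obtains d where "0 < d" "!!\<epsilon>. 0 < \<epsilon> ==> \<epsilon> < d ==>
   \<bar>(\<L> x. g x * S \<epsilon> R t i x) - (\<L> x. g x * main0 R t i x)\<bar> <= e + pair_err ubound (U t) g R i"
proof -
 have t0: "t \<in> {0..<T}" and tt: "0 < t" "t < T" "t \<in> {t..t}" using t by auto
 define V where "V = l2 (indicator (cball (0::real^3) R))"
 have qV: "sq_int (indicator (cball (0::real^3) R))"
  using borel_integrable_compact[of "cball (0::real^3) R" "%_. 1::real"] by (simp add: sq_int_def power2_eq_square indicator_inter_arith[symmetric])
 define h where "h = e / (l2 g * V + 1)"
 have p: "0 < l2 g * V + 1" by (simp add: V_def add_nonneg_pos)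
 have h: "0 < h" unfolding h_def using e p by simp
 have he: "l2 g * (h * V) <= e"
 proof -
  have "l2 g * (h * V) <= (l2 g * V + 1) * h" using h by (simp add: algebra_simps)
  also have "... = e" unfolding h_def using p by simp
  finally show ?thesis .
 qed
 obtain d where d: "0 < d" "!!\<epsilon> i x. 0 < \<epsilon> ==> \<epsilon> < d ==> \<bar>main \<epsilon> R t i x - main0 R t i x\<bar> <= h"
  using main_modulus[OF tt(1,2) R h] tt(3) by metis
 show ?thesis
 proof (rule that[of "min d R"])
  fix \<epsilon> assume \<epsilon>: "0 < \<epsilon>" "\<epsilon> < min d R"
  have tests: "test (main \<epsilon> R t i)" "test (main0 R t i)" "test (S \<epsilon> R t i)"
   using \<epsilon> by (auto intro: test_main test_main0 test_S R t0)
  have te: "test (leray_err \<epsilon> R (U t) i)" unfolding leray_err_eq by (intro test_diff tests)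
  have tM: "test (%x. main \<epsilon> R t i x - main0 R t i x)" by (intro test_diff tests)
  have i: "integrable lborel (%x. g x * f x)" if "test f" for f by (intro sq_int_mult_integrable g test_sq_int that)
  have "(\<L> x. g x * S \<epsilon> R t i x) = (\<L> x. g x * leray_err \<epsilon> R (U t) i x + g x * (main \<epsilon> R t i x - main0 R t i x) + g x * main0 R t i x)"
   unfolding leray_err_eq by (simp add: algebra_simps)
  also have "... = (\<L> x. g x * leray_err \<epsilon> R (U t) i x) + (\<L> x. g x * (main \<epsilon> R t i x - main0 R t i x)) + (\<L> x. g x * main0 R t i x)"
   using i[OF te] i[OF tM] i[OF tests(2)] by simp
  finally have "(\<L> x. g x * S \<epsilon> R t i x) - (\<L> x. g x * main0 R t i x)
    = (\<L> x. g x * leray_err \<epsilon> R (U t) i x) + (\<L> x. g x * (main \<epsilon> R t i x - main0 R t i x))" by simp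
  moreover have "\<bar>\<L> x. g x * leray_err \<epsilon> R (U t) i x\<bar> <= pair_err ubound (U t) g R i"
   unfolding pair_err_def using \<epsilon> by (intro pairing_leray_err smooth_U L2_U(1) l2_U_le t0 divergence_free t g) auto
  moreover have "\<bar>\<L> x. g x * (main \<epsilon> R t i x - main0 R t i x)\<bar> <= e"
  proof -
   have "l2 (%x. main \<epsilon> R t i x - main0 R t i x) <= h * V" unfolding V_def
   proof (rule sq_int_bound(2)[OF qV test_borel[OF tM]])
    show "\<bar>main \<epsilon> R t i x - main0 R t i x\<bar> <= h * \<bar>indicat_real (cball 0 R) x\<bar>" for x
     using d(2)[of \<epsilon> i x] \<epsilon> cutoff_outside[OF R, of x] by (cases "norm x <= R") (auto simp: main_def main0_def)
   qed (use h in simp)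
   then have "l2 g * l2 (%x. main \<epsilon> R t i x - main0 R t i x) <= l2 g * (h * V)" by (rule mult_left_mono) simp
   then show ?thesis using l2_Cauchy_Schwarz[OF g test_sq_int[OF tM]] he by linarith
  qed
  ultimately show "\<bar>(\<L> x. g x * S \<epsilon> R t i x) - (\<L> x. g x * main0 R t i x)\<bar> <= e + pair_err ubound (U t) g R i"
   by linarith
 qed (use d R in auto)
qed

lemma pairing_S_sum_close:
 assumes t: "t \<in> {0<..<T}" and R: "0 < R" and e: "0 < e" and g: "!!i. sq_int (g i)"
 obtains d where "0 < d" "!!\<epsilon>. 0 < \<epsilon> ==> \<epsilon> < d ==>
   \<bar>(\<S> i. \<L> x. g i x * S \<epsilon> R t i x) - (\<S> i. \<L> x. g i x * main0 R t i x)\<bar>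
   <= e + (\<S> i. pair_err ubound (U t) (g i) R i)"
proof -
 define near where "near i d \<longleftrightarrow> 0 < d \<and> (\<forall>\<epsilon>. 0 < \<epsilon> --> \<epsilon> < d -->
   \<bar>(\<L> x. g i x * S \<epsilon> R t i x) - (\<L> x. g i x * main0 R t i x)\<bar> <= e / 3 + pair_err ubound (U t) (g i) R i)" for i d
 have e3: "0 < e / 3" using e by simp
 have "\<exists>d. near i d" for i
  by (rule pairing_S_close[OF t R e3 g[of i], of i]) (unfold near_def, intro exI conjI allI impI; assumption)
 then obtain d where "!!i. near i (d i)" by metis
 then have d: "!!i. 0 < d i" "!!i \<epsilon>. 0 < \<epsilon> ==> \<epsilon> < d i ==>
   \<bar>(\<L> x. g i x * S \<epsilon> R t i x) - (\<L> x. g i x * main0 R t i x)\<bar> <= e / 3 + pair_err ubound (U t) (g i) R i"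
  by (auto simp: near_def)
 show ?thesis
 proof (rule that[of "Min (range d)"])
  show "0 < Min (range d)" using d(1) by (simp add: Min_gr_iff)
  fix \<epsilon> assume \<epsilon>: "0 < \<epsilon>" "\<epsilon> < Min (range d)"
  have "\<bar>\<S> i. (\<L> x. g i x * S \<epsilon> R t i x) - (\<L> x. g i x * main0 R t i x)\<bar>
    <= (\<S> i. e / 3 + pair_err ubound (U t) (g i) R i)"
   using \<epsilon> by (intro order_trans[OF sum_abs] sum_mono d(2)) (auto simp: Min_gr_iff)
  then show "\<bar>(\<S> i. \<L> x. g i x * S \<epsilon> R t i x) - (\<S> i. \<L> x. g i x * main0 R t i x)\<bar>
   <= e + (\<S> i. pair_err ubound (U t) (g i) R i)"
   by (simp add: sum_subtractf sum.distrib)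
 qed
qed

lemma Q_close:
 assumes t: "t \<in> {0<..<T}" and R: "0 < R" and e: "0 < e"
 obtains d where "0 < d" "!!\<epsilon>. 0 < \<epsilon> ==> \<epsilon> < d ==> \<bar>Q \<epsilon> R t - (\<S> i. (l2 (%x. cutoff R x * U t i x))^2)\<bar>
   <= e + (\<S> i. pair_err ubound (U t) (U t i) R i)"
proof -
 have e0: "(\<S> i. (l2 (%x. cutoff R x * U t i x))^2) = (\<S> i. \<L> x. U t i x * main0 R t i x)"
  unfolding l2_power2 main0_def by (simp add: power2_eq_square mult_ac)
 have q: "sq_int (U t i)" for i using t by (intro L2_U) auto
 show ?thesis
  by (rule pairing_S_sum_close[OF t R e, of "U t", OF q], rule that, assumption) (simp only: Q_def e0)
qed

lemma stress_power_S_lower: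
 assumes ab: "0 < a" "b < T" and R: "0 < R" and e: "0 < e"
 obtains d where "0 < d" "!!\<epsilon> t. 0 < \<epsilon> ==> \<epsilon> < d ==> t \<in> {a..b} ==> H1 (u t) ==>
   stress_power t (S \<epsilon> R t) \<ge> - dirichlet (u t) - (27 * cutoff_const + 9 * err_const) * ubound * sbound t / R - e"
proof -
 obtain B where B: "0 < B" "!!i j t x. t \<in> {a..b} ==> norm x <= R ==> \<bar>stress t i j x\<bar> <= B"
 proof -
  have "\<forall>p. \<exists>B>0. \<forall>t x. t \<in> {a..b} --> norm x <= R --> \<bar>stress t (fst p) (snd p) x\<bar> <= B"
   using slab_bounded[OF slab_cont(3)[OF ab], where r = R] by metis
  then obtain B where B: "!!p. 0 < B p" "!!p t x. t \<in> {a..b} ==> norm x <= R ==> \<bar>stress t (fst p) (snd p) x\<bar> <= B p" by metis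
  show ?thesis
  proof (rule that[of "Max (range B)"])
   show "0 < Max (range B)" using B(1) by (simp add: Max_gr_iff)
   show "\<bar>stress t i j x\<bar> <= Max (range B)" if "t \<in> {a..b}" "norm x <= R" for i j t x
    by (rule order_trans[OF B(2)[OF that, of "(i, j)", simplified] Max_ge]) auto
  qed
 qed
 define V where "V = measure lborel (cball (0::real^3) R)"
 have V: "0 <= V" by (simp add: V_def)
 define h where "h = e / (9 * V * B + 1)"
 have h: "0 < h" unfolding h_def using e V B by (simp add: add_nonneg_pos)
 have he: "9 * (V * (B * h)) <= e"
 proof -
  have "9 * (V * (B * h)) <= (9 * V * B + 1) * h" using h by (simp add: algebra_simps)
  also have "... = e" unfolding h_def using V B by (simp add: add_nonneg_pos less_imp_neq[symmetric])
  finally show ?thesis .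
 qed
 obtain d where d: "0 < d" "!!\<epsilon> t i j x. 0 < \<epsilon> ==> \<epsilon> < d ==> t \<in> {a..b} ==> \<bar>pd j (%x. main \<epsilon> R t i x - main0 R t i x) x\<bar> <= h"
  using main_modulus[OF ab R h] by metis
 show ?thesis
 proof (rule that[of "min d R"])
  fix \<epsilon> t assume p: "0 < \<epsilon>" "\<epsilon> < min d R" "t \<in> {a..b}" and H: "H1 (u t)"
  have t: "t \<in> {0<..<T}" "t \<in> {0..<T}" using p ab by auto
  have tests: "test (main \<epsilon> R t i)" "test (main0 R t i)" "test (S \<epsilon> R t i)" for i
   using p by (auto intro: test_main test_main0 test_S R t)
  have tM: "test (%x. main \<epsilon> R t i x - main0 R t i x)" for i by (intro test_diff tests)
  have "\<bar>\<L> x. stress t i j x * pd j (%x. main \<epsilon> R t i x - main0 R t i x) x\<bar> <= V * (B * h)" for i j unfolding V_def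
  proof (rule integral_bound_ball[OF smooth_cont[OF smooth_stress[OF t(2)]] test_dir_deriv[OF tM] R])
   show "pd j (%x. main \<epsilon> R t i x - main0 R t i x) x = 0" if "R < norm x" for x
    by (rule dir_deriv_outside_supp[OF _ that]) (simp add: main_def main0_def cutoff_outside[OF R])
  qed (use B d p in auto)
  then have "\<bar>stress_power t (%i x. main \<epsilon> R t i x - main0 R t i x)\<bar> <= (\<Sum>i\<in>(UNIV::3 set). \<Sum>j\<in>(UNIV::3 set). V * (B * h))"
   unfolding stress_power_def by (intro order_trans[OF sum_abs] sum_mono)
  then have "\<bar>stress_power t (main \<epsilon> R t) - stress_power t (main0 R t)\<bar> <= e"
   using he stress_power_diff[OF t(1) tests(1,2)] by simp
  moreover have "\<bar>stress_power t (S \<epsilon> R t) - stress_power t (main \<epsilon> R t)\<bar> <= 9 * err_const * ubound * sbound t / R"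
   using stress_power_err[OF t(1) H, of \<epsilon> R] p stress_power_diff[OF t(1), of "S \<epsilon> R t" "main \<epsilon> R t"] tests leray_err_eq[of \<epsilon> R t] by (simp add: ext[OF leray_err_eq])
  moreover note main0_power[OF t(1) H R]
  moreover have "(27 * cutoff_const + 9 * err_const) * ubound * sbound t / R = 27 * cutoff_const * ubound * sbound t / R + 9 * err_const * ubound * sbound t / R"
   by (simp add: distrib_right add_divide_distrib)
  ultimately show "stress_power t (S \<epsilon> R t) \<ge> - dirichlet (u t) - (27 * cutoff_const + 9 * err_const) * ubound * sbound t / R - e"
   by linarith
 qed (use d R in auto)
qed

text \<open>First \<open>\<epsilon>\<close> tends to zero at fixed \<open>R\<close>, then \<open>R\<close> to infinity along the integers.\<close>

lemma kinetic_lower_interior: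
 assumes ab: "0 < a" "a < b" "b < T"
 shows "kinetic (u a) <= kinetic (u b) + 2 * dissip {a..b}"
proof -
 define D where "D = dissip {a..b}"
 define c where "c = (27 * cutoff_const + 9 * err_const) * ubound"
 define q where "q R t = (\<S> i. (l2 (%x. cutoff R x * U t i x))^2)" for R t
 define p where "p R t = (\<S> i. pair_err ubound (U t) (U t i) R i)" for R t
 have iD: "set_integrable lebesgue {a..b} (%\<tau>. dirichlet (u \<tau>))" using ab by (intro set_integrable_dirichlet) auto
 have ic: "set_integrable lebesgue {a..b} (%\<tau>. k)" for k :: real by (rule set_integrable_lebesgue_continuous(1)) auto
 have isb: "set_integrable lebesgue {a..b} sbound" unfolding sbound_def[abs_def] using iD ic by simp
 define Z where "Z = (LINT \<tau>:{a..b}|lebesgue. sbound \<tau>)"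
 have tab: "a \<in> {0<..<T}" "b \<in> {0<..<T}" "a \<in> {0..<T}" "b \<in> {0..<T}" using ab by auto
 have main: "q R a - p R a <= q R b + p R b + 2 * D + 2 * c * Z / R" if R: "0 < R" for R
 proof (rule field_le_epsilon)
  fix e :: real assume e: "0 < e"
  define h where "h = e / (2 + 2 * (b - a))"
  have h: "0 < h" and he: "2 * h + 2 * (h * (b - a)) = e"
  proof -
   have p: "0 < 2 + 2 * (b - a)" using ab by simp
   show "0 < h" unfolding h_def using e p by (rule divide_pos_pos)
   have "2 * h + 2 * (h * (b - a)) = (2 + 2 * (b - a)) * h" by (simp add: algebra_simps)
   then show "2 * h + 2 * (h * (b - a)) = e" unfolding h_def using p by simp
  qed
  obtain da where da: "0 < da" "!!\<epsilon>. 0 < \<epsilon> ==> \<epsilon> < da ==> \<bar>Q \<epsilon> R a - q R a\<bar> <= h + p R a"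
   unfolding q_def p_def using Q_close[OF tab(1) R h] by blast
  obtain db where db: "0 < db" "!!\<epsilon>. 0 < \<epsilon> ==> \<epsilon> < db ==> \<bar>Q \<epsilon> R b - q R b\<bar> <= h + p R b"
   unfolding q_def p_def using Q_close[OF tab(2) R h] by blast
  obtain dc where dc: "0 < dc" "!!\<epsilon> t. 0 < \<epsilon> ==> \<epsilon> < dc ==> t \<in> {a..b} ==> H1 (u t) ==>
    stress_power t (S \<epsilon> R t) \<ge> - dirichlet (u t) - c * sbound t / R - h"
   unfolding c_def using stress_power_S_lower[OF ab(1,3) R h] by blast
  define \<epsilon> where "\<epsilon> = min da (min db dc) / 2"
  have \<epsilon>: "0 < \<epsilon>" "\<epsilon> < da" "\<epsilon> < db" "\<epsilon> < dc" unfolding \<epsilon>_def using da(1) db(1) dc(1) by auto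
  define K where "K \<tau> = stress_power \<tau> (S \<epsilon> R \<tau>)" for \<tau>
  have cK: "continuous_on {a..b} K" unfolding K_def by (rule continuous_K[OF ab(1,3) R])
  note iK = set_integrable_lebesgue_continuous[OF cK]
  have icr: "set_integrable lebesgue {a..b} (%\<tau>. c / R * sbound \<tau>)" using isb by (simp add: set_integrable_mult_right)
  have i1: "set_integrable lebesgue {a..b} (%\<tau>. dirichlet (u \<tau>) + c / R * sbound \<tau> + h)"
   by (intro set_integral_add iD icr ic)
  have "- (LINT \<tau>:{a..b}|lebesgue. dirichlet (u \<tau>) + c / R * sbound \<tau> + h) <= (LINT \<tau>:{a..b}|lebesgue. K \<tau>)"
   unfolding set_lebesgue_integral_def B_integral_minus[symmetric]
  proof (rule integral_mono_AE)
   show "integrable lebesgue (%x. - (indicat_real {a..b} x *\<^sub>R (dirichlet (u x) + c / R * sbound x + h)))"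
    using i1 by (simp add: set_integrable_def)
   show "integrable lebesgue (%x. indicat_real {a..b} x *\<^sub>R K x)" using iK(1) by (simp add: set_integrable_def)
   show "AE x in lebesgue. - (indicat_real {a..b} x *\<^sub>R (dirichlet (u x) + c / R * sbound x + h)) <= indicat_real {a..b} x *\<^sub>R K x"
    using lh_facts(6)
   proof eventually_elim
    case (elim x)
    then show ?case using dc(2)[OF \<epsilon>(1,4), of x] ab by (cases "x \<in> {a..b}") (auto simp: K_def)
   qed
  qed
  also have "(LINT \<tau>:{a..b}|lebesgue. dirichlet (u \<tau>) + c / R * sbound \<tau> + h) = D + c / R * Z + h * (b - a)"
  proof -
   have "(LINT \<tau>:{a..b}|lebesgue. h) = h * (b - a)" unfolding set_lebesgue_integral_def using ab by simp
   then show ?thesis using iD icr ic by (simp add: set_integral_add D_def Z_def)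
  qed
  finally have "Q \<epsilon> R b - Q \<epsilon> R a \<ge> - 2 * (D + c / R * Z + h * (b - a))"
   using Q_integral[OF ab R, of \<epsilon>] iK(2) unfolding K_def by simp
  then show "q R a - p R a <= q R b + p R b + 2 * D + 2 * c * Z / R + e"
   using da(2)[OF \<epsilon>(1,2)] db(2)[OF \<epsilon>(1,3)] he by (simp add: abs_le_iff field_simps)
 qed
 have lim: "(%n. q (real (Suc n)) t) ----> kinetic (u t)" "(%n. p (real (Suc n)) t) ----> (\<Sum>i\<in>(UNIV::3 set). 0)" if t: "t \<in> {0..<T}" for t
  unfolding q_def p_def L2_U(2)[OF t] by (intro tendsto_sum l2_cutoff_tendsto pair_err_tendsto L2_U(1) smooth_U t)+
 have lR: "(%n. 2 * c * Z / real (Suc n)) ----> 0" using tendsto_mult[OF tendsto_const[of "2 * c * Z"] LIMSEQ_Suc[OF lim_1_over_n]] by simp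
 have "kinetic (u a) - (\<Sum>i\<in>(UNIV::3 set). 0) <= kinetic (u b) + (\<Sum>i\<in>(UNIV::3 set). 0) + 2 * D + 0"
  by (rule LIMSEQ_le[OF tendsto_diff[OF lim(1,2)[OF tab(3)]] tendsto_add[OF tendsto_add[OF tendsto_add[OF lim(1,2)[OF tab(4)]] tendsto_const] lR]])
    (use main in auto)
 then show ?thesis by (simp add: D_def)
qed

end

section \<open>The size of the oscillation near the final time\<close>

lemma pairing_le_kinetic:
 assumes f: "L2 f" and g: "L2 g"
 shows "2 * (LINT x|lebesgue. f x \<bullet> g x) <= kinetic f + kinetic g"
proof -
 have i: "integrable lebesgue (%x. (norm (f x))^2)" "integrable lebesgue (%x. (norm (g x))^2)"
  and [measurable]: "f \<in> borel_measurable lebesgue" "g \<in> borel_measurable lebesgue" using f g by (auto simp: L2_def)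
 have b: "2 * \<bar>f x \<bullet> g x\<bar> <= (norm (f x))^2 + (norm (g x))^2" for x
  using Cauchy_Schwarz_ineq2[of "f x" "g x"] sum_squares_bound[of "norm (f x)" "norm (g x)"] by linarith
 have "integrable lebesgue (%x. f x \<bullet> g x)"
 proof (rule B_integrable_bound[OF B_integrable_add[OF i]])
  show "AE x in lebesgue. norm (f x \<bullet> g x) <= norm ((norm (f x))^2 + (norm (g x))^2)"
  proof (rule AE_I2)
   fix x show "norm (f x \<bullet> g x) <= norm ((norm (f x))^2 + (norm (g x))^2)" using b[of x] by simp
  qed
 qed measurable
 then have "(LINT x|lebesgue. 2 * (f x \<bullet> g x)) <= (LINT x|lebesgue. (norm (f x))^2 + (norm (g x))^2)"
 proof (intro integral_mono B_integrable_add i)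
  fix x show "2 * (f x \<bullet> g x) <= (norm (f x))^2 + (norm (g x))^2" using b[of x] by linarith
 qed auto
 then show ?thesis using i by (simp add: kinetic_def)
qed

abbreviation bmo_high :: "(real => real^3 => real^3) => real set => real => real set" where
 "bmo_high u I \<sigma> == {t \<in> I. ennreal \<sigma> < bmo_norm (u t)}"

lemma continuous_slice:
 assumes c: "continuous_on (I \<times> UNIV) (%(t, x). f t x)" and t: "t \<in> I" shows "continuous_on UNIV (f t)"
proof -
 have "continuous_on UNIV (%x. (t, x))" by (intro continuous_on_Pair continuous_on_const continuous_on_id)
 from continuous_on_compose2[OF c this] t show ?thesis by (auto simp: subset_iff)
qed

lemma continuous_ball_integral:
 fixes f :: "real => real^3 => 'b::euclidean_space"
 assumes c: "continuous_on (I \<times> UNIV) (%(t, x). f t x)"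
 shows "continuous_on I (%t. LINT x:ball c r|lebesgue. f t x)"
 unfolding continuous_on_sequentially
proof (intro allI ballI impI, elim conjE)
 fix s :: "nat => real" and t assume s: "\<forall>n. s n \<in> I" "s ----> t" and t: "t \<in> I"
 define K where "K = insert t (range s)"
 have K: "compact K" "K \<subseteq> I" unfolding K_def using compact_sequence_with_limit[OF s(2)] s t by auto
 have "compact ((%p. f (fst p) (snd p)) ` (K \<times> cball c r))"
  by (intro compact_continuous_image continuous_on_subset[OF c[unfolded split_beta']] compact_Times K compact_cball) (use K in auto)
 then obtain B where B: "\<forall>y\<in>(%p. f (fst p) (snd p)) ` (K \<times> cball c r). norm y <= B" using compact_imp_bounded bounded_iff by metis
 have fB: "norm (f t x) <= B" if "t \<in> K" "x \<in> ball c r" for t x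
 proof -
  have "(t, x) \<in> K \<times> cball c r" using that by auto
  from bspec[OF B imageI[OF this]] show ?thesis by simp
 qed
 have cf: "continuous_on UNIV (f t)" if "t \<in> I" for t
  by (rule continuous_slice[OF c that])
 have m: "f t \<in> borel_measurable lebesgue" if "t \<in> I" for t
  using borel_measurable_continuous_onI[OF cf[OF that]] by (intro measurable_completion) simp
 show "((%t. LINT x:ball c r|lebesgue. f t x) \<circ> s) ----> (LINT x:ball c r|lebesgue. f t x)"
  unfolding o_def set_lebesgue_integral_def
 proof (rule integral_dominated_convergence[where w = "%x. indicator (ball c r) x * B"])
  show "(%x. indicat_real (ball c r) x *\<^sub>R f t x) \<in> borel_measurable lebesgue" "(%x. indicat_real (ball c r) x *\<^sub>R f (s n) x) \<in> borel_measurable lebesgue" for n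
   using m t s(1) by (auto intro!: borel_measurable_scaleR borel_measurable_indicator)
  show "integrable lebesgue (%x. indicator (ball c r) x * B)"
   using emeasure_lborel_ball_finite[of c r] by (auto simp: less_top)
  show "AE x in lebesgue. (%n. indicat_real (ball c r) x *\<^sub>R f (s n) x) ----> indicat_real (ball c r) x *\<^sub>R f t x"
  proof (intro AE_I2 tendsto_scaleR tendsto_const)
   fix x :: "real^3"
   have "(%n. (s n, x)) ----> (t, x)" by (intro tendsto_Pair s(2) tendsto_const)
   moreover have "\<forall>n. (s n, x) \<in> I \<times> UNIV" "(t, x) \<in> I \<times> UNIV" using s t by auto
   ultimately have "((%(t, x). f t x) \<circ> (%n. (s n, x))) ----> (%(t, x). f t x) (t, x)"
    by (intro c[unfolded continuous_on_sequentially, rule_format] conjI) auto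
   then show "(%n. f (s n) x) ----> f t x" by (simp add: o_def)
  qed
  show "AE x in lebesgue. norm (indicat_real (ball c r) x *\<^sub>R f (s n) x) <= indicat_real (ball c r) x * B" for n
   using fB[of "s n"] by (intro AE_I2) (auto simp: indicator_def K_def)
 qed
qed

text \<open>The mean oscillation over a fixed ball is continuous in time, so the seminorm is lower semicontinuous.\<close>

lemma bmo_level_set:
 fixes u :: "real => real^3 => real^3"
 assumes c: "continuous_on (I \<times> UNIV) (%(t, x). u t x)" and \<sigma>: "0 <= \<sigma>" and I: "I \<in> sets borel"
 shows "bmo_high u I \<sigma> \<in> sets borel"
proof -
 define F where "F c r t = (LINT x:ball c r|lebesgue. norm (u t x - average (ball c r) (u t))) / measure lebesgue (ball c r)" for c r t
 have "continuous_on I (F c r)" for c r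
 proof -
  have "continuous_on I (%t. average (ball c r) (u t))"
   unfolding average_def by (intro continuous_intros continuous_ball_integral c)
  then have "continuous_on (I \<times> UNIV) (%p::real \<times> (real^3). average (ball c r) (u (fst p)))"
   by (rule continuous_on_compose2) (auto intro!: continuous_intros)
  then have "continuous_on (I \<times> UNIV) (%(t, x). norm (u t x - average (ball c r) (u t)))"
   unfolding split_beta by (intro continuous_intros c[unfolded split_beta])
  from continuous_ball_integral[OF this] show ?thesis
   unfolding F_def divide_inverse by (intro continuous_intros)
 qed
 then have "\<exists>G. open G \<and> G \<inter> I = F c r -` {\<sigma><..} \<inter> I" for c r
  using open_greaterThan unfolding continuous_on_open_invariant by blast
 then obtain G where G: "!!c r. open (G c r)" "!!c r. G c r \<inter> I = F c r -` {\<sigma><..} \<inter> I" by metis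
 have eq: "(\<integral>\<^sup>+x\<in>ball c r. ennreal (norm (u t x - average (ball c r) (u t))) \<partial>lebesgue) / emeasure lebesgue (ball c r) = ennreal (F c r t)"
  if t: "t \<in> I" and r: "0 < r" for t c r
 proof -
  define g where "g x = norm (u t x - average (ball c r) (u t))" for x
  have cu: "continuous_on UNIV (u t)" by (rule continuous_slice[OF c t])
  have cg: "continuous_on UNIV g" unfolding g_def[abs_def] by (intro continuous_intros cu)
  have "integrable lborel (%x. indicator (cball c r) x *\<^sub>R g x)"
   using cg by (intro borel_integrable_compact) (auto intro: continuous_on_subset)
  then have "set_integrable lborel (cball c r) g" by (simp add: set_integrable_def)
  then have "set_integrable lborel (ball c r) g" by (rule set_integrable_subset) auto
  then have i0: "integrable lborel (%x. indicator (ball c r) x * g x)" by (simp add: set_integrable_def)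
  then have "integrable lebesgue (%x. indicator (ball c r) x * g x)"
   using borel_measurable_integrable[OF i0] by (subst integrable_lebesgue_borel) auto
  then have "(\<integral>\<^sup>+x. ennreal (indicator (ball c r) x * g x) \<partial>lebesgue) = ennreal (LINT x|lebesgue. indicator (ball c r) x * g x)"
   by (rule nn_integral_eq_integral) (auto simp: g_def)
  moreover have "(\<integral>\<^sup>+x\<in>ball c r. ennreal (g x) \<partial>lebesgue) = (\<integral>\<^sup>+x. ennreal (indicator (ball c r) x * g x) \<partial>lebesgue)"
   by (intro nn_integral_cong) (simp split: split_indicator)
  moreover have "emeasure lebesgue (ball c r) = ennreal (measure lebesgue (ball c r))"
   using emeasure_lborel_ball_finite[of c r] by (intro emeasure_eq_ennreal_measure) auto
  moreover have "0 <= (LINT x|lebesgue. indicator (ball c r) x * g x)" by (intro B_integral_nonneg) (simp add: g_def)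
  ultimately show ?thesis using content_ball_pos[OF r, of c] unfolding F_def g_def[symmetric] set_lebesgue_integral_def
   by (simp add: divide_ennreal)
 qed
 have "bmo_high u I \<sigma> = I \<inter> (\<Union>c. \<Union>r\<in>{0<..}. G c r)"
 proof (intro set_eqI iffI)
  fix t assume "t \<in> bmo_high u I \<sigma>"
  then obtain c r where "t \<in> I" "0 < r" "ennreal \<sigma> < ennreal (F c r t)"
   unfolding bmo_norm_def less_SUP_iff using eq by auto
  then show "t \<in> I \<inter> (\<Union>c. \<Union>r\<in>{0<..}. G c r)" using G(2)[of c r] \<sigma> by (auto simp: ennreal_less_iff)
 next
  fix t assume "t \<in> I \<inter> (\<Union>c. \<Union>r\<in>{0<..}. G c r)"
  then obtain c r where t: "t \<in> I" "0 < r" "\<sigma> < F c r t" using G(2) by blast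
  then have "ennreal \<sigma> < ennreal (F c r t)" using \<sigma> by (simp add: ennreal_less_iff)
  also have "... <= bmo_norm (u t)"
   unfolding bmo_norm_def eq[OF t(1,2), of c, symmetric] using t by (intro SUP_upper) blast
  finally show "t \<in> bmo_high u I \<sigma>" using t by simp
 qed
 also have "... \<in> sets borel" by (intro sets.Int I borel_open open_UN ballI G(1))
 finally show ?thesis .
qed

text \<open>A measurable form of the layer cake formula: \<open>h\<close> adds \<open>2^k \<sigma>\<close> wherever \<open>f\<close> exceeds \<open>2^k \<sigma>\<close>, and its
 integral over the levels above \<open>\<sigma>\<close> is a geometric series.  Keeping \<open>h\<close> above \<open>\<sigma>\<close> makes it positive, as
 the interpolation inequality requires.\<close>

lemma dyadic_majorant:
 fixes f :: "real => ennreal"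
 assumes A: "A \<in> sets lebesgue" and L: "!!\<sigma>. 0 < \<sigma> ==> {t \<in> A. ennreal \<sigma> < f t} \<in> sets lebesgue"
  "!!\<sigma>. 0 < \<sigma> ==> emeasure lebesgue {t \<in> A. ennreal \<sigma> < f t} <= ennreal (C / \<sigma>^2)" and \<sigma>: "0 < \<sigma>" "0 <= C"
 obtains h where "h \<in> borel_measurable lebesgue" "!!t. t \<in> A ==> f t <= h t" "!!t. ennreal \<sigma> <= h t"
  "(\<integral>\<^sup>+t\<in>A. h t \<partial>lebesgue) <= ennreal \<sigma> * emeasure lebesgue A + ennreal (2 * C / \<sigma>)"
proof -
 define s where "s k = 2 ^ k * \<sigma>" for k :: nat
 have s: "0 < s k" "0 <= s k" for k using \<sigma> by (auto simp: s_def)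
 define L where "L k = {t \<in> A. ennreal (s k) < f t}" for k
 have [measurable]: "L k \<in> sets lebesgue" "A \<in> sets lebesgue" for k unfolding L_def using assms s by auto
 define h where "h t = ennreal \<sigma> + (\<Sum>k. ennreal (s k) * indicator (L k) t)" for t
 show ?thesis
 proof (rule that[of h])
  show "h \<in> borel_measurable lebesgue" unfolding h_def by measurable
  show "ennreal \<sigma> <= h t" for t unfolding h_def by simp
  show "f t <= h t" if t: "t \<in> A" for t
  proof -
   have step: "ennreal (s n) <= h t" if "\<forall>k<n. ennreal (s k) < f t" for n
   proof -
    have sn: "\<sigma> + (\<Sum>k<n. s k) = s n" by (induction n) (simp_all add: s_def)
    have "ennreal (s n) = ennreal \<sigma> + (\<Sum>k<n. ennreal (s k))"
     unfolding sn[symmetric] using s \<sigma> by (subst ennreal_plus) (auto simp: sum_nonneg sum_ennreal)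
    also have "(\<Sum>k<n. ennreal (s k)) = (\<Sum>k<n. ennreal (s k) * indicator (L k) t)"
     using that t by (intro sum.cong) (auto simp: L_def)
    also have "... <= (\<Sum>k. ennreal (s k) * indicator (L k) t)" by (rule sum_le_suminf) auto
    finally show ?thesis unfolding h_def by (simp add: add_left_mono)
   qed
   show ?thesis
   proof (cases "\<exists>k. f t <= ennreal (s k)")
    case True
    define k where "k = (LEAST k. f t <= ennreal (s k))"
    have "f t <= ennreal (s k)" unfolding k_def using True by (rule LeastI_ex)
    moreover have "\<forall>j<k. ennreal (s j) < f t" unfolding k_def using not_less_Least by (meson not_le)
    ultimately show ?thesis using step order_trans by blast
   next
    case False
    then have big: "ennreal (s n) <= h t" for n by (intro step) (auto simp: not_le)
    have "h t = top"
    proof (rule ccontr)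
     assume "h t \<noteq> top"
     then obtain r where r: "h t = ennreal r" "0 <= r" by (cases "h t") auto
     obtain n where "r / \<sigma> < 2 ^ n" using real_arch_pow[of 2 "r / \<sigma>"] by auto
     then have "r < s n" unfolding s_def using \<sigma> by (simp add: divide_less_eq mult.commute)
     then show False using big[of n] r s by simp
    qed
    then show ?thesis by simp
   qed
  qed
  have "(\<integral>\<^sup>+t\<in>A. h t \<partial>lebesgue) = (\<integral>\<^sup>+t. ennreal \<sigma> * indicator A t + (\<Sum>k. ennreal (s k) * indicator (L k) t) \<partial>lebesgue)"
  proof (rule nn_integral_cong)
   fix t
   show "h t * indicator A t = ennreal \<sigma> * indicator A t + (\<Sum>k. ennreal (s k) * indicator (L k) t)"
    unfolding h_def by (cases "t \<in> A") (auto simp: L_def)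
  qed
  also have "... = ennreal \<sigma> * emeasure lebesgue A + (\<Sum>k. ennreal (s k) * emeasure lebesgue (L k))"
   by (simp add: nn_integral_add nn_integral_suminf nn_integral_cmult_indicator)
  also have "(\<Sum>k. ennreal (s k) * emeasure lebesgue (L k)) <= (\<Sum>k. ennreal (C / \<sigma> * (1 / 2) ^ k))"
  proof (rule suminf_le)
   fix k
   have "ennreal (s k) * emeasure lebesgue (L k) <= ennreal (s k) * ennreal (C / (s k)^2)"
    unfolding L_def by (intro mult_left_mono assms s) auto
   also have "... = ennreal (C / \<sigma> * (1 / 2) ^ k)"
    using s \<sigma> by (simp add: ennreal_mult'[symmetric] s_def power2_eq_square field_simps)
   finally show "ennreal (s k) * emeasure lebesgue (L k) <= ennreal (C / \<sigma> * (1 / 2) ^ k)" .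
  qed auto
  also have "(\<Sum>k. ennreal (C / \<sigma> * (1 / 2) ^ k)) = ennreal (C / \<sigma> * 2)"
   using \<sigma> sums_mult[OF geometric_sums[of "1 / 2 :: real"], of "C / \<sigma>"] by (intro suminf_ennreal_eq) auto
  finally show "(\<integral>\<^sup>+t\<in>A. h t \<partial>lebesgue) <= ennreal \<sigma> * emeasure lebesgue A + ennreal (2 * C / \<sigma>)"
   by (simp add: mult_ac add_left_mono)
 qed
qed

text \<open>Both hypotheses imply the weak type bound near \<open>T\<close>: under the pointwise one, \<open>bmo_norm (u t) > \<sigma>\<close> forces
 \<open>T - t \<le> C^2 / \<sigma>^2\<close>.\<close>

lemma weak_bmo_tail:
 assumes T: "0 < T" and lvl: "!!\<sigma>. 0 < \<sigma> ==> bmo_high u {0..<T} \<sigma> \<in> sets lebesgue"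
  and w: "weak_L2_BMO T u \<or> Limsup (at_left T) (%t. ennreal (sqrt (T - t)) * bmo_norm (u t)) < \<infinity>"
 obtains \<delta> C where "0 < \<delta>" "\<delta> <= T" "0 <= C" "!!\<sigma>. 0 < \<sigma> ==> emeasure lebesgue (bmo_high u {T - \<delta>..<T} \<sigma>) <= ennreal (C / \<sigma>^2)"
 using w
proof
 assume w: "weak_L2_BMO T u"
 define m where "m \<sigma> = measure lebesgue (bmo_high u {0..<T} \<sigma>)" for \<sigma>
 obtain C where C: "(SUP \<sigma> \<in> {0<..}. ennreal (\<sigma> * sqrt (m \<sigma>))) = ennreal C" "0 <= C"
  using w unfolding weak_L2_BMO_def m_def by (auto simp: less_top_ennreal)
 show ?thesis
 proof (rule that[of T "C^2"])
  fix \<sigma> :: real assume \<sigma>: "0 < \<sigma>"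
  have "ennreal (\<sigma> * sqrt (m \<sigma>)) <= ennreal C" unfolding C(1)[symmetric] using \<sigma> by (intro SUP_upper) auto
  then have "\<sigma> * sqrt (m \<sigma>) <= C" using C(2) by simp
  then have "(\<sigma> * sqrt (m \<sigma>))^2 <= C^2" using \<sigma> by (intro power_mono) (auto simp: m_def)
  then have "m \<sigma> <= C^2 / \<sigma>^2" using \<sigma> by (subst pos_le_divide_eq) (simp_all add: power_mult_distrib m_def mult.commute)
  moreover have "emeasure lebesgue (bmo_high u {0..<T} \<sigma>) = ennreal (m \<sigma>)"
   unfolding m_def
  proof (rule emeasure_eq_ennreal_measure)
   have "emeasure lebesgue (bmo_high u {0..<T} \<sigma>) <= emeasure lebesgue {0..<T}"
    by (rule emeasure_mono) auto
   also have "... < top" using T by simp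
   finally show "emeasure lebesgue (bmo_high u {0..<T} \<sigma>) \<noteq> top" by simp
  qed
  ultimately show "emeasure lebesgue (bmo_high u {T - T..<T} \<sigma>) <= ennreal (C^2 / \<sigma>^2)"
   by (simp add: ennreal_leI)
 qed (use T in auto)
next
 assume L: "Limsup (at_left T) (%t. ennreal (sqrt (T - t)) * bmo_norm (u t)) < \<infinity>"
 then obtain l where l: "Limsup (at_left T) (%t. ennreal (sqrt (T - t)) * bmo_norm (u t)) = ennreal l" "0 <= l"
  by (auto simp: less_top_ennreal)
 define C where "C = l + 1"
 have "Limsup (at_left T) (%t. ennreal (sqrt (T - t)) * bmo_norm (u t)) < ennreal C"
  unfolding l C_def using l(2) by (simp add: ennreal_less_iff)
 then have "\<forall>\<^sub>F t in at_left T. ennreal (sqrt (T - t)) * bmo_norm (u t) < ennreal C" by (rule Limsup_lessD)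
 then obtain b where b: "b < T" "!!t. b < t ==> t < T ==> ennreal (sqrt (T - t)) * bmo_norm (u t) < ennreal C"
  unfolding eventually_at_left_field by blast
 show ?thesis
 proof (rule that[of "min T ((T - b) / 2)" "C^2"])
  fix \<sigma> :: real assume \<sigma>: "0 < \<sigma>"
  have "bmo_high u {T - min T ((T - b) / 2)..<T} \<sigma> \<subseteq> {T - C^2 / \<sigma>^2..<T}"
  proof
   fix t assume t: "t \<in> bmo_high u {T - min T ((T - b) / 2)..<T} \<sigma>"
   then have tb: "b < t" "t < T" using b(1) by (auto simp: min_def field_simps split: if_splits)
   have "ennreal (sqrt (T - t)) * ennreal \<sigma> <= ennreal (sqrt (T - t)) * bmo_norm (u t)"
    using t by (intro mult_left_mono) auto
   also have "... < ennreal C" by (rule b(2)[OF tb])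
   finally have "ennreal (sqrt (T - t) * \<sigma>) < ennreal C" using tb \<sigma> by (simp add: ennreal_mult)
   then have "sqrt (T - t) * \<sigma> < C" using \<sigma> tb by (simp add: ennreal_less_iff)
   then have "(sqrt (T - t) * \<sigma>)^2 <= C^2" using \<sigma> tb by (intro power_mono) auto
   then have "(T - t) * \<sigma>^2 <= C^2" using tb by (simp add: power_mult_distrib)
   then have "T - t <= C^2 / \<sigma>^2" using \<sigma> by (simp add: le_divide_eq)
   then show "t \<in> {T - C^2 / \<sigma>^2..<T}" using tb by auto
  qed
  then have "emeasure lebesgue (bmo_high u {T - min T ((T - b) / 2)..<T} \<sigma>) <= emeasure lebesgue {T - C^2 / \<sigma>^2..<T}"
   by (intro emeasure_mono) auto
  also have "... = ennreal (C^2 / \<sigma>^2)" by simp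
  finally show "emeasure lebesgue (bmo_high u {T - min T ((T - b) / 2)..<T} \<sigma>) <= ennreal (C^2 / \<sigma>^2)" .
 qed (use T b in auto)
qed

context smooth_leray
begin

lemma L2_u: "t \<in> {0..T} ==> L2 (u t)"
 using lh_facts(1) by (auto simp: weakly_continuous_L2_def)

text \<open>By weak continuity at time zero, \<open>2 <u a, u 0> - E 0 \<le> E a\<close> tends to \<open>E 0\<close> as \<open>a\<close> tends to zero.\<close>

lemma kinetic_lower:
 assumes b: "0 < b" "b < T"
 shows "kinetic (u 0) <= kinetic (u b) + 2 * dissip {0..b}"
proof -
 define f where "f t = (LINT x|lebesgue. u t x \<bullet> u 0 x)" for t
 have "continuous_on {0..T} f" unfolding f_def
  using lh_facts(1) L2_u[of 0] T by (auto simp: weakly_continuous_L2_def)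
 then have "(f \<longlongrightarrow> f 0) (at 0 within {0..T})" using T by (auto simp: continuous_on_def)
 then have "(f \<longlongrightarrow> f 0) (at 0 within {0<..<b})" by (rule tendsto_within_subset) (use b in auto)
 then have lim: "((%t. 2 * f t - kinetic (u 0)) \<longlongrightarrow> 2 * f 0 - kinetic (u 0)) (at 0 within {0<..<b})" by (intro tendsto_intros)
 have nb: "at 0 within {0<..<b} \<noteq> bot"
  using b by (simp add: trivial_limit_within islimpt_greaterThanLessThan1)
 have "2 * f 0 - kinetic (u 0) <= kinetic (u b) + 2 * dissip {0..b}"
 proof (rule tendsto_upperbound[OF lim _ nb])
  show "\<forall>\<^sub>F t in at 0 within {0<..<b}. 2 * f t - kinetic (u 0) <= kinetic (u b) + 2 * dissip {0..b}"
   unfolding eventually_at_filter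
  proof (intro always_eventually allI impI)
   fix a assume a: "a \<in> {0<..<b}"
   have "2 * f a <= kinetic (u a) + kinetic (u 0)"
    unfolding f_def using a b T by (intro pairing_le_kinetic L2_u) auto
   moreover have "kinetic (u a) <= kinetic (u b) + 2 * dissip {a..b}"
    using a b by (intro kinetic_lower_interior) auto
   moreover have "dissip {a..b} <= dissip {0..b}"
    using a b by (intro set_integral_mono_dirichlet) auto
   ultimately show "2 * f a - kinetic (u 0) <= kinetic (u b) + 2 * dissip {0..b}" by linarith
  qed
 qed
 moreover have "f 0 = kinetic (u 0)" by (simp add: f_def kinetic_def power2_norm_eq_inner)
 ultimately show ?thesis by simp
qed

end

section \<open>Energy balance at the final time\<close>

text \<open>At the final time \<open>u\<close> is only Lebesgue measurable; a Borel version makes the estimates for pairings applicable.\<close>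

lemma L2_borel_version:
 fixes f :: "real^3 => real^3"
 assumes f: "L2 f"
 obtains g :: vfield where "!!i. sq_int (g i)" "!!i. AE x in lebesgue. f x $ i = g i x"
proof -
 have i2: "integrable lebesgue (%x. (norm (f x))^2)" and m: "f \<in> borel_measurable lebesgue" using f by (auto simp: L2_def)
 have "\<exists>g. sq_int g \<and> (AE x in lebesgue. f x $ i = g x)" for i
 proof -
  have "(%x. f x $ i) \<in> borel_measurable lebesgue" by (rule measurable_compose[OF m]) simp
  from completion_ex_borel_measurable_real[OF this]
  obtain g where g: "g \<in> borel_measurable lborel" "AE x in lborel. f x $ i = g x" by blast
  have ae: "AE x in lebesgue. f x $ i = g x" using g(2) by (rule AE_completion)
  have [measurable]: "meas g" using g(1) by simp
  have b: "meas ((%x. (g x)^2))" by measurable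
  have "integrable lebesgue (%x. (g x)^2)"
  proof (rule B_integrable_bound[OF i2])
   show "(%x. (g x)^2) \<in> borel_measurable lebesgue" using b by (intro measurable_completion) simp
   show "AE x in lebesgue. norm ((g x)^2) <= norm ((norm (f x))^2)" using ae
   proof eventually_elim
    case (elim x)
    have "\<bar>g x\<bar> <= norm (f x)" unfolding elim[symmetric] by (rule component_le_norm_cart)
    then show ?case using power_mono[of "\<bar>g x\<bar>" "norm (f x)" 2] by simp
   qed
  qed
  then have "sq_int g" using integrable_lebesgue_borel[OF b] by (simp add: sq_int_def)
  then show ?thesis using ae by blast
 qed
 then show ?thesis using that by metis
qed

lemma borel_version_pairing:
 fixes f :: "real^3 => real^3" and g w :: vfield
 assumes f: "L2 f" and g: "!!i. sq_int (g i)" "!!i. AE x in lebesgue. f x $ i = g i x" and w: "!!i. sq_int (w i)"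
 shows "(LINT x|lebesgue. f x \<bullet> (\<chi> i. w i x)) = (\<S> i. \<L> x. g i x * w i x)" "L2 (%x. \<chi> i. w i x)"
proof -
 have [measurable]: "meas (g i)" "meas (w i)" for i using g w by (auto intro: sq_int_borel)
 have wm: "meas ((%x. \<chi> i. w i x))" 
  unfolding borel_measurable_euclidean_space[of "%x. (\<chi> i. w i x) :: real^3"] by (auto simp: Basis_vec_def inner_axis)
 then have wl: "(%x. \<chi> i. w i x) \<in> borel_measurable lebesgue" by (intro measurable_completion) simp
 have gw: "meas ((%x. \<S> i. g i x * w i x))" by measurable
 then have gl: "(%x. \<S> i. g i x * w i x) \<in> borel_measurable lebesgue" by (intro measurable_completion) simp
 have "AE x in lebesgue. \<forall>i. f x $ i = g i x" using g(2) by (simp add: AE_all_countable)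
 then have "(LINT x|lebesgue. f x \<bullet> (\<chi> i. w i x)) = (LINT x|lebesgue. (\<S> i. g i x * w i x))"
  using f wl gl by (intro integral_cong_AE borel_measurable_inner) (auto simp: inner_vec_def L2_def)
 also have "... = (\<S> i. \<L> x. g i x * w i x)"
  unfolding integral_lebesgue_borel[OF gw] by (intro B_integral_sum sq_int_mult_integrable g w)
 finally show "(LINT x|lebesgue. f x \<bullet> (\<chi> i. w i x)) = (\<S> i. \<L> x. g i x * w i x)" .
 have "integrable lborel (%x. \<S> i. (w i x)^2)" using w by (intro B_integrable_sum) (auto simp: sq_int_def)
 then have "integrable lebesgue (%x. (norm (\<chi> i. w i x))^2)"
  by (subst integrable_lebesgue_borel) (auto simp: norm_vec_sq)
 with wl show "L2 (%x. \<chi> i. w i x)" by (simp add: L2_def)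
qed

lemma cutoff_pairing_tendsto:
 assumes f: "sq_int f" and g: "sq_int g"
 shows "(%n. \<L> x. f x * (cutoff (real (Suc n)) x * (cutoff (real (Suc n)) x * g x))) ----> (\<L> x. f x * g x)"
proof (rule integral_dominated_convergence[where w = "%x. \<bar>f x * g x\<bar>"])
 have [measurable]: "meas (cutoff (real (Suc n)))" "meas f" "meas g" for n
  using f g by (auto intro: test_borel[OF test_cutoff] sq_int_borel)
 show "(%x. f x * (cutoff (real (Suc n)) x * (cutoff (real (Suc n)) x * g x))) \<in> borel_measurable lborel" for n by measurable
 show "(%x. f x * g x) \<in> borel_measurable lborel" by measurable
 show "integrable lborel (%x. \<bar>f x * g x\<bar>)" by (intro integrable_abs sq_int_mult_integrable f g)
 show "AE x in lborel. (%n. f x * (cutoff (real (Suc n)) x * (cutoff (real (Suc n)) x * g x))) ----> f x * g x"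
 proof (rule AE_I2)
  fix x
  have "(%n. f x * (cutoff (real (Suc n)) x * (cutoff (real (Suc n)) x * g x))) ----> f x * (1 * (1 * g x))"
   by (intro tendsto_intros cutoff_tendsto)
  then show "(%n. f x * (cutoff (real (Suc n)) x * (cutoff (real (Suc n)) x * g x))) ----> f x * g x" by simp
 qed
 show "AE x in lborel. norm (f x * (cutoff (real (Suc n)) x * (cutoff (real (Suc n)) x * g x))) <= \<bar>f x * g x\<bar>" for n
 proof (rule AE_I2)
  fix x
  have "\<bar>cutoff (real (Suc n)) x\<bar> * (\<bar>cutoff (real (Suc n)) x\<bar> * \<bar>f x * g x\<bar>) <= 1 * (1 * \<bar>f x * g x\<bar>)"
   by (intro mult_mono cutoff_bounds) auto
  then show "norm (f x * (cutoff (real (Suc n)) x * (cutoff (real (Suc n)) x * g x))) <= \<bar>f x * g x\<bar>"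
   by (simp add: abs_mult mult_ac)
 qed
qed

context smooth_leray
begin

text \<open>Mollification does not increase the norm of the gradient, and each cutoff adds \<open>O(1 / R)\<close>.\<close>

lemma l2_pd_S:
 assumes s: "s \<in> {0<..<T}" and H: "H1 (u s)" and R: "0 < \<epsilon>" "\<epsilon> < R"
 shows "l2 (pd j (S \<epsilon> R s i)) <= sqrt (dirichlet (u s)) + (err_const + 2 * cutoff_const) * ubound / R"
proof -
 have s0: "s \<in> {0..<T}" and R0: "0 < R" using s R by auto
 note sU = smooth_U[OF s0] and qU = L2_U(1)[OF s0] and lU = l2_U_le[OF s0]
 define F where "F x = cutoff R x * U s i x" for x
 have tF: "test F" unfolding F_def[abs_def] by (rule test_cut_U[OF R0 s0])
 have t\<phi>: "test (cutoff R)" and tm: "test (mol \<epsilon>)" using R by (auto intro: test_cutoff test_mol)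
 have F0: "l2 F <= ubound" unfolding F_def[abs_def] using l2_cut_u[OF R0 qU[of i]] lU[of i] by linarith
 have F1: "l2 (pd j F) <= sqrt (dirichlet (u s)) + cutoff_const / R * ubound"
 proof -
  have e: "pd j F = (%x. cutoff R x * pd j (U s i) x + pd j (cutoff R) x * U s i x)"
   unfolding F_def[abs_def] by (rule dir_deriv_mult[OF test_smooth[OF t\<phi>] sU])
  note b = sq_int_mult_bounded[OF gradient_U(1)[OF s0 H] test_borel[OF t\<phi>] cutoff_bounds(3), of j i]
   sq_int_mult_bounded[OF qU test_borel[OF test_dir_deriv[OF t\<phi>]] cutoff_const(2)[OF R0], of j i]
  have "l2 (pd j F) <= 1 * l2 (pd j (U s i)) + cutoff_const / R * l2 (U s i)"
   unfolding e using l2_triangle[OF b(1,3)] b(2,4) by linarith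
  moreover have "cutoff_const / R * l2 (U s i) <= cutoff_const / R * ubound"
   using lU[of i] cutoff_const(1) R0 by (intro mult_left_mono) auto
  ultimately show ?thesis using stress_bounds(1)[OF s0 H, of j i] by linarith
 qed
 define C where "C = conv (mol \<epsilon>) F"
 have tC: "test C" unfolding C_def by (rule test_conv[OF tm tF])
 have C0: "l2 C <= ubound" unfolding C_def using l2_conv[OF tm tF] F0 by (simp add: integral_abs_mol R)
 have C1: "l2 (pd j C) <= sqrt (dirichlet (u s)) + cutoff_const / R * ubound"
  unfolding C_def dir_deriv_conv_right[OF tm tF] using l2_conv[OF tm test_dir_deriv[OF tF], of "axis j 1"] F1 by (simp add: integral_abs_mol R)
 have m: "main \<epsilon> R s i = (%x. cutoff R x * C x)" unfolding main_def C_def F_def ..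
 have n1: "l2 (pd j (main \<epsilon> R s i)) <= cutoff_const / R * ubound + 1 * (sqrt (dirichlet (u s)) + cutoff_const / R * ubound)"
  unfolding m by (rule l2_product_bounds(2)[OF t\<phi> tC cutoff_bounds(3) cutoff_const(2)[OF R0] C0 C1])
 have n2: "l2 (pd j (leray_err \<epsilon> R (U s) i)) <= err_const * ubound / R"
  by (intro l2_pd_leray_err R sU qU lU divergence_free s)
 have n3: "l2 (pd j (S \<epsilon> R s i)) <= l2 (pd j (leray_err \<epsilon> R (U s) i)) + l2 (pd j (main \<epsilon> R s i))"
 proof -
  have tests: "test (S \<epsilon> R s i)" "test (main \<epsilon> R s i)" using R by (auto intro: test_S test_main s0)
  then have te: "test (leray_err \<epsilon> R (U s) i)" unfolding leray_err_eq by (rule test_diff)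
  have "pd j (S \<epsilon> R s i) = (%x. pd j (leray_err \<epsilon> R (U s) i) x + pd j (main \<epsilon> R s i) x)"
   unfolding leray_err_eq by (simp add: dir_deriv_diff test_smooth tests)
  then show ?thesis using l2_triangle[OF test_sq_int[OF test_dir_deriv[OF te]] test_sq_int[OF test_dir_deriv[OF tests(2)]]] by simp
 qed
 have n4: "(err_const + 2 * cutoff_const) * ubound / R = err_const * ubound / R + cutoff_const / R * ubound + cutoff_const / R * ubound"
  by (simp add: add_divide_distrib distrib_right)
 from order_trans[OF n3 add_mono[OF n2 n1]] show ?thesis unfolding n4 by simp
qed

text \<open>Test with the approximations of \<open>u s\<close>.  The increment of the pairing up to time \<open>T\<close> is bounded by \<open>J\<close>, so
 in the limit \<open>|<u T, u s> - E s| \<le> J\<close>.\<close>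

lemma terminal_comparison:
 assumes s: "s \<in> {0<..<T}" and H: "H1 (u s)" and G: "sqrt (dirichlet (u s)) < G"
  and J: "!!w t. (!!i. test (w i)) ==> (!!i j. l2 (pd j (w i)) <= G) ==> s < t ==> t < T ==> \<bar>LINT \<tau>:{s..t}|lborel. stress_power \<tau> w\<bar> <= J"
 shows "kinetic (u s) <= kinetic (u T) + 2 * J"
proof -
 have s0: "s \<in> {0..<T}" using s by auto
 note sU = smooth_U[OF s0] and qU = L2_U(1)[OF s0]
 have LT: "L2 (u T)" and Ls: "L2 (u s)" using s T by (auto intro: L2_u)
 obtain g :: vfield where g: "!!i. sq_int (g i)" "!!i. AE x in lebesgue. u T x $ i = g i x" using L2_borel_version[OF LT] by blast
 define p where "p R = (\<S> i. pair_err ubound (U s) (g i) R i) + (\<S> i. pair_err ubound (U s) (U s i) R i)" for R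
 define m where "m f R = (\<S> i. \<L> x. f i x * main0 R s i x)" for f R
 have key: "\<bar>m g R - m (U s) R\<bar> <= J + p R"
  if R: "0 < R" "sqrt (dirichlet (u s)) + (err_const + 2 * cutoff_const) * ubound / R <= G" for R
 proof (rule field_le_epsilon)
  fix e :: real assume e: "0 < e"
  then have e2: "0 < e / 2" by simp
  obtain d1 where d1: "0 < d1" "!!\<epsilon>. 0 < \<epsilon> ==> \<epsilon> < d1 ==>
   \<bar>(\<S> i. \<L> x. g i x * S \<epsilon> R s i x) - m g R\<bar> <= e / 2 + (\<S> i. pair_err ubound (U s) (g i) R i)"
   unfolding m_def by (rule pairing_S_sum_close[OF s R(1) e2, of g, OF g(1)]) blast
  obtain d2 where d2: "0 < d2" "!!\<epsilon>. 0 < \<epsilon> ==> \<epsilon> < d2 ==>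
   \<bar>(\<S> i. \<L> x. U s i x * S \<epsilon> R s i x) - m (U s) R\<bar> <= e / 2 + (\<S> i. pair_err ubound (U s) (U s i) R i)"
   unfolding m_def by (rule pairing_S_sum_close[OF s R(1) e2, of "U s", OF qU]) blast
  define \<epsilon> where "\<epsilon> = min R (min d1 d2) / 2"
  have \<epsilon>: "0 < \<epsilon>" "\<epsilon> < d1" "\<epsilon> < d2" "\<epsilon> < R" unfolding \<epsilon>_def using R(1) d1(1) d2(1) by auto
  define w where "w = S \<epsilon> R s"
  have tw: "test (w i)" for i unfolding w_def by (rule test_S[OF R(1) s0])
  have wG: "l2 (pd j (w i)) <= G" for i j unfolding w_def using l2_pd_S[OF s H \<epsilon>(1,4), of j i] R(2) by linarith
  define W :: "real^3 => real^3" where "W x = (\<chi> i. w i x)" for x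
  define f where "f t = (LINT x|lebesgue. u t x \<bullet> W x)" for t
  note bv = borel_version_pairing[where w = w, OF _ _ _ test_sq_int[OF tw], folded W_def]
  have ft: "f t = (\<S> i. \<L> x. U t i x * w i x)" if t: "t \<in> {0..<T}" for t
   unfolding f_def using t by (intro bv L2_u L2_U(1)) (auto simp: U_def)
  have fT: "f T = (\<S> i. \<L> x. g i x * w i x)" unfolding f_def by (rule bv(1)[OF LT g])
  have "L2 W" by (rule bv(2)[OF LT g])
  then have "continuous_on {0..T} f" using lh_facts(1) by (simp add: weakly_continuous_L2_def f_def)
  then have "(f \<longlongrightarrow> f T) (at T within {0..T})" using T by (auto simp: continuous_on_def)
  then have lim: "(f \<longlongrightarrow> f T) (at T within {s<..<T})" by (rule tendsto_within_subset) (use s in auto)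
  have nb: "at T within {s<..<T} \<noteq> bot"
   using s by (simp add: trivial_limit_within islimpt_greaterThanLessThan2)
  have "\<bar>f T - f s\<bar> <= J"
  proof (rule tendsto_upperbound[OF tendsto_rabs[OF tendsto_diff[OF lim tendsto_const]] _ nb])
   show "\<forall>\<^sub>F t in at T within {s<..<T}. \<bar>f t - f s\<bar> <= J"
    unfolding eventually_at_filter
   proof (intro always_eventually allI impI)
    fix t assume t: "t \<in> {s<..<T}"
    then have "f t - f s = (LINT \<tau>:{s..t}|lborel. stress_power \<tau> w)"
     using s ft[of t] ft[OF s0] momentum[OF tw div_S[OF R(1) s0, of \<epsilon>, folded w_def], of s t] by auto
    then show "\<bar>f t - f s\<bar> <= J" using J[OF tw wG] t by simp
   qed
  qed
  then have "\<bar>(\<S> i. \<L> x. g i x * S \<epsilon> R s i x) - (\<S> i. \<L> x. U s i x * S \<epsilon> R s i x)\<bar> <= J"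
   unfolding fT ft[OF s0] w_def .
  then show "\<bar>m g R - m (U s) R\<bar> <= J + p R + e"
   using d1(2)[OF \<epsilon>(1,2)] d2(2)[OF \<epsilon>(1,3)] unfolding p_def by linarith
 qed
 define a where "a = (\<S> i. \<L> x. g i x * U s i x)"
 have lim1: "(%n. m f (real (Suc n))) ----> (\<S> i. \<L> x. f i x * U s i x)" if "!!i. sq_int (f i)" for f
  unfolding m_def main0_def by (intro tendsto_sum cutoff_pairing_tendsto that qU)
 have k: "(\<S> i. \<L> x. U s i x * U s i x) = kinetic (u s)"
  unfolding L2_U(2)[OF s0] l2_power2 by (simp add: power2_eq_square)
 have limp: "(%n. p (real (Suc n))) ----> (\<Sum>i\<in>(UNIV::3 set). 0) + (\<Sum>i\<in>(UNIV::3 set). 0)"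
  unfolding p_def by (intro tendsto_add tendsto_sum pair_err_tendsto sU qU g(1))
 have "(%n. sqrt (dirichlet (u s)) + (err_const + 2 * cutoff_const) * ubound * (1 / real (Suc n))) ----> sqrt (dirichlet (u s)) + (err_const + 2 * cutoff_const) * ubound * 0"
  by (intro tendsto_intros LIMSEQ_Suc[OF lim_1_over_n])
 then have "\<forall>\<^sub>F n in sequentially. sqrt (dirichlet (u s)) + (err_const + 2 * cutoff_const) * ubound * (1 / real (Suc n)) < G"
  using G by (intro order_tendstoD(2)) auto
 then have ev: "\<forall>\<^sub>F n in sequentially. \<bar>m g (real (Suc n)) - m (U s) (real (Suc n))\<bar> <= J + p (real (Suc n))"
  by eventually_elim (intro key; simp)
 have la: "(%n. m g (real (Suc n))) ----> a" unfolding a_def by (rule lim1[OF g(1)])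
 have lk: "(%n. m (U s) (real (Suc n))) ----> kinetic (u s)" unfolding k[symmetric] by (rule lim1[OF qU])
 have "\<bar>a - kinetic (u s)\<bar> <= J + ((\<Sum>i\<in>(UNIV::3 set). 0) + (\<Sum>i\<in>(UNIV::3 set). 0))"
  by (rule tendsto_le[OF _ tendsto_add[OF tendsto_const limp] tendsto_rabs[OF tendsto_diff[OF la lk]] ev]) simp
 moreover have "2 * a <= kinetic (u T) + kinetic (u s)"
 proof -
  have "(LINT x|lebesgue. u T x \<bullet> u s x) = a"
   using borel_version_pairing(1)[OF LT g, of "U s", OF qU] unfolding a_def by (simp add: U_def)
  then show ?thesis using pairing_le_kinetic[OF LT Ls] by simp
 qed
 ultimately show ?thesis by simp
qed

lemma bmo_product_bound:
 assumes t: "t \<in> {0..<T}" and b: "bmo_norm (u t) <= ennreal b" "0 < b"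
 shows "l2 (%x. U t i x * U t j x) <= sqrt bmo_const * ubound * b"
proof -
 have cu: "continuous_on UNIV (u t)"
  using continuous_slice[of "{0..<T}" u t] sm t unfolding smooth_on_def by (metis C_k_on.simps(1))
 have [measurable]: "meas (u t)" using cu by (rule borel_measurable_continuous_onI)
 have m: "meas ((%x. (norm (u t x))^2))" by measurable
 have i: "integrable lborel (%x. (norm (u t x))^2)"
  using L2_u[of t] t integrable_lebesgue_borel[OF m] by (auto simp: L2_def)
 have E: "(\<L> x. (norm (u t x))^2) <= ubound^2"
  using kinetic_le[of t] t kinetic_nonneg integral_lebesgue_borel[OF m] by (simp add: kinetic_def ubound_def)
 note I = bmo_interpolation[OF cu i b]
 have le: "(U t i x * U t j x)^2 <= norm (u t x) ^ 4" for x
 proof -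
  have "\<bar>U t i x * U t j x\<bar> <= norm (u t x) * norm (u t x)"
   unfolding U_def abs_mult by (intro mult_mono component_le_norm_cart) auto
  then have "\<bar>U t i x * U t j x\<bar>^2 <= (norm (u t x) * norm (u t x))^2" by (rule power_mono) simp
  then show ?thesis by (simp add: power4_eq_xxxx power2_eq_square mult_ac)
 qed
 have [measurable]: "meas (U t i)" for i by (rule smooth_borel[OF smooth_U[OF t]])
 have "integrable lborel (%x. (U t i x * U t j x)^2)"
  by (rule B_integrable_bound[OF I(1)]) (use le in auto)
 then have "(\<L> x. (U t i x * U t j x)^2) <= (\<L> x. norm (u t x) ^ 4)" by (rule integral_mono[OF _ I(1) le])
 also have "... <= bmo_const * b^2 * ubound^2"
  using I(2) E mult_left_mono[OF E, of "bmo_const * b^2"] by (simp add: bmo_const_def)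
 finally have "l2 (%x. U t i x * U t j x) <= sqrt (bmo_const * b^2 * ubound^2)" unfolding l2_def by (rule real_sqrt_le_mono)
 then show ?thesis using b ubound_nonneg by (simp add: real_sqrt_mult mult_ac)
qed

text \<open>Over a final time interval of length \<open>\<delta>\<close> the stress has an \<open>L\<^sup>2\<close> norm whose time integral is of order
 \<open>\<surd>\<delta>\<close>, by the interpolation inequality and the tail bound for the \<open>BMO\<close> norm.\<close>

lemma stress_power_time_bound:
 assumes \<delta>: "0 < \<delta>" "\<delta> <= T" and C: "0 <= C"
  and tail: "!!\<sigma>. 0 < \<sigma> ==> emeasure lebesgue (bmo_high u {T - \<delta>..<T} \<sigma>) <= ennreal (C / \<sigma>^2)"
  and w: "!!i. test (w i)" and G: "0 < G" "!!i j. l2 (pd j (w i)) <= G" and st: "T - \<delta> < s" "s < t" "t < T"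
 shows "\<bar>LINT \<tau>:{s..t}|lborel. stress_power \<tau> w\<bar>
   <= 9 * (G * sqrt \<delta>) * ((1 + dissip {T - \<delta>..<T}) / 2 + (sqrt bmo_const * ubound + 1) * (1 + 2 * C))"
proof -
 define A where "A = {T - \<delta>..<T}"
 define \<eta> where "\<eta> = dissip A"
 \<comment> \<open>The summand \<open>1\<close> makes \<open>\<kappa>\<close> positive, so that \<open>\<kappa> * h\<close> is infinite wherever \<open>h\<close> is.\<close>
 define \<kappa> where "\<kappa> = sqrt bmo_const * ubound + 1"
 have \<kappa>: "0 < \<kappa>" using ubound_nonneg by (simp add: \<kappa>_def bmo_const_def add_nonneg_pos)
 define r where "r = sqrt \<delta>"
 have r: "0 < r" "r * r = \<delta>" using \<delta> by (auto simp: r_def)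
 have Am: "A \<in> sets lebesgue" "A \<in> sets borel" "A \<subseteq> {0..<T}" using \<delta> by (auto simp: A_def)
 have sub: "{s..t} \<subseteq> A" using st by (auto simp: A_def)
 have cu: "continuous_on (A \<times> UNIV) (%(t, x). u t x)"
 proof -
  have "continuous_on ({0..<T} \<times> UNIV) (%(t, x). u t x)" using sm unfolding smooth_on_def by (metis C_k_on.simps(1))
  then show ?thesis by (rule continuous_on_subset) (use Am in auto)
 qed
 have lvl: "bmo_high u A \<sigma> \<in> sets lebesgue" if "0 < \<sigma>" for \<sigma>
  by (rule sets_completionI_sets, unfold sets_lborel, rule bmo_level_set[OF cu _ Am(2)]) (use that in simp)
 have r1: "0 < 1 / r" using r by simp
 have "\<exists>h. h \<in> borel_measurable lebesgue \<and> (\<forall>t\<in>A. bmo_norm (u t) <= h t) \<and> (\<forall>t. ennreal (1 / r) <= h t) \<and>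
  (\<integral>\<^sup>+t\<in>A. h t \<partial>lebesgue) <= ennreal (1 / r) * emeasure lebesgue A + ennreal (2 * C / (1 / r))"
  by (rule dyadic_majorant[OF Am(1) lvl tail[folded A_def] r1 C]; (assumption | blast))
 then obtain h where h: "h \<in> borel_measurable lebesgue" "!!t. t \<in> A ==> bmo_norm (u t) <= h t" "!!t. ennreal (1 / r) <= h t"
  "(\<integral>\<^sup>+t\<in>A. h t \<partial>lebesgue) <= ennreal (1 / r) * emeasure lebesgue A + ennreal (2 * C / (1 / r))" by blast
 define B where "B \<tau> = 9 * G / 2 * r * dirichlet (u \<tau>) + 9 * G / 2 * (1 / r)" for \<tau>
 have B0: "0 <= B \<tau>" for \<tau> unfolding B_def using G r dirichlet_nonneg by (intro mult_nonneg_nonneg add_nonneg_nonneg) auto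
 have point: "ennreal \<bar>stress_power \<tau> w\<bar> <= ennreal (B \<tau>) + ennreal (9 * G * \<kappa>) * h \<tau>" if \<tau>: "\<tau> \<in> {s..t}" and H: "H1 (u \<tau>)" for \<tau>
 proof (cases "h \<tau>")
  case (real b)
  have \<tau>A: "\<tau> \<in> A" "\<tau> \<in> {0..<T}" using \<tau> st \<delta> by (auto simp: A_def)
  have "ennreal (1 / r) <= ennreal b" using h(3)[of \<tau>] real by simp
  then have b: "0 < b" using r1 real by (metis ennreal_le_iff less_le_trans)
  have bb: "bmo_norm (u \<tau>) <= ennreal b" using h(2)[OF \<tau>A(1)] real by simp
  define K where "K = (r * dirichlet (u \<tau>) + 1 / r) / 2 + \<kappa> * b"
  have D: "sqrt (dirichlet (u \<tau>)) <= (r * dirichlet (u \<tau>) + 1 / r) / 2"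
  proof -
   have "2 * (sqrt r * sqrt (dirichlet (u \<tau>))) * (1 / sqrt r) <= (sqrt r * sqrt (dirichlet (u \<tau>)))^2 + (1 / sqrt r)^2"
    by (rule sum_squares_bound)
   then show ?thesis using r dirichlet_nonneg[of "u \<tau>"] by (simp add: power_mult_distrib power_divide)
  qed
  have "l2 (stress \<tau> i j) <= K" for i j
  proof -
   have "l2 (stress \<tau> i j) <= l2 (pd j (U \<tau> i)) + l2 (%x. U \<tau> i x * U \<tau> j x)"
    unfolding stress_def[abs_def]
    using l2_triangle[OF sq_int_minus[OF gradient_U(1)[OF \<tau>A(2) H]] stress_bounds(4)[OF \<tau>A(2) H]] by simp
   moreover have "l2 (%x. U \<tau> i x * U \<tau> j x) <= \<kappa> * b"
    using bmo_product_bound[OF \<tau>A(2) bb b, of i j] b by (simp add: \<kappa>_def distrib_right)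
   ultimately show ?thesis unfolding K_def using stress_bounds(1)[OF \<tau>A(2) H, of j i] D by linarith
  qed
  moreover have "0 <= K" using l2_nonneg calculation order_trans by blast
  ultimately have "\<bar>\<L> x. stress \<tau> i j x * pd j (w i) x\<bar> <= K * G" for i j
   using l2_Cauchy_Schwarz[OF stress_bounds(5)[OF \<tau>A(2) H] test_sq_int[OF test_dir_deriv[OF w]], of i j "axis j 1" i] G
   by (meson l2_nonneg mult_mono order_trans)
  then have "\<bar>stress_power \<tau> w\<bar> <= (\<Sum>i\<in>(UNIV::3 set). \<Sum>j\<in>(UNIV::3 set). K * G)"
   unfolding stress_power_def by (intro order_trans[OF sum_abs] sum_mono)
  also have "... = B \<tau> + 9 * G * \<kappa> * b" by (simp add: K_def B_def algebra_simps)
  finally have "ennreal \<bar>stress_power \<tau> w\<bar> <= ennreal (B \<tau> + 9 * G * \<kappa> * b)" by (rule ennreal_leI)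
  also have "... = ennreal (B \<tau>) + ennreal (9 * G * \<kappa>) * h \<tau>"
   using B0[of \<tau>] G \<kappa> b real by (simp add: ennreal_plus[symmetric] ennreal_mult[symmetric] del: ennreal_plus)
  finally show ?thesis .
 next
  case top
  have "9 * G * \<kappa> > 0" using G \<kappa> by simp
  then have "ennreal (9 * G * \<kappa>) \<noteq> 0" by (simp only: ennreal_eq_0_iff not_le)
  then have "ennreal (9 * G * \<kappa>) * h \<tau> = top" unfolding top by (rule ennreal_top_mult_left)
  then show ?thesis by simp
 qed
 have iD: "set_integrable lebesgue A (%\<tau>. dirichlet (u \<tau>))" using Am by (intro set_integrable_dirichlet) auto
 have ic: "set_integrable lebesgue A (%\<tau>. k)" for k :: real
  by (rule set_integrable_subset[OF set_integrable_lebesgue_continuous(1)[of "T - \<delta>" T]]) (auto simp: A_def)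
 have iB: "integrable lebesgue (%\<tau>. indicator A \<tau> * B \<tau>)"
 proof -
  have "set_integrable lebesgue A B" unfolding B_def[abs_def] by (intro set_integral_add(1) set_integrable_mult_right iD ic)
  then show ?thesis by (simp add: set_integrable_def)
 qed
 have LA: "measure lebesgue A = \<delta>" "emeasure lebesgue A = ennreal \<delta>" using \<delta> by (auto simp: A_def)
 have B_int: "(LINT \<tau>|lebesgue. indicator A \<tau> * B \<tau>) = 9 * G / 2 * (r * \<eta> + r)"
 proof -
  have "(LINT \<tau>:A|lebesgue. B \<tau>) = (LINT \<tau>:A|lebesgue. 9 * G / 2 * r * dirichlet (u \<tau>)) + (LINT \<tau>:A|lebesgue. 9 * G / 2 * (1 / r))"
   unfolding B_def[abs_def] by (intro set_integral_add(2) set_integrable_mult_right iD ic)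
  also have "(LINT \<tau>:A|lebesgue. 9 * G / 2 * r * dirichlet (u \<tau>)) = 9 * G / 2 * r * \<eta>" unfolding \<eta>_def by simp
  also have "(LINT \<tau>:A|lebesgue. 9 * G / 2 * (1 / r)) = \<delta> * (9 * G / 2 * (1 / r))"
   unfolding set_lebesgue_integral_def using LA by simp
  also have "\<delta> * (9 * G / 2 * (1 / r)) = 9 * G / 2 * r" using r by (simp add: field_simps)
  finally show ?thesis unfolding set_lebesgue_integral_def by (simp add: distrib_left)
 qed
 have csp: "continuous_on {s..t} (%\<tau>. stress_power \<tau> w)"
  by (rule continuous_on_subset[OF continuous_stress_power[OF w]]) (use st \<delta> in auto)
 note isp = set_integrable_lebesgue_continuous[OF csp]
 have "ennreal \<bar>LINT \<tau>:{s..t}|lborel. stress_power \<tau> w\<bar> <= (\<integral>\<^sup>+\<tau>. ennreal (norm (indicator {s..t} \<tau> *\<^sub>R stress_power \<tau> w)) \<partial>lebesgue)"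
  using integral_norm_bound_ennreal[OF isp(1)[unfolded set_integrable_def]]
  unfolding isp(2)[symmetric] unfolding set_lebesgue_integral_def by simp
 also have "... <= (\<integral>\<^sup>+\<tau>. ennreal (indicator A \<tau> * B \<tau>) + ennreal (9 * G * \<kappa>) * (h \<tau> * indicator A \<tau>) \<partial>lebesgue)"
 proof (rule nn_integral_mono_AE)
  show "AE \<tau> in lebesgue. ennreal (norm (indicator {s..t} \<tau> *\<^sub>R stress_power \<tau> w)) <= ennreal (indicator A \<tau> * B \<tau>) + ennreal (9 * G * \<kappa>) * (h \<tau> * indicator A \<tau>)"
   using lh_facts(6)
  proof eventually_elim
   case (elim \<tau>)
   show ?case
   proof (cases "\<tau> \<in> {s..t}")
    case True
    then have "\<tau> \<in> {0<..<T}" "\<tau> \<in> A" using sub st \<delta> by auto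
    then show ?thesis using point[OF True] elim True by simp
   qed simp
  qed
 qed
 also have "... = (\<integral>\<^sup>+\<tau>. ennreal (indicator A \<tau> * B \<tau>) \<partial>lebesgue) + ennreal (9 * G * \<kappa>) * (\<integral>\<^sup>+\<tau>\<in>A. h \<tau> \<partial>lebesgue)"
  using borel_measurable_integrable[OF iB] h(1) Am(1) by (simp add: nn_integral_add nn_integral_cmult)
 also have "(\<integral>\<^sup>+\<tau>. ennreal (indicator A \<tau> * B \<tau>) \<partial>lebesgue) = ennreal (9 * G / 2 * (r * \<eta> + r))"
  unfolding B_int[symmetric] using B0 by (intro nn_integral_eq_integral iB) (auto intro!: AE_I2 mult_nonneg_nonneg)
 also have "... + ennreal (9 * G * \<kappa>) * (\<integral>\<^sup>+\<tau>\<in>A. h \<tau> \<partial>lebesgue) <= ennreal (9 * G / 2 * (r * \<eta> + r)) + ennreal (9 * G * \<kappa>) * ennreal (r + 2 * C * r)"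
 proof (intro add_left_mono mult_left_mono)
  have "(1 / r) * \<delta> = r" "2 * C / (1 / r) = 2 * C * r" using r by (auto simp: field_simps)
  then have "ennreal (1 / r) * emeasure lebesgue A + ennreal (2 * C / (1 / r)) = ennreal (r + 2 * C * r)"
   unfolding LA using r1 \<delta> r C by (simp add: ennreal_mult[symmetric] ennreal_plus[symmetric] del: ennreal_plus)
  then show "(\<integral>\<^sup>+\<tau>\<in>A. h \<tau> \<partial>lebesgue) <= ennreal (r + 2 * C * r)" using h(4) by simp
 qed simp
 also have "... = ennreal (9 * G / 2 * (r * \<eta> + r) + 9 * G * \<kappa> * (r + 2 * C * r))"
 proof -
  have "0 <= \<eta>" unfolding \<eta>_def set_lebesgue_integral_def by (intro B_integral_nonneg) (simp add: dirichlet_nonneg)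
  then have "0 <= 9 * G / 2 * (r * \<eta> + r)" "0 <= 9 * G * \<kappa>" "0 <= r + 2 * C * r" using G r \<kappa> C by auto
  then show ?thesis by (simp add: ennreal_mult ennreal_plus)
 qed
 finally have "ennreal \<bar>LINT \<tau>:{s..t}|lborel. stress_power \<tau> w\<bar> <= ennreal (9 * G / 2 * (r * \<eta> + r) + 9 * G * \<kappa> * (r + 2 * C * r))" .
 moreover have "0 <= 9 * G / 2 * (r * \<eta> + r) + 9 * G * \<kappa> * (r + 2 * C * r)"
 proof -
  have "0 <= \<eta>" unfolding \<eta>_def set_lebesgue_integral_def by (intro B_integral_nonneg) (simp add: dirichlet_nonneg)
  then show ?thesis using G r \<kappa> C by (intro add_nonneg_nonneg mult_nonneg_nonneg) auto
 qed
 ultimately have "\<bar>LINT \<tau>:{s..t}|lborel. stress_power \<tau> w\<bar> <= 9 * G / 2 * (r * \<eta> + r) + 9 * G * \<kappa> * (r + 2 * C * r)" by simp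
 also have "... = 9 * (G * r) * ((1 + \<eta>) / 2 + \<kappa> * (1 + 2 * C))" by (simp add: field_simps)
 finally show ?thesis unfolding \<eta>_def \<kappa>_def r_def A_def .
qed

text \<open>Otherwise the dissipation over the interval would exceed itself.\<close>

lemma good_time:
 assumes \<delta>: "0 < \<delta>" "\<delta> <= T" and z: "0 < z"
 obtains s where "T - \<delta> < s" "s < T" "H1 (u s)" "\<delta> * dirichlet (u s) <= dissip {T - \<delta>..<T} + z"
proof (rule ccontr)
 assume "\<not> thesis"
 note none = that this
 define A where "A = {T - \<delta>..<T}"
 define \<eta> where "\<eta> = dissip A"
 have Am: "A \<in> sets lebesgue" "A \<subseteq> {0..T}" using \<delta> by (auto simp: A_def)
 have i: "set_integrable lebesgue A (%\<tau>. (\<eta> + z) / \<delta>)"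
  by (rule set_integrable_subset[OF set_integrable_lebesgue_continuous(1)[of "T - \<delta>" T]]) (auto simp: A_def)
 have "AE \<tau> in lebesgue. \<tau> \<noteq> T - \<delta>" using AE_not_in[of "{T - \<delta>}" lebesgue] by (simp add: null_sets_def)
 then have "(LINT \<tau>:A|lebesgue. (\<eta> + z) / \<delta>) <= \<eta>"
  unfolding \<eta>_def set_lebesgue_integral_def
 proof (intro integral_mono_AE)
  show "AE \<tau> in lebesgue. indicat_real A \<tau> *\<^sub>R (((LINT x|lebesgue. indicat_real A x *\<^sub>R dirichlet (u x)) + z) / \<delta>) <= indicat_real A \<tau> *\<^sub>R dirichlet (u \<tau>)"
   using lh_facts(6) \<open>AE \<tau> in lebesgue. \<tau> \<noteq> T - \<delta>\<close>
  proof eventually_elim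
   case (elim \<tau>)
   show ?case
   proof (cases "\<tau> \<in> A")
    case True
    then have "T - \<delta> < \<tau>" "\<tau> < T" "H1 (u \<tau>)" using elim \<delta> by (auto simp: A_def)
    then have "\<not> \<delta> * dirichlet (u \<tau>) <= \<eta> + z" using none unfolding \<eta>_def A_def by blast
    then have "(\<eta> + z) / \<delta> <= dirichlet (u \<tau>)" using \<delta> by (simp add: divide_le_eq mult.commute)
    then show ?thesis using True by (simp add: \<eta>_def set_lebesgue_integral_def)
   qed simp
  qed
 qed (use i set_integrable_dirichlet[OF Am(2,1)] in \<open>auto simp: set_integrable_def \<eta>_def set_lebesgue_integral_def\<close>)
 moreover have "(LINT \<tau>:A|lebesgue. (\<eta> + z) / \<delta>) = \<eta> + z"
  using \<delta> unfolding set_lebesgue_integral_def by (simp add: A_def)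
 ultimately show False using z by simp
qed

lemma dirichlet_tail_tendsto:
 assumes \<delta>: "0 < \<delta>" "\<delta> <= T"
 shows "(%n. LINT \<tau>:{T - \<delta> / real (Suc n)..<T}|lebesgue. dirichlet (u \<tau>)) ----> 0"
proof -
 have i: "set_integrable lebesgue {0..T} (%\<tau>. dirichlet (u \<tau>))" by (rule set_integrable_dirichlet) auto
 have sub: "{T - \<delta> / real (Suc n)..<T} \<subseteq> {0..T}" for n
 proof -
  have "\<delta> / real (Suc n) <= \<delta>" using \<delta> by (simp add: divide_le_eq)
  then show ?thesis using \<delta> by auto
 qed
 have "(%n. LINT \<tau>|lebesgue. indicator {T - \<delta> / real (Suc n)..<T} \<tau> *\<^sub>R dirichlet (u \<tau>)) ----> (LINT \<tau>::real|lebesgue. (0::real))"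
 proof (rule integral_dominated_convergence[where w = "%\<tau>. indicator {0..T} \<tau> *\<^sub>R dirichlet (u \<tau>)"])
  show "(%\<tau>. indicator {T - \<delta> / real (Suc n)..<T} \<tau> *\<^sub>R dirichlet (u \<tau>)) \<in> borel_measurable lebesgue" for n
   using set_integrable_dirichlet[OF sub, of n] unfolding set_integrable_def by (intro borel_measurable_integrable) auto
  show "integrable lebesgue (%\<tau>. indicator {0..T} \<tau> *\<^sub>R dirichlet (u \<tau>))" using i by (simp add: set_integrable_def)
  show "AE \<tau> in lebesgue. (%n. indicator {T - \<delta> / real (Suc n)..<T} \<tau> *\<^sub>R dirichlet (u \<tau>)) ----> 0"
  proof (rule AE_I2)
   fix \<tau>
   show "(%n. indicator {T - \<delta> / real (Suc n)..<T} \<tau> *\<^sub>R dirichlet (u \<tau>)) ----> 0"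
   proof (cases "\<tau> < T")
    case True
    have "(%n. T - \<delta> * (1 / real (Suc n))) ----> T - \<delta> * 0" by (intro tendsto_intros LIMSEQ_Suc[OF lim_1_over_n])
    then have "\<forall>\<^sub>F n in sequentially. \<tau> < T - \<delta> * (1 / real (Suc n))" using True by (intro order_tendstoD(1)) auto
    then have "\<forall>\<^sub>F n in sequentially. indicator {T - \<delta> / real (Suc n)..<T} \<tau> *\<^sub>R dirichlet (u \<tau>) = 0"
     by eventually_elim simp
    then show ?thesis by (rule tendsto_eventually)
   qed simp
  qed
  show "AE \<tau> in lebesgue. norm (indicator {T - \<delta> / real (Suc n)..<T} \<tau> *\<^sub>R dirichlet (u \<tau>)) <= indicator {0..T} \<tau> *\<^sub>R dirichlet (u \<tau>)" for n
  proof (rule AE_I2)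
   fix \<tau> show "norm (indicator {T - \<delta> / real (Suc n)..<T} \<tau> *\<^sub>R dirichlet (u \<tau>)) <= indicator {0..T} \<tau> *\<^sub>R dirichlet (u \<tau>)"
    using sub[of n] dirichlet_nonneg[of "u \<tau>"] by (auto simp: indicator_def)
  qed
 qed simp
 then show ?thesis by (simp add: set_lebesgue_integral_def)
qed

text \<open>The factor \<open>G \<surd>\<delta>\<close> of the time bound equals \<open>\<surd>(\<eta> + 2 \<delta>)\<close> for the gradient bound \<open>G\<close> at a good time.\<close>

lemma kinetic_lower_terminal:
 assumes w: "weak_L2_BMO T u \<or> Limsup (at_left T) (%t. ennreal (sqrt (T - t)) * bmo_norm (u t)) < \<infinity>"
 shows "kinetic (u 0) <= kinetic (u T) + 2 * dissip {0..T}"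
proof -
 have cu: "continuous_on ({0..<T} \<times> UNIV) (%(t, x). u t x)" using sm unfolding smooth_on_def by (metis C_k_on.simps(1))
 have lvl: "bmo_high u {0..<T} \<sigma> \<in> sets lebesgue" if "0 < \<sigma>" for \<sigma>
  by (rule sets_completionI_sets, unfold sets_lborel, rule bmo_level_set[OF cu]) (use that in auto)
 have "\<exists>\<delta> C. 0 < \<delta> \<and> \<delta> <= T \<and> 0 <= C \<and>
   (\<forall>\<sigma>>0. emeasure lebesgue (bmo_high u {T - \<delta>..<T} \<sigma>) <= ennreal (C / \<sigma>^2))"
  by (rule weak_bmo_tail[OF T lvl w]; (assumption | blast))
 then obtain \<delta> C where \<delta>: "0 < \<delta>" "\<delta> <= T" and C: "0 <= C"
  and tail: "!!\<sigma>. 0 < \<sigma> ==> emeasure lebesgue (bmo_high u {T - \<delta>..<T} \<sigma>) <= ennreal (C / \<sigma>^2)"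
  by blast
 define d where "d n = \<delta> / real (Suc n)" for n
 have d: "0 < d n" "d n <= \<delta>" "d n <= T" for n
 proof -
  show "0 < d n" using \<delta> by (simp add: d_def)
  show "d n <= \<delta>" using \<delta> by (simp add: d_def divide_le_eq)
  then show "d n <= T" using \<delta> by simp
 qed
 define \<eta> where "\<eta> n = dissip {T - d n..<T}" for n
 have \<eta>0: "0 <= \<eta> n" for n unfolding \<eta>_def set_lebesgue_integral_def by (intro B_integral_nonneg) (simp add: dirichlet_nonneg)
 define b where "b n = (1 + \<eta> n) / 2 + (sqrt bmo_const * ubound + 1) * (1 + 2 * C)" for n
 have "kinetic (u 0) <= kinetic (u T) + 2 * dissip {0..T} + 2 * (9 * sqrt (\<eta> n + 2 * d n) * b n)" for n
 proof -
  obtain s where s: "T - d n < s" "s < T" "H1 (u s)" "d n * dirichlet (u s) <= \<eta> n + d n"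
   unfolding \<eta>_def using good_time[OF d(1)[of n] d(3)[of n] d(1)[of n]] by blast
  have s0: "s \<in> {0<..<T}" "0 < s" using s d(3)[of n] by auto
  \<comment> \<open>The second \<open>d n\<close> makes the bound by \<open>G\<close> strict, which leaves room for the error of the approximation.\<close>
  define G where "G = sqrt ((\<eta> n + 2 * d n) / d n)"
  have "dirichlet (u s) < (\<eta> n + 2 * d n) / d n"
   using s(4) d(1)[of n] by (simp add: less_divide_eq mult.commute)
  then have G: "sqrt (dirichlet (u s)) < G" unfolding G_def by simp
  have G0: "0 < G" using G real_sqrt_ge_zero[OF dirichlet_nonneg[of "u s"]] by linarith
  have Gd: "G * sqrt (d n) = sqrt (\<eta> n + 2 * d n)"
   unfolding G_def real_sqrt_mult[symmetric] using d(1)[of n] by simp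
  have tail': "emeasure lebesgue (bmo_high u {T - d n..<T} \<sigma>) <= ennreal (C / \<sigma>^2)" if "0 < \<sigma>" for \<sigma>
  proof (rule order_trans[OF emeasure_mono tail[OF that]])
   have e: "bmo_high u {T - \<delta>..<T} \<sigma> = {T - \<delta>..<T} \<inter> bmo_high u {0..<T} \<sigma>"
    using \<delta> by auto
   have "{T - \<delta>..<T} \<in> sets lebesgue" by simp
   then show "bmo_high u {T - \<delta>..<T} \<sigma> \<in> sets lebesgue"
    unfolding e by (rule sets.Int[OF _ lvl[OF that]])
   show "bmo_high u {T - d n..<T} \<sigma> \<subseteq> bmo_high u {T - \<delta>..<T} \<sigma>"
    using d(2)[of n] by auto
  qed
  have "kinetic (u s) <= kinetic (u T) + 2 * (9 * (G * sqrt (d n)) * b n)"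
   unfolding b_def \<eta>_def
   by (rule terminal_comparison[OF s0(1) s(3) G])
     (rule stress_power_time_bound[OF d(1,3) C tail' _ G0 _ s(1)])
  moreover have "kinetic (u 0) <= kinetic (u s) + 2 * dissip {0..s}"
   by (rule kinetic_lower[OF s0(2) s(2)])
  moreover have "dissip {0..s} <= dissip {0..T}"
   using s(2) by (intro set_integral_mono_dirichlet) auto
  ultimately show ?thesis unfolding Gd by linarith
 qed
 moreover have "(%n. kinetic (u T) + 2 * dissip {0..T} + 2 * (9 * sqrt (\<eta> n + 2 * d n) * b n))
   ----> kinetic (u T) + 2 * dissip {0..T} + 2 * (9 * sqrt (0 + 2 * 0) * ((1 + 0) / 2 + (sqrt bmo_const * ubound + 1) * (1 + 2 * C)))"
 proof -
  have l\<eta>: "\<eta> ----> 0" unfolding \<eta>_def[abs_def] d_def by (rule dirichlet_tail_tendsto[OF \<delta>])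
  have "(%n. \<delta> * (1 / real (Suc n))) ----> \<delta> * 0" by (intro tendsto_intros LIMSEQ_Suc[OF lim_1_over_n])
  then have ld: "d ----> 0" by (simp add: d_def[abs_def])
  show ?thesis unfolding b_def by (intro tendsto_intros l\<eta> ld) simp
 qed
 ultimately have "kinetic (u 0) <= kinetic (u T) + 2 * dissip {0..T} + 2 * (9 * sqrt (0 + 2 * 0) * ((1 + 0) / 2 + (sqrt bmo_const * ubound + 1) * (1 + 2 * C)))"
  by (intro LIMSEQ_le_const) auto
 then show ?thesis by simp
qed

lemma energy_equality:
 assumes w: "weak_L2_BMO T u \<or> Limsup (at_left T) (%t. ennreal (sqrt (T - t)) * bmo_norm (u t)) < \<infinity>" and t: "t \<in> {0..T}"
 shows "kinetic (u t) + 2 * dissip {0..t} = kinetic u0"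
proof -
 have "kinetic (u 0) <= kinetic (u t) + 2 * dissip {0..t}"
 proof (cases "t = 0 \<or> t = T")
  case True
  have "0 <= dissip {0..t}"
   unfolding set_lebesgue_integral_def by (intro B_integral_nonneg) (simp add: dirichlet_nonneg)
  then show ?thesis using kinetic_lower_terminal[OF w] True by auto
 qed (use kinetic_lower[of t] t in auto)
 moreover have "kinetic (u t) + 2 * dissip {0..t} <= kinetic (u 0)"
  using lh_facts(5)[OF t] by (simp add: energy_inequality_def)
 moreover have "kinetic (u 0) = kinetic u0"
 proof -
  have m: "u 0 \<in> borel_measurable lebesgue" using L2_u[of 0] T by (simp add: L2_def)
  have m0: "u0 \<in> borel_measurable lebesgue" by (rule borel_measurable_AE[OF m lh_facts(4)])
  show ?thesis unfolding kinetic_def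
   by (rule integral_cong_AE) (use m m0 lh_facts(4) in \<open>auto elim: eventually_mono\<close>)
 qed
 ultimately show ?thesis by simp
qed

end

section \<open>The theorem\<close>

theorem theorem1p3:
  fixes T :: real
    and u :: "real \<Rightarrow> real^3 \<Rightarrow> real^3"
    and P :: "(real \<times> (real^3) \<Rightarrow> real) \<Rightarrow> real"
    and u\<^sub>0 :: "real^3 \<Rightarrow> real^3"
  assumes "T > 0"
    and "leray_hopf T u P u\<^sub>0"
    and "smooth_on ({0..<T} \<times> UNIV) (\<lambda>(t, x). u t x)"
    and "weak_L2_BMO T u \<or>
         Limsup (at_left T) (\<lambda>t. ennreal (sqrt (T - t)) * bmo_norm (u t)) < \<infinity>"
  shows "\<forall>t\<in>{0..T}.
           (LINT x|lebesgue. (norm (u t x))\<^sup>2)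
           + 2 * (LINT \<tau>:{0..t}|lebesgue. LINT x|lebesgue. (norm (weak_gradient (u \<tau>) x))\<^sup>2)
           = (LINT x|lebesgue. (norm (u\<^sub>0 x))\<^sup>2)"
proof
 fix t assume "t \<in> {0..T}"
 interpret smooth_leray T u P u\<^sub>0 using assms(1-3) by unfold_locales
 show "(LINT x|lebesgue. (norm (u t x))\<^sup>2)
   + 2 * (LINT \<tau>:{0..t}|lebesgue. LINT x|lebesgue. (norm (weak_gradient (u \<tau>) x))\<^sup>2)
   = (LINT x|lebesgue. (norm (u\<^sub>0 x))\<^sup>2)"
  using energy_equality[OF assms(4) \<open>t \<in> {0..T}\<close>] by (simp add: kinetic_def dirichlet_def)
qed

end
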